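(* Let $\alpha,\beta>0$ be real numbers with $\alpha\beta>2$. Let $Q$ be the non-commutative harmonic oscillator $$Q=\begin{pmatrix}\alpha&0\\0&\beta\end{pmatrix}\left(-\frac12\frac{d^2}{dx^2}+\frac{x^2}{2}\right)+\begin{pmatrix}0&-1\\1&0\end{pmatrix}\left(x\frac{d}{dx}+\frac12\right),$$ acting on $L^2(\mathbb{R})\otimes\mathbb{C}^2$, let $0<\lambda_1\le\lambda_2\le\cdots\to\infty$ be its eigenvalues (with multiplicity), and let $\zeta_Q(s)=\sum_{n\ge1}\lambda_n^{-s}$. Then $$\zeta_Q(3)=\frac74\zeta(3)\frac{(\alpha+\beta)^3}{(\alpha\beta(\alpha\beta-1))^{3/2}}\left\{1+3\left(\frac{\alpha-\beta}{\alpha+\beta}\,{}_2F_1\!\left(\frac14,\frac34;1;\frac1{1-\alpha\beta}\right)\right)^{2}\right\}-\frac{3(\alpha+\beta)(\alpha-\beta)^2}{2\alpha^2\beta^2(\alpha\beta-1)}\sum_{k=0}^\infty(-1)^k\binom{-\frac12}{k}^{3}(\alpha\beta)^{-k}\sum_{j=0}^{k-1}\frac{1}{(2j+1)^3}\binom{-\frac12}{j}^{-2}.$$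
   Context: For $\alpha,\beta>0$ with $\alpha\beta>1$, the operator $Q$ defines a positive self-adjoint operator on $L^2(\mathbb{R})\otimes\mathbb{C}^2$ with purely discrete spectrum, so the Dirichlet series $\zeta_Q(s)=\sum_n\lambda_n^{-s}$ (the spectral zeta function of $Q$) converges absolutely for $\Re s>1$. Here $\zeta$ is the Riemann zeta function, ${}_2F_1$ is the Gauss hypergeometric function, and $\binom{-1/2}{k}=\frac{(-1/2)(-3/2)\cdots(-1/2-k+1)}{k!}$ is the generalized binomial coefficient; the inner sum is empty (equal to $0$) for $k=0$. *)

theory Defs
  imports
    "HOL-Analysis.Analysis"
    "HOL-Computational_Algebra.Formal_Power_Series"
    "HOL-Library.Function_Algebras"
begin

text \<open>
  The Hilbert space \<open>L^2(R) \<otimes> C^2\<close> is rendered as \<open>L^2(R; C^2)\<close>; its elements are given by Borel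
  measurable representatives.
\<close>

definition square_integrable :: "(real \<Rightarrow> complex^2) \<Rightarrow> bool" where
  "square_integrable f \<longleftrightarrow>
     f \<in> borel_measurable lborel \<and> integrable lborel (\<lambda>x. (norm (f x))\<^sup>2)"

definition ncho_A :: "real \<Rightarrow> real \<Rightarrow> complex^2^2" where
  "ncho_A \<alpha> \<beta> = vector [vector [of_real \<alpha>, 0], vector [0, of_real \<beta>]]"

definition ncho_J :: "complex^2^2" where
  "ncho_J = vector [vector [0, -1], vector [1, 0]]"

text \<open>
  \<open>D j\<close> plays the part of the \<open>j\<close>-th weak derivative of \<open>u = D 0\<close>, for \<open>j \<le> 2\<close>: each of \<open>D 0\<close>,
  \<open>D 1\<close> is a primitive of the next function, so that \<open>u\<close> is the continuously differentiable
  representative of its class, unique as such. The weighted bounds describe the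
  domain \<open>{u. x^i u^(j) is square-integrable whenever i + j \<le> 2}\<close> of the self-adjoint realisation
  of \<open>Q\<close> (the domain of the harmonic oscillator).
\<close>

definition weak_derivs :: "(real \<Rightarrow> complex^2) \<Rightarrow> (nat \<Rightarrow> real \<Rightarrow> complex^2) \<Rightarrow> bool" where
  "weak_derivs u D \<longleftrightarrow>
     D 0 = u \<and>
     (\<forall>j<2. \<forall>a b. a \<le> b \<longrightarrow> (D (Suc j) has_integral (D j b - D j a)) {a..b}) \<and>
     (\<forall>i j. i + j \<le> 2 \<longrightarrow> square_integrable (\<lambda>x. x ^ i *\<^sub>R D j x))"

text \<open>
  \<open>ncho_graph \<alpha> \<beta> u f\<close>: \<open>u\<close> lies in the domain of \<open>Q\<close>, and \<open>Q u = f\<close> in the Hilbert space.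
\<close>

definition ncho_graph ::
  "real \<Rightarrow> real \<Rightarrow> (real \<Rightarrow> complex^2) \<Rightarrow> (real \<Rightarrow> complex^2) \<Rightarrow> bool" where
  "ncho_graph \<alpha> \<beta> u f \<longleftrightarrow> square_integrable f \<and>
     (\<exists>D. weak_derivs u D \<and>
        (AE x in lborel. f x =
           ncho_A \<alpha> \<beta> *v (- (1/2) *\<^sub>R D 2 x + (x\<^sup>2 / 2) *\<^sub>R D 0 x)
           + ncho_J *v (x *\<^sub>R D 1 x + (1/2) *\<^sub>R D 0 x)))"

definition ncho_eigenspace :: "real \<Rightarrow> real \<Rightarrow> complex \<Rightarrow> (real \<Rightarrow> complex^2) set" where
  "ncho_eigenspace \<alpha> \<beta> \<mu> = {u. ncho_graph \<alpha> \<beta> u (\<lambda>x. \<mu> *s u x)}"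

definition cscale_fun :: "complex \<Rightarrow> (real \<Rightarrow> complex^2) \<Rightarrow> (real \<Rightarrow> complex^2)" where
  "cscale_fun c u = (\<lambda>x. c *s u x)"

lemma vector_space_cscale_fun: "vector_space cscale_fun"
  by unfold_locales
    (auto simp: cscale_fun_def fun_eq_iff vector_add_ldistrib vector_sadd_rdistrib)

text \<open>
  Multiplicity zero means that \<open>\<mu>\<close> is not an eigenvalue. (The eigenspaces of \<open>Q\<close> are solution
  spaces of a regular second-order linear system, so they are finite-dimensional and the
  convention \<open>dim = 0\<close> for infinite-dimensional spaces plays no role.)
\<close>

definition ncho_multiplicity :: "real \<Rightarrow> real \<Rightarrow> complex \<Rightarrow> nat" where
  "ncho_multiplicity \<alpha> \<beta> \<mu> = vector_space.dim cscale_fun (ncho_eigenspace \<alpha> \<beta> \<mu>)"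

text \<open>
  Indices start at \<open>0\<close>: \<open>lam n\<close> is the \<open>(n + 1)\<close>-st eigenvalue. All complex \<open>\<mu>\<close> are considered, so
  the sequence exhausts the whole point spectrum.
\<close>

definition ncho_eigenvalue_seq :: "real \<Rightarrow> real \<Rightarrow> (nat \<Rightarrow> real) \<Rightarrow> bool" where
  "ncho_eigenvalue_seq \<alpha> \<beta> lam \<longleftrightarrow>
     0 < lam 0 \<and> mono lam \<and> filterlim lam at_top sequentially \<and>
     (\<forall>\<mu>. card {n. complex_of_real (lam n) = \<mu>} = ncho_multiplicity \<alpha> \<beta> \<mu>)"

definition spectral_zeta :: "(nat \<Rightarrow> real) \<Rightarrow> complex \<Rightarrow> complex" where
  "spectral_zeta lam s = (\<Sum>n. complex_of_real (lam n) powr (- s))"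

text \<open>The Riemann zeta function on its half-plane of convergence \<open>Re s > 1\<close>.\<close>

definition riemann_zeta :: "complex \<Rightarrow> complex" where
  "riemann_zeta s = (\<Sum>n. of_nat (Suc n) powr (- s))"

definition hypergeo_2F1 :: "real \<Rightarrow> real \<Rightarrow> real \<Rightarrow> real \<Rightarrow> real" where
  "hypergeo_2F1 a b c z = eval_fps (fps_hypergeo [a, b] [c] 1) z"

end

theory Submission
  imports
    Defs
    "HOL-Probability.Probability"
    "HOL-Real_Asymp.Real_Asymp"
begin

text \<open>
  Put \<open>\<tau> = 1 / (\<alpha>\<beta>)\<close>, \<open>\<kappa> = sqrt (1 - \<tau>)\<close>, \<open>\<delta> = sqrt (\<tau> / (1 - \<tau>))\<close>, \<open>a, b = (1 / \<alpha> \<plusminus> 1 / \<beta>) / 2\<close>. For the two combinations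
  \<open>(sqrt \<alpha> u\<^sub>1 \<plusminus> \<i> sqrt \<beta> u\<^sub>2) / 2\<close>, rescaled by \<open>1 / sqrt \<kappa>\<close> and multiplied by the chirps \<open>exp (\<minusplus> \<i> \<delta> y\<^sup>2 / 2)\<close>, the
  first-order term of \<open>Q\<close> disappears: \<open>Q u = \<mu> u\<close> becomes
  \<open>H V\<^sub>\<plusminus> = (\<mu> / \<kappa>) (a V\<^sub>\<plusminus> + b exp (\<minusplus> \<i> \<delta> y\<^sup>2) V\<^sub>\<minusplus>)\<close> with the harmonic oscillator \<open>H\<close>. In Hermite coordinates,
  scaled by \<open>(n + 1/2)\<close> to the power \<open>1/2\<close>, this is the eigenvalue equation with eigenvalue \<open>\<kappa> / \<mu>\<close> of a Hermitian Hilbert-Schmidt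
  kernel built from the overlaps \<open>U\<^sub>n\<^sub>m\<close> of \<open>h\<^sub>n\<close> with \<open>exp (- \<i> \<delta> y\<^sup>2) h\<^sub>m\<close>. Hence the sum of \<open>\<lambda>\<^sub>n\<close> to the power \<open>-3\<close> is, up to
  \<open>\<kappa>\<close> to the power \<open>3\<close>, the trace of the cube of the kernel. The only nontrivial part of the trace is
  \<open>\<Sum> |U\<^sub>n\<^sub>m|\<^sup>2 / ((n + 1/2)\<^sup>2 (m + 1/2))\<close>. The generating function of \<open>|U\<^sub>n\<^sub>m|\<^sup>2\<close> is a Gaussian integral by Mehler's formula;
  writing the weights as Laplace integrals turns the sum into a double integral, whose expansion in powers of \<open>\<tau>\<close> has
  coefficients \<open>M\<^sub>k\<close> obeying a two-term recursion. The recursion produces the inner sums of the statement,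
  and Clausen's identity identifies \<open>\<Sum> binom(-1/2, k)\<^sup>3 (-\<tau>)\<^sup>k\<close> with \<open>1 / \<kappa>\<close> times the square of the hypergeometric function.
\<close>

section \<open>Compact symmetric operators\<close>

text \<open>Multiplicities are dimensions of spaces of functions, so each eigenspace of
  \<open>Q\<close> is matched with one of the kernel before any trace is taken. From functions to
  coefficients this needs completeness of the Hermite functions, which comes from Mehler's kernel as
  an approximate identity. The way back needs that a series with suitably decaying coefficients is a
  C^2 function with the weighted bounds: second derivatives of the partial sums converge only
  weakly, and the bounds come from an energy identity and Fatou's lemma. The diagonal of the kernel
  decays like 1/n, so the kernel itself has no trace, but its cube has one. The weight of the double
  sum is not symmetric in n and m while |U|^2 is; symmetrising replaces it by s + t in the Laplace
  variables. With s = p + q, t = p - q and \<delta>^2 = \<tau> / (1 - \<tau>) the square root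
  becomes sinh p sqrt (1 - \<tau> (sinh q / sinh p)^2) / sqrt (1 - \<tau>), a power series in \<tau>
  whose terms separate p from q. The bound \<alpha>\<beta> > 2 puts 1 / (1 - \<alpha>\<beta>) inside
  the unit disc, where the hypergeometric series converges.\<close>

lemma bessel_real:
  fixes b :: "'i \<Rightarrow> 'a::real_inner"
  assumes fin: "finite F"
    and orth: "\<And>i j. i \<in> F \<Longrightarrow> j \<in> F \<Longrightarrow> b i \<bullet> b j = (if i = j then 1 else 0)"
  shows "(\<Sum>i\<in>F. (b i \<bullet> x)\<^sup>2) \<le> (norm x)\<^sup>2"
    and "(norm (x - (\<Sum>i\<in>F. (b i \<bullet> x) *\<^sub>R b i)))\<^sup>2 = (norm x)\<^sup>2 - (\<Sum>i\<in>F. (b i \<bullet> x)\<^sup>2)"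
proof -
  let ?p = "\<Sum>i\<in>F. (b i \<bullet> x) *\<^sub>R b i"
  have px: "?p \<bullet> x = (\<Sum>i\<in>F. (b i \<bullet> x)\<^sup>2)"
    by (simp add: inner_sum_left power2_eq_square)
  have "?p \<bullet> ?p = (\<Sum>i\<in>F. \<Sum>j\<in>F. (b i \<bullet> x) * ((b j \<bullet> x) * (b i \<bullet> b j)))"
    by (simp add: inner_sum_left inner_sum_right sum_distrib_left inner_commute mult.left_commute cong: sum.cong)
  also have "\<dots> = (\<Sum>i\<in>F. \<Sum>j\<in>F. if i = j then (b i \<bullet> x)\<^sup>2 else 0)"
    by (intro sum.cong refl) (auto simp: orth power2_eq_square)
  also have "\<dots> = (\<Sum>i\<in>F. (b i \<bullet> x)\<^sup>2)" using fin by simp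
  finally have pp: "?p \<bullet> ?p = (\<Sum>i\<in>F. (b i \<bullet> x)\<^sup>2)" .
  show eq: "(norm (x - ?p))\<^sup>2 = (norm x)\<^sup>2 - (\<Sum>i\<in>F. (b i \<bullet> x)\<^sup>2)"
    unfolding power2_norm_eq_inner inner_diff_left inner_diff_right
    using px pp by (simp add: inner_commute power2_norm_eq_inner)
  show "(\<Sum>i\<in>F. (b i \<bullet> x)\<^sup>2) \<le> (norm x)\<^sup>2"
    using eq zero_le_power2[of "norm (x - ?p)"] by linarith
qed

text \<open>Maximising \<open>norm (K x)\<close> over the unit ball of S, instead of the quadratic
  form, yields an eigenvector of the square of K first; factoring K^2 - m^2 then gives the
  eigenvalue m or - m. The invariant closed subspace S is carried along so that the result applies
  to the orthogonal complement of known eigenvectors.\<close>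

lemma compact_symmetric_eigenvector:
  fixes K :: "'a::{real_inner,complete_space} \<Rightarrow> 'a"
  assumes lin: "bounded_linear K"
    and sym: "\<And>x y. K x \<bullet> y = x \<bullet> K y"
    and cpt: "compact (closure (K ` cball 0 1))"
    and S: "subspace S" "closed S" and inv: "\<And>x. x \<in> S \<Longrightarrow> K x \<in> S"
    and x0: "x0 \<in> S" "K x0 \<noteq> 0"
  obtains y \<nu> where "y \<in> S" "y \<noteq> 0" "\<nu> \<noteq> 0" "K y = \<nu> *\<^sub>R y"
proof -
  interpret K: bounded_linear K by (rule lin)
  define N where "N = (\<lambda>x. norm (K x)) ` (S \<inter> cball 0 1)"
  define m where "m = Sup N"
  have bdd: "bdd_above N"
  proof -
    obtain B where B: "\<And>x. norm (K x) \<le> norm x * B" "B > 0" using K.pos_bounded by blast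
    have "norm (K x) \<le> B" if "x \<in> cball 0 1" for x
      using B(1)[of x] that B(2) mult_right_mono[of "norm x" 1 B] by (auto intro: order_trans)
    then show ?thesis unfolding N_def by (auto intro!: bdd_aboveI[of _ B])
  qed
  have ne: "N \<noteq> {}" unfolding N_def using subspace_0[OF S(1)] by auto
  have le_m: "norm (K x) \<le> m * norm x" if "x \<in> S" for x
  proof (cases "x = 0")
    case False
    have "norm (K (x /\<^sub>R norm x)) \<in> N"
      unfolding N_def using that False S(1) by (auto simp: subspace_scale)
    then have "norm (K (x /\<^sub>R norm x)) \<le> m" unfolding m_def by (rule cSup_upper[OF _ bdd])
    then show ?thesis using False by (simp add: K.scaleR field_simps)
  qed (simp add: K.zero)
  have mpos: "m > 0"
  proof -
    have "0 < norm (K x0)" using x0 by simp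
    also have "\<dots> \<le> m * norm x0" using le_m x0 by simp
    finally show ?thesis by (simp add: zero_less_mult_iff)
  qed
  have "\<exists>x. x \<in> S \<and> norm x \<le> 1 \<and> m - 1 / Suc n < norm (K x)" for n :: nat
  proof -
    have "m - 1 / Suc n < Sup N" unfolding m_def by simp
    then obtain r where "r \<in> N" "m - 1 / Suc n < r" using less_cSupD[OF ne] by blast
    then show ?thesis unfolding N_def by auto
  qed
  then obtain x where x: "\<And>n. x n \<in> S" "\<And>n. norm (x n) \<le> 1" "\<And>n::nat. m - 1 / Suc n < norm (K (x n))"
    by metis
  have "K (x n) \<in> closure (K ` cball 0 1)" for n
    using x(2)[of n] closure_subset[of "K ` cball 0 1"] by auto
  then obtain y r where y: "strict_mono (r::nat\<Rightarrow>nat)" "(\<lambda>n. K (x (r n))) \<longlonglongrightarrow> y"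
    using cpt[unfolded compact_def, rule_format, of "\<lambda>n. K (x n)"] by (auto simp: o_def)
  have nK: "norm (K (x n)) \<le> m" for n
    using le_m[OF x(1)[of n]] x(2)[of n] mpos mult_left_mono[of "norm (x n)" 1 m] by linarith
  have limN: "(\<lambda>n. norm (K (x n))) \<longlonglongrightarrow> m"
  proof (rule tendsto_sandwich[of "\<lambda>n. m - 1 / Suc n" _ _ "\<lambda>n. m"])
    show "(\<lambda>n. m - 1 / real (Suc n)) \<longlonglongrightarrow> m"
      using tendsto_diff[OF tendsto_const lim_inverse_n'[THEN LIMSEQ_Suc], of m] by simp
  qed (use x(3) nK in \<open>auto intro!: always_eventually less_imp_le\<close>)
  have yS: "y \<in> S"
    using closed_sequentially[OF S(2) _ y(2)] inv x(1) by blast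
  have ynorm: "norm y = m"
    using LIMSEQ_unique[OF tendsto_norm[OF y(2)] LIMSEQ_subseq_LIMSEQ[OF limN y(1), unfolded o_def]] .
  \<comment> \<open>By symmetry the cross term is a multiple of the square of
    \<open>norm (K (x n))\<close>, and \<open>K (x n)\<close> lies again in S, so
    \<open>le_m\<close> bounds the first term. An almost maximising vector is thus almost an
    eigenvector of K^2 for m^2.\<close>
  have est: "(norm (K (K (x n)) - (m\<^sup>2) *\<^sub>R x n))\<^sup>2 \<le> m\<^sup>2 * (m\<^sup>2 - (norm (K (x n)))\<^sup>2)" for n
  proof -
    have "(norm (K (K (x n)) - (m\<^sup>2) *\<^sub>R x n))\<^sup>2
        = (norm (K (K (x n))))\<^sup>2 - 2 * m\<^sup>2 * (norm (K (x n)))\<^sup>2 + m^4 * (norm (x n))\<^sup>2"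
      unfolding power2_norm_eq_inner inner_diff_left inner_diff_right inner_scaleR_left inner_scaleR_right
      by (simp add: sym[of "K (x n)" "x n"] inner_commute[of "x n" "K (K (x n))"] power2_eq_square power4_eq_xxxx algebra_simps)
    also have "(norm (K (K (x n))))\<^sup>2 \<le> (m * norm (K (x n)))\<^sup>2"
      using le_m[OF inv[OF x(1)[of n]]] by (intro power_mono) auto
    also have "m^4 * (norm (x n))\<^sup>2 \<le> m^4 * 1"
      using x(2)[of n] mpos by (intro mult_left_mono) (auto simp: power_le_one)
    finally show ?thesis by (simp add: algebra_simps power2_eq_square power4_eq_xxxx)
  qed
  have "(\<lambda>n. m\<^sup>2 * (m\<^sup>2 - (norm (K (x n)))\<^sup>2)) \<longlonglongrightarrow> m\<^sup>2 * (m\<^sup>2 - m\<^sup>2)"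
    by (intro tendsto_intros limN)
  then have "(\<lambda>n. (norm (K (K (x n)) - (m\<^sup>2) *\<^sub>R x n))\<^sup>2) \<longlonglongrightarrow> 0"
    by (intro tendsto_sandwich[of "\<lambda>n. 0" "\<lambda>n. (norm (K (K (x n)) - (m\<^sup>2) *\<^sub>R x n))\<^sup>2" _
          "\<lambda>n. m\<^sup>2 * (m\<^sup>2 - (norm (K (x n)))\<^sup>2)" 0])
       (use est in \<open>auto intro!: always_eventually\<close>)
  then have "(\<lambda>n. norm (K (K (x n)) - (m\<^sup>2) *\<^sub>R x n)) \<longlonglongrightarrow> 0"
    using tendsto_real_sqrt[of _ 0] by fastforce
  then have "(\<lambda>n. K (K (x n)) - (m\<^sup>2) *\<^sub>R x n) \<longlonglongrightarrow> 0"
    by (rule tendsto_norm_zero_cancel)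
  \<comment> \<open>Only the images \<open>K (x (r n))\<close> are known to converge, not the
    \<open>x (r n)\<close>; one more application of K expresses everything through the
    images.\<close>
  from K.tendsto[OF LIMSEQ_subseq_LIMSEQ[OF this y(1)]]
  have "(\<lambda>n. K (K (K (x (r n)))) - (m\<^sup>2) *\<^sub>R K (x (r n))) \<longlonglongrightarrow> 0"
    by (simp add: o_def K.diff K.scaleR K.zero)
  moreover have "(\<lambda>n. K (K (K (x (r n)))) - (m\<^sup>2) *\<^sub>R K (x (r n))) \<longlonglongrightarrow> K (K y) - (m\<^sup>2) *\<^sub>R y"
    by (intro tendsto_intros K.tendsto y(2))
  ultimately have KK: "K (K y) = (m\<^sup>2) *\<^sub>R y"
    using LIMSEQ_unique by fastforce
  \<comment> \<open>(K - m) (K + m) y = 0: either (K + m) y vanishes, or it is an eigenvector for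
    m.\<close>
  define z where "z = K y + m *\<^sub>R y"
  show ?thesis
  proof (cases "z = 0")
    case True
    then have "K y = (-m) *\<^sub>R y" unfolding z_def by (simp add: add_eq_0_iff2)
    moreover have "y \<noteq> 0" using ynorm mpos by auto
    ultimately show ?thesis using that[of y "-m"] yS mpos by simp
  next
    case False
    have "K z = m *\<^sub>R z"
      unfolding z_def by (simp add: K.add K.scaleR KK algebra_simps power2_eq_square)
    moreover have "z \<in> S" unfolding z_def using S(1) inv yS by (simp add: subspace_add subspace_scale)
    ultimately show ?thesis using that[of z m] False mpos by simp
  qed
qed

text \<open>Maximality of the sequence b is the hypothesis \<open>maxi\<close>: no eigenvector with
  nonzero eigenvalue is orthogonal to all of it. Hence K vanishes on the orthogonal complement, and
  the expansion of the cube holds although b need not span the space.\<close>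

lemma compact_symmetric_cube:
  fixes K :: "'a::{real_inner,complete_space} \<Rightarrow> 'a" and b :: "nat \<Rightarrow> 'a"
  assumes lin: "bounded_linear K"
    and sym: "\<And>x y. K x \<bullet> y = x \<bullet> K y"
    and cpt: "compact (closure (K ` cball 0 1))"
    and orth: "\<And>i j. b i \<bullet> b j = (if i = j then 1 else 0)"
    and eig: "\<And>n. K (b n) = \<nu> n *\<^sub>R b n"
    and maxi: "\<And>x c. K x = c *\<^sub>R x \<Longrightarrow> c \<noteq> 0 \<Longrightarrow> (\<And>n. b n \<bullet> x = 0) \<Longrightarrow> x = 0"
  shows "(\<lambda>n. \<nu> n ^ 3 * (b n \<bullet> x)\<^sup>2) sums (K (K (K x)) \<bullet> x)"
proof -
  interpret K: bounded_linear K by (rule lin)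
  define S where "S = {x. \<forall>n. b n \<bullet> x = 0}"
  have S: "subspace S" by (auto simp: S_def subspace_def inner_add_right)
  have Scl: "closed S"
  proof -
    have "S = (\<Inter>n. {x. b n \<bullet> x = 0})" by (auto simp: S_def)
    also have "closed \<dots>" by (intro closed_INT ballI closed_Collect_eq continuous_intros)
    finally show ?thesis .
  qed
  have inv: "K x \<in> S" if "x \<in> S" for x
    using that by (auto simp: S_def sym[symmetric] eig)
  have KS: "K x = 0" if xS: "x \<in> S" for x
  proof (rule ccontr)
    assume "K x \<noteq> 0"
    then obtain y c where "y \<in> S" "y \<noteq> 0" "c \<noteq> 0" "K y = c *\<^sub>R y"
      using compact_symmetric_eigenvector[OF lin sym cpt S Scl inv xS] by blast
    then show False using maxi[of y c] by (auto simp: S_def)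
  qed
  define p where "p N = (\<Sum>i<N. (b i \<bullet> x) *\<^sub>R b i)" for N
  have bes: "(\<Sum>i<N. (b i \<bullet> x)\<^sup>2) \<le> (norm x)\<^sup>2" for N
    by (rule bessel_real(1)) (auto simp: orth)
  have sm: "summable (\<lambda>i. (b i \<bullet> x)\<^sup>2)"
    by (rule summableI_nonneg_bounded[where x="(norm x)\<^sup>2"]) (use bes in auto)
  have "Cauchy p"
  proof (rule CauchyI)
    fix e :: real assume e: "0 < e"
    obtain M where M: "\<And>m n. M \<le> m \<Longrightarrow> norm (\<Sum>i\<in>{m..<n}. (b i \<bullet> x)\<^sup>2) < e\<^sup>2"
      using sm e unfolding summable_Cauchy by (meson zero_less_power)
    have le: "norm (p n - p m) < e" if "M \<le> m" "m \<le> n" for m n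
    proof -
      have eq: "p n - p m = (\<Sum>i\<in>{m..<n}. (b i \<bullet> x) *\<^sub>R b i)"
        unfolding p_def using sum_diff_nat_ivl[of 0 m n "\<lambda>i. (b i \<bullet> x) *\<^sub>R b i"] that by (simp add: atLeast0LessThan)
      have "(norm (p n - p m))\<^sup>2 = (\<Sum>i\<in>{m..<n}. \<Sum>j\<in>{m..<n}. if i = j then (b i \<bullet> x)\<^sup>2 else 0)"
        unfolding eq power2_norm_eq_inner inner_sum_left inner_sum_right
        by (intro sum.cong refl) (auto simp: orth power2_eq_square)
      also have "\<dots> < e\<^sup>2" using M[OF that(1), of n] by simp
      finally show ?thesis using e by (simp add: power_less_imp_less_base)
    qed
    show "\<exists>M. \<forall>m\<ge>M. \<forall>n\<ge>M. norm (p m - p n) < e"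
    proof (intro exI allI impI)
      fix m n assume "M \<le> m" "M \<le> n"
      then show "norm (p m - p n) < e"
        using le[of m n] le[of n m] by (cases "m \<le> n") (auto simp: norm_minus_commute)
    qed
  qed
  then obtain l where l: "p \<longlonglongrightarrow> l" using Cauchy_convergent convergent_def by blast
  have bp: "b n \<bullet> p N = b n \<bullet> x" if "n < N" for n N
    unfolding p_def inner_sum_right using that by (simp add: orth sum.delta' if_distrib[of "\<lambda>t. _ * t"] cong: if_cong)
  have "x - l \<in> S"
    unfolding S_def mem_Collect_eq
  proof
    fix n
    have "(\<lambda>N. b n \<bullet> (x - p N)) \<longlonglongrightarrow> b n \<bullet> (x - l)" by (intro tendsto_intros l)
    moreover have "(\<lambda>N. b n \<bullet> (x - p N)) \<longlonglongrightarrow> 0"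
      by (rule tendsto_eventually) (auto simp: eventually_sequentially inner_diff_right bp intro!: exI[of _ "Suc n"])
    ultimately show "b n \<bullet> (x - l) = 0" using LIMSEQ_unique by blast
  qed
  then have Kl: "K x = K l" using KS[of "x - l"] by (simp add: K.diff)
  have "(\<lambda>N. K (K (K (p N))) \<bullet> x) \<longlonglongrightarrow> K (K (K l)) \<bullet> x"
    by (intro tendsto_intros K.tendsto l)
  moreover have "K (K (K (p N))) \<bullet> x = (\<Sum>n<N. \<nu> n ^ 3 * (b n \<bullet> x)\<^sup>2)" for N
    unfolding p_def by (simp add: K.sum K.scaleR eig inner_sum_left power2_eq_square power3_eq_cube mult_ac)
  ultimately show ?thesis unfolding sums_def Kl by simp
qed

section \<open>Hilbert-Schmidt kernels\<close>

text \<open>A type of its own, so that it can be an instance of \<open>real_inner\<close> and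
  \<open>complete_space\<close>. These classes know only a real inner product, here the real part of
  the Hermitian form; complex scalars enter through \<open>cscale\<close>, and complex orthogonality
  of x and y becomes the pair of conditions that x is orthogonal to y and to
  \<open>cscale \<i> y\<close>.\<close>

typedef 'i ell2 = "{f :: 'i \<Rightarrow> complex. (\<lambda>i. (cmod (f i))\<^sup>2) summable_on UNIV}"
  morphisms coeff Abs_ell2
  by (rule exI[of _ "\<lambda>_. 0"]) simp

setup_lifting type_definition_ell2

lemma norm_add_sq_le: "(norm (x + y))\<^sup>2 \<le> 2 * (norm x)\<^sup>2 + 2 * (norm (y::'a::real_normed_vector))\<^sup>2"
proof -
  have "(norm (x + y))\<^sup>2 \<le> (norm x + norm y)\<^sup>2" by (intro power_mono norm_triangle_ineq) auto
  also have "\<dots> \<le> 2 * (norm x)\<^sup>2 + 2 * (norm y)\<^sup>2"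
    using zero_le_power2[of "norm x - norm y"] by (simp add: power2_diff power2_sum)
  finally show ?thesis .
qed

lemma ell2_add_closed:
  fixes f g :: "'i \<Rightarrow> complex"
  assumes "(\<lambda>i. (cmod (f i))\<^sup>2) summable_on A" "(\<lambda>i. (cmod (g i))\<^sup>2) summable_on A"
  shows "(\<lambda>i. (cmod (f i + g i))\<^sup>2) summable_on A"
  by (rule summable_on_comparison_test[of "\<lambda>i. 2 * (cmod (f i))\<^sup>2 + 2 * (cmod (g i))\<^sup>2"])
     (auto intro!: summable_on_add summable_on_cmult_right assms norm_add_sq_le)

lemma ell2_mult_summable:
  fixes f g :: "'i \<Rightarrow> complex"
  assumes "(\<lambda>i. (cmod (f i))\<^sup>2) summable_on A" "(\<lambda>i. (cmod (g i))\<^sup>2) summable_on A"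
  shows "(\<lambda>i. cmod (f i) * cmod (g i)) summable_on A"
proof (rule summable_on_comparison_test[of "\<lambda>i. (cmod (f i))\<^sup>2 + (cmod (g i))\<^sup>2"])
  fix i
  have "0 \<le> cmod (f i) * cmod (g i)" by simp
  then show "cmod (f i) * cmod (g i) \<le> (cmod (f i))\<^sup>2 + (cmod (g i))\<^sup>2"
    using sum_squares_bound[of "cmod (f i)" "cmod (g i)"] by linarith
qed (auto intro!: summable_on_add assms)

lemma inner_le_cmod: "\<bar>x \<bullet> y\<bar> \<le> cmod x * cmod y"
  by (rule Cauchy_Schwarz_ineq2)

instantiation ell2 :: (type) real_vector
begin
lift_definition zero_ell2 :: "'a ell2" is "\<lambda>_. 0" by simp
lift_definition plus_ell2 :: "'a ell2 \<Rightarrow> 'a ell2 \<Rightarrow> 'a ell2" is "\<lambda>f g i. f i + g i"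
  by (rule ell2_add_closed)
lift_definition uminus_ell2 :: "'a ell2 \<Rightarrow> 'a ell2" is "\<lambda>f i. - f i" by simp
lift_definition minus_ell2 :: "'a ell2 \<Rightarrow> 'a ell2 \<Rightarrow> 'a ell2" is "\<lambda>f g i. f i - g i"
proof -
  fix f g :: "'a \<Rightarrow> complex"
  assume "(\<lambda>i. (cmod (f i))\<^sup>2) summable_on UNIV" "(\<lambda>i. (cmod (g i))\<^sup>2) summable_on UNIV"
  then show "(\<lambda>i. (cmod (f i - g i))\<^sup>2) summable_on UNIV"
    using ell2_add_closed[of f UNIV "\<lambda>i. - g i"] by simp
qed
lift_definition scaleR_ell2 :: "real \<Rightarrow> 'a ell2 \<Rightarrow> 'a ell2" is "\<lambda>r f i. r *\<^sub>R f i"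
  by (simp add: power_mult_distrib summable_on_cmult_right)
instance
proof
  fix x y z :: "'a ell2" and r t :: real
  show "x + y + z = x + (y + z)" by transfer (simp add: add.assoc)
  show "x + y = y + x" by transfer (simp add: add.commute)
  show "0 + x = x" by transfer simp
  show "- x + x = 0" by transfer simp
  show "x - y = x + - y" by transfer simp
  show "r *\<^sub>R (x + y) = r *\<^sub>R x + r *\<^sub>R y" by transfer (simp add: scaleR_add_right)
  show "(r + t) *\<^sub>R x = r *\<^sub>R x + t *\<^sub>R x" by transfer (simp add: scaleR_add_left)
  show "r *\<^sub>R t *\<^sub>R x = (r * t) *\<^sub>R x" by transfer simp
  show "1 *\<^sub>R x = x" by transfer simp
qed
end

lift_definition cscale :: "complex \<Rightarrow> 'a ell2 \<Rightarrow> 'a ell2" is "\<lambda>c f i. c * f i"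
  by (simp add: norm_mult power_mult_distrib summable_on_cmult_right)

lemma coeff_add [simp]: "coeff (x + y) i = coeff x i + coeff y i" by transfer simp
lemma coeff_diff [simp]: "coeff (x - y) i = coeff x i - coeff y i" by transfer simp
lemma coeff_minus [simp]: "coeff (- x) i = - coeff x i" by transfer simp
lemma coeff_scaleR [simp]: "coeff (r *\<^sub>R x) i = r *\<^sub>R coeff x i" by transfer simp
lemma coeff_zero [simp]: "coeff 0 i = 0" by transfer simp
lemma coeff_cscale [simp]: "coeff (cscale c x) i = c * coeff x i" by transfer simp
lemma ell2_eqI: "(\<And>i. coeff x i = coeff y i) \<Longrightarrow> x = y" by transfer (simp add: fun_eq_iff)
lemma coeff_sum: "coeff (sum f A) i = (\<Sum>a\<in>A. coeff (f a) i)"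
  by (induction A rule: infinite_finite_induct) auto
lemma coeff_sq_summable: "(\<lambda>i. (cmod (coeff x i))\<^sup>2) summable_on A"
  using coeff[of x] summable_on_subset_banach by blast
lemma coeff_mult_summable: "(\<lambda>i. cmod (coeff x i) * cmod (coeff y i)) summable_on A"
  by (intro ell2_mult_summable coeff_sq_summable)

lemma coeff_inner_summable: "(\<lambda>i. coeff x i \<bullet> coeff y i) summable_on A"
  by (rule abs_summable_summable, rule summable_on_comparison_test[OF coeff_mult_summable[of x y A]])
     (auto simp: inner_le_cmod)

instantiation ell2 :: (type) real_inner
begin
definition inner_ell2 :: "'a ell2 \<Rightarrow> 'a ell2 \<Rightarrow> real" where
  "inner_ell2 x y = infsum (\<lambda>i. coeff x i \<bullet> coeff y i) UNIV"
definition norm_ell2 :: "'a ell2 \<Rightarrow> real" where "norm_ell2 x = sqrt (x \<bullet> x)"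
definition sgn_ell2 :: "'a ell2 \<Rightarrow> 'a ell2" where "sgn_ell2 x = x /\<^sub>R norm x"
definition dist_ell2 :: "'a ell2 \<Rightarrow> 'a ell2 \<Rightarrow> real" where "dist_ell2 x y = norm (x - y)"
definition uniformity_ell2 :: "('a ell2 \<times> 'a ell2) filter" where
  "uniformity_ell2 = (INF e\<in>{0 <..}. principal {(x, y). dist x y < e})"
definition open_ell2 :: "'a ell2 set \<Rightarrow> bool" where
  "open_ell2 U = (\<forall>x\<in>U. eventually (\<lambda>(x', y). x' = x \<longrightarrow> y \<in> U) uniformity)"
instance
proof
  fix x y z :: "'a ell2" and r :: real
  show "dist x y = norm (x - y)" by (simp add: dist_ell2_def)
  show "sgn x = x /\<^sub>R norm x" by (simp add: sgn_ell2_def)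
  show "(uniformity :: ('a ell2 \<times> 'a ell2) filter) = (INF e\<in>{0 <..}. principal {(x, y). dist x y < e})"
    by (simp add: uniformity_ell2_def)
  show "open U \<longleftrightarrow> (\<forall>x\<in>U. \<forall>\<^sub>F (x', y) in uniformity. x' = x \<longrightarrow> y \<in> U)" for U :: "'a ell2 set"
    by (simp add: open_ell2_def)
  show "x \<bullet> y = y \<bullet> x" by (simp add: inner_ell2_def inner_commute)
  show "(x + y) \<bullet> z = x \<bullet> z + y \<bullet> z"
    by (simp add: inner_ell2_def inner_add_left infsum_add coeff_inner_summable)
  show "(r *\<^sub>R x) \<bullet> y = r * (x \<bullet> y)"
    by (simp add: inner_ell2_def infsum_cmult_right')
  show "0 \<le> x \<bullet> x" by (simp add: inner_ell2_def infsum_nonneg)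
  show "(x \<bullet> x = 0) = (x = 0)"
  proof
    assume "x \<bullet> x = 0"
    then have "infsum (\<lambda>i. coeff x i \<bullet> coeff x i) UNIV = 0" by (simp add: inner_ell2_def)
    then have "coeff x i \<bullet> coeff x i = 0" for i
      by (intro nonneg_infsum_le_0D[of _ UNIV]) (auto simp: coeff_inner_summable)
    then show "x = 0" by (intro ell2_eqI) auto
  qed (simp add: inner_ell2_def)
  show "norm x = sqrt (x \<bullet> x)" by (simp add: norm_ell2_def)
qed
end

lemma norm_ell2_sq: "(norm x)\<^sup>2 = infsum (\<lambda>i. (cmod (coeff x i))\<^sup>2) UNIV"
  by (simp add: power2_norm_eq_inner inner_ell2_def)

lemma sum_coeff_le_norm: "finite F \<Longrightarrow> (\<Sum>i\<in>F. (cmod (coeff x i))\<^sup>2) \<le> (norm x)\<^sup>2"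
  unfolding norm_ell2_sq by (intro finite_sum_le_infsum coeff_sq_summable) auto

lemma cmod_coeff_le: "cmod (coeff x i) \<le> norm x"
  using sum_coeff_le_norm[of "{i}" x] by (simp add: power2_le_iff_abs_le)

lemma norm_ell2_le: "(\<And>F. finite F \<Longrightarrow> (\<Sum>i\<in>F. (cmod (coeff x i))\<^sup>2) \<le> B) \<Longrightarrow> (norm x)\<^sup>2 \<le> B"
  unfolding norm_ell2_sq by (rule infsum_le_finite_sums[OF coeff_sq_summable]) auto

lemma coeff_Abs_ell2:
  assumes "\<And>F. finite F \<Longrightarrow> (\<Sum>i\<in>F. (cmod (f i))\<^sup>2) \<le> B"
  shows "coeff (Abs_ell2 f) i = f i"
proof -
  have "(\<lambda>i. (cmod (f i))\<^sup>2) summable_on UNIV"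
    by (rule nonneg_bdd_above_summable_on) (use assms in \<open>auto intro!: bdd_aboveI[of _ B]\<close>)
  then show ?thesis by (simp add: Abs_ell2_inverse)
qed

text \<open>Coordinates are contractions, so coordinatewise limits exist; norm bounds pass to the
  limit because they are tested on finite partial sums.\<close>

instance ell2 :: (type) complete_space
proof
  fix X :: "nat \<Rightarrow> 'a ell2"
  assume C: "Cauchy X"
  have "Cauchy (\<lambda>n. coeff (X n) i)" for i
    unfolding Cauchy_def
  proof (intro allI impI)
    fix e :: real assume "e > 0"
    then obtain M where M: "\<And>m n. m \<ge> M \<Longrightarrow> n \<ge> M \<Longrightarrow> dist (X m) (X n) < e"
      using C unfolding Cauchy_def by blast
    then have "dist (coeff (X m) i) (coeff (X n) i) < e" if "m \<ge> M" "n \<ge> M" for m n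
      using cmod_coeff_le[of "X m - X n" i] M[OF that] by (simp add: dist_norm)
    then show "\<exists>M. \<forall>m\<ge>M. \<forall>n\<ge>M. dist (coeff (X m) i) (coeff (X n) i) < e" by blast
  qed
  then have "convergent (\<lambda>n. coeff (X n) i)" for i by (rule Cauchy_convergent)
  then obtain l where l: "\<And>i. (\<lambda>n. coeff (X n) i) \<longlonglongrightarrow> l i"
    unfolding convergent_LIMSEQ_iff by (rule that)
  obtain B where B: "\<And>n. norm (X n) \<le> B"
    using cauchy_imp_bounded[OF C] by (auto simp: bounded_iff)
  have fin: "(\<Sum>i\<in>F. (cmod (l i))\<^sup>2) \<le> B\<^sup>2" if "finite F" for F
  proof (rule LIMSEQ_le_const2)
    show "(\<lambda>n. \<Sum>i\<in>F. (cmod (coeff (X n) i))\<^sup>2) \<longlonglongrightarrow> (\<Sum>i\<in>F. (cmod (l i))\<^sup>2)"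
      by (intro tendsto_intros l)
    show "\<exists>N. \<forall>n\<ge>N. (\<Sum>i\<in>F. (cmod (coeff (X n) i))\<^sup>2) \<le> B\<^sup>2"
      using sum_coeff_le_norm[OF that] B by (meson norm_ge_zero order_trans power_mono)
  qed
  define L where "L = Abs_ell2 l"
  have L: "coeff L i = l i" for i unfolding L_def using coeff_Abs_ell2[OF fin] by blast
  have "X \<longlonglongrightarrow> L"
  proof (rule LIMSEQ_I)
    fix e :: real assume e: "e > 0"
    then obtain M where M: "\<And>m n. m \<ge> M \<Longrightarrow> n \<ge> M \<Longrightarrow> dist (X m) (X n) < e / 2"
      using C unfolding Cauchy_def by (meson half_gt_zero)
    have "norm (X n - L) < e" if n: "n \<ge> M" for n
    proof -
      have "(norm (X n - L))\<^sup>2 \<le> (e / 2)\<^sup>2"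
      proof (rule norm_ell2_le)
        fix F :: "'a set" assume F: "finite F"
        show "(\<Sum>i\<in>F. (cmod (coeff (X n - L) i))\<^sup>2) \<le> (e / 2)\<^sup>2"
        proof (rule LIMSEQ_le_const2)
          show "(\<lambda>m. \<Sum>i\<in>F. (cmod (coeff (X n) i - coeff (X m) i))\<^sup>2) \<longlonglongrightarrow> (\<Sum>i\<in>F. (cmod (coeff (X n - L) i))\<^sup>2)"
            unfolding coeff_diff L by (intro tendsto_intros l)
          have "(\<Sum>i\<in>F. (cmod (coeff (X n) i - coeff (X m) i))\<^sup>2) \<le> (e / 2)\<^sup>2" if "m \<ge> M" for m
          proof -
            have "(\<Sum>i\<in>F. (cmod (coeff (X n - X m) i))\<^sup>2) \<le> (norm (X n - X m))\<^sup>2" by (rule sum_coeff_le_norm[OF F])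
            also have "\<dots> \<le> (e / 2)\<^sup>2" using M[OF n that] by (intro power_mono) (auto simp: dist_norm)
            finally show ?thesis by simp
          qed
          then show "\<exists>N. \<forall>m\<ge>N. (\<Sum>i\<in>F. (cmod (coeff (X n) i - coeff (X m) i))\<^sup>2) \<le> (e / 2)\<^sup>2" by blast
        qed
      qed
      then have "norm (X n - L) \<le> e / 2" using e by (simp add: power2_le_iff_abs_le)
      then show ?thesis using e by simp
    qed
    then show "\<exists>M. \<forall>n\<ge>M. norm (X n - L) < e" by blast
  qed
  then show "convergent X" by (auto simp: convergent_def)
qed

definition basis_ell2 :: "'a \<Rightarrow> 'a ell2" where
  "basis_ell2 j = Abs_ell2 (\<lambda>i. if i = j then 1 else 0)"

lemma coeff_basis [simp]: "coeff (basis_ell2 j) i = (if i = j then 1 else 0)"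
  unfolding basis_ell2_def
proof (rule coeff_Abs_ell2[where B = 1])
  fix F :: "'a set" assume "finite F"
  then show "(\<Sum>i\<in>F. (cmod (if i = j then 1 else 0))\<^sup>2) \<le> 1"
    by (simp add: if_distrib[of cmod] if_distrib[of "\<lambda>t. t\<^sup>2"] cong: if_cong)
qed

lemma inner_basis: "x \<bullet> basis_ell2 j = Re (coeff x j)"
proof -
  have "x \<bullet> basis_ell2 j = infsum (\<lambda>i. coeff x i \<bullet> coeff (basis_ell2 j) i) {j}"
    unfolding inner_ell2_def by (rule infsum_cong_neutral) auto
  then show ?thesis by (simp add: inner_complex_def)
qed

lemma cscale_simps [simp]:
  "cscale c (x + y) = cscale c x + cscale c y" "cscale (c + d) x = cscale c x + cscale d x"
  "cscale c (cscale d x) = cscale (c * d) x" "cscale 1 x = x" "cscale 0 x = 0" "cscale c 0 = 0"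
  "cscale (of_real r) x = r *\<^sub>R x" 
  by (rule ell2_eqI; simp add: algebra_simps scaleR_conv_of_real)+

lemma inner_cscale_i: "cscale \<i> x \<bullet> cscale \<i> y = x \<bullet> y"
  by (simp add: inner_ell2_def inner_complex_def add.commute)

lemma inner_cscale_i_left: "cscale \<i> x \<bullet> y = - (x \<bullet> cscale \<i> y)"
proof -
  have "cscale \<i> x \<bullet> y = cscale \<i> (cscale \<i> x) \<bullet> cscale \<i> y" by (simp only: inner_cscale_i)
  also have "cscale \<i> (cscale \<i> x) = - x" by (rule ell2_eqI) simp
  finally show ?thesis by simp
qed

lemma cscale_minus1 [simp]: "cscale (- 1) x = - x" by (rule ell2_eqI) simp

lemma cscale_scaleR: "cscale c (r *\<^sub>R x) = r *\<^sub>R cscale c x"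
  by (rule ell2_eqI) (simp add: scaleR_conv_of_real)

lemma norm_cscale [simp]: "norm (cscale c x) = cmod c * norm x"
proof -
  have "(norm (cscale c x))\<^sup>2 = (cmod c * norm x)\<^sup>2"
    by (simp add: norm_ell2_sq power_mult_distrib norm_mult infsum_cmult_right')
  then show ?thesis by (simp add: power2_eq_iff_nonneg)
qed

lemma continuous_on_cscale: "continuous_on A (\<lambda>c. cscale c x)"
proof (rule continuous_onI)
  fix c e assume e: "0 < (e::real)"
  have "dist (cscale c' x) (cscale c x) = dist c' c * norm x" for c'
  proof -
    have "cscale c' x - cscale c x = cscale (c' - c) x" by (rule ell2_eqI) (simp add: algebra_simps)
    then show ?thesis by (simp add: dist_norm)
  qed
  moreover have "dist c' c * norm x < e" if "dist c' c < e / (norm x + 1)" for c'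
  proof -
    have "dist c' c * norm x \<le> dist c' c * (norm x + 1)" by (simp add: algebra_simps)
    also have "\<dots> < e" using that by (simp add: pos_less_divide_eq add_nonneg_pos)
    finally show ?thesis .
  qed
  ultimately show "\<exists>d>0. \<forall>c'\<in>A. dist c' c < d \<longrightarrow> dist (cscale c' x) (cscale c x) \<le> e"
    using e by (intro exI[of _ "e / (norm x + 1)"]) (auto simp: add_nonneg_pos intro: less_imp_le)
qed

section \<open>Compactness by finite-rank approximation\<close>

lemma compact_finite_combinations:
  fixes v :: "'i \<Rightarrow> 'a ell2"
  assumes "finite F"
  shows "compact {\<Sum>i\<in>F. cscale (g i) (v i) | g. \<forall>i\<in>F. cmod (g i) \<le> B}"
  using assms
proof (induction F rule: finite_induct)
  case empty
  have "{\<Sum>i\<in>{}. cscale (g i) (v i) | g. \<forall>i\<in>{}. cmod (g i) \<le> B} = {0}" by auto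
  then show ?case by simp
next
  case (insert i F)
  have "{\<Sum>j\<in>insert i F. cscale (g j) (v j) | g. \<forall>j\<in>insert i F. cmod (g j) \<le> B}
      = {x + y | x y. x \<in> (\<lambda>c. cscale c (v i)) ` cball 0 B \<and> y \<in> {\<Sum>i\<in>F. cscale (g i) (v i) | g. \<forall>i\<in>F. cmod (g i) \<le> B}}"
    (is "?L = ?R")
  proof
    show "?L \<subseteq> ?R"
    proof
      fix s assume "s \<in> ?L"
      then obtain g where g: "s = (\<Sum>j\<in>insert i F. cscale (g j) (v j))" "\<forall>j\<in>insert i F. cmod (g j) \<le> B" by blast
      have "s = cscale (g i) (v i) + (\<Sum>j\<in>F. cscale (g j) (v j))" using g(1) insert.hyps by simp
      moreover have "cscale (g i) (v i) \<in> (\<lambda>c. cscale c (v i)) ` cball 0 B" using g(2) by auto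
      moreover have "\<forall>j\<in>F. cmod (g j) \<le> B" using g(2) by auto
      ultimately show "s \<in> ?R" by blast
    qed
    show "?R \<subseteq> ?L"
    proof
      fix s assume "s \<in> ?R"
      then obtain c g where cg: "s = cscale c (v i) + (\<Sum>i\<in>F. cscale (g i) (v i))" "cmod c \<le> B" "\<forall>i\<in>F. cmod (g i) \<le> B"
        by auto
      have "(\<Sum>j\<in>F. cscale ((g(i := c)) j) (v j)) = (\<Sum>j\<in>F. cscale (g j) (v j))"
        using insert.hyps by (intro sum.cong) auto
      then have "s = (\<Sum>j\<in>insert i F. cscale ((g(i := c)) j) (v j))"
        using insert.hyps cg(1) by simp
      moreover have "\<forall>j\<in>insert i F. cmod ((g(i := c)) j) \<le> B" using cg by auto
      ultimately show "s \<in> ?L" by blast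
    qed
  qed
  moreover have "compact ((\<lambda>c. cscale c (v i)) ` cball 0 B)"
    by (intro compact_continuous_image continuous_on_cscale compact_cball)
  ultimately show ?case using compact_sums[OF _ insert.IH] by simp
qed

text \<open>Approximability by compact sets at every scale makes S totally bounded. This is how an
  operator is recognised as compact from its finite-rank truncations.\<close>

lemma compact_closure_approx:
  fixes S :: "'a::complete_space set"
  assumes "\<And>e. e > 0 \<Longrightarrow> \<exists>C. compact C \<and> (\<forall>x\<in>S. \<exists>c\<in>C. dist x c < e)"
  shows "compact (closure S)"
  unfolding compact_eq_totally_bounded
proof (rule conjI[OF iffD2[OF complete_eq_closed closed_closure]], intro allI impI)
  fix e :: real assume e: "e > 0"
  obtain C where C: "compact C" "\<forall>x\<in>S. \<exists>c\<in>C. dist x c < e / 3" using assms[of "e / 3"] e by auto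
  obtain k where k: "finite k" "C \<subseteq> (\<Union>x\<in>k. ball x (e / 3))"
    using C(1)[unfolded compact_eq_totally_bounded, THEN conjunct2, rule_format, of "e / 3"] e by auto
  have "closure S \<subseteq> (\<Union>x\<in>k. ball x e)"
  proof
    fix x assume "x \<in> closure S"
    then obtain s where s: "s \<in> S" "dist s x < e / 3"
      using e closure_approachable[THEN iffD1, rule_format, of x S "e / 3"] by auto
    obtain c where c: "c \<in> C" "dist s c < e / 3" using C(2) s by blast
    obtain y where y: "y \<in> k" "dist y c < e / 3" using k(2) c(1) by auto
    have "dist y x \<le> dist y c + dist c x" "dist c x \<le> dist c s + dist s x"
      by (rule dist_triangle)+
    then have "dist y x < e" using s c y by (simp add: dist_commute)
    then show "x \<in> (\<Union>x\<in>k. ball x e)" using y by auto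
  qed
  then show "\<exists>k. finite k \<and> closure S \<subseteq> (\<Union>x\<in>k. ball x e)" using k(1) by blast
qed

text \<open>Taking moduli coordinatewise lets the Cauchy-Schwarz inequality of the real inner
  product bound sums of absolute values.\<close>

lift_definition eabs :: "'a ell2 \<Rightarrow> 'a ell2" is "\<lambda>f i. of_real (cmod (f i))" by simp

lemma coeff_eabs [simp]: "coeff (eabs x) i = of_real (cmod (coeff x i))" by transfer simp
lemma norm_eabs [simp]: "norm (eabs x) = norm x"
proof -
  have "(norm (eabs x))\<^sup>2 = (norm x)\<^sup>2" by (simp add: norm_ell2_sq)
  then show ?thesis by simp
qed

lemma cauchy_schwarz_ell2: "infsum (\<lambda>i. cmod (coeff x i) * cmod (coeff y i)) UNIV \<le> norm x * norm y"
  using norm_cauchy_schwarz[of "eabs x" "eabs y"] by (simp add: inner_ell2_def inner_complex_def)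

section \<open>Hermitian Hilbert-Schmidt kernels and the trace of the cube\<close>

locale hs_kernel =
  fixes k :: "'i \<Rightarrow> 'i \<Rightarrow> complex"
  assumes hs: "(\<lambda>(i,j). (cmod (k i j))\<^sup>2) summable_on UNIV"
    and herm: "k j i = cnj (k i j)"
begin

definition row :: "'i \<Rightarrow> 'i ell2" where "row i = Abs_ell2 (k i)"

lemma row_summable: "(\<lambda>j. (cmod (k i j))\<^sup>2) summable_on UNIV"
  using summable_on_SigmaD1[of "\<lambda>i j. (cmod (k i j))\<^sup>2" UNIV "\<lambda>_. UNIV" i] hs by simp

lemma coeff_row [simp]: "coeff (row i) j = k i j"
  unfolding row_def by (simp add: Abs_ell2_inverse row_summable)

lemma row_norm_summable: "(\<lambda>i. (norm (row i))\<^sup>2) summable_on UNIV"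
  unfolding norm_ell2_sq coeff_row
  using summable_on_Sigma_banach[of "\<lambda>i j. (cmod (k i j))\<^sup>2" UNIV "\<lambda>_. UNIV"] hs by simp

definition HS :: real where "HS = infsum (\<lambda>i. (norm (row i))\<^sup>2) UNIV"

lemma sum_row_le: "finite F \<Longrightarrow> (\<Sum>i\<in>F. (norm (row i))\<^sup>2) \<le> HS"
  unfolding HS_def by (rule finite_sum_le_infsum[OF row_norm_summable]) auto

lemma HS_nonneg: "HS \<ge> 0" using sum_row_le[of "{}"] by simp

text \<open>The bare family of coordinates; it has to be bounded by \<open>sum_app_le\<close> before
  \<open>op\<close> can wrap it into the type and \<open>coeff\<close> can read it back.\<close>

definition app :: "'i ell2 \<Rightarrow> 'i \<Rightarrow> complex" where
  "app x i = infsum (\<lambda>j. k i j * coeff x j) UNIV"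

lemma app_abs_summable: "(\<lambda>j. norm (k i j * coeff x j)) summable_on UNIV"
  using coeff_mult_summable[of "row i" x UNIV] by (simp add: norm_mult)

lemma app_summable: "(\<lambda>j. k i j * coeff x j) summable_on UNIV"
  by (rule abs_summable_summable) (rule app_abs_summable)

lemma cmod_app_le: "cmod (app x i) \<le> norm (row i) * norm x"
proof -
  have "cmod (app x i) \<le> infsum (\<lambda>j. norm (k i j * coeff x j)) UNIV"
    unfolding app_def by (rule norm_infsum_bound) (rule app_abs_summable)
  also have "\<dots> = infsum (\<lambda>j. cmod (coeff (row i) j) * cmod (coeff x j)) UNIV" by (simp add: norm_mult)
  also have "\<dots> \<le> norm (row i) * norm x" by (rule cauchy_schwarz_ell2)
  finally show ?thesis .
qed

lemma sum_app_le: "(\<Sum>i\<in>F. (cmod (app x i))\<^sup>2) \<le> (\<Sum>i\<in>F. (norm (row i))\<^sup>2) * (norm x)\<^sup>2"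
  unfolding sum_distrib_right power_mult_distrib[symmetric]
  by (intro sum_mono power_mono cmod_app_le) auto

definition op :: "'i ell2 \<Rightarrow> 'i ell2" where "op x = Abs_ell2 (app x)"

lemma coeff_op_app: "coeff (op x) i = app x i"
  unfolding op_def
proof (rule coeff_Abs_ell2)
  fix F :: "'i set" assume "finite F"
  then show "(\<Sum>i\<in>F. (cmod (app x i))\<^sup>2) \<le> HS * (norm x)\<^sup>2"
    using sum_app_le[where F = F and x = x] mult_right_mono[OF sum_row_le[of F], of "(norm x)\<^sup>2"] by simp
qed

lemma coeff_op: "coeff (op x) i = infsum (\<lambda>j. k i j * coeff x j) UNIV"
  by (simp add: coeff_op_app app_def)

lemma op_cscale: "op (cscale c x) = cscale c (op x)"
proof (rule ell2_eqI)
  fix i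
  have "infsum (\<lambda>j. k i j * (c * coeff x j)) UNIV = infsum (\<lambda>j. c * (k i j * coeff x j)) UNIV"
    by (simp add: algebra_simps)
  then show "coeff (op (cscale c x)) i = coeff (cscale c (op x)) i"
    by (simp add: coeff_op infsum_cmult_right')
qed

lemma norm_op_le: "norm (op x) \<le> norm x * sqrt HS"
proof -
  have "(norm (op x))\<^sup>2 \<le> HS * (norm x)\<^sup>2"
  proof (rule norm_ell2_le)
    fix F :: "'i set" assume "finite F"
    then show "(\<Sum>i\<in>F. (cmod (coeff (op x) i))\<^sup>2) \<le> HS * (norm x)\<^sup>2"
      unfolding coeff_op_app
      using sum_app_le[where F = F and x = x] mult_right_mono[OF sum_row_le[of F], of "(norm x)\<^sup>2"] by simp
  qed
  also have "\<dots> = (norm x * sqrt HS)\<^sup>2" using HS_nonneg by (simp add: power_mult_distrib)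
  finally show ?thesis using HS_nonneg by (simp add: power2_le_iff_abs_le)
qed

lemma bounded_linear_op: "bounded_linear op"
proof (rule bounded_linear_intro)
  fix x y r
  show "op (x + y) = op x + op y"
    by (rule ell2_eqI) (simp add: coeff_op distrib_left infsum_add app_summable)
  show "op (r *\<^sub>R x) = r *\<^sub>R op x" using op_cscale[of "of_real r" x] by simp
  show "norm (op x) \<le> norm x * sqrt HS" by (rule norm_op_le)
qed

lemma op_symmetric: "op x \<bullet> y = x \<bullet> op y"
proof -
  \<comment> \<open>Over pairs of indices both the squared kernel and the product of the squared
    coordinates are summable; their sum dominates the triple product and licenses the exchange of
    the two sums.\<close>
  have S1: "(\<lambda>(i,j). (cmod (coeff x j) * cmod (coeff y i))\<^sup>2) summable_on UNIV \<times> UNIV"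
    unfolding power_mult_distrib
    by (rule summable_on_SigmaI[where g = "\<lambda>i. (norm x)\<^sup>2 * (cmod (coeff y i))\<^sup>2"])
       (auto simp: norm_ell2_sq intro!: has_sum_cmult_left has_sum_infsum coeff_sq_summable summable_on_cmult_right)
  have "(\<lambda>(i,j). k i j * coeff x j * cnj (coeff y i)) summable_on UNIV \<times> UNIV"
  proof (rule abs_summable_summable, rule summable_on_comparison_test)
    show "(\<lambda>(i,j). (cmod (k i j))\<^sup>2 + (cmod (coeff x j) * cmod (coeff y i))\<^sup>2) summable_on UNIV \<times> UNIV"
      using summable_on_add[OF hs[unfolded UNIV_Times_UNIV[symmetric]] S1] by (simp add: case_prod_unfold)
    fix p :: "'i \<times> 'i"
    obtain i j where p: "p = (i, j)" by force
    have "2 * cmod (k i j) * (cmod (coeff x j) * cmod (coeff y i)) \<le> (cmod (k i j))\<^sup>2 + (cmod (coeff x j) * cmod (coeff y i))\<^sup>2"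
      by (rule sum_squares_bound)
    moreover have "0 \<le> cmod (k i j) * (cmod (coeff x j) * cmod (coeff y i))" by simp
    ultimately show "norm (case p of (i, j) \<Rightarrow> k i j * coeff x j * cnj (coeff y i))
        \<le> (case p of (i,j) \<Rightarrow> (cmod (k i j))\<^sup>2 + (cmod (coeff x j) * cmod (coeff y i))\<^sup>2)"
      unfolding p norm_mult prod.case complex_mod_cnj mult.assoc by linarith
  qed auto
  note sw = infsum_swap_banach[OF this]
  \<comment> \<open>The argument runs through the Hermitian form, since only there does
    \<open>herm\<close> move the kernel from one side to the other; the real inner product is its
    real part.\<close>
  have re: "u \<bullet> v = Re (infsum (\<lambda>i. coeff u i * cnj (coeff v i)) UNIV)" for u v :: "'i ell2"
  proof -
    have "(\<lambda>i. coeff u i * cnj (coeff v i)) summable_on UNIV"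
      by (rule abs_summable_summable) (use coeff_mult_summable[of u v] in \<open>simp add: norm_mult\<close>)
    then show ?thesis by (simp add: inner_ell2_def inner_complex_def infsum_Re[symmetric])
  qed
  have "op x \<bullet> y = Re (infsum (\<lambda>i. infsum (\<lambda>j. k i j * coeff x j * cnj (coeff y i)) UNIV) UNIV)"
    by (simp add: re coeff_op infsum_cmult_left')
  also have "\<dots> = Re (infsum (\<lambda>j. infsum (\<lambda>i. k i j * coeff x j * cnj (coeff y i)) UNIV) UNIV)"
    by (simp only: sw)
  also have "(\<lambda>j. infsum (\<lambda>i. k i j * coeff x j * cnj (coeff y i)) UNIV) = (\<lambda>j. coeff x j * cnj (coeff (op y) j))"
  proof
    fix j
    have "(\<lambda>i. k i j * coeff x j * cnj (coeff y i)) = (\<lambda>i. coeff x j * cnj (k j i * coeff y i))"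
      by (simp add: herm[of _ j] mult_ac)
    then show "infsum (\<lambda>i. k i j * coeff x j * cnj (coeff y i)) UNIV = coeff x j * cnj (coeff (op y) j)"
      by (simp add: coeff_op infsum_cmult_right' infsum_cnj del: complex_cnj_mult)
  qed
  finally show ?thesis by (simp add: re)
qed

text \<open>Choose finitely many rows F that carry all of \<open>HS\<close> up to (e/2)^2. Dropping
  the coordinates outside F changes \<open>op x\<close> by at most e/2 uniformly on the unit ball,
  and what remains has finite rank and bounded coefficients.\<close>

lemma compact_op: "compact (closure (op ` cball 0 1))"
proof (rule compact_closure_approx)
  fix e :: real assume e: "e > 0"
  obtain F where F: "finite F" "dist (\<Sum>i\<in>F. (norm (row i))\<^sup>2) HS \<le> (e/2)\<^sup>2"
    using infsum_finite_approximation[OF row_norm_summable, of "(e/2)\<^sup>2"] e unfolding HS_def by auto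
  let ?C = "{\<Sum>i\<in>F. cscale (g i) (basis_ell2 i) | g. \<forall>i\<in>F. cmod (g i) \<le> sqrt HS}"
  have "\<exists>c\<in>?C. dist y c < e" if y: "y \<in> op ` cball 0 1" for y
  proof -
    obtain x where x: "y = op x" "norm x \<le> 1" using y by auto
    have ny: "norm y \<le> sqrt HS"
      using norm_op_le[of x] x HS_nonneg mult_right_mono[of "norm x" 1 "sqrt HS"] by simp
    define c where "c = (\<Sum>i\<in>F. cscale (coeff y i) (basis_ell2 i))"
    have cc: "coeff (y - c) i = (if i \<in> F then 0 else coeff y i)" for i
      unfolding c_def coeff_diff coeff_sum using F(1)
      by (simp add: if_distrib[of "\<lambda>t. _ * t"] cong: if_cong)
    have "(norm (y - c))\<^sup>2 \<le> (e/2)\<^sup>2"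
    proof (rule norm_ell2_le)
      fix G :: "'i set" assume G: "finite G"
      have "(\<Sum>i\<in>G. (cmod (coeff (y - c) i))\<^sup>2) = (\<Sum>i\<in>G-F. (cmod (coeff (y - c) i))\<^sup>2)"
        by (rule sum.mono_neutral_right) (use G cc in auto)
      also have "\<dots> = (\<Sum>i\<in>G-F. (cmod (app x i))\<^sup>2)"
        by (rule sum.cong) (use cc x(1) coeff_op_app in auto)
      also have "\<dots> \<le> (\<Sum>i\<in>G-F. (norm (row i))\<^sup>2) * (norm x)\<^sup>2" by (rule sum_app_le)
      also have "\<dots> \<le> (\<Sum>i\<in>G-F. (norm (row i))\<^sup>2) * 1"
        using x(2) by (intro mult_left_mono sum_nonneg) (auto simp: power_le_one)
      also have "\<dots> = (\<Sum>i\<in>G\<union>F. (norm (row i))\<^sup>2) - (\<Sum>i\<in>F. (norm (row i))\<^sup>2)"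
        using sum_diff[of "G \<union> F" F "\<lambda>i. (norm (row i))\<^sup>2"] F(1) G by (simp add: Un_Diff)
      also have "\<dots> \<le> HS - (\<Sum>i\<in>F. (norm (row i))\<^sup>2)" using sum_row_le[of "G \<union> F"] F(1) G by simp
      also have "\<dots> \<le> (e/2)\<^sup>2" using F(2) by (simp add: dist_real_def)
      finally show "(\<Sum>i\<in>G. (cmod (coeff (y - c) i))\<^sup>2) \<le> (e/2)\<^sup>2" .
    qed
    then have "norm (y - c) \<le> e / 2" using e by (simp add: power2_le_iff_abs_le)
    moreover have "c \<in> ?C" unfolding c_def using cmod_coeff_le[of y] ny by (auto intro: order_trans)
    ultimately show ?thesis using e by (intro bexI[of _ c]) (auto simp: dist_norm)
  qed
  then show "\<exists>C. compact C \<and> (\<forall>x\<in>op ` cball 0 1. \<exists>c\<in>C. dist x c < e)"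
    using compact_finite_combinations[OF F(1)] by blast
qed

text \<open>The squared norms of the images of an orthonormal family add up to at most
  \<open>HS\<close>, and each eigenvector contributes the square of its eigenvalue. So
  multiplicities are finite, which later yields families of maximal cardinality.\<close>

lemma orthonormal_eigen_bound:
  assumes fin: "finite B"
    and orth: "\<And>x y. x \<in> B \<Longrightarrow> y \<in> B \<Longrightarrow> x \<bullet> y = (if x = y then 1 else 0)"
    and eig: "\<And>x. x \<in> B \<Longrightarrow> op x = \<nu> *\<^sub>R x" and nu: "\<nu> \<noteq> 0"
    and orth': "\<And>x y. x \<in> B \<Longrightarrow> y \<in> B \<Longrightarrow> x \<bullet> cscale \<i> y = 0"
  shows "real (card B) \<le> HS / \<nu>\<^sup>2"
proof -
  have "real (card B) * \<nu>\<^sup>2 = (\<Sum>x\<in>B. (norm (op x))\<^sup>2)"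
  proof -
    have "(norm (op x))\<^sup>2 = \<nu>\<^sup>2" if "x \<in> B" for x
      unfolding power2_norm_eq_inner using eig[OF that] orth[OF that that] by (simp add: power2_eq_square)
    then show ?thesis by simp
  qed
  also have "\<dots> \<le> HS"
  proof -
    have bnd: "(\<Sum>x\<in>B. \<Sum>i\<in>F. (cmod (coeff (op x) i))\<^sup>2) \<le> HS" if F: "finite F" for F
    proof -
      \<comment> \<open>Entries are conjugated here, so that coordinate i of \<open>op x\<close> is
        the Hermitian product of x with this vector.\<close>
      define eabs_row where "eabs_row i = Abs_ell2 (\<lambda>j. cnj (k i j))" for i
      have er: "coeff (eabs_row i) j = cnj (k i j)" for i j
        unfolding eabs_row_def by (simp add: Abs_ell2_inverse row_summable)
      have nr: "norm (eabs_row i) = norm (row i)" for i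
      proof -
        have "(norm (eabs_row i))\<^sup>2 = (norm (row i))\<^sup>2" by (simp add: norm_ell2_sq er)
        then show ?thesis by simp
      qed
      have c: "(cmod (coeff (op x) i))\<^sup>2 = (x \<bullet> eabs_row i)\<^sup>2 + (cscale \<i> x \<bullet> eabs_row i)\<^sup>2" for x i
      proof -
        have "x \<bullet> eabs_row i = Re (coeff (op x) i)"
          unfolding coeff_op infsum_Re[OF app_summable, symmetric] inner_ell2_def er
          by (simp add: inner_complex_def algebra_simps)
        moreover have "cscale \<i> x \<bullet> eabs_row i = - Im (coeff (op x) i)"
          unfolding coeff_op infsum_Im[OF app_summable, symmetric] inner_ell2_def er infsum_uminus[symmetric]
          by (simp add: inner_complex_def algebra_simps)
        ultimately show ?thesis by (simp add: cmod_power2)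
      qed
      have b: "(\<Sum>x\<in>B. (x \<bullet> r)\<^sup>2 + (cscale \<i> x \<bullet> r)\<^sup>2) \<le> (norm r)\<^sup>2" for r
      proof -
        \<comment> \<open>B together with its multiples by the imaginary unit is orthonormal for the
          real inner product. Both halves are needed, since the squared modulus of a coordinate is
          the sum of the squares of its real and imaginary part.\<close>
        let ?b = "\<lambda>(x, t::bool). if t then cscale \<i> x else x"
        have "(\<Sum>p\<in>B \<times> UNIV. (?b p \<bullet> r)\<^sup>2) \<le> (norm r)\<^sup>2"
        proof (rule bessel_real(1))
          show "finite (B \<times> (UNIV::bool set))" using fin by simp
          show "?b p \<bullet> ?b q = (if p = q then 1 else 0)" if "p \<in> B \<times> UNIV" "q \<in> B \<times> UNIV" for p q
          proof -
            obtain x s y t where pq: "p = (x, s)" "q = (y, t)" by fastforce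
            show ?thesis using that unfolding pq
              by (cases s; cases t) (simp_all add: inner_cscale_i inner_cscale_i_left orth orth')
          qed
        qed
        moreover have "(\<Sum>p\<in>B \<times> UNIV. (?b p \<bullet> r)\<^sup>2) = (\<Sum>x\<in>B. \<Sum>t\<in>UNIV. (?b (x, t) \<bullet> r)\<^sup>2)"
          by (subst sum.cartesian_product) (rule sum.cong; auto)
        ultimately show ?thesis by (simp add: UNIV_bool add.commute)
      qed
      have "(\<Sum>x\<in>B. \<Sum>i\<in>F. (cmod (coeff (op x) i))\<^sup>2) = (\<Sum>i\<in>F. \<Sum>x\<in>B. (x \<bullet> eabs_row i)\<^sup>2 + (cscale \<i> x \<bullet> eabs_row i)\<^sup>2)"
        unfolding c by (rule sum.swap)
      also have "\<dots> \<le> (\<Sum>i\<in>F. (norm (row i))\<^sup>2)" using b[of "eabs_row _"] by (intro sum_mono) (simp add: nr)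
      also have "\<dots> \<le> HS" by (rule sum_row_le[OF F])
      finally show ?thesis .
    qed
    have hs: "((\<lambda>i. \<Sum>x\<in>B. (cmod (coeff (op x) i))\<^sup>2) has_sum (\<Sum>x\<in>B. (norm (op x))\<^sup>2)) UNIV"
      unfolding norm_ell2_sq using fin
    proof (induction B rule: finite_induct)
      case (insert x B)
      then show ?case by (simp add: has_sum_add has_sum_infsum coeff_sq_summable)
    qed simp
    show ?thesis
    proof (rule has_sum_le_finite_sums[OF hs])
      show "(\<Sum>i\<in>F. \<Sum>x\<in>B. (cmod (coeff (op x) i))\<^sup>2) \<le> HS" if "finite F" for F
        by (subst sum.swap) (rule bnd[OF that])
    qed
  qed
  finally show ?thesis using nu by (simp add: pos_le_divide_eq)
qed

lemma trace_cube_diag: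
  fixes b :: "nat \<Rightarrow> 'i ell2"
  assumes orth: "\<And>i j. b i \<bullet> b j = (if i = j then 1 else 0)"
    and orth': "\<And>i j. b i \<bullet> cscale \<i> (b j) = 0"
    and eig: "\<And>n. op (b n) = \<nu> n *\<^sub>R b n"
    and maxi: "\<And>x c. op x = c *\<^sub>R x \<Longrightarrow> c \<noteq> 0 \<Longrightarrow> (\<And>n. b n \<bullet> x = 0) \<Longrightarrow> (\<And>n. cscale \<i> (b n) \<bullet> x = 0) \<Longrightarrow> x = 0"
  shows "(\<lambda>n. \<nu> n ^ 3 * (cmod (coeff (b n) i))\<^sup>2) sums Re (coeff (op (op (op (basis_ell2 i)))) i)"
proof -
  \<comment> \<open>Over the reals the system is doubled: even positions hold \<open>b n\<close>,
    odd ones \<open>cscale \<i> (b n)\<close>, with the same eigenvalue. Grouping consecutive pairs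
    restores one term per n, in which real and imaginary part combine to a squared modulus.\<close>
  let ?b = "\<lambda>m. if even m then b (m div 2) else cscale \<i> (b (m div 2))"
  let ?\<nu> = "\<lambda>m. \<nu> (m div 2)"
  have "(\<lambda>m. ?\<nu> m ^ 3 * (?b m \<bullet> basis_ell2 i)\<^sup>2) sums (op (op (op (basis_ell2 i))) \<bullet> basis_ell2 i)"
  proof (rule compact_symmetric_cube[OF bounded_linear_op op_symmetric compact_op])
    show "?b m \<bullet> ?b n = (if m = n then 1 else 0)" for m n
      by (auto simp: inner_cscale_i inner_cscale_i_left orth orth' elim!: evenE oddE)
    show "op (?b n) = ?\<nu> n *\<^sub>R ?b n" for n
      using eig[of "n div 2"] cscale_simps(3)[of \<i> "of_real (?\<nu> n)" "b (n div 2)"] cscale_simps(3)[of "of_real (?\<nu> n)" \<i> "b (n div 2)"]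
      by (auto simp: op_cscale cscale_scaleR)
    fix x c assume x: "op x = c *\<^sub>R x" "c \<noteq> 0" and *: "\<And>n. ?b n \<bullet> x = 0"
    have "b n \<bullet> x = 0" "cscale \<i> (b n) \<bullet> x = 0" for n
      using *[of "2 * n"] *[of "2 * n + 1"] by auto
    then show "x = 0" by (rule maxi[OF x])
  qed
  from sums_group[OF this, of 2]
  have "(\<lambda>n. \<Sum>m=n*2..<n*2+2. ?\<nu> m ^ 3 * (?b m \<bullet> basis_ell2 i)\<^sup>2) sums Re (coeff (op (op (op (basis_ell2 i)))) i)"
    by (simp add: inner_basis)
  moreover have "(\<Sum>m=n*2..<n*2+2. ?\<nu> m ^ 3 * (?b m \<bullet> basis_ell2 i)\<^sup>2) = \<nu> n ^ 3 * (cmod (coeff (b n) i))\<^sup>2" for n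
  proof -
    have "{n*2..<n*2+2} = {2*n, 2*n+1}" by auto
    then show ?thesis by (simp add: inner_basis cmod_power2 algebra_simps)
  qed
  ultimately show ?thesis by simp
qed

text \<open>Summing the diagonal entries over all coordinates: nonnegative eigenvalues make the
  double family summable, so the sums may be exchanged, and for each n the squared moduli of the
  coordinates of \<open>b n\<close> add up to 1.\<close>

lemma trace_cube:
  fixes b :: "nat \<Rightarrow> 'i ell2"
  assumes orth: "\<And>i j. b i \<bullet> b j = (if i = j then 1 else 0)"
    and orth': "\<And>i j. b i \<bullet> cscale \<i> (b j) = 0"
    and eig: "\<And>n. op (b n) = \<nu> n *\<^sub>R b n" and pos: "\<And>n. \<nu> n \<ge> 0"
    and maxi: "\<And>x c. op x = c *\<^sub>R x \<Longrightarrow> c \<noteq> 0 \<Longrightarrow> (\<And>n. b n \<bullet> x = 0) \<Longrightarrow> (\<And>n. cscale \<i> (b n) \<bullet> x = 0) \<Longrightarrow> x = 0"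
    and tr: "((\<lambda>i. Re (coeff (op (op (op (basis_ell2 i)))) i)) has_sum T) UNIV"
  shows "(\<lambda>n. \<nu> n ^ 3) sums T"
proof -
  let ?g = "\<lambda>i n. \<nu> n ^ 3 * (cmod (coeff (b n) i))\<^sup>2"
  let ?t = "\<lambda>i. Re (coeff (op (op (op (basis_ell2 i)))) i)"
  have g: "(?g i has_sum ?t i) UNIV" for i
    by (rule sums_nonneg_imp_has_sum[OF trace_cube_diag[OF orth orth' eig maxi]]) (use pos in auto)
  have S: "(\<lambda>(i,n). ?g i n) summable_on UNIV \<times> UNIV"
    by (rule summable_on_SigmaI[where g = ?t]) (use g tr pos in \<open>auto simp: has_sum_imp_summable\<close>)
  have "((\<lambda>(i,n). ?g i n) has_sum T) (UNIV \<times> UNIV)"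
    by (rule has_sum_SigmaI[OF _ tr S]) (use g in auto)
  then have "((\<lambda>(n,i). case (i,n) of (i,n) \<Rightarrow> ?g i n) has_sum T) (UNIV \<times> UNIV)"
    by (rule has_sum_swap[THEN iffD1])
  then have "((\<lambda>(n,i). ?g i n) has_sum T) (UNIV \<times> UNIV)" by simp
  then have "((\<lambda>n. \<nu> n ^ 3 * 1) has_sum T) UNIV"
  proof (rule has_sum_SigmaD)
    fix n
    have "((\<lambda>i. (cmod (coeff (b n) i))\<^sup>2) has_sum 1) UNIV"
      using has_sum_infsum[OF coeff_sq_summable[of "b n" UNIV]] orth[of n n]
      unfolding norm_ell2_sq[symmetric] by (simp add: power2_norm_eq_inner)
    then show "((\<lambda>i. case (n, i) of (n, i) \<Rightarrow> ?g i n) has_sum (\<nu> n ^ 3 * 1)) UNIV"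
      using has_sum_cmult_right[of "\<lambda>i. (cmod (coeff (b n) i))\<^sup>2" UNIV 1 "\<nu> n ^ 3"] by simp
  qed
  then show ?thesis using has_sum_imp_sums by simp
qed

end

section \<open>Clausen's identity\<close>

text \<open>The modulus of binom(-1/2, k), that is, the coefficient of x^k in (1 - x)^(-1/2); the
  sign is split off in \<open>gchoose_minus_half\<close>.\<close>

definition bcoef :: "nat \<Rightarrow> real" where "bcoef k = pochhammer (1 / 2) k / fact k"

lemma pochhammer_ratio_Suc:
  "pochhammer a (Suc n) / fact (Suc n) = pochhammer a n / fact n * ((a + real n) / (real n + 1))"
  for a :: real
proof -
  have "pochhammer a (Suc n) / fact (Suc n) = (pochhammer a n * (a + real n)) / (fact n * (real n + 1))"
    by (simp add: pochhammer_Suc algebra_simps)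
  then show ?thesis by (simp only: times_divide_times_eq)
qed

lemma gchoose_uminus_power: "((- a) gchoose j) * (- t) ^ j = pochhammer a j / fact j * t ^ j" for a t :: real
  by (cases "even j") (simp_all add: gbinomial_pochhammer)

lemma bcoef_pos: "bcoef k > 0"
  by (simp add: bcoef_def pochhammer_pos)

lemma bcoef_Suc: "real (k + 1) * bcoef (Suc k) = (real k + 1 / 2) * bcoef k"
proof -
  have "(real k + 1) * (q * ((1 / 2 + real k) / (real k + 1))) = (real k + 1 / 2) * q" for q :: real
    by (simp add: field_simps)
  then show ?thesis unfolding bcoef_def pochhammer_ratio_Suc by (simp add: add.commute)
qed

lemma bcoef_0 [simp]: "bcoef 0 = 1" by (simp add: bcoef_def)

lemma gchoose_minus_half: "(- 1 / 2 :: real) gchoose k = (- 1) ^ k * bcoef k"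
  by (simp add: bcoef_def gbinomial_pochhammer)

lemma pochhammer_le_fact:
  assumes "0 \<le> x" "x \<le> (1::real)"
  shows "pochhammer x n / fact n \<le> 1"
proof -
  have "pochhammer x n \<le> fact n"
  proof (induction n)
    case (Suc n)
    have "pochhammer x n * (x + real n) \<le> fact n * (1 + real n)"
      using assms Suc by (intro mult_mono) (auto intro!: pochhammer_nonneg)
    then show ?case by (simp add: pochhammer_Suc mult.commute)
  qed simp
  then show ?thesis by simp
qed

lemma pochhammer_fact_nonneg: "0 \<le> x \<Longrightarrow> 0 \<le> pochhammer x n / (fact n :: real)"
  by (cases "x = 0") (auto simp: pochhammer_0_left intro!: divide_nonneg_pos less_imp_le[OF pochhammer_pos])

text \<open>Coefficients of 2F1(1/4, 1/4; 1; t). Clausen's identity makes its square 3F2(1/2, 1/2,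
  1/2; 1, 1; t), whose coefficients are the cubes of \<open>bcoef\<close>.\<close>

definition qcoef :: "nat \<Rightarrow> real" where "qcoef n = (pochhammer (1 / 4) n / fact n)\<^sup>2"

lemma qcoef_bounds: "0 \<le> qcoef n" "qcoef n \<le> 1"
  unfolding qcoef_def
  using pochhammer_le_fact[of "1/4" n] pochhammer_fact_nonneg[of "1/4" n] by (auto intro: power_le_one)

lemma fps_XD_mult: "fps_XD (f * g) = fps_XD f * g + f * fps_XD (g :: 'a::comm_ring_1 fps)"
  by (simp add: fps_XD_def algebra_simps)

lemma fps_XD_X: "fps_XD fps_X = (fps_X :: 'a::comm_ring_1 fps)"
  by (simp add: fps_XD_def)

lemma fps_XD_numeral: "fps_XD (numeral k * f) = numeral k * fps_XD (f :: real fps)"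
proof -
  have "fps_XD (numeral k :: real fps) = 0"
    by (simp add: fps_XD_def fps_numeral_fps_const)
  then show ?thesis by (simp add: fps_XD_mult)
qed

lemma fps_XD_diff: "fps_XD (f - g) = fps_XD f - fps_XD (g :: real fps)"
  by (simp add: fps_XD_def algebra_simps)

lemma fps_XD_plus: "fps_XD (f + g) = fps_XD f + fps_XD (g :: real fps)"
  by (simp add: fps_XD_def algebra_simps)

text \<open>Clausen's formula: the square of a solution of a second-order equation solves its symmetric square.\<close>

lemma clausen_coeff: "(\<Sum>i\<le>n. qcoef i * qcoef (n - i)) = bcoef n ^ 3"
proof -
  define G where "G = Abs_fps qcoef"
  define G1 where "G1 = fps_XD G"
  define G2 where "G2 = fps_XD G1"
  define G3 where "G3 = fps_XD G2"
  \<comment> \<open>With \<theta> for \<open>fps_XD\<close> this is the hypergeometric equation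
    \<theta>^2 G = X (\<theta> + 1/4)^2 G, cleared of denominators.\<close>
  have A: "16 * ((1 - fps_X) * G2) = fps_X * (8 * G1 + G)"
  proof (rule fps_ext)
    fix n
    show "fps_nth (16 * ((1 - fps_X) * G2)) n = fps_nth (fps_X * (8 * G1 + G)) n"
    proof (cases n)
      case 0
      then show ?thesis by (simp add: G2_def fps_numeral_fps_const)
    next
      case (Suc m)
      have q: "(real m + 1)\<^sup>2 * qcoef (Suc m) = (real m + 1 / 4)\<^sup>2 * qcoef m"
        unfolding qcoef_def pochhammer_ratio_Suc by (simp add: power_mult_distrib power_divide add.commute)
      then show ?thesis
        by (simp add: Suc G2_def G1_def G_def fps_numeral_fps_const left_diff_distrib power2_eq_square algebra_simps)
    qed
  qed
  have "fps_XD (16 * ((1 - fps_X) * G2)) = fps_XD (fps_X * (8 * G1 + G))" by (simp only: A)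
  then have B: "16 * ((1 - fps_X) * G3) = 16 * (fps_X * G2) + fps_X * (8 * G1 + G) + fps_X * (8 * G2 + G1)"
    unfolding fps_XD_numeral fps_XD_mult fps_XD_diff fps_XD_plus fps_XD_X G1_def[symmetric] G2_def[symmetric] G3_def[symmetric]
    by (simp add: fps_XD_def algebra_simps)
  define Y where "Y = G * G"
  have Y1: "fps_XD Y = 2 * (G * G1)" unfolding Y_def fps_XD_mult G1_def[symmetric] by (simp add: algebra_simps)
  have Y2: "fps_XD (fps_XD Y) = 2 * (G1 * G1 + G * G2)"
    unfolding Y1 fps_XD_numeral unfolding fps_XD_mult G1_def[symmetric] G2_def[symmetric] by simp
  have Y3: "fps_XD (fps_XD (fps_XD Y)) = 6 * (G1 * G2) + 2 * (G * G3)"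
    unfolding Y2 fps_XD_numeral unfolding fps_XD_plus fps_XD_mult G1_def[symmetric] G2_def[symmetric] G3_def[symmetric]
    by (simp add: algebra_simps)
  \<comment> \<open>In the same notation \<theta>^3 Y = X (\<theta> + 1/2)^3 Y, the equation of
    3F2(1/2, 1/2, 1/2; 1, 1). It is obtained as 3 G1 times the equation A plus G times its
    derivative B, and its coefficient recursion is the one of \<open>bcoef n ^ 3\<close>.\<close>
  have C: "8 * ((1 - fps_X) * fps_XD (fps_XD (fps_XD Y)))
     = fps_X * (12 * fps_XD (fps_XD Y) + 6 * fps_XD Y + Y)"
  proof -
    have "8 * ((1 - fps_X) * fps_XD (fps_XD (fps_XD Y)))
        = 3 * G1 * (16 * ((1 - fps_X) * G2)) + G * (16 * ((1 - fps_X) * G3))"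
      unfolding Y3 by (simp add: algebra_simps)
    also have "\<dots> = fps_X * (12 * fps_XD (fps_XD Y) + 6 * fps_XD Y + Y)"
      unfolding A B Y2 unfolding Y1 unfolding Y_def by (simp add: algebra_simps)
    finally show ?thesis .
  qed
  have rec: "(real n + 1) ^ 3 * fps_nth Y (Suc n) = (real n + 1 / 2) ^ 3 * fps_nth Y n" for n
  proof -
    have "fps_nth (8 * ((1 - fps_X) * fps_XD (fps_XD (fps_XD Y)))) (Suc n)
        = fps_nth (fps_X * (12 * fps_XD (fps_XD Y) + 6 * fps_XD Y + Y)) (Suc n)" by (simp only: C)
    then show ?thesis
      by (simp add: fps_numeral_fps_const left_diff_distrib power3_eq_cube algebra_simps)
  qed
  have "fps_nth Y n = bcoef n ^ 3"
  proof (induction n)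
    case 0
    then show ?case by (simp add: Y_def G_def qcoef_def)
  next
    case (Suc n)
    have "(real n + 1) ^ 3 * fps_nth Y (Suc n) = (real n + 1) ^ 3 * bcoef (Suc n) ^ 3"
      unfolding rec Suc power_mult_distrib[symmetric] using bcoef_Suc[of n] by (simp add: add.commute)
    then show ?case by simp
  qed
  then show ?thesis by (simp add: Y_def G_def fps_mult_nth atMost_atLeast0)
qed

lemma clausen_sum:
  assumes "\<bar>t\<bar> < (1::real)"
  shows "(\<lambda>n. bcoef n ^ 3 * t ^ n) sums ((\<Sum>n. qcoef n * t ^ n)\<^sup>2)"
proof -
  have s: "summable (\<lambda>n. norm (qcoef n * t ^ n))"
    by (rule summable_comparison_test'[of "\<lambda>n. \<bar>t\<bar> ^ n" 0])
       (use assms qcoef_bounds in \<open>auto simp: abs_mult power_abs mult_left_le_one_le\<close>)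
  have "(\<lambda>n. \<Sum>i\<le>n. (qcoef i * t ^ i) * (qcoef (n - i) * t ^ (n - i))) sums ((\<Sum>n. qcoef n * t ^ n) * (\<Sum>n. qcoef n * t ^ n))"
    by (rule Cauchy_product_sums[OF s s])
  moreover have "(\<Sum>i\<le>n. (qcoef i * t ^ i) * (qcoef (n - i) * t ^ (n - i))) = bcoef n ^ 3 * t ^ n" for n
    unfolding clausen_coeff[symmetric] sum_distrib_right
    by (intro sum.cong refl) (auto simp: power_add[symmetric] mult_ac)
  ultimately show ?thesis by (simp add: power2_eq_square)
qed

section \<open>Pfaff's transformation\<close>

definition pcoef :: "nat \<Rightarrow> real" where
  "pcoef k = (pochhammer (1 / 4) k / fact k) * (pochhammer (3 / 4) k / fact k)"

lemma pcoef_bounds: "0 \<le> pcoef k" "pcoef k \<le> 1"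
  unfolding pcoef_def
  using pochhammer_le_fact[of "1/4" k] pochhammer_fact_nonneg[of "1/4" k]
     pochhammer_le_fact[of "3/4" k] pochhammer_fact_nonneg[of "3/4" k]
  by (intro mult_nonneg_nonneg mult_le_one; simp only:)+

text \<open>Coefficient form of 2F1(1/4, 1/4; 1; t) = (1 - t)^(-1/4) 2F1(1/4, 3/4; 1; - t / (1 -
  t)). Once (1 - t)^(- k - 1/4) is expanded, the Pochhammer symbols at 1/4 merge into one of length
  n, and Vandermonde's convolution for -3/4 and n does the rest.\<close>

lemma pfaff_coeff:
  "(\<Sum>k\<le>n. pcoef k * (- 1) ^ k * (pochhammer (real k + 1 / 4) (n - k) / fact (n - k))) = qcoef n"
proof -
  have "pcoef k * (- 1) ^ k * (pochhammer (real k + 1 / 4) (n - k) / fact (n - k))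
      = pochhammer (1 / 4) n / fact n * (((- 3 / 4) gchoose k) * (real n gchoose (n - k)))" if "k \<le> n" for k
  proof -
    have p: "pochhammer (1 / 4 :: real) n = pochhammer (1 / 4) k * pochhammer (1 / 4 + real k) (n - k)"
      by (rule pochhammer_product[OF that])
    have c: "real n gchoose (n - k) = fact n / (fact (n - k) * fact k)"
      using binomial_fact[of "n - k" n, where 'a = real] that by (simp add: binomial_gbinomial)
    show ?thesis
      unfolding p c pcoef_def gbinomial_pochhammer[of "- 3 / 4"] by (simp add: add.commute field_simps)
  qed
  then have "(\<Sum>k\<le>n. pcoef k * (- 1) ^ k * (pochhammer (real k + 1 / 4) (n - k) / fact (n - k)))
     = pochhammer (1 / 4) n / fact n * (\<Sum>k=0..n. ((- 3 / 4) gchoose k) * (real n gchoose (n - k)))"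
    by (simp add: sum_distrib_left atMost_atLeast0)
  also have "(\<Sum>k=0..n. ((- 3 / 4) gchoose k) * (real n gchoose (n - k))) = (real n - 3 / 4) gchoose n"
    using gbinomial_Vandermonde[of "- 3 / 4 :: real" "real n" n] by (simp add: add.commute)
  also have "\<dots> = pochhammer (1 / 4) n / fact n" by (simp add: gbinomial_pochhammer')
  finally show ?thesis by (simp add: qcoef_def power2_eq_square)
qed

lemma pfaff_sum:
  assumes t: "0 < t" "t < (1 / 2 :: real)"
  shows "(\<lambda>k. pcoef k * (- t / (1 - t)) ^ k * (1 - t) powr (- 1 / 4)) sums (\<Sum>n. qcoef n * t ^ n)"
proof -
  define A where "A k j = pcoef k * (- t) ^ k * (pochhammer (real k + 1 / 4) j / fact j * t ^ j)" for k j
  have inner: "((\<lambda>j. pochhammer (real k + 1 / 4) j / fact j * t ^ j) has_sum (1 - t) powr (- (real k + 1 / 4))) UNIV" for k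
  proof (rule sums_nonneg_imp_has_sum)
    have "(\<lambda>j. ((- (real k + 1 / 4)) gchoose j) * (- t) ^ j) sums (1 + - t) powr (- (real k + 1 / 4))"
      by (rule gen_binomial_real) (use t in auto)
    then show "(\<lambda>j. pochhammer (real k + 1 / 4) j / fact j * t ^ j) sums (1 - t) powr (- (real k + 1 / 4))"
      unfolding gchoose_uminus_power by simp
    show "0 \<le> pochhammer (real k + 1 / 4) j / fact j * t ^ j" for j
      by (rule mult_nonneg_nonneg[OF pochhammer_fact_nonneg]) (use t in auto)
  qed
  have pw: "(1 - t) powr (- (real k + 1 / 4)) = (1 / (1 - t)) ^ k * (1 - t) powr (- 1 / 4)" for k
  proof -
    have "(1 - t) powr (- (real k + 1 / 4)) = (1 - t) powr (- real k) * (1 - t) powr (- 1 / 4)"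
      unfolding powr_add[symmetric] by simp
    also have "(1 - t) powr (- real k) = (1 / (1 - t)) ^ k"
      using t by (simp add: powr_minus powr_realpow power_one_over inverse_eq_divide)
    finally show ?thesis .
  qed
  have mp: "(- t) ^ k * (1 / (1 - t)) ^ k = (- t / (1 - t)) ^ k" for k
    by (simp flip: power_mult_distrib)
  \<comment> \<open>Absolute convergence of the double series: the inner sums are known exactly, and
    the outer one is dominated by a geometric series in t / (1 - t), which is where t < 1/2
    enters.\<close>
  have sumA: "(\<lambda>(k,j). A k j) summable_on UNIV \<times> UNIV"
  proof (rule abs_summable_summable, rule summable_on_SigmaI[where g = "\<lambda>k. pcoef k * t ^ k * (1 - t) powr (- (real k + 1 / 4))"])
    fix k
    have "norm (A k j) = pcoef k * t ^ k * (pochhammer (real k + 1 / 4) j / fact j * t ^ j)" for j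
      using t pcoef_bounds[of k] pochhammer_nonneg[of "real k + 1/4" j]
      by (simp add: A_def abs_mult power_abs)
    then show "((\<lambda>j. norm (case (k, j) of (k, j) \<Rightarrow> A k j)) has_sum pcoef k * t ^ k * (1 - t) powr (- (real k + 1 / 4))) UNIV"
      using has_sum_cmult_right[OF inner[of k], of "pcoef k * t ^ k"] by (simp only: prod.case)
  next
    show "(\<lambda>k. pcoef k * t ^ k * (1 - t) powr (- (real k + 1 / 4))) summable_on UNIV"
    proof (rule summable_nonneg_imp_summable_on)
      show "summable (\<lambda>k. pcoef k * t ^ k * (1 - t) powr (- (real k + 1 / 4)))"
      proof (rule summable_comparison_test'[of "\<lambda>k. (t / (1 - t)) ^ k * (1 - t) powr (- 1 / 4)" 0])
        show "summable (\<lambda>k. (t / (1 - t)) ^ k * (1 - t) powr (- 1 / 4))"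
          by (intro summable_mult2 summable_geometric) (use t in \<open>auto simp: field_simps\<close>)
        fix k
        have "pcoef k * ((t / (1 - t)) ^ k * (1 - t) powr (- 1 / 4)) \<le> 1 * ((t / (1 - t)) ^ k * (1 - t) powr (- 1 / 4))"
          using t pcoef_bounds[of k] by (intro mult_right_mono) auto
        then show "norm (pcoef k * t ^ k * (1 - t) powr (- (real k + 1 / 4))) \<le> (t / (1 - t)) ^ k * (1 - t) powr (- 1 / 4)"
          using t pcoef_bounds[of k] unfolding pw by (simp add: abs_mult power_divide)
      qed
    qed (use t pcoef_bounds in auto)
  qed auto
  define S where "S = infsum (\<lambda>(k,j). A k j) (UNIV \<times> UNIV)"
  have hS: "((\<lambda>(k,j). A k j) has_sum S) (UNIV \<times> UNIV)" unfolding S_def by (rule has_sum_infsum[OF sumA])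
  have "((\<lambda>k. pcoef k * (- t / (1 - t)) ^ k * (1 - t) powr (- 1 / 4)) has_sum S) UNIV"
  proof (rule has_sum_SigmaD[OF hS])
    fix k
    have "pcoef k * (- t) ^ k * (1 - t) powr (- (real k + 1 / 4)) = pcoef k * (- t / (1 - t)) ^ k * (1 - t) powr (- 1 / 4)"
      unfolding pw mp[symmetric] by simp
    then show "((\<lambda>j. case (k, j) of (k, j) \<Rightarrow> A k j) has_sum pcoef k * (- t / (1 - t)) ^ k * (1 - t) powr (- 1 / 4)) UNIV"
      using has_sum_cmult_right[OF inner[of k], of "pcoef k * (- t) ^ k"] by (simp only: A_def prod.case)
  qed
  moreover have "((\<lambda>n. qcoef n * t ^ n) has_sum S) UNIV"
  proof (rule has_sum_SigmaD)
    \<comment> \<open>Regrouping along k + j = n turns the inner sums into the left side of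
      \<open>pfaff_coeff\<close>.\<close>
    show "((\<lambda>(n,k). A k (n - k)) has_sum S) (SIGMA n:UNIV. {..n})"
      by (rule has_sum_reindex_bij_witness[THEN iffD1, OF _ _ _ _ _ _ hS, of "\<lambda>(n,k). (k, n - k)" "\<lambda>(k,j). (k + j, k)"]) auto
    fix n
    have "(\<Sum>k\<le>n. A k (n - k)) = qcoef n * t ^ n"
      unfolding pfaff_coeff[symmetric] sum_distrib_right A_def
      by (intro sum.cong refl) (auto simp: power_minus[of t] power_add[symmetric] mult_ac)
    then show "((\<lambda>k. case (n, k) of (n, k) \<Rightarrow> A k (n - k)) has_sum qcoef n * t ^ n) {..n}"
      by (simp add: has_sum_finiteI)
  qed
  ultimately show ?thesis
    using has_sum_imp_sums sums_unique by metis
qed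

text \<open>Clausen followed by Pfaff: squaring the factor (1 - t)^(-1/4) leaves 1 / sqrt (1 - t).
  For t = 1 / (\<alpha>\<beta>) the argument - t / (1 - t) is 1 / (1 - \<alpha>\<beta>).\<close>

lemma hypergeo_square:
  assumes t: "0 < t" "t < (1 / 2 :: real)"
  shows "(\<lambda>n. bcoef n ^ 3 * t ^ n) sums ((hypergeo_2F1 (1 / 4) (3 / 4) 1 (- t / (1 - t)))\<^sup>2 / sqrt (1 - t))"
proof -
  have "fps_nth (fps_hypergeo [1 / 4, 3 / 4] [1] 1) k = pcoef k" for k
    by (simp add: pcoef_def pochhammer_fact[symmetric])
  then have h: "hypergeo_2F1 (1 / 4) (3 / 4) 1 (- t / (1 - t)) = (\<Sum>k. pcoef k * (- t / (1 - t)) ^ k)"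
    by (simp add: hypergeo_2F1_def eval_fps_def)
  have "summable (\<lambda>k. (1 - t) powr (- 1 / 4) * (pcoef k * (- t / (1 - t)) ^ k))"
    using pfaff_sum[OF t] by (simp add: sums_iff mult.commute)
  then have sm: "summable (\<lambda>k. pcoef k * (- t / (1 - t)) ^ k)"
    using t by (subst (asm) summable_cmult_iff) auto
  have "(\<Sum>n. qcoef n * t ^ n) = hypergeo_2F1 (1 / 4) (3 / 4) 1 (- t / (1 - t)) * (1 - t) powr (- 1 / 4)"
    unfolding h using sums_unique[OF pfaff_sum[OF t]] by (simp only: suminf_mult2[OF sm])
  moreover have "((1 - t) powr (- 1 / 4))\<^sup>2 = 1 / sqrt (1 - t)"
    using t by (simp add: power2_eq_square powr_add[symmetric] powr_minus powr_half_sqrt divide_simps)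
  ultimately show ?thesis
    using clausen_sum[of t] t by (simp add: power_mult_distrib)
qed

section \<open>The integrals \<open>M\<^sub>k\<close>\<close>

text \<open>The integral over q that remains when the power series in \<tau> is integrated over - p
  < q < p; by evenness it is twice this one.\<close>

definition Wint :: "nat \<Rightarrow> real \<Rightarrow> real" where
  "Wint k x = integral {0..x} (\<lambda>q. sinh q ^ (2 * k))"

lemma Wint_has_integral:
  "((\<lambda>q. sinh q ^ (2 * k)) has_integral Wint k x) {0..x}"
  unfolding Wint_def by (intro integrable_integral integrable_continuous_interval continuous_intros)

lemma Wint_deriv:
  assumes "x > 0" shows "(Wint k has_real_derivative sinh x ^ (2 * k)) (at x)"
proof -
  have "((\<lambda>u. integral {0..u} (\<lambda>q. sinh q ^ (2 * k))) has_vector_derivative sinh x ^ (2 * k)) (at x within {0..x+1})"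
    by (rule integral_has_vector_derivative) (use assms in \<open>auto intro!: continuous_intros\<close>)
  then show ?thesis
    using assms at_within_Icc_at[of 0 x "x+1"]
    by (simp add: Wint_def[abs_def] has_real_derivative_iff_has_vector_derivative)
qed

lemma Wint_nonneg: "0 \<le> Wint k x"
  unfolding Wint_def by (rule integral_nonneg) (auto intro!: integrable_continuous_interval continuous_intros)

lemma Wint_le: assumes "x \<ge> 0" shows "Wint k x \<le> x * sinh x ^ (2 * k)"
proof -
  have "Wint k x \<le> integral {0..x} (\<lambda>q. sinh x ^ (2 * k))"
    unfolding Wint_def
    by (rule integral_le) (auto intro!: integrable_continuous_interval continuous_intros power_mono)
  also have "\<dots> = x * sinh x ^ (2 * k)" using assms by simp
  finally show ?thesis .
qed

lemma DERIV_sinh_power: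
  "((\<lambda>x. sinh x ^ n) has_real_derivative real n * sinh x ^ (n - 1) * cosh x) (at (x::real) within A)"
  by (auto intro!: derivative_eq_intros)

text \<open>The reduction formula for powers of sinh, from the derivative of sinh^(2k+1) cosh and
  cosh^2 = 1 + sinh^2. It eliminates \<open>Wint (Suc k)\<close> in
  \<open>Phi_deriv\<close>.\<close>

lemma Wint_rec:
  assumes "x \<ge> 0"
  shows "sinh x ^ (2 * k + 1) * cosh x = (2 * real k + 1) * Wint k x + (2 * real k + 2) * Wint (Suc k) x"
proof -
  have a1: "((\<lambda>q. (2 * real k + 1) * sinh q ^ (2 * k) + (2 * real k + 2) * sinh q ^ (2 * Suc k)) has_integral
      (sinh x ^ (2 * k + 1) * cosh x - sinh 0 ^ (2 * k + 1) * cosh 0)) {0..x}"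
  proof (rule fundamental_theorem_of_calculus[OF assms])
    fix q :: real
    have c: "cosh q * cosh q = 1 + sinh q * sinh q" using cosh_square_eq[of q] by (simp add: power2_eq_square)
    have "((\<lambda>q. sinh q ^ (2 * k + 1) * cosh q) has_real_derivative
       real (2 * k + 1) * sinh q ^ (2 * k + 1 - 1) * cosh q * cosh q + sinh q * 1 * sinh q ^ (2 * k + 1)) (at q within {0..x})"
      by (rule DERIV_mult[OF DERIV_sinh_power]) (auto intro!: derivative_eq_intros)
    also have "real (2 * k + 1) * sinh q ^ (2 * k + 1 - 1) * cosh q * cosh q + sinh q * 1 * sinh q ^ (2 * k + 1)
      = (2 * real k + 1) * sinh q ^ (2 * k) + (2 * real k + 2) * sinh q ^ (2 * Suc k)"
      by (simp add: mult.assoc c) (simp add: algebra_simps)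
    finally show "((\<lambda>q. sinh q ^ (2 * k + 1) * cosh q) has_vector_derivative
       (2 * real k + 1) * sinh q ^ (2 * k) + (2 * real k + 2) * sinh q ^ (2 * Suc k)) (at q within {0..x})"
      by (simp add: has_real_derivative_iff_has_vector_derivative)
  qed
  have a2: "((\<lambda>q. (2 * real k + 1) * sinh q ^ (2 * k) + (2 * real k + 2) * sinh q ^ (2 * Suc k)) has_integral
      ((2 * real k + 1) * Wint k x + (2 * real k + 2) * Wint (Suc k) x)) {0..x}"
    by (intro has_integral_add has_integral_mult_right Wint_has_integral)
  show ?thesis using has_integral_unique[OF a1 a2] by simp
qed

definition gint :: "nat \<Rightarrow> real \<Rightarrow> real" where
  "gint k x = x * Wint k x / sinh x ^ (2 * k + 1)"

lemma gint_nonneg: "x > 0 \<Longrightarrow> 0 \<le> gint k x"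
  by (simp add: gint_def Wint_nonneg)

lemma Wint_ratio_le: "x > 0 \<Longrightarrow> Wint k x / sinh x ^ (2 * k + 1) \<le> x / sinh x"
  using Wint_le[of x k] by (simp add: field_simps)

lemma sinh_ge: assumes "x \<ge> 0" shows "x \<le> sinh (x::real)"
proof -
  have "sinh 0 - 0 \<le> sinh x - x"
  proof (rule DERIV_nonneg_imp_nondecreasing[OF assms])
    fix y :: real
    show "\<exists>d. ((\<lambda>x. sinh x - x) has_real_derivative d) (at y) \<and> 0 \<le> d"
      by (rule exI[of _ "cosh y - 1"]) (auto intro!: derivative_eq_intros simp: cosh_real_ge_1)
  qed
  then show ?thesis by simp
qed

lemma sinh_lower: assumes "x > 0" shows "x * exp (x / 2) / 2 \<le> sinh (x::real)"
proof -
  have "(x / 2) * (exp (x / 2) / 2) \<le> sinh (x / 2) * cosh (x / 2)"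
    using assms sinh_ge[of "x / 2"] by (intro mult_mono) (auto simp: cosh_def)
  then show ?thesis using sinh_double[of "x / 2"] by simp
qed

text \<open>The bound is uniform in k because \<open>Wint k x\<close> is at most x sinh^(2k) x,
  which leaves x^2 / sinh x; then sinh x \<ge> x exp (x/2) / 2 controls this near 0 and at infinity
  at once.\<close>

lemma gint_le: assumes "x > 0" shows "gint k x \<le> 8 * exp (- x / 4)"
proof -
  have "gint k x = x * (Wint k x / sinh x ^ (2 * k + 1))" by (simp add: gint_def)
  also have "\<dots> \<le> x * (x / sinh x)" using assms Wint_ratio_le[of x k] by (intro mult_left_mono) auto
  also have "\<dots> \<le> x * (x / (x * exp (x / 2) / 2))"
    using assms sinh_lower[of x] by (intro mult_left_mono divide_left_mono) auto
  also have "\<dots> = 2 * (x * exp (- x / 2))" using assms by (simp add: exp_minus field_simps)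
  also have "x * exp (- x / 2) \<le> (4 * exp (x / 4)) * exp (- x / 2)"
  proof (rule mult_right_mono)
    show "x \<le> 4 * exp (x / 4)" using exp_ge_add_one_self[of "x / 4"] by linarith
  qed simp
  also have "(4 * exp (x / 4)) * exp (- x / 2) = 4 * exp (- x / 4)" by (simp add: exp_add[symmetric])
  finally show ?thesis by simp
qed

lemma nn_integral_power_exp:
  assumes c: "c > 0"
  shows "(\<integral>\<^sup>+x. ennreal (x ^ k * exp (- c * x)) * indicator {0<..} x \<partial>lborel) = ennreal (fact k / c ^ (k + 1))"
proof -
  have "ennreal (fact k) = (\<integral>\<^sup>+x. ennreal (x^k * exp (-x)) * indicator {0 ..} x \<partial>lborel)"
    by (simp add: nn_intergal_power_times_exp_Ici)
  also have "\<dots> = ennreal \<bar>c\<bar> * (\<integral>\<^sup>+x. ennreal ((0 + c * x)^k * exp (- (0 + c * x))) * indicator {0 ..} (0 + c * x) \<partial>lborel)"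
    by (rule nn_integral_real_affine) (use c in auto)
  also have "(\<integral>\<^sup>+x. ennreal ((0 + c * x)^k * exp (- (0 + c * x))) * indicator {0 ..} (0 + c * x) \<partial>lborel)
     = (\<integral>\<^sup>+x. ennreal (c ^ k) * (ennreal (x ^ k * exp (- c * x)) * indicator {0<..} x) \<partial>lborel)"
  proof (rule nn_integral_cong_AE)
    show "AE x in lborel. ennreal ((0 + c * x)^k * exp (- (0 + c * x))) * indicator {0 ..} (0 + c * x)
       = ennreal (c ^ k) * (ennreal (x ^ k * exp (- c * x)) * indicator {0<..} x)"
      using AE_lborel_singleton[of "0::real"]
    proof eventually_elim
      case (elim x)
      then show ?case using c
        by (auto simp: indicator_def zero_le_mult_iff ennreal_mult[symmetric] power_mult_distrib mult.assoc)
    qed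
  qed
  also have "\<dots> = ennreal (c ^ k) * (\<integral>\<^sup>+x. ennreal (x ^ k * exp (- c * x)) * indicator {0<..} x \<partial>lborel)" (is "_ = _ * ?I")
    by (rule nn_integral_cmult) auto
  finally have "ennreal (fact k) = ennreal (c ^ (k + 1)) * ?I"
    using c by (simp add: ennreal_mult mult.assoc)
  then have "ennreal (1 / c ^ (k + 1)) * ennreal (fact k) = ennreal (1 / c ^ (k + 1)) * ennreal (c ^ (k + 1)) * ?I"
    by (simp add: mult.assoc)
  also have "ennreal (1 / c ^ (k + 1)) * ennreal (c ^ (k + 1)) = 1"
    using c by (subst ennreal_mult[symmetric]) auto
  finally show ?thesis using c by (subst (asm) ennreal_mult[symmetric]) auto
qed

lemma power_exp_integral:
  assumes c: "c > 0"
  shows "set_integrable lborel {0<..} (\<lambda>x. x ^ k * exp (- c * x :: real))"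
    and "(LBINT x:{0<..}. x ^ k * exp (- c * x)) = fact k / c ^ (k + 1)"
proof -
  have "(\<integral>\<^sup>+x. ennreal (indicator {0<..} x * (x ^ k * exp (- c * x))) \<partial>lborel) = ennreal (fact k / c ^ (k + 1))"
    unfolding nn_integral_power_exp[OF c, of k, symmetric] by (rule nn_integral_cong) (auto simp: indicator_def)
  then have "has_bochner_integral lborel (\<lambda>x. indicator {0<..} x * (x ^ k * exp (- c * x))) (fact k / c ^ (k + 1))"
    using c by (intro has_bochner_integral_nn_integral) (auto simp: indicator_def)
  then show "set_integrable lborel {0<..} (\<lambda>x. x ^ k * exp (- c * x :: real))"
    and "(LBINT x:{0<..}. x ^ k * exp (- c * x)) = fact k / c ^ (k + 1)"
    by (auto simp: set_integrable_def set_lebesgue_integral_def has_bochner_integral_iff)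
qed

lemma gint_continuous: "x > 0 \<Longrightarrow> isCont (gint k) x"
  unfolding gint_def
  by (intro continuous_intros DERIV_isCont[OF Wint_deriv]) auto

lemma gint_integrable: "set_integrable lborel {0<..} (gint k)"
proof (rule set_integrable_bound)
  show "set_integrable lborel {0<..} (\<lambda>x::real. 8 * exp (- (1/4) * x))"
  proof -
    have "set_integrable lborel {0<..} (\<lambda>x::real. exp (- (1/4) * x))"
      using power_exp_integral(1)[of "1/4" 0] by simp
    then show ?thesis by simp
  qed
  show "set_borel_measurable lborel {0<..} (gint k)"
  proof -
    have "(\<lambda>x. indicator {0<..} x *\<^sub>R gint k x) \<in> borel_measurable borel"
      by (intro borel_measurable_continuous_on_indicator continuous_at_imp_continuous_on ballI gint_continuous) auto
    then show ?thesis unfolding set_borel_measurable_def by simp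
  qed
  show "AE x in lborel. x \<in> {0<..} \<longrightarrow> norm (gint k x) \<le> norm (8 * exp (- (1/4) * x))"
    using gint_le gint_nonneg by (intro AE_I2) auto
qed

section \<open>The two-term recursion for \<open>Mint\<close> and its solution\<close>

definition Mint :: "nat \<Rightarrow> real" where "Mint k = (LBINT x:{0<..}. gint k x)"

text \<open>The certificate of the recursion: an explicit antiderivative of the combination of
  \<open>gint (Suc k)\<close> and \<open>gint k\<close> that appears in \<open>Phi_deriv\<close>.
  Its limit at 0 is the inhomogeneous term of the recursion, and its limit at infinity is 0.\<close>

definition Phi :: "nat \<Rightarrow> real \<Rightarrow> real" where
  "Phi k x = - (1/4) * (x / sinh x) + (2 * real k + 1) / 4 * (x * cosh x * Wint k x / sinh x ^ (2 * k + 2))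
     + (1/4) * (Wint k x / sinh x ^ (2 * k + 1))"

lemma Phi_deriv:
  assumes x: "x > 0"
  shows "(Phi k has_real_derivative (real k + 1)\<^sup>2 * gint (Suc k) x - (real k + 1/2)\<^sup>2 * gint k x) (at x)"
proof -
  define S C W where "S = sinh x" and "C = cosh x" and "W = Wint k x"
  have S: "S > 0" using x by (simp add: S_def)
  define E where "E = S ^ (2 * k)"
  have E: "E > 0" using S by (simp add: E_def)
  have CC: "C * C = 1 + S * S" using cosh_square_eq[of x] by (simp add: S_def C_def power2_eq_square)
  have W1: "Wint (Suc k) x = (S * E * C - (2 * real k + 1) * W) / (2 * real k + 2)"
    using Wint_rec[of x k] x by (simp add: S_def C_def W_def E_def field_simps)
  have sE: "sinh x ^ (2 * k) = E" by (simp add: E_def S_def)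
  have d1: "((\<lambda>x. x / sinh x) has_real_derivative (S - x * C) / S\<^sup>2) (at x)"
    using S by (auto intro!: derivative_eq_intros simp: S_def C_def power2_eq_square)
  have dS: "((\<lambda>x. sinh x ^ n) has_real_derivative real n * S ^ (n - 1) * C) (at x)" for n
    unfolding S_def C_def by (rule DERIV_sinh_power)
  have pw: "sinh x ^ (2 * k + 1) = S * E" "sinh x ^ (2 * k + 2) = S\<^sup>2 * E"
     "S ^ (2 * k + 1 - 1) = E" "S ^ (2 * k + 2 - 1) = S * E"
    by (simp_all add: E_def S_def power2_eq_square)
  \<comment> \<open>In terms of S, C, x and p all fractions become monomials in C, x and p over
    powers of S, and the factor E drops out.\<close>
  define p where "p = W / (S * E)"
  have Wp: "W = p * S * E" using S E by (simp add: p_def)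
  have dW: "(Wint k has_real_derivative E) (at x)" using Wint_deriv[OF x, of k] by (simp add: sE)
  have "((\<lambda>x. Wint k x / sinh x ^ (2 * k + 1)) has_real_derivative
     (E * sinh x ^ (2 * k + 1) - Wint k x * (real (2 * k + 1) * S ^ (2 * k + 1 - 1) * C)) / (sinh x ^ (2 * k + 1) * sinh x ^ (2 * k + 1))) (at x)"
    by (rule DERIV_divide[OF dW dS]) (use x in simp)
  also have "(E * sinh x ^ (2 * k + 1) - Wint k x * (real (2 * k + 1) * S ^ (2 * k + 1 - 1) * C)) / (sinh x ^ (2 * k + 1) * sinh x ^ (2 * k + 1))
     = 1 / S - (2 * real k + 1) * (C * W / (S\<^sup>2 * E))"
    unfolding pw W_def[symmetric] using S E by (simp add: field_simps power2_eq_square)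
  finally have d2: "((\<lambda>x. Wint k x / sinh x ^ (2 * k + 1)) has_real_derivative 1 / S - (2 * real k + 1) * (C * W / (S\<^sup>2 * E))) (at x)" .
  have "((\<lambda>x. x * cosh x * Wint k x) has_real_derivative (C + x * S) * W + x * C * E) (at x)"
    by (auto intro!: derivative_eq_intros dW simp: S_def C_def W_def algebra_simps)
  then have "((\<lambda>x. x * cosh x * Wint k x / sinh x ^ (2 * k + 2)) has_real_derivative
     (((C + x * S) * W + x * C * E) * sinh x ^ (2 * k + 2) - x * cosh x * Wint k x * (real (2 * k + 2) * S ^ (2 * k + 2 - 1) * C)) / (sinh x ^ (2 * k + 2) * sinh x ^ (2 * k + 2))) (at x)"
    by (rule DERIV_divide[OF _ dS]) (use x in simp)
  also have "(((C + x * S) * W + x * C * E) * sinh x ^ (2 * k + 2) - x * cosh x * Wint k x * (real (2 * k + 2) * S ^ (2 * k + 2 - 1) * C)) / (sinh x ^ (2 * k + 2) * sinh x ^ (2 * k + 2))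
     = ((C + x * S) * W + x * C * E) / (S\<^sup>2 * E) - (2 * real k + 2) * x * W * (C * C) / (S ^ 3 * E)"
    unfolding pw W_def[symmetric] C_def[symmetric] using S E by (simp add: field_simps power2_eq_square power3_eq_cube)
  finally have d3: "((\<lambda>x. x * cosh x * Wint k x / sinh x ^ (2 * k + 2)) has_real_derivative
     ((C + x * S) * W + x * C * E) / (S\<^sup>2 * E) - (2 * real k + 2) * x * W * (C * C) / (S ^ 3 * E)) (at x)" .
  have "(Phi k has_real_derivative - (1/4) * ((S - x * C) / S\<^sup>2)
     + (2 * real k + 1) / 4 * (((C + x * S) * W + x * C * E) / (S\<^sup>2 * E) - (2 * real k + 2) * x * W * (C * C) / (S ^ 3 * E))
     + (1/4) * (1 / S - (2 * real k + 1) * (C * W / (S\<^sup>2 * E)))) (at x)"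
    unfolding Phi_def[abs_def] by (intro DERIV_add DERIV_cmult d1 d2 d3)
  also have "- (1/4) * ((S - x * C) / S\<^sup>2)
     + (2 * real k + 1) / 4 * (((C + x * S) * W + x * C * E) / (S\<^sup>2 * E) - (2 * real k + 2) * x * W * (C * C) / (S ^ 3 * E))
     + (1/4) * (1 / S - (2 * real k + 1) * (C * W / (S\<^sup>2 * E)))
     = (real k + 1)\<^sup>2 * gint (Suc k) x - (real k + 1/2)\<^sup>2 * gint k x"
  proof -
    have g0: "gint k x = x * p" by (simp add: gint_def S_def E_def W_def p_def)
    have "gint (Suc k) x = x * ((S * E * C - (2 * real k + 1) * W) / (2 * real k + 2)) / (S ^ 3 * E)"
      unfolding gint_def W1 by (simp add: S_def E_def power_add power3_eq_cube mult_ac)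
    also have "\<dots> = x * (C - (2 * real k + 1) * p) / ((2 * real k + 2) * S\<^sup>2)"
    proof -
      have "x * ((S * E * C - n * (p * S * E)) / m) / (S ^ 3 * E) = x * (C - n * p) / (m * S\<^sup>2)" if "m > 0" for m n
        using S E that by (simp add: field_simps power2_eq_square power3_eq_cube)
      from this[of "2 * real k + 2" "2 * real k + 1"] show ?thesis unfolding Wp by simp
    qed
    finally have g1: "gint (Suc k) x = x * (C - (2 * real k + 1) * p) / ((2 * real k + 2) * S\<^sup>2)" .
    have "2 * real k + 2 = 2 * (real k + 1)" by simp
    then have g1': "gint (Suc k) x = x * (C - (2 * real k + 1) * p) / (2 * (real k + 1) * S\<^sup>2)" by (simp only: g1)
    have eq1: "q\<^sup>2 * (x * (C - n * p) / (2 * q * S\<^sup>2)) = q / 2 * (x * C / S\<^sup>2 - n * (x * p / S\<^sup>2))" if "q > 0" for q n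
      using that S by (simp add: field_simps power2_eq_square)
    have e1: "(real k + 1)\<^sup>2 * gint (Suc k) x = (real k + 1) / 2 * (x * C / S\<^sup>2 - (2 * real k + 1) * (x * p / S\<^sup>2))"
      unfolding g1' by (rule eq1) simp
    have e2: "((C + x * S) * W + x * C * E) / (S\<^sup>2 * E) = C * p / S + x * p + x * C / S\<^sup>2"
      unfolding Wp using S E by (simp add: field_simps power2_eq_square)
    have "m * x * (p * S * E) * (1 + S * S) / (S ^ 3 * E) = m * (x * p / S\<^sup>2) + m * (x * p)" for m
      using S E by (simp add: field_simps power2_eq_square power3_eq_cube)
    then have e3: "(2 * real k + 2) * x * W * (C * C) / (S ^ 3 * E) = (2 * real k + 2) * (x * p / S\<^sup>2) + (2 * real k + 2) * (x * p)"
      unfolding Wp CC .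
    have e4: "C * W / (S\<^sup>2 * E) = C * p / S"
      unfolding Wp using S E by (simp add: field_simps power2_eq_square)
    have e5: "(S - x * C) / S\<^sup>2 = 1 / S - x * C / S\<^sup>2"
      using S by (simp add: field_simps power2_eq_square)
    \<comment> \<open>After C^2 = 1 + S^2 only 1 / S, x C / S^2, C p / S, x p and x p / S^2 are
      left, named \<open>u1\<close>, \<open>u2\<close>, \<open>u3\<close>, \<open>u4\<close>,
      \<open>u5\<close>; the claim is a linear identity in them.\<close>
    have "- (1/4) * (u1 - u2) + (2 * r + 1) / 4 * ((u3 + u4 + u2) - ((2 * r + 2) * u5 + (2 * r + 2) * u4)) + (1/4) * (u1 - (2 * r + 1) * u3)
       = (r + 1) / 2 * (u2 - (2 * r + 1) * u5) - (r + 1/2)\<^sup>2 * u4" for u1 u2 u3 u4 u5 r :: real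
      by (simp add: field_simps power2_eq_square)
    then show ?thesis unfolding e1 e2 e3 e4 e5 g0 .
  qed
  finally show ?thesis .
qed

lemma sinh_ratio_at_0: "((\<lambda>x. x / sinh x) \<longlongrightarrow> (1::real)) (at_right 0)"
  by (rule lhopital_right_0[of "\<lambda>x. x" sinh cosh "\<lambda>_. 1"])
     (auto intro!: derivative_eq_intros tendsto_eq_intros eventually_at_rightI[of 0 1])

lemma Wint_at_0: "(Wint k \<longlongrightarrow> 0) (at_right 0)"
proof (rule tendsto_sandwich[of "\<lambda>_. 0" _ _ "\<lambda>x. x * sinh x ^ (2 * k)"])
  show "((\<lambda>x. x * sinh x ^ (2 * k)) \<longlongrightarrow> (0::real)) (at_right 0)"
    by (auto intro!: tendsto_eq_intros)
qed (auto simp: Wint_nonneg intro!: Wint_le eventually_at_rightI[of 0 1])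

lemma Wint_ratio_at_0: "((\<lambda>x. Wint k x / sinh x ^ (2 * k + 1)) \<longlongrightarrow> 1 / (2 * real k + 1)) (at_right 0)"
proof (rule lhopital_right_0[of "Wint k" "\<lambda>x. sinh x ^ (2 * k + 1)" "\<lambda>x. real (2 * k + 1) * sinh x ^ (2 * k) * cosh x" "\<lambda>x. sinh x ^ (2 * k)"])
  show "((\<lambda>x. sinh x ^ (2 * k) / (real (2 * k + 1) * sinh x ^ (2 * k) * cosh x)) \<longlongrightarrow> 1 / (2 * real k + 1)) (at_right 0)"
  proof (rule Lim_transform_eventually)
    show "((\<lambda>x. 1 / ((2 * real k + 1) * cosh x)) \<longlongrightarrow> 1 / (2 * real k + 1)) (at_right 0)"
      by (auto intro!: tendsto_eq_intros)
    show "\<forall>\<^sub>F x in at_right 0. 1 / ((2 * real k + 1) * cosh x) = sinh x ^ (2 * k) / (real (2 * k + 1) * sinh x ^ (2 * k) * cosh x)"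
    proof (rule eventually_at_rightI[of 0 1])
      fix x :: real assume "x \<in> {0<..<1}"
      then have "x \<noteq> 0" "cosh x > 0" by auto
      then show "1 / ((2 * real k + 1) * cosh x) = sinh x ^ (2 * k) / (real (2 * k + 1) * sinh x ^ (2 * k) * cosh x)"
        by (simp add: add.commute)
    qed simp
  qed
  have "((\<lambda>x::real. sinh x ^ (2 * k + 1)) \<longlongrightarrow> sinh 0 ^ (2 * k + 1)) (at_right 0)"
    by (intro tendsto_intros)
  then show "((\<lambda>x::real. sinh x ^ (2 * k + 1)) \<longlongrightarrow> 0) (at_right 0)" by simp
  show "\<forall>\<^sub>F x in at_right 0. ((\<lambda>x. sinh x ^ (2 * k + 1)) has_real_derivative real (2 * k + 1) * sinh x ^ (2 * k) * cosh x) (at x)"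
    using DERIV_sinh_power[of "2 * k + 1"] by (intro always_eventually) simp
  show "\<forall>\<^sub>F x in at_right 0. sinh x ^ (2 * k + 1) \<noteq> (0::real)"
    by (rule eventually_at_rightI[of 0 1]) auto
  show "\<forall>\<^sub>F x in at_right 0. real (2 * k + 1) * sinh x ^ (2 * k) * cosh x \<noteq> 0"
  proof (rule eventually_at_rightI[of 0 1])
    fix x :: real assume "x \<in> {0<..<1}"
    then have "sinh x > 0" "cosh x > 0" by auto
    then show "real (2 * k + 1) * sinh x ^ (2 * k) * cosh x \<noteq> 0" by simp
  qed simp
  show "\<forall>\<^sub>F x in at_right 0. (Wint k has_real_derivative sinh x ^ (2 * k)) (at x)"
    by (rule eventually_at_rightI[of 0 1]) (auto intro: Wint_deriv)
qed (rule Wint_at_0)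

lemma Phi_at_0: "(Phi k \<longlongrightarrow> 1 / (4 * (2 * real k + 1))) (at_right 0)"
proof -
  have "((\<lambda>x. - (1/4) * (x / sinh x) + (2 * real k + 1) / 4 * ((x / sinh x) * cosh x * (Wint k x / sinh x ^ (2 * k + 1)))
     + (1/4) * (Wint k x / sinh x ^ (2 * k + 1))) \<longlongrightarrow>
     - (1/4) * 1 + (2 * real k + 1) / 4 * (1 * cosh 0 * (1 / (2 * real k + 1))) + (1/4) * (1 / (2 * real k + 1))) (at_right 0)"
    by (intro tendsto_intros sinh_ratio_at_0 Wint_ratio_at_0)
  moreover have "Phi k = (\<lambda>x. - (1/4) * (x / sinh x) + (2 * real k + 1) / 4 * ((x / sinh x) * cosh x * (Wint k x / sinh x ^ (2 * k + 1)))
     + (1/4) * (Wint k x / sinh x ^ (2 * k + 1)))"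
    by (simp add: Phi_def fun_eq_iff)
  ultimately show ?thesis by (simp add: field_simps)
qed

lemma Phi_at_top: "(Phi k \<longlongrightarrow> 0) at_top"
proof -
  have l1: "((\<lambda>x. x / sinh x) \<longlongrightarrow> (0::real)) at_top" unfolding sinh_field_def by real_asymp
  have l2: "((\<lambda>x. (x / sinh x) * x * (cosh x / sinh x)) \<longlongrightarrow> (0::real)) at_top" unfolding sinh_field_def cosh_field_def by real_asymp
  have W: "((\<lambda>x. Wint k x / sinh x ^ (2 * k + 1)) \<longlongrightarrow> 0) at_top"
  proof (rule tendsto_sandwich[OF _ _ tendsto_const l1])
    show "\<forall>\<^sub>F x in at_top. Wint k x / sinh x ^ (2 * k + 1) \<le> x / sinh x"
      by (rule eventually_at_top_linorderI[of 1], rule Wint_ratio_le) simp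
  qed (auto intro!: eventually_at_top_linorderI[of 1] simp: Wint_nonneg)
  have X: "((\<lambda>x. x * (cosh x / sinh x) * (Wint k x / sinh x ^ (2 * k + 1))) \<longlongrightarrow> 0) at_top"
  proof (rule tendsto_sandwich[OF _ _ tendsto_const l2])
    show "\<forall>\<^sub>F x in at_top. x * (cosh x / sinh x) * (Wint k x / sinh x ^ (2 * k + 1)) \<le> (x / sinh x) * x * (cosh x / sinh x)"
    proof (rule eventually_at_top_linorderI[of 1])
      fix x :: real assume "1 \<le> x"
      then have "x * (cosh x / sinh x) * (Wint k x / sinh x ^ (2 * k + 1)) \<le> x * (cosh x / sinh x) * (x / sinh x)"
        by (intro mult_left_mono Wint_ratio_le) auto
      then show "x * (cosh x / sinh x) * (Wint k x / sinh x ^ (2 * k + 1)) \<le> (x / sinh x) * x * (cosh x / sinh x)"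
        by (simp add: mult_ac)
    qed
  qed (auto intro!: eventually_at_top_linorderI[of 1] simp: Wint_nonneg)
  have "((\<lambda>x. - (1/4) * (x / sinh x) + (2 * real k + 1) / 4 * (x * (cosh x / sinh x) * (Wint k x / sinh x ^ (2 * k + 1)))
     + (1/4) * (Wint k x / sinh x ^ (2 * k + 1))) \<longlongrightarrow> - (1/4) * 0 + (2 * real k + 1) / 4 * 0 + (1/4) * 0) at_top"
    by (intro tendsto_intros l1 X W)
  moreover have "Phi k = (\<lambda>x. - (1/4) * (x / sinh x) + (2 * real k + 1) / 4 * (x * (cosh x / sinh x) * (Wint k x / sinh x ^ (2 * k + 1)))
     + (1/4) * (Wint k x / sinh x ^ (2 * k + 1)))"
    by (simp add: Phi_def fun_eq_iff)
  ultimately show ?thesis by simp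
qed

lemma Mint_rec: "(real k + 1)\<^sup>2 * Mint (Suc k) - (real k + 1/2)\<^sup>2 * Mint k = - 1 / (4 * (2 * real k + 1))"
proof -
  have e: "einterval 0 \<infinity> = {0<..}" by (auto simp: einterval_def)
  have "(LBINT x=0..\<infinity>. (real k + 1)\<^sup>2 * gint (Suc k) x - (real k + 1/2)\<^sup>2 * gint k x) = 0 - 1 / (4 * (2 * real k + 1))"
  proof (rule interval_integral_FTC_integrable)
    show "((Phi k \<circ> real_of_ereal) \<longlongrightarrow> 1 / (4 * (2 * real k + 1))) (at_right 0)"
      using Phi_at_0 by (simp add: zero_ereal_def ereal_tendsto_simps)
    show "((Phi k \<circ> real_of_ereal) \<longlongrightarrow> 0) (at_left \<infinity>)"
      using Phi_at_top by (simp add: ereal_tendsto_simps)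
    show "set_integrable lborel (einterval 0 \<infinity>) (\<lambda>x. (real k + 1)\<^sup>2 * gint (Suc k) x - (real k + 1/2)\<^sup>2 * gint k x)"
      unfolding e by (intro set_integral_diff set_integrable_mult_right gint_integrable)
    fix x :: real assume "0 < ereal x"
    then have x: "x > 0" by simp
    show "(Phi k has_vector_derivative (real k + 1)\<^sup>2 * gint (Suc k) x - (real k + 1/2)\<^sup>2 * gint k x) (at x)"
      using Phi_deriv[OF x] by (simp add: has_real_derivative_iff_has_vector_derivative)
    show "isCont (\<lambda>x. (real k + 1)\<^sup>2 * gint (Suc k) x - (real k + 1/2)\<^sup>2 * gint k x) x"
      by (intro continuous_intros gint_continuous x)
  qed simp
  moreover have "(LBINT x=0..\<infinity>. (real k + 1)\<^sup>2 * gint (Suc k) x - (real k + 1/2)\<^sup>2 * gint k x)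
     = (real k + 1)\<^sup>2 * Mint (Suc k) - (real k + 1/2)\<^sup>2 * Mint k"
    unfolding Mint_def interval_lebesgue_integral_def e
    by (simp add: set_integral_diff set_integrable_mult_right gint_integrable)
  ultimately show ?thesis by simp
qed

definition Zodd :: real where "Zodd = (\<Sum>n. 1 / (real n + 1 / 2) ^ 3)"

lemma summable_Zodd: "summable (\<lambda>n. 1 / (real n + 1 / 2) ^ 3)"
proof (rule summable_comparison_test'[of "\<lambda>n. 8 * inverse (real (Suc n) ^ 3)" 0])
  show "summable (\<lambda>n. 8 * inverse (real (Suc n) ^ 3))"
    by (intro summable_mult summable_Suc_iff[THEN iffD2] inverse_power_summable) simp
  fix n
  define y where "y = real n + 1 / 2"
  have y: "y > 0" "real (Suc n) \<le> 2 * y" by (auto simp: y_def)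
  then have "real (Suc n) ^ 3 \<le> (2 * y) ^ 3" by (intro power_mono) auto
  then have "1 / (2 * y) ^ 3 \<le> 1 / real (Suc n) ^ 3"
    using y by (intro divide_left_mono) auto
  then have "1 / y ^ 3 \<le> 8 * inverse (real (Suc n) ^ 3)"
    by (simp add: power_mult_distrib inverse_eq_divide)
  then show "norm (1 / (real n + 1 / 2) ^ 3) \<le> 8 * inverse (real (Suc n) ^ 3)"
    using y unfolding y_def[symmetric] by simp
qed

text \<open>Here \<open>gint 0 x\<close> is x^2 / sinh x; expanding 1 / sinh x as a geometric series
  in exp (- 2 x) gives Laplace integrals of x^2 at the odd numbers 2 n + 1.\<close>

lemma Mint_0: "Mint 0 = Zodd / 2"
proof -
  define f where "f n x = indicator {0<..} x * (2 * (x ^ 2 * exp (- (2 * real n + 1) * x)))" for n and x :: real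
  have fi: "integrable lborel (f n)" and fI: "integral\<^sup>L lborel (f n) = 1 / (real n + 1 / 2) ^ 3 / 2" for n
  proof -
    have c: "2 * real n + 1 > 0" by simp
    have "set_integrable lborel {0<..} (\<lambda>x. 2 * (x ^ 2 * exp (- (2 * real n + 1) * x)))"
      using power_exp_integral(1)[OF c, of 2] by (intro set_integrable_mult_right)
    then show "integrable lborel (f n)" by (simp add: f_def[abs_def] set_integrable_def)
    have "(LBINT x:{0<..}. 2 * (x ^ 2 * exp (- (2 * real n + 1) * x))) = 2 * (fact 2 / (2 * real n + 1) ^ (2 + 1))"
      using power_exp_integral(2)[OF c, of 2] by (subst set_integral_mult_right) simp
    moreover have "2 * (fact 2 / (2 * real n + 1) ^ (2 + 1)) = 1 / (real n + 1 / 2) ^ 3 / 2"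
    proof -
      have "2 * real n + 1 = 2 * (real n + 1/2)" by simp
      then show ?thesis by (simp only: power_mult_distrib) (simp add: fact_numeral)
    qed
    moreover have "integral\<^sup>L lborel (f n) = (LBINT x:{0<..}. 2 * (x ^ 2 * exp (- (2 * real n + 1) * x)))"
      unfolding set_lebesgue_integral_def f_def[abs_def] real_scaleR_def ..
    ultimately show "integral\<^sup>L lborel (f n) = 1 / (real n + 1 / 2) ^ 3 / 2" by (simp only:)
  qed
  have fnn: "0 \<le> f n x" for n x by (simp add: f_def)
  have fs: "(\<lambda>n. f n x) sums (indicator {0<..} x * gint 0 x)" for x
  proof (cases "x > 0")
    case True
    have W0: "Wint 0 x = x" using True by (simp add: Wint_def)
    have "(\<lambda>n. exp (- 2 * x) ^ n) sums (1 / (1 - exp (- 2 * x)))"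
      by (rule geometric_sums) (use True in simp)
    then have "(\<lambda>n. 2 * x\<^sup>2 * exp (- x) * exp (- 2 * x) ^ n) sums (2 * x\<^sup>2 * exp (- x) * (1 / (1 - exp (- 2 * x))))"
      by (rule sums_mult)
    moreover have "2 * x\<^sup>2 * exp (- x) * exp (- 2 * x) ^ n = f n x" for n
      using True by (simp add: f_def exp_of_nat_mult[symmetric] exp_add[symmetric] algebra_simps)
    moreover have "2 * x\<^sup>2 * exp (- x) * (1 / (1 - exp (- 2 * x))) = x\<^sup>2 / sinh x"
    proof -
      have "exp (- 2 * x) = exp (- x) * exp (- x)" by (simp add: exp_add[symmetric])
      moreover have "exp (- x) * exp x = 1" by (simp add: exp_add[symmetric])
      moreover have "exp (-x) < 1" "exp x > 1" using True by auto
      ultimately have "(1 - exp (- 2 * x)) = exp (-x) * (2 * sinh x)" by (simp add: sinh_def algebra_simps)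
      then show ?thesis by simp
    qed
    ultimately show ?thesis using True by (simp add: gint_def W0 power2_eq_square)
  qed (simp add: f_def)
  have "(\<lambda>n. integral\<^sup>L lborel (f n)) sums (\<integral>x. (\<Sum>n. f n x) \<partial>lborel)"
  proof (rule sums_integral[OF fi])
    show "AE x in lborel. summable (\<lambda>n. norm (f n x))" using fs fnn by (auto simp: sums_iff)
    show "summable (\<lambda>n. \<integral>x. norm (f n x) \<partial>lborel)"
      using summable_divide[OF summable_Zodd, of 2] by (simp add: fnn fI)
  qed
  then have "(\<lambda>n. 1 / (real n + 1 / 2) ^ 3 / 2) sums Mint 0"
    using fs by (simp add: fI sums_iff Mint_def set_lebesgue_integral_def)
  moreover have "(\<lambda>n. 1 / (real n + 1 / 2) ^ 3 / 2) sums (Zodd / 2)"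
    unfolding Zodd_def by (intro sums_divide summable_sums summable_Zodd)
  ultimately show ?thesis by (rule sums_unique2)
qed

text \<open>The homogeneous recursion is solved by the squares of \<open>bcoef\<close>; dividing by
  them turns \<open>Mint_rec\<close> into a telescoping sum, the inner sum of the theorem. The extra
  factor \<open>2 * bcoef k\<close> is the one with which \<open>Mint k\<close> enters the power
  series in \<tau>.\<close>

lemma Mint_closed_form:
  "2 * bcoef k * Mint k = bcoef k ^ 3 * (Zodd - 2 * (\<Sum>j<k. 1 / ((2 * real j + 1) ^ 3 * (bcoef j)\<^sup>2)))"
proof (induction k)
  case (Suc k)
  have b: "bcoef (Suc k) = (real k + 1/2) / (real k + 1) * bcoef k" using bcoef_Suc[of k] by (simp add: field_simps)
  have bp: "bcoef k > 0" by (rule bcoef_pos)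
  define R where "R = (\<Sum>j<k. 1 / ((2 * real j + 1) ^ 3 * (bcoef j)\<^sup>2))"
  have IH: "2 * Mint k = (bcoef k)\<^sup>2 * (Zodd - 2 * R)"
    using Suc bp unfolding R_def[symmetric] by (simp add: power2_eq_square power3_eq_cube)
  define r where "r = real k + 1/2"
  have r: "r > 0" "2 * real k + 1 = 2 * r" by (auto simp: r_def)
  have "(real k + 1)\<^sup>2 * (2 * Mint (Suc k)) = r\<^sup>2 * (2 * Mint k) - 1 / (4 * r)"
  proof -
    have "1 / (4 * (2 * real k + 1)) = 1 / (4 * r) / 2" unfolding r(2) by simp
    then show ?thesis using Mint_rec[of k] unfolding r_def[symmetric] by (simp add: algebra_simps)
  qed
  also have "\<dots> = r\<^sup>2 * (bcoef k)\<^sup>2 * (Zodd - 2 * (R + 1 / ((2 * r) ^ 3 * (bcoef k)\<^sup>2)))"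
    unfolding IH using r(1) bp by (simp add: field_simps power2_eq_square power3_eq_cube)
  also have "\<dots> = (real k + 1)\<^sup>2 * ((bcoef (Suc k))\<^sup>2 * (Zodd - 2 * (R + 1 / ((2 * r) ^ 3 * (bcoef k)\<^sup>2))))"
    unfolding b r_def[symmetric] by (simp add: power_mult_distrib power_divide)
  finally have "2 * Mint (Suc k) = (bcoef (Suc k))\<^sup>2 * (Zodd - 2 * (R + 1 / ((2 * r) ^ 3 * (bcoef k)\<^sup>2)))" by simp
  then show ?case unfolding sum.lessThan_Suc R_def[symmetric] r(2)
    by (simp add: power2_eq_square power3_eq_cube mult_ac)
qed (simp add: Mint_0)

section \<open>Hermite functions\<close>

definition l2 :: "(real \<Rightarrow> 'b::real_normed_vector) \<Rightarrow> bool" where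
  "l2 f \<longleftrightarrow> f \<in> borel_measurable lborel \<and> integrable lborel (\<lambda>x. (norm (f x))\<^sup>2)"

lemma l2_mult_integrable:
  fixes f g :: "real \<Rightarrow> 'b::{real_normed_field,second_countable_topology,banach}"
  assumes "l2 f" "l2 g"
  shows "integrable lborel (\<lambda>x. f x * g x)"
proof (rule Bochner_Integration.integrable_bound)
  show "integrable lborel (\<lambda>x. (norm (f x))\<^sup>2 + (norm (g x))\<^sup>2)"
    using assms unfolding l2_def by auto
  show "(\<lambda>x. f x * g x) \<in> borel_measurable lborel" using assms unfolding l2_def by auto
  have "norm (f x * g x) \<le> (norm (f x))\<^sup>2 + (norm (g x))\<^sup>2" for x
  proof -
    have "2 * norm (f x) * norm (g x) \<le> (norm (f x))\<^sup>2 + (norm (g x))\<^sup>2" by (rule sum_squares_bound)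
    moreover have "0 \<le> norm (f x) * norm (g x)" by simp
    ultimately show ?thesis unfolding norm_mult by linarith
  qed
  then show "AE x in lborel. norm (f x * g x) \<le> norm ((norm (f x))\<^sup>2 + (norm (g x))\<^sup>2)"
    by (auto intro: order_trans)
qed

lemma l2_norm: "l2 f \<Longrightarrow> l2 (\<lambda>x. norm (f x))"
  unfolding l2_def by auto

lemma l2_add:
  fixes f g :: "real \<Rightarrow> 'b::{real_normed_vector,second_countable_topology}"
  assumes "l2 f" "l2 g" shows "l2 (\<lambda>x. f x + g x)"
  unfolding l2_def
proof
  show m: "(\<lambda>x. f x + g x) \<in> borel_measurable lborel" using assms unfolding l2_def by auto
  show "integrable lborel (\<lambda>x. (norm (f x + g x))\<^sup>2)"
  proof (rule Bochner_Integration.integrable_bound)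
    show "integrable lborel (\<lambda>x. 2 * (norm (f x))\<^sup>2 + 2 * (norm (g x))\<^sup>2)"
      using assms unfolding l2_def by auto
    show "AE x in lborel. norm ((norm (f x + g x))\<^sup>2) \<le> norm (2 * (norm (f x))\<^sup>2 + 2 * (norm (g x))\<^sup>2)"
    proof (rule AE_I2)
      fix x
      have "(norm (f x + g x))\<^sup>2 \<le> (norm (f x) + norm (g x))\<^sup>2" by (intro power_mono norm_triangle_ineq) auto
      also have "\<dots> \<le> 2 * (norm (f x))\<^sup>2 + 2 * (norm (g x))\<^sup>2"
        using zero_le_power2[of "norm (f x) - norm (g x)"] by (simp add: power2_diff power2_sum)
      finally show "norm ((norm (f x + g x))\<^sup>2) \<le> norm (2 * (norm (f x))\<^sup>2 + 2 * (norm (g x))\<^sup>2)" by simp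
    qed
  qed (use m in measurable)
qed

lemma l2_bounded_mult:
  fixes f u :: "real \<Rightarrow> 'b::{real_normed_field,second_countable_topology}"
  assumes "l2 f" and m: "u \<in> borel_measurable borel" and b: "\<And>x. norm (u x) \<le> C"
  shows "l2 (\<lambda>x. u x * f x)"
  unfolding l2_def
proof
  show m: "(\<lambda>x. u x * f x) \<in> borel_measurable lborel" using assms unfolding l2_def by auto
  show "integrable lborel (\<lambda>x. (norm (u x * f x))\<^sup>2)"
  proof (rule Bochner_Integration.integrable_bound)
    show "integrable lborel (\<lambda>x. C\<^sup>2 * (norm (f x))\<^sup>2)"
      using assms(1) unfolding l2_def by auto
    have "(norm (u x * f x))\<^sup>2 \<le> C\<^sup>2 * (norm (f x))\<^sup>2" for x
      unfolding norm_mult power_mult_distrib by (intro mult_right_mono power_mono b) auto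
    then show "AE x in lborel. norm ((norm (u x * f x))\<^sup>2) \<le> norm (C\<^sup>2 * (norm (f x))\<^sup>2)" by simp
  qed (use m in measurable)
qed

lemma l2_scale: "l2 f \<Longrightarrow> l2 (\<lambda>x. c * f x)"
  for f :: "real \<Rightarrow> 'b::{real_normed_field,second_countable_topology}"
  by (rule l2_bounded_mult[where C = "norm c"]) auto

lemma l2_of_real: "l2 f \<Longrightarrow> l2 (\<lambda>x. complex_of_real (f x))"
  unfolding l2_def by auto

lemma l2_Cauchy_Schwarz:
  fixes f g :: "real \<Rightarrow> complex"
  assumes f: "l2 f" and g: "l2 g"
  shows "(\<integral>x. norm (f x) * norm (g x) \<partial>lborel)\<^sup>2 \<le> (\<integral>x. (norm (f x))\<^sup>2 \<partial>lborel) * (\<integral>x. (norm (g x))\<^sup>2 \<partial>lborel)"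
    and "(norm (\<integral>x. f x * g x \<partial>lborel))\<^sup>2 \<le> (\<integral>x. (norm (f x))\<^sup>2 \<partial>lborel) * (\<integral>x. (norm (g x))\<^sup>2 \<partial>lborel)"
proof -
  define A B I where "A = (\<integral>x. (norm (f x))\<^sup>2 \<partial>lborel)" and "B = (\<integral>x. (norm (g x))\<^sup>2 \<partial>lborel)"
    and "I = (\<integral>x. norm (f x) * norm (g x) \<partial>lborel)"
  have fi: "integrable lborel (\<lambda>x. (norm (f x))\<^sup>2)" and gi: "integrable lborel (\<lambda>x. (norm (g x))\<^sup>2)"
    using f g by (auto simp: l2_def)
  have Ii: "integrable lborel (\<lambda>x. norm (f x) * norm (g x))"
    by (rule l2_mult_integrable[OF l2_norm[OF f] l2_norm[OF g]])
  have nn: "A \<ge> 0" "B \<ge> 0" "I \<ge> 0" by (auto simp: A_def B_def I_def)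
  have q: "0 \<le> A - 2 * t * I + t\<^sup>2 * B" for t
  proof -
    have "0 \<le> (\<integral>x. (norm (f x) - t * norm (g x))\<^sup>2 \<partial>lborel)" by simp
    also have "(\<integral>x. (norm (f x) - t * norm (g x))\<^sup>2 \<partial>lborel)
       = (\<integral>x. ((norm (f x))\<^sup>2 - 2 * t * (norm (f x) * norm (g x))) + t\<^sup>2 * (norm (g x))\<^sup>2 \<partial>lborel)"
      by (simp add: power2_diff power_mult_distrib algebra_simps)
    also have "\<dots> = A - 2 * t * I + t\<^sup>2 * B"
      using fi gi Ii by (simp add: A_def B_def I_def)
    finally show ?thesis .
  qed
  have "I\<^sup>2 \<le> A * B"
  proof (cases "B = 0")
    case True
    have "I = 0"
    proof (rule ccontr)
      assume "I \<noteq> 0"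
      \<comment> \<open>For B = 0 the quadratic is affine in t, and at this t it takes the value
        -1.\<close>
      then show False using q[of "(A + 1) / (2 * I)"] True by (simp add: field_simps)
    qed
    then show ?thesis using nn by simp
  next
    case False
    then show ?thesis using q[of "I / B"] nn by (simp add: field_simps power2_eq_square)
  qed
  then show 1: "(\<integral>x. norm (f x) * norm (g x) \<partial>lborel)\<^sup>2 \<le> (\<integral>x. (norm (f x))\<^sup>2 \<partial>lborel) * (\<integral>x. (norm (g x))\<^sup>2 \<partial>lborel)"
    by (simp add: A_def B_def I_def)
  have "norm (\<integral>x. f x * g x \<partial>lborel) \<le> I"
    unfolding I_def norm_mult[symmetric] by (rule integral_norm_bound)
  then have "(norm (\<integral>x. f x * g x \<partial>lborel))\<^sup>2 \<le> I\<^sup>2" by (intro power_mono) auto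
  also note 1[folded I_def]
  finally show "(norm (\<integral>x. f x * g x \<partial>lborel))\<^sup>2 \<le> (\<integral>x. (norm (f x))\<^sup>2 \<partial>lborel) * (\<integral>x. (norm (g x))\<^sup>2 \<partial>lborel)" .
qed

text \<open>Integrating \<open>F (x + 1) - F x\<close> over the line gives zero, and by Fubini also the integral of the derivative.\<close>

lemma integral_derivative_eq_0:
  fixes F f :: "real \<Rightarrow> 'b::euclidean_space"
  assumes d: "\<And>x. (F has_vector_derivative f x) (at x)" and c: "continuous_on UNIV f"
    and F: "integrable lborel F" and f: "integrable lborel f"
  shows "(\<integral>x. f x \<partial>lborel) = 0"
proof -
  have fm [measurable]: "f \<in> borel_measurable borel" using f by auto
  let ?g = "\<lambda>(t, x). indicator {0..1} t *\<^sub>R f (t + 1 * x)"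
  have gi: "integrable (lborel \<Otimes>\<^sub>M lborel) ?g"
  proof (rule lborel_pair.Fubini_integrable)
    show "?g \<in> borel_measurable (lborel \<Otimes>\<^sub>M lborel)" by measurable
    have eq: "(\<integral>x. norm (indicator {0..1} t *\<^sub>R f (t + 1 * x)) \<partial>lborel) = indicator {0..1} t * (\<integral>x. norm (f x) \<partial>lborel)" for t :: real
      using lborel_integral_real_affine[of 1 "\<lambda>x. norm (f x)" t] by simp
    show "integrable lborel (\<lambda>t. \<integral>x. norm (case (t, x) of (t, x) \<Rightarrow> indicator {0..1} t *\<^sub>R f (t + 1 * x)) \<partial>lborel)"
      unfolding prod.case eq by simp
    show "AE t in lborel. integrable lborel (\<lambda>x. case (t, x) of (t, x) \<Rightarrow> indicator {0..1} t *\<^sub>R f (t + 1 * x))"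
      using lborel_integrable_real_affine[OF f, of 1] by auto
  qed
  have "(\<integral>x. f x \<partial>lborel) = (\<integral>t. indicator {0..1} (t::real) *\<^sub>R (\<integral>x. f x \<partial>lborel) \<partial>lborel)"
    by (subst integral_scaleR_left) auto
  also have "\<dots> = (\<integral>t. (\<integral>x. ?g (t, x) \<partial>lborel) \<partial>lborel)"
    using lborel_integral_real_affine[of 1 f] by simp
  also have "\<dots> = (\<integral>x. (\<integral>t. ?g (t, x) \<partial>lborel) \<partial>lborel)"
    using lborel_pair.Fubini_integral[of "\<lambda>t x. ?g (t, x)"] gi by simp
  also have "\<dots> = (\<integral>x. F (1 + 1 * x) - F x \<partial>lborel)"
  proof (rule Bochner_Integration.integral_cong[OF refl])
    fix x :: real
    have "(\<integral>t. indicator {0..1} t *\<^sub>R f (t + x) \<partial>lborel) = F (1 + x) - F (0 + x)"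
    proof (rule integral_FTC_atLeastAtMost)
      fix t :: real
      have a: "((\<lambda>t. t + x) has_vector_derivative 1) (at t within {0..1})"
        by (auto intro!: derivative_eq_intros)
      have b: "(F has_vector_derivative f (t + x)) (at (t + x) within (\<lambda>t. t + x) ` {0..1})"
        by (rule has_vector_derivative_at_within[OF d])
      show "((\<lambda>t. F (t + x)) has_vector_derivative f (t + x)) (at t within {0..1})"
        using vector_diff_chain_within[OF a b] by (simp add: o_def)
    next
      show "continuous_on {0..1} (\<lambda>t. f (t + x))"
        by (rule continuous_on_compose2[OF c]) (auto intro!: continuous_intros)
    qed simp
    then show "(\<integral>t. ?g (t, x) \<partial>lborel) = F (1 + 1 * x) - F x" by simp
  qed
  also have "\<dots> = (\<integral>x. F (1 + 1 * x) \<partial>lborel) - (\<integral>x. F x \<partial>lborel)"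
    by (rule Bochner_Integration.integral_diff[OF lborel_integrable_real_affine[OF F] F]) simp
  also have "\<dots> = 0" using lborel_integral_real_affine[of 1 F 1] by simp
  finally show ?thesis .
qed

text \<open>The Hermite functions, normalised in L2. Defining them by the normalised three-term
  recursion keeps Hermite polynomials and factorials out of all later computations.\<close>

fun hf :: "nat \<Rightarrow> real \<Rightarrow> real" where
  "hf 0 x = exp (- x\<^sup>2 / 2) / sqrt (sqrt pi)"
| "hf (Suc 0) x = sqrt 2 * x * (exp (- x\<^sup>2 / 2) / sqrt (sqrt pi))"
| "hf (Suc (Suc n)) x = (sqrt 2 * x * hf (Suc n) x - sqrt (real (Suc n)) * hf n x) / sqrt (real (Suc (Suc n)))"

text \<open>For n = 0 the truncated \<open>n - 1\<close> is 0, but its coefficient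
  \<open>sqrt 0\<close> removes that term, so one formula covers all n.\<close>

lemma hf_rec: "sqrt (real (Suc n)) * hf (Suc n) x = sqrt 2 * x * hf n x - sqrt (real n) * hf (n - 1) x"
  by (cases n) (simp_all del: of_nat_Suc)

declare hf.simps(3) [simp del]

definition hf' :: "nat \<Rightarrow> real \<Rightarrow> real" where
  "hf' n x = sqrt 2 * sqrt (real n) * hf (n - 1) x - x * hf n x"

lemma hf_deriv: "(hf n has_real_derivative hf' n x) (at x within A)"
proof (induction n x rule: hf.induct)
  case (1 x)
  have "((\<lambda>x. exp (- x\<^sup>2 / 2) / sqrt (sqrt pi)) has_real_derivative hf' 0 x) (at x within A)"
    by (auto intro!: derivative_eq_intros simp: hf'_def field_simps)
  moreover have "hf 0 = (\<lambda>x. exp (- x\<^sup>2 / 2) / sqrt (sqrt pi))" by (rule ext) simp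
  ultimately show ?case by (simp only:)
next
  case (2 x)
  define k where "k = sqrt 2 / sqrt (sqrt pi)"
  have "((\<lambda>x. k * (x * exp (- x\<^sup>2 / 2))) has_real_derivative k * (exp (- x\<^sup>2 / 2) + x * (exp (- x\<^sup>2 / 2) * (- x)))) (at x within A)"
    by (rule DERIV_cmult) (auto intro!: derivative_eq_intros)
  moreover have "hf (Suc 0) = (\<lambda>x. k * (x * exp (- x\<^sup>2 / 2)))" by (rule ext) (simp add: k_def)
  moreover have "k * (exp (- x\<^sup>2 / 2) + x * (exp (- x\<^sup>2 / 2) * (- x))) = hf' (Suc 0) x"
    by (simp add: hf'_def k_def algebra_simps diff_divide_distrib)
  ultimately show ?case by (simp only:)
next
  case (3 n x)
  have e: "hf (Suc (Suc n)) = (\<lambda>x. (sqrt 2 * x * hf (Suc n) x - sqrt (real (Suc n)) * hf n x) / sqrt (real (Suc (Suc n))))"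
    by (rule ext) (simp add: hf.simps(3) del: of_nat_Suc)
  define r0 r1 r2 where "r0 = sqrt (real n)" and "r1 = sqrt (real (Suc n))" and "r2 = sqrt (real (Suc (Suc n)))"
  have r: "r0 * r0 = real n" "r1 * r1 = real n + 1" "r2 * r2 = real n + 2" "r2 > 0"
    by (auto simp: r0_def r1_def r2_def)
  define a b c where "a = hf (n - 1) x" and "b = hf n x" and "c = hf (Suc n) x"
  have rc: "r1 * c = sqrt 2 * x * b - r0 * a" using hf_rec[of n x] by (simp add: r0_def r1_def a_def b_def c_def)
  have "(hf (Suc (Suc n)) has_real_derivative
      (sqrt 2 * (c + x * hf' (Suc n) x) - r1 * hf' n x) / r2) (at x within A)"
    unfolding e r1_def[symmetric] r2_def[symmetric]
    by (rule DERIV_cdivide) (use 3 in \<open>auto intro!: derivative_eq_intros simp: c_def algebra_simps\<close>)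
  also have "(sqrt 2 * (c + x * hf' (Suc n) x) - r1 * hf' n x) / r2 = hf' (Suc (Suc n)) x"
  proof -
    have "sqrt 2 * (c + x * hf' (Suc n) x) - r1 * hf' n x
        = sqrt 2 * c + sqrt 2 * x * (sqrt 2 * r1 * b - x * c) - r1 * (sqrt 2 * r0 * a - x * b)"
      by (simp add: hf'_def a_def b_def c_def r0_def r1_def algebra_simps)
    also have "\<dots> = sqrt 2 * (r2 * r2) * c - x * (sqrt 2 * x * c - r1 * b)"
    proof -
      define s where "s = sqrt 2"
      have "s * (r1 * r1) * c = s * r1 * (r1 * c)" by simp
      also have "\<dots> = s * s * x * r1 * b - s * r0 * r1 * a" unfolding rc s_def by (simp add: algebra_simps)
      finally have A: "s * (r1 * r1) * c = s * s * x * r1 * b - s * r0 * r1 * a" .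
      have "s * c + s * x * (s * r1 * b - x * c) - r1 * (s * r0 * a - x * b)
         = s * c + (s * s * x * r1 * b - s * r0 * r1 * a) - s * x * x * c + r1 * x * b"
        by (simp add: algebra_simps)
      also have "\<dots> = s * (r2 * r2) * c - x * (s * x * c - r1 * b)"
        unfolding A[symmetric] r by (simp add: algebra_simps)
      finally show ?thesis by (simp add: s_def)
    qed
    also have "\<dots> = r2 * hf' (Suc (Suc n)) x"
    proof -
      have H: "r2 * hf (Suc (Suc n)) x = sqrt 2 * x * c - r1 * b"
        using hf_rec[of "Suc n" x] by (simp add: r2_def r1_def b_def c_def)
      have "r2 * hf' (Suc (Suc n)) x = sqrt 2 * (r2 * r2) * c - x * (r2 * hf (Suc (Suc n)) x)"
        unfolding hf'_def r2_def[symmetric] by (simp add: c_def algebra_simps)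
      then show ?thesis unfolding H by simp
    qed
    finally show ?thesis using r(4) by simp
  qed
  finally show ?case .
qed

lemma hf'_deriv: "(hf' n has_real_derivative (x\<^sup>2 - (2 * real n + 1)) * hf n x) (at x within A)"
proof -
  define r0 r1 where "r0 = sqrt (real n)" and "r1 = sqrt (real (n - 1))"
  have r: "r0 * r0 = real n" by (simp add: r0_def)
  \<comment> \<open>The recursion at \<open>n - 1\<close> holds only for n > 0; multiplied by r0 =
    sqrt n it becomes true for n = 0 as well.\<close>
  have rc: "r0 * (r0 * hf n x) = r0 * (sqrt 2 * x * hf (n - 1) x - r1 * hf (n - 2) x)"
    using hf_rec[of "n - 1" x] by (cases n) (auto simp: r0_def r1_def numeral_2_eq_2)
  have "(hf' n has_real_derivative sqrt 2 * r0 * hf' (n - 1) x - (hf n x + x * hf' n x)) (at x within A)"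
    unfolding hf'_def[abs_def] by (auto intro!: derivative_eq_intros hf_deriv simp: r0_def hf'_def)
  also have "sqrt 2 * r0 * hf' (n - 1) x - (hf n x + x * hf' n x)
     = sqrt 2 * r0 * (sqrt 2 * r1 * hf (n - 2) x - x * hf (n - 1) x) - (hf n x + x * (sqrt 2 * r0 * hf (n - 1) x - x * hf n x))"
    by (simp add: hf'_def r0_def r1_def numeral_2_eq_2)
  also have "\<dots> = (x\<^sup>2 - (2 * real n + 1)) * hf n x"
  proof -
    define s where "s = sqrt 2"
    have B: "r0 * r1 * hf (n - 2) x = s * r0 * x * hf (n - 1) x - real n * hf n x"
      using rc unfolding r[symmetric] s_def by (simp add: algebra_simps)
    have "s * r0 * (s * r1 * hf (n - 2) x - x * hf (n - 1) x) - (hf n x + x * (s * r0 * hf (n - 1) x - x * hf n x))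
      = (s * s) * (r0 * r1 * hf (n - 2) x) - 2 * (s * r0 * x * hf (n - 1) x) - hf n x + x * x * hf n x"
      by (simp add: algebra_simps)
    also have "\<dots> = (x * x - (2 * real n + 1)) * hf n x"
      unfolding B by (simp add: s_def algebra_simps)
    finally show ?thesis by (simp add: s_def power2_eq_square)
  qed
  finally show ?thesis .
qed

text \<open>The lowering formula of \<open>hf'\<close> with x removed by the recursion; in this form
  the norm of the derivative follows from orthonormality.\<close>

lemma hf'_alt: "sqrt 2 * hf' n x = sqrt (real n) * hf (n - 1) x - sqrt (real (Suc n)) * hf (Suc n) x"
proof -
  have "sqrt 2 * hf' n x = sqrt 2 * (sqrt 2 * sqrt (real n) * hf (n - 1) x - x * hf n x)" by (simp add: hf'_def)
  also have "\<dots> = sqrt (real n) * hf (n - 1) x - (sqrt 2 * x * hf n x - sqrt (real n) * hf (n - 1) x)"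
  proof -
    have "s * (s * A * B - x * C) = (s * s) * (A * B) - s * x * C" for s A B C :: real by (simp add: algebra_simps)
    from this[of "sqrt 2"] show ?thesis by simp
  qed
  finally show ?thesis by (simp only: hf_rec)
qed

lemma hf_continuous [continuous_intros]:
  assumes "continuous_on A g" shows "continuous_on A (\<lambda>x. hf n (g x))"
proof -
  have "continuous_on UNIV (hf n)" by (intro continuous_at_imp_continuous_on ballI DERIV_isCont[OF hf_deriv])
  then show ?thesis using assms by (rule continuous_on_compose2) auto
qed

lemma hf'_continuous [continuous_intros]:
  assumes "continuous_on A g" shows "continuous_on A (\<lambda>x. hf' n (g x))"
  unfolding hf'_def by (intro continuous_intros assms)

lemma hf_measurable [measurable]: "hf n \<in> borel_measurable borel"
  by (rule borel_measurable_continuous_onI) (use hf_continuous[of UNIV "\<lambda>x. x"] in simp)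

lemma power_le_fact_exp: "y \<ge> 0 \<Longrightarrow> y ^ k \<le> fact k * exp (y::real)"
proof -
  assume y: "y \<ge> 0"
  have "(\<Sum>n\<in>{k}. y ^ n /\<^sub>R fact n) \<le> exp y"
    unfolding exp_def by (rule sum_le_suminf[OF summable_exp_generic]) (use y in auto)
  then show ?thesis by (simp add: field_simps)
qed

text \<open>All powers k are treated at once, because the recursion trades a lower index for one
  more factor x. Half of the Gaussian exponent is spent on absorbing the power.\<close>

lemma hf_decay: "\<exists>C. \<forall>x. \<bar>x\<bar> ^ k * \<bar>hf n x\<bar> \<le> C * exp (- x\<^sup>2 / 4)"
proof (induction n arbitrary: k rule: less_induct)
  case (less n)
  have base: "\<bar>x\<bar> ^ k * exp (- x\<^sup>2 / 2) \<le> (1 + 4 ^ k * fact k) * exp (- x\<^sup>2 / 4)" for x :: real and k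
  proof -
    have "\<bar>x\<bar> ^ k \<le> 1 + (x\<^sup>2) ^ k"
    proof (cases "\<bar>x\<bar> \<le> 1")
      case True then show ?thesis using power_le_one[of "\<bar>x\<bar>" k] by (simp add: add_increasing2)
    next
      case False
      then have "\<bar>x\<bar> ^ k \<le> \<bar>x\<bar> ^ (2 * k)" by (intro power_increasing) auto
      then show ?thesis by (simp add: power_mult)
    qed
    also have "(x\<^sup>2) ^ k = 4 ^ k * (x\<^sup>2 / 4) ^ k" by (simp add: power_divide)
    also have "\<dots> \<le> 4 ^ k * (fact k * exp (x\<^sup>2 / 4))" by (intro mult_left_mono power_le_fact_exp) auto
    also have "1 + 4 ^ k * (fact k * exp (x\<^sup>2 / 4)) \<le> (1 + 4 ^ k * fact k) * exp (x\<^sup>2 / 4)"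
      by (simp add: algebra_simps)
    finally have "\<bar>x\<bar> ^ k * exp (- x\<^sup>2 / 2) \<le> (1 + 4 ^ k * fact k) * exp (x\<^sup>2 / 4) * exp (- x\<^sup>2 / 2)"
      by (intro mult_right_mono) auto
    also have "\<dots> = (1 + 4 ^ k * fact k) * exp (- x\<^sup>2 / 4)" by (simp add: mult.assoc exp_add[symmetric])
    finally show ?thesis .
  qed
  have p: "sqrt (sqrt pi) > 0" by simp
  consider "n = 0" | "n = 1" | m where "n = Suc (Suc m)" by (metis One_nat_def not0_implies_Suc)
  then show ?case
  proof cases
    case 1
    then show ?thesis using base[where k = k] p
      by (intro exI[of _ "(1 + 4 ^ k * fact k) / sqrt (sqrt pi)"]) (simp add: divide_simps)
  next
    case 2
    have "\<bar>x\<bar> ^ k * \<bar>hf n x\<bar> \<le> sqrt 2 * (1 + 4 ^ Suc k * fact (Suc k)) / sqrt (sqrt pi) * exp (- x\<^sup>2 / 4)" for x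
    proof -
      have "\<bar>x\<bar> ^ k * \<bar>hf n x\<bar> = sqrt 2 / sqrt (sqrt pi) * (\<bar>x\<bar> ^ Suc k * exp (- x\<^sup>2 / 2))"
        using 2 p by (simp add: abs_mult)
      also have "\<dots> \<le> sqrt 2 / sqrt (sqrt pi) * ((1 + 4 ^ Suc k * fact (Suc k)) * exp (- x\<^sup>2 / 4))"
        by (intro mult_left_mono base) auto
      finally show ?thesis by simp
    qed
    then show ?thesis by blast
  next
    case 3
    obtain C1 where C1: "\<And>x. \<bar>x\<bar> ^ Suc k * \<bar>hf (Suc m) x\<bar> \<le> C1 * exp (- x\<^sup>2 / 4)" using less[of "Suc m" "Suc k"] 3 by auto
    obtain C2 where C2: "\<And>x. \<bar>x\<bar> ^ k * \<bar>hf m x\<bar> \<le> C2 * exp (- x\<^sup>2 / 4)" using less[of m k] 3 by auto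
    define q where "q = sqrt (real (Suc (Suc m)))"
    have q: "q > 0" by (simp add: q_def)
    have "\<bar>x\<bar> ^ k * \<bar>hf n x\<bar> \<le> (sqrt 2 * C1 + sqrt (real (Suc m)) * C2) / q * exp (- x\<^sup>2 / 4)" for x
    proof -
      have "\<bar>x\<bar> ^ k * \<bar>hf n x\<bar> = \<bar>x\<bar> ^ k * \<bar>sqrt 2 * x * hf (Suc m) x - sqrt (real (Suc m)) * hf m x\<bar> / q"
        using 3 q by (simp add: q_def hf.simps(3))
      also have "\<dots> \<le> \<bar>x\<bar> ^ k * (sqrt 2 * \<bar>x\<bar> * \<bar>hf (Suc m) x\<bar> + sqrt (real (Suc m)) * \<bar>hf m x\<bar>) / q"
        using q abs_triangle_ineq4[of "sqrt 2 * x * hf (Suc m) x" "sqrt (real (Suc m)) * hf m x"]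
        by (intro divide_right_mono mult_left_mono) (auto simp: abs_mult)
      also have "\<dots> = (sqrt 2 * (\<bar>x\<bar> ^ Suc k * \<bar>hf (Suc m) x\<bar>) + sqrt (real (Suc m)) * (\<bar>x\<bar> ^ k * \<bar>hf m x\<bar>)) / q"
        by (simp add: algebra_simps)
      also have "\<dots> \<le> (sqrt 2 * (C1 * exp (- x\<^sup>2 / 4)) + sqrt (real (Suc m)) * (C2 * exp (- x\<^sup>2 / 4))) / q"
        using q by (intro divide_right_mono add_mono mult_left_mono C1 C2) auto
      finally show ?thesis by (simp add: algebra_simps)
    qed
    then show ?thesis by blast
  qed
qed

lemma gauss_integrable: assumes "c > 0" shows "integrable lborel (\<lambda>x::real. exp (- c * x\<^sup>2))"
proof -
  have "0 < sqrt (1 / (2 * c))" using assms by simp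
  then have "integrable lborel (normal_density 0 (sqrt (1 / (2 * c))))" by (rule integrable_normal_density)
  then have "integrable lborel (\<lambda>x. sqrt (2 * pi * (1 / (2 * c))) * normal_density 0 (sqrt (1 / (2 * c))) x)" by (rule integrable_mult_right)
  moreover have "sqrt (2 * pi * (1 / (2 * c))) * normal_density 0 (sqrt (1 / (2 * c))) x = exp (- c * x\<^sup>2)" for x
    using assms unfolding normal_density_def by simp
  ultimately show ?thesis by (simp only:)
qed

lemma gauss_integral: assumes "c > 0" shows "(\<integral>x. exp (- c * x\<^sup>2) \<partial>lborel) = sqrt (pi / c)"
proof -
  have "0 < sqrt (1 / (2 * c))" using assms by simp
  then have "(\<integral>x. normal_density 0 (sqrt (1 / (2 * c))) x \<partial>lborel) = 1" by (rule integral_normal_density)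
  then have "(\<integral>x. sqrt (2 * pi * (1 / (2 * c))) * normal_density 0 (sqrt (1 / (2 * c))) x \<partial>lborel) = sqrt (2 * pi * (1 / (2 * c)))"
    by (simp only: integral_mult_right_zero mult_1_right)
  moreover have "sqrt (2 * pi * (1 / (2 * c))) * normal_density 0 (sqrt (1 / (2 * c))) x = exp (- c * x\<^sup>2)" for x
    using assms unfolding normal_density_def by simp
  ultimately have "(\<integral>x. exp (- c * x\<^sup>2) \<partial>lborel) = sqrt (2 * pi * (1 / (2 * c)))" by (simp only:)
  then show ?thesis by simp
qed

lemma gauss_bound_l2:
  fixes f :: "real \<Rightarrow> 'b::{real_normed_vector,second_countable_topology}"
  assumes m: "f \<in> borel_measurable borel" and b: "\<And>x. norm (f x) \<le> C * exp (- x\<^sup>2 / 4)"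
  shows "l2 f"
  unfolding l2_def
proof
  show "f \<in> borel_measurable lborel" using m by simp
  show "integrable lborel (\<lambda>x. (norm (f x))\<^sup>2)"
  proof (rule Bochner_Integration.integrable_bound)
    show "integrable lborel (\<lambda>x::real. C\<^sup>2 * exp (- (1/2) * x\<^sup>2))" by (intro integrable_mult_right gauss_integrable) simp
    have "(norm (f x))\<^sup>2 \<le> (C * exp (- x\<^sup>2 / 4))\<^sup>2" for x by (intro power_mono b) auto
    then show "AE x in lborel. norm ((norm (f x))\<^sup>2) \<le> norm (C\<^sup>2 * exp (- (1/2) * x\<^sup>2))"
      by (simp add: power_mult_distrib exp_of_nat_mult[symmetric] flip: power2_eq_square exp_double)
  qed (use m in measurable)
qed

lemma hf_power_l2: "l2 (\<lambda>x. x ^ k * hf n x)"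
proof -
  obtain C where "\<And>x. \<bar>x\<bar> ^ k * \<bar>hf n x\<bar> \<le> C * exp (- x\<^sup>2 / 4)" using hf_decay by blast
  then show ?thesis by (intro gauss_bound_l2[where C = C]) (auto simp: abs_mult power_abs)
qed

lemma hf_l2: "l2 (hf n)" using hf_power_l2[of 0 n] by simp

lemma hf'_l2: "l2 (hf' n)"
proof -
  have "l2 (\<lambda>x. sqrt 2 * sqrt (real n) * hf (n - 1) x + (- 1) * (x ^ 1 * hf n x))"
    by (intro l2_add l2_scale hf_l2 hf_power_l2)
  then show ?thesis by (simp add: hf'_def[abs_def])
qed

lemma hf_integrable_mult: "integrable lborel (\<lambda>x. hf n x * hf m x)"
  by (intro l2_mult_integrable hf_l2)

text \<open>The Wronskian of two Hermite functions is integrable, and its derivative is 2 (n - m)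
  times their product.\<close>

lemma hf_orthogonal: assumes "n \<noteq> m" shows "(\<integral>x. hf n x * hf m x \<partial>lborel) = 0"
proof -
  have "(\<integral>x. 2 * (real n - real m) * (hf n x * hf m x) \<partial>lborel) = 0"
  proof (rule integral_derivative_eq_0)
    show "((\<lambda>x. hf n x * hf' m x - hf' n x * hf m x) has_vector_derivative 2 * (real n - real m) * (hf n x * hf m x)) (at x)" for x
      unfolding has_real_derivative_iff_has_vector_derivative[symmetric]
      by (auto intro!: derivative_eq_intros hf_deriv hf'_deriv simp: algebra_simps)
  qed (auto intro!: continuous_intros hf_integrable_mult l2_mult_integrable hf_l2 hf'_l2)
  then have "2 * (real n - real m) * (\<integral>x. hf n x * hf m x \<partial>lborel) = 0" by (simp only: integral_mult_right_zero)
  then show ?thesis using assms by simp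
qed

text \<open>The integral of x \<open>hf n\<close> \<open>hf (Suc n)\<close> is evaluated twice by
  the recursion, once raising the first factor and once lowering the second. Orthogonality leaves
  the norm of \<open>hf (Suc n)\<close> on one side and that of \<open>hf n\<close> on the other,
  with the same factor.\<close>

lemma hf_norm: "(\<integral>x. hf n x * hf n x \<partial>lborel) = 1"
proof (induction n)
  case 0
  have "(\<integral>x. hf 0 x * hf 0 x \<partial>lborel) = (\<integral>x. exp (- 1 * x\<^sup>2) / sqrt pi \<partial>lborel)"
    by (rule Bochner_Integration.integral_cong) (auto simp: exp_add[symmetric])
  then show ?case using gauss_integral[of 1] by simp
next
  case (Suc n)
  have x1: "integrable lborel (\<lambda>x. (x ^ 1 * hf n x) * hf (Suc n) x)"
    by (intro l2_mult_integrable hf_l2 hf_power_l2)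
  define X where "X = (\<integral>x. (x ^ 1 * hf n x) * hf (Suc n) x \<partial>lborel)"
  define s where "s = sqrt (real (Suc n))"
  have s: "s > 0" by (simp add: s_def)
  have "s * (\<integral>x. hf (Suc n) x * hf (Suc n) x \<partial>lborel) = (\<integral>x. (s * hf (Suc n) x) * hf (Suc n) x \<partial>lborel)"
    using hf_integrable_mult[of "Suc n" "Suc n"] by (simp add: mult.assoc)
  also have "\<dots> = (\<integral>x. sqrt 2 * ((x ^ 1 * hf n x) * hf (Suc n) x) - sqrt (real n) * (hf (n - 1) x * hf (Suc n) x) \<partial>lborel)"
    unfolding s_def hf_rec by (simp add: algebra_simps)
  also have "\<dots> = sqrt 2 * X - sqrt (real n) * (\<integral>x. hf (n - 1) x * hf (Suc n) x \<partial>lborel)"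
    using x1 hf_integrable_mult[of "n - 1" "Suc n"] by (simp add: X_def)
  also have "(\<integral>x. hf (n - 1) x * hf (Suc n) x \<partial>lborel) = 0" by (rule hf_orthogonal) simp
  finally have 1: "s * (\<integral>x. hf (Suc n) x * hf (Suc n) x \<partial>lborel) = sqrt 2 * X" by simp
  have "sqrt 2 * X = (\<integral>x. hf n x * (sqrt 2 * x * hf (Suc n) x) \<partial>lborel)"
    unfolding X_def using x1 by (simp add: mult_ac flip: integral_mult_right_zero)
  also have "\<dots> = (\<integral>x. sqrt (real (Suc (Suc n))) * (hf n x * hf (Suc (Suc n)) x) + s * (hf n x * hf n x) \<partial>lborel)"
  proof -
    have "sqrt 2 * x * hf (Suc n) x = sqrt (real (Suc (Suc n))) * hf (Suc (Suc n)) x + s * hf n x" for x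
      using hf_rec[of "Suc n" x] by (simp add: s_def)
    then show ?thesis by (simp add: algebra_simps)
  qed
  also have "\<dots> = sqrt (real (Suc (Suc n))) * (\<integral>x. hf n x * hf (Suc (Suc n)) x \<partial>lborel) + s * (\<integral>x. hf n x * hf n x \<partial>lborel)"
    using hf_integrable_mult[of n "Suc (Suc n)"] hf_integrable_mult[of n n] by simp
  also have "\<dots> = s" using hf_orthogonal[of n "Suc (Suc n)"] Suc by simp
  finally show ?case using 1 s by simp
qed

lemma hf_orthonormal: "(\<integral>x. hf n x * hf m x \<partial>lborel) = (if n = m then 1 else 0)"
  using hf_norm hf_orthogonal by auto

lemma hf'_norm: "(\<integral>x. (hf' n x)\<^sup>2 \<partial>lborel) = real n + 1 / 2"
proof -
  have "(\<integral>x. 2 * (hf' n x)\<^sup>2 \<partial>lborel) = (\<integral>x. real n * (hf (n - 1) x * hf (n - 1) x)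
      - 2 * (sqrt (real n) * sqrt (real (Suc n))) * (hf (n - 1) x * hf (Suc n) x) + real (Suc n) * (hf (Suc n) x * hf (Suc n) x) \<partial>lborel)"
  proof (rule Bochner_Integration.integral_cong[OF refl])
    fix x
    have "2 * (hf' n x)\<^sup>2 = (sqrt 2 * hf' n x)\<^sup>2" by (simp add: power_mult_distrib)
    also have "\<dots> = (sqrt (real n) * hf (n - 1) x)\<^sup>2 - 2 * (sqrt (real n) * hf (n - 1) x) * (sqrt (real (Suc n)) * hf (Suc n) x) + (sqrt (real (Suc n)) * hf (Suc n) x)\<^sup>2"
      unfolding hf'_alt power2_diff by simp
    also have "\<dots> = real n * (hf (n - 1) x * hf (n - 1) x)
      - 2 * (sqrt (real n) * sqrt (real (Suc n))) * (hf (n - 1) x * hf (Suc n) x) + real (Suc n) * (hf (Suc n) x * hf (Suc n) x)"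
      unfolding power_mult_distrib real_sqrt_pow2[OF of_nat_0_le_iff] by (simp add: power2_eq_square mult_ac)
    finally show "2 * (hf' n x)\<^sup>2 = \<dots>" .
  qed
  also have "\<dots> = real n + real (Suc n)"
    by (simp add: hf_integrable_mult hf_orthonormal)
  finally show ?thesis by simp
qed

text \<open>The square at x differs from the square at x - R by an integral of 2 h h', which the
  norms of h and h' bound independently of R; at x - R the function disappears as R grows.\<close>

lemma hf_sup: "(hf n x)\<^sup>2 \<le> 2 * sqrt (real n + 1)"
proof -
  \<comment> \<open>This weight balances the two norms: lam + (n + 1/2) / lam \<le> 2 lam.\<close>
  define lam where "lam = sqrt (real n + 1)"
  have l: "lam > 0" "lam\<^sup>2 = real n + 1" by (auto simp: lam_def)
  have i2: "integrable lborel (\<lambda>x. (hf n x)\<^sup>2)" "integrable lborel (\<lambda>x. (hf' n x)\<^sup>2)"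
    using hf_l2 hf'_l2 by (auto simp: l2_def)
  have bound: "(hf n x)\<^sup>2 - (hf n (x - R))\<^sup>2 \<le> 2 * lam" if "R \<ge> 0" for R
  proof -
    have FTC: "(\<integral>t. indicator {x-R..x} t *\<^sub>R (2 * hf n t * hf' n t) \<partial>lborel) = (hf n x)\<^sup>2 - (hf n (x - R))\<^sup>2"
    proof (rule integral_FTC_atLeastAtMost)
      fix t
      show "((\<lambda>t. (hf n t)\<^sup>2) has_vector_derivative 2 * hf n t * hf' n t) (at t within {x-R..x})"
        unfolding has_real_derivative_iff_has_vector_derivative[symmetric]
        by (auto intro!: derivative_eq_intros hf_deriv)
    qed (use that in \<open>auto intro!: continuous_intros\<close>)
    have "(hf n x)\<^sup>2 - (hf n (x - R))\<^sup>2 \<le> (\<integral>t. lam * (hf n t)\<^sup>2 + (1 / lam) * (hf' n t)\<^sup>2 \<partial>lborel)"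
      unfolding FTC[symmetric]
    proof (rule integral_mono)
      show "integrable lborel (\<lambda>t. indicator {x-R..x} t *\<^sub>R (2 * hf n t * hf' n t))"
      proof -
        have "continuous_on {x-R..x} (\<lambda>t. 2 * hf n t * hf' n t)" by (intro continuous_intros)
        from borel_integrable_atLeastAtMost'[OF this] show ?thesis unfolding set_integrable_def .
      qed
      show "integrable lborel (\<lambda>t. lam * (hf n t)\<^sup>2 + (1 / lam) * (hf' n t)\<^sup>2)" using i2 by simp
      fix t
      have "2 * (lam * hf n t) * hf' n t \<le> (lam * hf n t)\<^sup>2 + (hf' n t)\<^sup>2" by (rule sum_squares_bound)
      then have "2 * hf n t * hf' n t \<le> lam * (hf n t)\<^sup>2 + (1 / lam) * (hf' n t)\<^sup>2"
        using l by (simp add: field_simps power2_eq_square)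
      moreover have "0 \<le> lam * (hf n t)\<^sup>2 + (1 / lam) * (hf' n t)\<^sup>2" using l by simp
      ultimately show "indicator {x-R..x} t *\<^sub>R (2 * hf n t * hf' n t) \<le> lam * (hf n t)\<^sup>2 + (1 / lam) * (hf' n t)\<^sup>2"
        by (auto simp: indicator_def)
    qed
    also have "\<dots> = lam + (1 / lam) * (real n + 1 / 2)"
      using i2 hf_norm[of n] by (simp add: hf'_norm power2_eq_square[of "hf n _"])
    also have "\<dots> \<le> 2 * lam" using l by (simp add: field_simps power2_eq_square)
    finally show ?thesis .
  qed
  obtain C where C: "\<And>x. \<bar>hf n x\<bar> \<le> C * exp (- x\<^sup>2 / 4)" using hf_decay[of 0 n] by auto
  have "((\<lambda>R. (C * exp (- (x - R)\<^sup>2 / 4))\<^sup>2 + 2 * lam) \<longlongrightarrow> (C * 0)\<^sup>2 + 2 * lam) at_top"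
    by (intro tendsto_intros) real_asymp
  moreover have "(hf n x)\<^sup>2 \<le> (C * exp (- (x - R)\<^sup>2 / 4))\<^sup>2 + 2 * lam" if "R \<ge> 0" for R
    using bound[OF that] power_mono[OF C[of "x - R"], of 2] by simp
  ultimately have "(hf n x)\<^sup>2 \<le> (C * 0)\<^sup>2 + 2 * lam"
    by (intro tendsto_lowerbound[where F = at_top]) (auto intro!: eventually_at_top_linorderI[of 0])
  then show ?thesis by (simp add: lam_def)
qed

section \<open>Mehler's formula\<close>

lemma summable_poly_geometric:
  assumes "\<bar>z\<bar> < (1::real)"
  shows "summable (\<lambda>n. (real n + 3) ^ 3 * z ^ n)"
proof -
  have s0: "summable (\<lambda>n. (\<lambda>_. 1::real) n * x ^ n)" if "norm x < 1" for x :: real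
    using that summable_geometric by simp
  have s1: "summable (\<lambda>n. diffs (\<lambda>_. 1::real) n * x ^ n)" if "norm x < 1" for x
    by (rule termdiff_converges[OF that s0])
  have s2: "summable (\<lambda>n. diffs (diffs (\<lambda>_. 1::real)) n * x ^ n)" if "norm x < 1" for x
    by (rule termdiff_converges[OF that s1])
  have s3: "summable (\<lambda>n. diffs (diffs (diffs (\<lambda>_. 1::real))) n * x ^ n)" if "norm x < 1" for x
    by (rule termdiff_converges[OF that s2])
  show ?thesis
  proof (rule summable_comparison_test'[of "\<lambda>n. 6 * (diffs (diffs (diffs (\<lambda>_. 1::real))) n * \<bar>z\<bar> ^ n)" 0])
    show "summable (\<lambda>n. 6 * (diffs (diffs (diffs (\<lambda>_. 1::real))) n * \<bar>z\<bar> ^ n))"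
      using s3[of "\<bar>z\<bar>"] assms by (intro summable_mult) simp
    fix n
    have d: "diffs (diffs (diffs (\<lambda>_. 1::real))) n = (real n + 1) * ((real n + 2) * (real n + 3))"
      by (simp add: diffs_def algebra_simps)
    have "(real n + 3) * ((real n + 3) * (real n + 3)) \<le> (3 * (real n + 1)) * ((2 * (real n + 2)) * (real n + 3))"
      by (intro mult_mono) auto
    then have "(real n + 3) ^ 3 \<le> 6 * diffs (diffs (diffs (\<lambda>_. 1::real))) n"
      unfolding d by (simp add: power3_eq_cube algebra_simps)
    then have "(real n + 3) ^ 3 * \<bar>z\<bar> ^ n \<le> 6 * diffs (diffs (diffs (\<lambda>_. 1::real))) n * \<bar>z\<bar> ^ n"
      by (intro mult_right_mono) auto
    then show "norm ((real n + 3) ^ 3 * z ^ n) \<le> 6 * (diffs (diffs (diffs (\<lambda>_. 1::real))) n * \<bar>z\<bar> ^ n)"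
      by (simp add: abs_mult power_abs mult.assoc)
  qed
qed

lemma summable_poly_bound:
  assumes "\<And>n. \<bar>f n\<bar> \<le> (real n + 3) ^ 3" "\<bar>z\<bar> < (1::real)"
  shows "summable (\<lambda>n. f n * z ^ n)" "summable (\<lambda>n. norm (f n * z ^ n))"
proof -
  show "summable (\<lambda>n. norm (f n * z ^ n))"
  proof (rule summable_comparison_test'[of "\<lambda>n. (real n + 3) ^ 3 * \<bar>z\<bar> ^ n" 0])
    show "summable (\<lambda>n. (real n + 3) ^ 3 * \<bar>z\<bar> ^ n)" by (rule summable_poly_geometric) (use assms in simp)
    show "norm (norm (f n * z ^ n)) \<le> (real n + 3) ^ 3 * \<bar>z\<bar> ^ n" for n
      using assms(1)[of n] by (simp add: abs_mult power_abs mult_right_mono)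
  qed
  then show "summable (\<lambda>n. f n * z ^ n)" by (rule summable_norm_cancel)
qed

lemma hf_abs_le: "\<bar>hf n x\<bar> \<le> real n + 2"
proof -
  have "sqrt (real n + 1) \<le> real n + 1" by (rule real_le_lsqrt) (auto simp: power2_eq_square)
  then have "\<bar>hf n x\<bar>\<^sup>2 \<le> 2 * (real n + 1)"
    using hf_sup[of n x] by simp
  also have "\<dots> \<le> (real n + 2)\<^sup>2" by (simp add: power2_eq_square algebra_simps)
  finally show ?thesis by (rule power2_le_imp_le) simp
qed

text \<open>One crude weight (n + 3)^3 dominates every coefficient sequence in the proof of Mehler's
  formula: two Hermite values of index at most n + 1, and a factor of size at most n + 1.\<close>

lemma hf_prod_le:
  assumes "0 \<le> r" "r \<le> real n + 1" "k \<le> Suc n" "l \<le> Suc n"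
  shows "\<bar>r * hf k x * hf l y\<bar> \<le> (real n + 3) ^ 3"
proof -
  have "\<bar>hf k x\<bar> \<le> real n + 3" "\<bar>hf l y\<bar> \<le> real n + 3"
    using hf_abs_le[of k x] hf_abs_le[of l y] assms by auto
  then have "r * \<bar>hf k x\<bar> * \<bar>hf l y\<bar> \<le> (real n + 3) * (real n + 3) * (real n + 3)"
    using assms by (intro mult_mono) auto
  then show ?thesis using assms by (simp add: abs_mult power3_eq_cube)
qed

lemma sqrt_Suc_le: "0 \<le> sqrt (real (Suc n))" "sqrt (real (Suc n)) \<le> real n + 1"
  by (auto intro!: real_le_lsqrt simp: power2_eq_square algebra_simps)

text \<open>Termwise differentiation gives the series D. The three-term recursions in x and in y tie
  D and the shifted series A, B, E to S by linear equations; eliminating them leaves a first-order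
  linear equation for S in z.\<close>

lemma mehler_ode:
  fixes x y z :: real
  assumes z: "\<bar>z\<bar> < 1"
  defines "S \<equiv> \<lambda>z. \<Sum>n. hf n x * hf n y * z ^ n"
  shows "(S has_real_derivative (2 * (x - y * z) * (y - x * z) / (1 - z\<^sup>2)\<^sup>2 + z / (1 - z\<^sup>2)) * S z) (at z)"
proof -
  let ?h = "\<lambda>n. hf n x" and ?k = "\<lambda>n. hf n y" and ?s = "\<lambda>n. sqrt (real n)"
  have sS: "summable (\<lambda>n. ?h n * ?k n * z ^ n)" if "\<bar>z\<bar> < 1" for z
    by (rule summable_poly_bound(1)[OF _ that]) (use hf_prod_le[of 1] in auto)
  have sA: "summable (\<lambda>n. ?s (Suc n) * ?h (Suc n) * ?k n * z ^ n)"
    by (rule summable_poly_bound(1)[OF _ z], rule hf_prod_le) (use sqrt_Suc_le in auto)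
  have sB: "summable (\<lambda>n. ?s (Suc n) * ?h n * ?k (Suc n) * z ^ n)"
    by (rule summable_poly_bound(1)[OF _ z], rule hf_prod_le) (use sqrt_Suc_le in auto)
  have sD: "summable (\<lambda>n. real (Suc n) * ?h (Suc n) * ?k (Suc n) * z ^ n)"
    by (rule summable_poly_bound(1)[OF _ z], rule hf_prod_le) auto
  have sE: "summable (\<lambda>n. real (Suc n) * ?h n * ?k n * z ^ n)"
    by (rule summable_poly_bound(1)[OF _ z], rule hf_prod_le) auto
  define A where "A = (\<Sum>n. ?s (Suc n) * ?h (Suc n) * ?k n * z ^ n)"
  define B where "B = (\<Sum>n. ?s (Suc n) * ?h n * ?k (Suc n) * z ^ n)"
  define D where "D = (\<Sum>n. real (Suc n) * ?h (Suc n) * ?k (Suc n) * z ^ n)"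
  define E where "E = (\<Sum>n. real (Suc n) * ?h n * ?k n * z ^ n)"
  have hA: "(\<lambda>n. ?s (Suc n) * ?h (Suc n) * ?k n * z ^ n) sums A" unfolding A_def by (rule summable_sums[OF sA])
  have hB: "(\<lambda>n. ?s (Suc n) * ?h n * ?k (Suc n) * z ^ n) sums B" unfolding B_def by (rule summable_sums[OF sB])
  have hD: "(\<lambda>n. real (Suc n) * ?h (Suc n) * ?k (Suc n) * z ^ n) sums D" unfolding D_def by (rule summable_sums[OF sD])
  have hE: "(\<lambda>n. real (Suc n) * ?h n * ?k n * z ^ n) sums E" unfolding E_def by (rule summable_sums[OF sE])
  have hS: "(\<lambda>n. ?h n * ?k n * z ^ n) sums S z" unfolding S_def by (rule summable_sums[OF sS[OF z]])
  \<comment> \<open>In each use the coefficient carries a factor n or sqrt n that vanishes at n = 0,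
    so the value at the truncated index \<open>n - 1\<close> does not matter there.\<close>
  have shift: "(\<lambda>n. f n * z ^ n) sums (z * t)" if "f 0 = 0" "(\<lambda>n. f (Suc n) * z ^ n) sums t" for f t
  proof -
    have "(\<lambda>n. f (Suc n) * z ^ Suc n) sums (z * t)"
      using sums_mult[OF that(2), of z] by (simp add: mult_ac)
    then show ?thesis using sums_Suc[of "\<lambda>n. f n * z ^ n" "z * t"] that(1) by simp
  qed
  have B': "(\<lambda>n. ?s n * ?h (n - 1) * ?k n * z ^ n) sums (z * B)"
    by (rule shift) (use hB in auto)
  have A': "(\<lambda>n. ?s n * ?h n * ?k (n - 1) * z ^ n) sums (z * A)"
    by (rule shift) (use hA in auto)
  have E': "(\<lambda>n. real n * ?h (n - 1) * ?k (n - 1) * z ^ n) sums (z * E)"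
    by (rule shift) (use hE in auto)
  have D': "(\<lambda>n. real n * ?h n * ?k n * z ^ n) sums (z * D)"
    by (rule shift) (use hD in auto)
  have recx: "?s (Suc n) * ?h (Suc n) = sqrt 2 * x * ?h n - ?s n * ?h (n - 1)" for n by (rule hf_rec)
  have recy: "?s (Suc n) * ?k (Suc n) = sqrt 2 * y * ?k n - ?s n * ?k (n - 1)" for n by (rule hf_rec)
  have eqA: "A = sqrt 2 * x * S z - z * B"
  proof (rule sums_unique2[OF hA])
    have "(\<lambda>n. sqrt 2 * x * (?h n * ?k n * z ^ n) - ?s n * ?h (n - 1) * ?k n * z ^ n) sums (sqrt 2 * x * S z - z * B)"
      by (intro sums_diff sums_mult hS B')
    then show "(\<lambda>n. ?s (Suc n) * ?h (Suc n) * ?k n * z ^ n) sums (sqrt 2 * x * S z - z * B)"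
      unfolding recx by (simp add: algebra_simps)
  qed
  have eqB: "B = sqrt 2 * y * S z - z * A"
  proof (rule sums_unique2[OF hB])
    have "(\<lambda>n. sqrt 2 * y * (?h n * ?k n * z ^ n) - ?s n * ?h n * ?k (n - 1) * z ^ n) sums (sqrt 2 * y * S z - z * A)"
      by (intro sums_diff sums_mult hS A')
    moreover have "?s (Suc n) * ?h n * ?k (Suc n) * z ^ n = sqrt 2 * y * (?h n * ?k n * z ^ n) - ?s n * ?h n * ?k (n - 1) * z ^ n" for n
    proof -
      have "?s (Suc n) * ?h n * ?k (Suc n) * z ^ n = ?h n * z ^ n * (?s (Suc n) * ?k (Suc n))" by (simp only: mult_ac)
      then show ?thesis unfolding recy by (simp only: right_diff_distrib mult_ac)
    qed
    ultimately show "(\<lambda>n. ?s (Suc n) * ?h n * ?k (Suc n) * z ^ n) sums (sqrt 2 * y * S z - z * A)"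
      by (simp only:)
  qed
  have eqE: "E = S z + z * D"
  proof (rule sums_unique2[OF hE])
    show "(\<lambda>n. real (Suc n) * ?h n * ?k n * z ^ n) sums (S z + z * D)"
      using sums_add[OF hS D'] by (simp add: algebra_simps)
  qed
  have eqD: "D = sqrt 2 * x * B - sqrt 2 * y * (z * B) + z * E"
  proof (rule sums_unique2[OF hD])
    have "(\<lambda>n. sqrt 2 * x * (?s (Suc n) * ?h n * ?k (Suc n) * z ^ n) - sqrt 2 * y * (?s n * ?h (n - 1) * ?k n * z ^ n)
        + real n * ?h (n - 1) * ?k (n - 1) * z ^ n) sums (sqrt 2 * x * B - sqrt 2 * y * (z * B) + z * E)"
      by (intro sums_add sums_diff sums_mult hB B' E')
    moreover have "real (Suc n) * ?h (Suc n) * ?k (Suc n) * z ^ n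
       = sqrt 2 * x * (?s (Suc n) * ?h n * ?k (Suc n) * z ^ n) - sqrt 2 * y * (?s n * ?h (n - 1) * ?k n * z ^ n)
        + real n * ?h (n - 1) * ?k (n - 1) * z ^ n" for n
    proof -
      have q: "?s m * ?s m = real m" for m by simp
      have g: "(s * a) * (s * b) = s * s * a * b" for s a b :: real by simp
      have "real (Suc n) * ?h (Suc n) * ?k (Suc n) = (?s (Suc n) * ?h (Suc n)) * (?s (Suc n) * ?k (Suc n))"
        by (simp only: g q)
      also have "\<dots> = sqrt 2 * x * (?s (Suc n) * ?h n * ?k (Suc n)) - ?s n * ?h (n - 1) * (?s (Suc n) * ?k (Suc n))"
        unfolding recx left_diff_distrib by (simp only: mult_ac)
      also have "?s n * ?h (n - 1) * (?s (Suc n) * ?k (Suc n)) = sqrt 2 * y * (?s n * ?h (n - 1) * ?k n) - (?s n * ?h (n - 1)) * (?s n * ?k (n - 1))"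
        unfolding recy by (simp only: right_diff_distrib mult_ac)
      also have "(?s n * ?h (n - 1)) * (?s n * ?k (n - 1)) = real n * ?h (n - 1) * ?k (n - 1)"
        by (simp only: g q)
      finally have "real (Suc n) * ?h (Suc n) * ?k (Suc n) = sqrt 2 * x * (?s (Suc n) * ?h n * ?k (Suc n))
         - (sqrt 2 * y * (?s n * ?h (n - 1) * ?k n) - real n * ?h (n - 1) * ?k (n - 1))" .
      moreover have "(a - (b - c)) * t = a * t - b * t + c * t" for a b c t :: real by (simp add: algebra_simps)
      ultimately show ?thesis by (simp only: mult.assoc)
    qed
    ultimately show "(\<lambda>n. real (Suc n) * ?h (Suc n) * ?k (Suc n) * z ^ n) sums (sqrt 2 * x * B - sqrt 2 * y * (z * B) + z * E)"
      by (simp only:)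
  qed
  \<comment> \<open>The pairs (A, B) and (D, E) each satisfy a 2 by 2 linear system, and w = 1 - z^2
    is the determinant of both.\<close>
  define w where "w = 1 - z * z"
  have w: "w > 0" unfolding w_def using z abs_square_less_1[of z] by (simp add: power2_eq_square)
  have wB: "w * B = sqrt 2 * (y - x * z) * S z"
  proof -
    have "B = sqrt 2 * y * S z - z * (sqrt 2 * x * S z - z * B)"
      by (subst eqA[symmetric]) (rule eqB)
    then show ?thesis unfolding w_def by (simp add: algebra_simps)
  qed
  have wD: "w * D = sqrt 2 * (x - y * z) * B + z * S z"
    using eqD eqE unfolding w_def by (simp add: algebra_simps)
  have "w * w * D = sqrt 2 * (x - y * z) * (w * B) + w * z * S z"
  proof -
    have "w * w * D = w * (w * D)" by simp
    also have "\<dots> = sqrt 2 * (x - y * z) * (w * B) + w * z * S z" unfolding wD by (simp add: algebra_simps)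
    finally show ?thesis .
  qed
  also have "\<dots> = 2 * (x - y * z) * (y - x * z) * S z + w * z * S z"
    unfolding wB by (simp add: algebra_simps)
  finally have "D = (2 * (x - y * z) * (y - x * z) / (w * w) + z / w) * S z"
    using w by (simp add: field_simps)
  moreover have "(S has_real_derivative (\<Sum>n. diffs (\<lambda>n. ?h n * ?k n) n * z ^ n)) (at z)"
    unfolding S_def by (rule termdiffs_strong'[where K = 1]) (use sS z in auto)
  moreover have "(\<Sum>n. diffs (\<lambda>n. ?h n * ?k n) n * z ^ n) = D"
    unfolding D_def diffs_def by (simp add: mult_ac)
  ultimately show ?thesis by (simp add: w_def power2_eq_square)
qed

text \<open>g is the logarithm of the expected quotient S z / S 0; \<open>mehler_ode\<close> says
  that S exp (- g) has derivative 0 on the unit interval, and S 0 is the product of the two ground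
  states.\<close>

lemma mehler_z:
  fixes x y z :: real
  assumes z: "\<bar>z\<bar> < 1"
  shows "(\<Sum>n. hf n x * hf n y * z ^ n) = exp (- (x\<^sup>2 + y\<^sup>2) / 2 + (2 * x * y * z - (x\<^sup>2 + y\<^sup>2) * z\<^sup>2) / (1 - z\<^sup>2)) / (sqrt pi * sqrt (1 - z\<^sup>2))"
proof -
  define S where "S = (\<lambda>z. \<Sum>n. hf n x * hf n y * z ^ n)"
  define g where "g = (\<lambda>z. (2 * x * y * z - (x\<^sup>2 + y\<^sup>2) * z\<^sup>2) / (1 - z\<^sup>2) - ln (1 - z\<^sup>2) / 2)"
  have "((\<lambda>z. S z * exp (- g z)) has_real_derivative 0) (at t within {-1<..<1})" if t: "t \<in> {-1<..<1}" for t
  proof -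
    have w: "1 - t\<^sup>2 > 0" using t abs_square_less_1[of t] by auto
    have dS: "(S has_real_derivative (2 * (x - y * t) * (y - x * t) / (1 - t\<^sup>2)\<^sup>2 + t / (1 - t\<^sup>2)) * S t) (at t within {-1<..<1})"
      unfolding S_def by (rule has_field_derivative_at_within[OF mehler_ode]) (use t in auto)
    have "((\<lambda>z. (2 * x * y * z - (x\<^sup>2 + y\<^sup>2) * z\<^sup>2) / (1 - z\<^sup>2)) has_real_derivative
       ((2 * x * y - (x\<^sup>2 + y\<^sup>2) * (2 * t)) * (1 - t\<^sup>2) - (2 * x * y * t - (x\<^sup>2 + y\<^sup>2) * t\<^sup>2) * (- (2 * t))) / ((1 - t\<^sup>2) * (1 - t\<^sup>2))) (at t within {-1<..<1})"
      using w by (auto intro!: derivative_eq_intros)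
    moreover have "((2 * x * y - (x\<^sup>2 + y\<^sup>2) * (2 * t)) * (1 - t\<^sup>2) - (2 * x * y * t - (x\<^sup>2 + y\<^sup>2) * t\<^sup>2) * (- (2 * t)))
       = 2 * (x - y * t) * (y - x * t)"
      by (simp add: algebra_simps power2_eq_square)
    moreover have "((\<lambda>z. ln (1 - z\<^sup>2) / 2) has_real_derivative - t / (1 - t\<^sup>2)) (at t within {-1<..<1})"
      using w by (auto intro!: derivative_eq_intros simp: field_simps)
    ultimately have dg: "(g has_real_derivative 2 * (x - y * t) * (y - x * t) / ((1 - t\<^sup>2) * (1 - t\<^sup>2)) - - t / (1 - t\<^sup>2)) (at t within {-1<..<1})"
      unfolding g_def by (intro DERIV_diff) simp_all
    show ?thesis
      by (rule DERIV_cong, (rule derivative_eq_intros dS dg refl)+) (simp add: power2_eq_square algebra_simps)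
  qed
  then obtain c where c: "\<And>t. t \<in> {-1<..<1} \<Longrightarrow> S t * exp (- g t) = c"
    using has_field_derivative_zero_constant[of "{-1<..<1::real}" "\<lambda>z. S z * exp (- g z)"] by auto
  have S0: "S 0 = hf 0 x * hf 0 y"
    using powser_zero[of "\<lambda>n. hf n x * hf n y"] by (simp add: S_def)
  have "S z * exp (- g z) = S 0 * exp (- g 0)" using c[of z] c[of 0] z by (simp add: abs_less_iff)
  then have "S z = S 0 * exp (g z)" by (simp add: g_def exp_minus field_simps)
  also have "exp (g z) = exp ((2 * x * y * z - (x\<^sup>2 + y\<^sup>2) * z\<^sup>2) / (1 - z\<^sup>2)) / sqrt (1 - z\<^sup>2)"
  proof -
    have "1 - z\<^sup>2 > 0" using z abs_square_less_1[of z] by auto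
    then have "exp (ln (1 - z\<^sup>2) / 2) = sqrt (1 - z\<^sup>2)" by (simp add: powr_half_sqrt[symmetric] powr_def)
    then show ?thesis unfolding g_def exp_diff by simp
  qed
  also have "S 0 = exp (- (x\<^sup>2 + y\<^sup>2) / 2) / sqrt pi"
    unfolding S0 by (simp add: exp_add[symmetric] add_divide_distrib)
  finally show ?thesis unfolding S_def by (simp add: exp_add)
qed

text \<open>Mehler's kernel in the parameter e with z = (1 - e) / (1 + e), which diagonalises the
  exponent in x + y and x - y. Small e means z near 1, and e = tanh (s/2) corresponds to z = exp (-
  s).\<close>

definition mehler :: "real \<Rightarrow> real \<Rightarrow> real \<Rightarrow> real" where
  "mehler e x y = (1 + e) / (2 * sqrt pi * sqrt e) * exp (- e * (x + y)\<^sup>2 / 4 - (x - y)\<^sup>2 / (4 * e))"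

lemma mehler_pos: "e > 0 \<Longrightarrow> mehler e x y > 0"
  by (simp add: mehler_def)

lemma mehler_sums:
  fixes e :: real
  assumes e: "0 < e"
  defines "z \<equiv> (1 - e) / (1 + e)"
  shows "(\<lambda>n. hf n x * hf n y * z ^ n) sums mehler e x y"
    and "summable (\<lambda>n. norm (hf n x * hf n y * z ^ n))"
proof -
  have z: "\<bar>z\<bar> < 1" using e by (auto simp: z_def abs_if field_simps)
  have "\<bar>hf n x * hf n y\<bar> \<le> (real n + 3) ^ 3" for n using hf_prod_le[of 1 n n n x y] by simp
  note s = summable_poly_bound[OF this z]
  show "summable (\<lambda>n. norm (hf n x * hf n y * z ^ n))" by (rule s)
  have w: "1 - z\<^sup>2 = 4 * e / (1 + e)\<^sup>2"
  proof -
    have "1 - z\<^sup>2 = ((1 + e)\<^sup>2 - (1 - e)\<^sup>2) / (1 + e)\<^sup>2"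
    proof -
      have "z\<^sup>2 = (1 - e)\<^sup>2 / (1 + e)\<^sup>2" by (simp add: z_def power_divide)
      then show ?thesis using e by (simp only: diff_divide_distrib) simp
    qed
    also have "(1 + e)\<^sup>2 - (1 - e)\<^sup>2 = 4 * e" by (simp add: power2_eq_square algebra_simps)
    finally show ?thesis .
  qed
  have "sqrt (1 - z\<^sup>2) = 2 * sqrt e / (1 + e)" unfolding w using e by (simp add: real_sqrt_divide real_sqrt_mult)
  moreover have "- (x\<^sup>2 + y\<^sup>2) / 2 + (2 * x * y * z - (x\<^sup>2 + y\<^sup>2) * z\<^sup>2) / (1 - z\<^sup>2) = - e * (x + y)\<^sup>2 / 4 - (x - y)\<^sup>2 / (4 * e)"
  proof -
    have z1: "(1 + e) * z = 1 - e" using e by (simp add: z_def)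
    have "(1 + e)\<^sup>2 * z\<^sup>2 = ((1 + e) * z)\<^sup>2" "(1 + e)\<^sup>2 * z = (1 + e) * ((1 + e) * z)"
      by (simp_all add: power_mult_distrib power2_eq_square)
    then have zz: "(1 + e)\<^sup>2 * z\<^sup>2 = (1 - e)\<^sup>2" "(1 + e)\<^sup>2 * z = (1 + e) * (1 - e)"
      unfolding z1 by simp_all
    have "(2 * x * y * z - (x\<^sup>2 + y\<^sup>2) * z\<^sup>2) / (1 - z\<^sup>2) = (2 * x * y * ((1 + e)\<^sup>2 * z) - (x\<^sup>2 + y\<^sup>2) * ((1 + e)\<^sup>2 * z\<^sup>2)) / (4 * e)"
      unfolding w using e by (simp add: field_simps)
    also have "\<dots> = (2 * x * y * ((1 + e) * (1 - e)) - (x\<^sup>2 + y\<^sup>2) * (1 - e)\<^sup>2) / (4 * e)"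
      unfolding zz ..
    also have "- (x\<^sup>2 + y\<^sup>2) / 2 + \<dots> = - e * (x + y)\<^sup>2 / 4 - (x - y)\<^sup>2 / (4 * e)"
      using e by (simp add: field_simps power2_eq_square)
    finally show ?thesis .
  qed
  ultimately have "(\<Sum>n. hf n x * hf n y * z ^ n) = mehler e x y"
    unfolding mehler_z[OF z] mehler_def using e by (simp only:) (simp add: divide_simps)
  then show "(\<lambda>n. hf n x * hf n y * z ^ n) sums mehler e x y"
    using summable_sums[OF s(1)] by simp
qed

section \<open>Parseval's identity for Hermite functions\<close>

definition hc :: "(real \<Rightarrow> complex) \<Rightarrow> nat \<Rightarrow> complex" where
  "hc f n = (\<integral>x. of_real (hf n x) * f x \<partial>lborel)"

lemma hf_l2c: "l2 (\<lambda>x. complex_of_real (hf n x))"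
  by (rule l2_of_real[OF hf_l2])

lemma hc_integrable: "l2 f \<Longrightarrow> integrable lborel (\<lambda>x. of_real (hf n x) * f x)"
  for f :: "real \<Rightarrow> complex"
  by (rule l2_mult_integrable[OF hf_l2c])

lemma cnj_measurable [measurable]: "cnj \<in> borel_measurable borel"
  by (intro borel_measurable_continuous_onI continuous_intros)

lemma l2_cnj: "l2 f \<Longrightarrow> l2 (\<lambda>x. cnj (f x))"
  unfolding l2_def by auto

lemma l2_sum_hf: "l2 (\<lambda>x. \<Sum>n<N. c n * complex_of_real (hf n x))"
proof (induction N)
  case 0 show ?case by (simp add: l2_def)
next
  case (Suc N) then show ?case by (simp add: l2_add l2_scale hf_l2c)
qed

lemma hf_orthonormal_c: "(\<integral>x. complex_of_real (hf n x) * of_real (hf m x) \<partial>lborel) = (if n = m then 1 else 0)"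
proof -
  have "(\<integral>x. complex_of_real (hf n x) * of_real (hf m x) \<partial>lborel) = of_real (\<integral>x. hf n x * hf m x \<partial>lborel)"
    by (simp flip: integral_complex_of_real)
  then show ?thesis by (simp add: hf_orthonormal)
qed

lemma hf_cross_integrable: "integrable lborel (\<lambda>x. complex_of_real (hf n x) * of_real (hf m x))"
  by (rule l2_mult_integrable[OF hf_l2c hf_l2c])

lemma hc_sum: "hc (\<lambda>x. \<Sum>n<N. c n * complex_of_real (hf n x)) m = (if m < N then c m else 0)"
proof -
  have "hc (\<lambda>x. \<Sum>n<N. c n * complex_of_real (hf n x)) m = (\<Sum>n<N. c n * (\<integral>x. of_real (hf m x) * of_real (hf n x) \<partial>lborel))"
    unfolding hc_def using hf_cross_integrable
    by (simp add: sum_distrib_left mult.left_commute[of _ "c _"] Bochner_Integration.integral_sum)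
  then show ?thesis by (simp add: hf_orthonormal_c if_distrib[of "\<lambda>t. _ * t"] cong: if_cong)
qed

lemma norm_sum_hf: "(\<integral>x. (cmod (\<Sum>n<N. c n * complex_of_real (hf n x)))\<^sup>2 \<partial>lborel) = (\<Sum>n<N. (cmod (c n))\<^sup>2)"
proof -
  have "complex_of_real (\<integral>x. (cmod (\<Sum>n<N. c n * complex_of_real (hf n x)))\<^sup>2 \<partial>lborel)
     = (\<integral>x. (\<Sum>m<N. cnj (c m) * (of_real (hf m x) * (\<Sum>n<N. c n * complex_of_real (hf n x)))) \<partial>lborel)"
    unfolding integral_complex_of_real[symmetric] complex_norm_square
    by (rule Bochner_Integration.integral_cong) (auto simp: sum_distrib_left sum_distrib_right mult_ac)
  also have "\<dots> = (\<Sum>m<N. cnj (c m) * hc (\<lambda>x. \<Sum>n<N. c n * complex_of_real (hf n x)) m)"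
    unfolding hc_def using hc_integrable[OF l2_sum_hf[of c N]]
    by (simp add: Bochner_Integration.integral_sum)
  also have "\<dots> = complex_of_real (\<Sum>n<N. (cmod (c n))\<^sup>2)"
    by (simp add: hc_sum complex_norm_square[symmetric] mult.commute)
  finally show ?thesis by (simp only: of_real_eq_iff)
qed

lemma bessel_norm:
  assumes f: "l2 f"
  shows "(\<integral>x. (cmod (f x - (\<Sum>n<N. hc f n * of_real (hf n x))))\<^sup>2 \<partial>lborel) = (\<integral>x. (cmod (f x))\<^sup>2 \<partial>lborel) - (\<Sum>n<N. (cmod (hc f n))\<^sup>2)"
proof -
  define p where "p x = (\<Sum>n<N. hc f n * complex_of_real (hf n x))" for x
  have pl: "l2 p" unfolding p_def[abs_def] by (rule l2_sum_hf)
  have i1: "integrable lborel (\<lambda>x. (cmod (f x))\<^sup>2)" using f by (simp add: l2_def)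
  have i2: "integrable lborel (\<lambda>x. (cmod (p x))\<^sup>2)" using pl by (simp add: l2_def)
  have i3: "integrable lborel (\<lambda>x. f x * cnj (p x))" by (rule l2_mult_integrable[OF f l2_cnj[OF pl]])
  have n2: "(\<integral>x. (cmod (p x))\<^sup>2 \<partial>lborel) = (\<Sum>n<N. (cmod (hc f n))\<^sup>2)" unfolding p_def by (rule norm_sum_hf)
  have cn: "cnj c * c = complex_of_real ((cmod c)\<^sup>2)" for c by (simp only: complex_norm_square mult.commute)
  have "(cmod (a - b))\<^sup>2 = (cmod a)\<^sup>2 - 2 * Re (a * cnj b) + (cmod b)\<^sup>2" for a b
    unfolding cmod_power2 by (simp add: power2_eq_square algebra_simps)
  then have "(\<integral>x. (cmod (f x - p x))\<^sup>2 \<partial>lborel) = (\<integral>x. (cmod (f x))\<^sup>2 - 2 * Re (f x * cnj (p x)) + (cmod (p x))\<^sup>2 \<partial>lborel)"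
    by (simp only:)
  also have "\<dots> = (\<integral>x. (cmod (f x))\<^sup>2 \<partial>lborel) - 2 * Re (\<integral>x. f x * cnj (p x) \<partial>lborel) + (\<Sum>n<N. (cmod (hc f n))\<^sup>2)"
  proof -
    have "(\<integral>x. A x - 2 * Re (q x) + C x \<partial>lborel) = (\<integral>x. A x \<partial>lborel) - 2 * Re (\<integral>x. q x \<partial>lborel) + (\<integral>x. C x \<partial>lborel)"
      if "integrable lborel A" "integrable lborel q" "integrable lborel C" for A C :: "real \<Rightarrow> real" and q
      using that by simp
    from this[OF i1 i3 i2] show ?thesis unfolding n2 .
  qed
  also have "(\<integral>x. f x * cnj (p x) \<partial>lborel) = (\<integral>x. (\<Sum>n<N. cnj (hc f n) * (of_real (hf n x) * f x)) \<partial>lborel)"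
    by (rule Bochner_Integration.integral_cong) (auto simp: p_def sum_distrib_left mult_ac)
  also have "\<dots> = (\<Sum>n<N. cnj (hc f n) * hc f n)"
    unfolding hc_def[of f] using hc_integrable[OF f] by (simp add: Bochner_Integration.integral_sum)
  also have "Re \<dots> = (\<Sum>n<N. (cmod (hc f n))\<^sup>2)"
    by (simp only: cn Re_sum Re_complex_of_real)
  finally show ?thesis by (simp add: p_def)
qed

lemma bessel_l2:
  assumes "l2 f" shows "(\<Sum>n<N. (cmod (hc f n))\<^sup>2) \<le> (\<integral>x. (cmod (f x))\<^sup>2 \<partial>lborel)"
proof -
  have "0 \<le> (\<integral>x. (cmod (f x - (\<Sum>n<N. hc f n * of_real (hf n x))))\<^sup>2 \<partial>lborel)" by simp
  then show ?thesis unfolding bessel_norm[OF assms] by simp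
qed

lemma hf_abs_integral_le:
  assumes "l2 f"
  shows "(\<integral>x. \<bar>hf n x\<bar> * cmod (f x) \<partial>lborel)\<^sup>2 \<le> (\<integral>x. (cmod (f x))\<^sup>2 \<partial>lborel)"
  using l2_Cauchy_Schwarz(1)[OF hf_l2c[of n] assms] hf_norm[of n] by (simp add: power2_eq_square[of "hf n _"])

lemma pair_integrable_mult:
  fixes u v :: "real \<Rightarrow> complex"
  assumes u: "integrable lborel u" and v: "integrable lborel v"
  shows "integrable (lborel \<Otimes>\<^sub>M lborel) (\<lambda>(x,y). u x * v y)"
    and "(\<integral>p. (case p of (x,y) \<Rightarrow> u x * v y) \<partial>(lborel \<Otimes>\<^sub>M lborel)) = (\<integral>x. u x \<partial>lborel) * (\<integral>y. v y \<partial>lborel)"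
proof -
  have [measurable]: "u \<in> borel_measurable borel" "v \<in> borel_measurable borel" using u v by auto
  show i: "integrable (lborel \<Otimes>\<^sub>M lborel) (\<lambda>(x,y). u x * v y)"
  proof (rule lborel_pair.Fubini_integrable)
    show "integrable lborel (\<lambda>x. \<integral>y. norm (case (x, y) of (x,y) \<Rightarrow> u x * v y) \<partial>lborel)"
      using u by (simp add: norm_mult)
    show "AE x in lborel. integrable lborel (\<lambda>y. case (x, y) of (x,y) \<Rightarrow> u x * v y)" using v by simp
  qed measurable
  show "(\<integral>p. (case p of (x,y) \<Rightarrow> u x * v y) \<partial>(lborel \<Otimes>\<^sub>M lborel)) = (\<integral>x. u x \<partial>lborel) * (\<integral>y. v y \<partial>lborel)"
    using lborel_pair.integral_fst'[OF i] by simp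
qed

text \<open>Integrating Mehler's series against f(x) times the conjugate of f(y) gives Abel means of
  the squared Hermite coefficients. It serves twice: for Parseval as e tends to 0, and for the
  generating function of the overlaps.\<close>

lemma mehler_form:
  fixes f :: "real \<Rightarrow> complex"
  assumes f: "l2 f" and e: "0 < e" "e \<le> 1"
  defines "z \<equiv> (1 - e) / (1 + e)"
  shows "(\<lambda>n. complex_of_real (z ^ n * (cmod (hc f n))\<^sup>2)) sums (\<integral>x. (\<integral>y. of_real (mehler e x y) * (f x * cnj (f y)) \<partial>lborel) \<partial>lborel)"
proof -
  have z: "0 \<le> z" "z < 1" using e by (auto simp: z_def field_simps)
  define u where "u n x = complex_of_real (hf n x) * f x" for n x
  have ui: "integrable lborel (u n)" for n unfolding u_def[abs_def] by (rule hc_integrable[OF f])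
  have vi: "integrable lborel (\<lambda>y. cnj (u n y))" for n using ui by simp
  define F where "F n = (\<lambda>(x,y). of_real (z ^ n) * (u n x * cnj (u n y)))" for n
  have F': "F n = (\<lambda>p. of_real (z ^ n) * (case p of (x,y) \<Rightarrow> u n x * cnj (u n y)))" for n
    by (auto simp: F_def fun_eq_iff)
  have Fi: "integrable (lborel \<Otimes>\<^sub>M lborel) (F n)" for n
    unfolding F' by (intro integrable_mult_right pair_integrable_mult(1) ui vi)
  have FI: "(\<integral>p. F n p \<partial>(lborel \<Otimes>\<^sub>M lborel)) = complex_of_real (z ^ n * (cmod (hc f n))\<^sup>2)" for n
  proof -
    have "(\<integral>p. F n p \<partial>(lborel \<Otimes>\<^sub>M lborel)) = of_real (z ^ n) * ((\<integral>x. u n x \<partial>lborel) * cnj (\<integral>x. u n x \<partial>lborel))"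
      unfolding F' using pair_integrable_mult(2)[OF ui vi] by simp
    also have "(\<integral>x. u n x \<partial>lborel) = hc f n" by (simp add: u_def hc_def)
    finally show ?thesis by (simp add: complex_norm_square[symmetric])
  qed
  \<comment> \<open>Cauchy-Schwarz with \<open>hf n\<close> of norm 1 bounds the absolute integrals
    by a geometric series, which justifies termwise integration.\<close>
  have Fn: "(\<integral>p. norm (F n p) \<partial>(lborel \<Otimes>\<^sub>M lborel)) \<le> z ^ n * (\<integral>x. (cmod (f x))\<^sup>2 \<partial>lborel)" for n
  proof -
    have r: "complex_of_real (norm (F n p)) = of_real (z ^ n) * (case p of (x,y) \<Rightarrow> complex_of_real (cmod (u n x)) * complex_of_real (cmod (u n y)))" for p
      using z by (simp add: F_def norm_mult norm_power split: prod.split)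
    have "complex_of_real (\<integral>p. norm (F n p) \<partial>(lborel \<Otimes>\<^sub>M lborel)) = (\<integral>p. complex_of_real (norm (F n p)) \<partial>(lborel \<Otimes>\<^sub>M lborel))"
      by (rule integral_complex_of_real[symmetric])
    also have "\<dots> = of_real (z ^ n) * ((\<integral>x. complex_of_real (cmod (u n x)) \<partial>lborel) * (\<integral>x. complex_of_real (cmod (u n x)) \<partial>lborel))"
      unfolding r using pair_integrable_mult(2)[of "\<lambda>x. complex_of_real (cmod (u n x))" "\<lambda>x. complex_of_real (cmod (u n x))"] ui
      by (simp del: integral_complex_of_real)
    also have "\<dots> = of_real (z ^ n * (\<integral>x. cmod (u n x) \<partial>lborel)\<^sup>2)" by (simp add: power2_eq_square)
    finally have "(\<integral>p. norm (F n p) \<partial>(lborel \<Otimes>\<^sub>M lborel)) = z ^ n * (\<integral>x. cmod (u n x) \<partial>lborel)\<^sup>2"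
      by (simp only: of_real_eq_iff)
    also have "\<dots> \<le> z ^ n * (\<integral>x. (cmod (f x))\<^sup>2 \<partial>lborel)"
      using z hf_abs_integral_le[OF f, of n] by (intro mult_left_mono) (auto simp: u_def norm_mult)
    finally show ?thesis .
  qed
  have Fs: "(\<lambda>n. F n p) sums (case p of (x,y) \<Rightarrow> of_real (mehler e x y) * (f x * cnj (f y)))"
    and Fsn: "summable (\<lambda>n. norm (F n p))" for p
  proof -
    obtain x y where p: "p = (x, y)" by force
    have eq: "F n p = of_real (hf n x * hf n y * z ^ n) * (f x * cnj (f y))" for n
      by (simp add: p F_def u_def mult_ac)
    show "(\<lambda>n. F n p) sums (case p of (x,y) \<Rightarrow> of_real (mehler e x y) * (f x * cnj (f y)))"
      unfolding eq unfolding p prod.case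
      by (intro sums_mult2 sums_of_real) (use mehler_sums(1)[OF e(1), of x y] in \<open>simp add: z_def\<close>)
    have "summable (\<lambda>n. norm (hf n x * hf n y * z ^ n) * norm (f x * cnj (f y)))"
      by (intro summable_mult2) (use mehler_sums(2)[OF e(1), of x y] in \<open>simp add: z_def\<close>)
    then show "summable (\<lambda>n. norm (F n p))" unfolding eq norm_mult norm_of_real by (simp add: abs_mult)
  qed
  have sm: "summable (\<lambda>n. \<integral>p. norm (F n p) \<partial>(lborel \<Otimes>\<^sub>M lborel))"
    by (rule summable_comparison_test'[of "\<lambda>n. z ^ n * (\<integral>x. (cmod (f x))\<^sup>2 \<partial>lborel)" 0])
       (use Fn z in \<open>auto intro!: summable_mult2 summable_geometric\<close>)
  have AE: "AE p in lborel \<Otimes>\<^sub>M lborel. summable (\<lambda>n. norm (F n p))" using Fsn by simp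
  have Fsum: "(\<lambda>p. \<Sum>n. F n p) = (\<lambda>(x,y). of_real (mehler e x y) * (f x * cnj (f y)))"
    by (rule ext) (rule sums_unique[OF Fs, symmetric])
  have I: "integrable (lborel \<Otimes>\<^sub>M lborel) (\<lambda>(x,y). of_real (mehler e x y) * (f x * cnj (f y)))"
    using integrable_suminf[OF Fi AE sm] unfolding Fsum .
  have "(\<lambda>n. complex_of_real (z ^ n * (cmod (hc f n))\<^sup>2)) sums (\<integral>p. (case p of (x,y) \<Rightarrow> of_real (mehler e x y) * (f x * cnj (f y))) \<partial>(lborel \<Otimes>\<^sub>M lborel))"
    using sums_integral[OF Fi AE sm] unfolding FI Fsum .
  then show ?thesis using lborel_pair.integral_fst'[OF I] by simp
qed

text \<open>As e tends to 0 Mehler's kernel concentrates on the diagonal. Boundedness and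
  integrability of f give the dominating function, continuity almost everywhere the pointwise limit.
  The class covers continuous functions cut off to an interval and the chirped Hermite
  functions.\<close>

lemma parseval:
  fixes f :: "real \<Rightarrow> complex"
  assumes m [measurable]: "f \<in> borel_measurable borel" and b: "\<And>x. cmod (f x) \<le> B"
    and i: "integrable lborel f" and c: "AE x in lborel. isCont f x"
  shows "l2 f" and "(\<lambda>n. (cmod (hc f n))\<^sup>2) sums (\<integral>x. (cmod (f x))\<^sup>2 \<partial>lborel)"
proof -
  have B: "B \<ge> 0" using b[of 0] norm_ge_zero order_trans by blast
  show l2: "l2 f"
    unfolding l2_def
  proof
    show "integrable lborel (\<lambda>x. (cmod (f x))\<^sup>2)"
    proof (rule Bochner_Integration.integrable_bound)
      show "integrable lborel (\<lambda>x. B * cmod (f x))" using i by simp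
      show "AE x in lborel. norm ((cmod (f x))\<^sup>2) \<le> norm (B * cmod (f x))"
        using b B by (auto simp: power2_eq_square mult_right_mono)
    qed simp
  qed simp
  define L where "L = (\<integral>x. (cmod (f x))\<^sup>2 \<partial>lborel)"
  define e where "e k = 1 / (real k + 2)" for k
  define z where "z k = (1 - e k) / (1 + e k)" for k
  have e: "0 < e k" "e k \<le> 1" for k by (auto simp: e_def)
  have e0: "e \<longlonglongrightarrow> 0" unfolding e_def by real_asymp
  have z: "0 \<le> z k" "z k \<le> 1" for k using e[of k] by (auto simp: z_def field_simps)
  have z1: "z \<longlonglongrightarrow> 1" unfolding z_def e_def by real_asymp
  \<comment> \<open>The integrand after y = x + 2 sqrt (e k) r: the singular factor of the kernel
    becomes exp (- r^2), independent of k, and the Jacobian cancels 1 / sqrt (e k).\<close>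
  define K where "K k x r = of_real ((1 + e k) / sqrt pi * exp (- e k * (2 * x + 2 * sqrt (e k) * r)\<^sup>2 / 4 - r\<^sup>2)) * (f x * cnj (f (x + 2 * sqrt (e k) * r)))" for k x r
  have Km [measurable]: "(\<lambda>(x, r). K k x r) \<in> borel_measurable (borel \<Otimes>\<^sub>M borel)" for k
    unfolding K_def by measurable
  have Kb: "cmod (K k x r) \<le> 2 / sqrt pi * B * cmod (f x) * exp (- 1 * r\<^sup>2)" for k x r
  proof -
    have n: "cmod (K k x r) = ((1 + e k) / sqrt pi * exp (- e k * (2 * x + 2 * sqrt (e k) * r)\<^sup>2 / 4 - r\<^sup>2)) * (cmod (f x) * cmod (f (x + 2 * sqrt (e k) * r)))"
      using e[of k] unfolding K_def norm_mult norm_of_real complex_mod_cnj by simp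
    have "(1 + e k) / sqrt pi * exp (- e k * (2 * x + 2 * sqrt (e k) * r)\<^sup>2 / 4 - r\<^sup>2) \<le> 2 / sqrt pi * exp (- 1 * r\<^sup>2)"
      using e[of k] by (intro mult_mono divide_right_mono) auto
    moreover have "cmod (f x) * cmod (f (x + 2 * sqrt (e k) * r)) \<le> cmod (f x) * B"
      by (intro mult_left_mono b) auto
    ultimately have "cmod (K k x r) \<le> (2 / sqrt pi * exp (- 1 * r\<^sup>2)) * (cmod (f x) * B)"
      unfolding n by (rule mult_mono) auto
    then show ?thesis by (simp add: mult_ac)
  qed
  have Ki: "integrable lborel (K k x)" for k x
  proof (rule Bochner_Integration.integrable_bound)
    show "integrable lborel (\<lambda>r::real. 2 / sqrt pi * B * cmod (f x) * exp (- 1 * r\<^sup>2))"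
      by (intro integrable_mult_right gauss_integrable) simp
    show "AE r in lborel. norm (K k x r) \<le> norm (2 / sqrt pi * B * cmod (f x) * exp (- 1 * r\<^sup>2))"
      by (rule AE_I2) (rule order_trans[OF Kb], simp only: real_norm_def abs_ge_self)
  qed measurable
  have form: "(\<lambda>n. complex_of_real (z k ^ n * (cmod (hc f n))\<^sup>2)) sums (\<integral>x. (\<integral>r. K k x r \<partial>lborel) \<partial>lborel)" for k
  proof -
    have "(\<integral>y. of_real (mehler (e k) x y) * (f x * cnj (f y)) \<partial>lborel) = (\<integral>r. K k x r \<partial>lborel)" for x
    proof -
      have s: "sqrt (e k) > 0" using e by simp
      have sq: "sqrt (e k) * sqrt (e k) = e k" using e[of k] by simp
      have "(\<integral>y. of_real (mehler (e k) x y) * (f x * cnj (f y)) \<partial>lborel)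
        = \<bar>2 * sqrt (e k)\<bar> *\<^sub>R (\<integral>r. of_real (mehler (e k) x (x + 2 * sqrt (e k) * r)) * (f x * cnj (f (x + 2 * sqrt (e k) * r))) \<partial>lborel)"
        by (rule lborel_integral_real_affine) (use s in simp)
      also have "\<dots> = (\<integral>r. (2 * sqrt (e k)) *\<^sub>R (of_real (mehler (e k) x (x + 2 * sqrt (e k) * r)) * (f x * cnj (f (x + 2 * sqrt (e k) * r)))) \<partial>lborel)"
        using s by simp
      also have "(\<lambda>r. (2 * sqrt (e k)) *\<^sub>R (of_real (mehler (e k) x (x + 2 * sqrt (e k) * r)) * (f x * cnj (f (x + 2 * sqrt (e k) * r))))) = K k x"
      proof
        fix r
        have "(x - (x + 2 * sqrt (e k) * r))\<^sup>2 / (4 * e k) = r\<^sup>2"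
          using sq e[of k] by (simp add: power2_eq_square field_simps)
        moreover have "x + (x + 2 * sqrt (e k) * r) = 2 * x + 2 * sqrt (e k) * r" by simp
        ultimately have "2 * sqrt (e k) * mehler (e k) x (x + 2 * sqrt (e k) * r) = (1 + e k) / sqrt pi * exp (- e k * (2 * x + 2 * sqrt (e k) * r)\<^sup>2 / 4 - r\<^sup>2)"
          unfolding mehler_def using s by (simp only:) simp
        then show "(2 * sqrt (e k)) *\<^sub>R (of_real (mehler (e k) x (x + 2 * sqrt (e k) * r)) * (f x * cnj (f (x + 2 * sqrt (e k) * r)))) = K k x r"
          unfolding K_def scaleR_conv_of_real mult.assoc[symmetric] of_real_mult[symmetric] by simp
      qed
      finally show ?thesis .
    qed
    then show ?thesis using mehler_form[OF l2 e, of k] unfolding z_def by (simp only:)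
  qed
  have lim_inner: "(\<lambda>k. \<integral>r. K k x r \<partial>lborel) \<longlonglongrightarrow> of_real ((cmod (f x))\<^sup>2)" if x: "isCont f x" for x
  proof -
    have "(\<lambda>k. \<integral>r. K k x r \<partial>lborel) \<longlonglongrightarrow> (\<integral>r. of_real (1 / sqrt pi * exp (- 1 * r\<^sup>2)) * (f x * cnj (f x)) \<partial>lborel)"
    proof (rule integral_dominated_convergence[where w = "\<lambda>r. 2 / sqrt pi * B * cmod (f x) * exp (- 1 * r\<^sup>2)"])
      show "integrable lborel (\<lambda>r::real. 2 / sqrt pi * B * cmod (f x) * exp (- 1 * r\<^sup>2))"
        by (intro integrable_mult_right gauss_integrable) simp
      show "AE r in lborel. (\<lambda>k. K k x r) \<longlonglongrightarrow> of_real (1 / sqrt pi * exp (- 1 * r\<^sup>2)) * (f x * cnj (f x))"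
      proof (rule AE_I2)
        fix r :: real
        have t: "(\<lambda>k. x + 2 * sqrt (e k) * r) \<longlonglongrightarrow> x + 2 * sqrt 0 * r" by (intro tendsto_intros e0)
        have "(\<lambda>k. f (x + 2 * sqrt (e k) * r)) \<longlonglongrightarrow> f x"
          by (rule isCont_tendsto_compose[OF x]) (use t in simp)
        then have "(\<lambda>k. K k x r) \<longlonglongrightarrow> of_real ((1 + 0) / sqrt pi * exp (- 0 * (2 * x + 2 * sqrt 0 * r)\<^sup>2 / 4 - r\<^sup>2)) * (f x * cnj (f x))"
          unfolding K_def by (intro tendsto_intros e0) auto
        then show "(\<lambda>k. K k x r) \<longlonglongrightarrow> of_real (1 / sqrt pi * exp (- 1 * r\<^sup>2)) * (f x * cnj (f x))" by simp
      qed
      show "AE r in lborel. norm (K k x r) \<le> 2 / sqrt pi * B * cmod (f x) * exp (- 1 * r\<^sup>2)" for k using Kb by simp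
    qed measurable
    also have "(\<integral>r. of_real (1 / sqrt pi * exp (- 1 * r\<^sup>2)) * (f x * cnj (f x)) \<partial>lborel) = of_real (\<integral>r. 1 / sqrt pi * exp (- 1 * r\<^sup>2) \<partial>lborel) * (f x * cnj (f x))"
      by (simp only: integral_mult_left_zero integral_complex_of_real)
    also have "(\<integral>r. 1 / sqrt pi * exp (- 1 * r\<^sup>2) \<partial>lborel) = (1::real)"
      using gauss_integral[of 1] by (simp only: integral_mult_right_zero) simp
    finally show ?thesis by (simp add: complex_norm_square[symmetric])
  qed
  have lim: "(\<lambda>k. \<integral>x. (\<integral>r. K k x r \<partial>lborel) \<partial>lborel) \<longlonglongrightarrow> (\<integral>x. complex_of_real ((cmod (f x))\<^sup>2) \<partial>lborel)"
  proof (rule integral_dominated_convergence[where w = "\<lambda>x. 2 * B * cmod (f x)"])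
    show "integrable lborel (\<lambda>x. 2 * B * cmod (f x))" using i by simp
    show "AE x in lborel. (\<lambda>k. \<integral>r. K k x r \<partial>lborel) \<longlonglongrightarrow> complex_of_real ((cmod (f x))\<^sup>2)"
      using c by eventually_elim (rule lim_inner)
    have "cmod (\<integral>r. K k x r \<partial>lborel) \<le> 2 * B * cmod (f x)" for k x
    proof -
      have "cmod (\<integral>r. K k x r \<partial>lborel) \<le> (\<integral>r. 2 / sqrt pi * B * cmod (f x) * exp (- 1 * r\<^sup>2) \<partial>lborel)"
        by (rule order_trans[OF integral_norm_bound integral_mono[OF integrable_norm[OF Ki] _ Kb]])
           (intro integrable_mult_right gauss_integrable, simp)
      also have "\<dots> = 2 * B * cmod (f x)"
        using gauss_integral[of 1] by (simp only: integral_mult_right_zero) simp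
      finally show ?thesis .
    qed
    then show "AE x in lborel. norm (\<integral>r. K k x r \<partial>lborel) \<le> 2 * B * cmod (f x)" for k by simp
  qed measurable
  define T where "T k = (\<Sum>n. z k ^ n * (cmod (hc f n))\<^sup>2)" for k
  have Ts: "(\<lambda>n. z k ^ n * (cmod (hc f n))\<^sup>2) sums T k" and Tk: "complex_of_real (T k) = (\<integral>x. (\<integral>r. K k x r \<partial>lborel) \<partial>lborel)" for k
  proof -
    have "summable (\<lambda>n. z k ^ n * (cmod (hc f n))\<^sup>2)"
      using sums_summable[OF form[of k]] by (simp only: summable_of_real_iff)
    then show s: "(\<lambda>n. z k ^ n * (cmod (hc f n))\<^sup>2) sums T k" unfolding T_def by (rule summable_sums)
    show "complex_of_real (T k) = (\<integral>x. (\<integral>r. K k x r \<partial>lborel) \<partial>lborel)"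
      by (rule sums_unique2[OF sums_of_real[OF s] form])
  qed
  have "(\<lambda>k. complex_of_real (T k)) \<longlonglongrightarrow> complex_of_real L"
    using lim unfolding Tk L_def integral_complex_of_real .
  then have TL: "T \<longlonglongrightarrow> L" by (simp only: tendsto_of_real_iff)
  \<comment> \<open>Bessel bounds the series by L, while the Abel means \<open>T k\<close> lie below
    the series and tend to L; so the series has the value L.\<close>
  have bs: "(\<Sum>n<N. (cmod (hc f n))\<^sup>2) \<le> L" for N unfolding L_def by (rule bessel_l2[OF l2])
  have sm: "summable (\<lambda>n. (cmod (hc f n))\<^sup>2)"
    by (rule summableI_nonneg_bounded[where x = L]) (use bs in auto)
  have "(\<Sum>n. (cmod (hc f n))\<^sup>2) \<le> L" by (rule suminf_le_const[OF sm]) (use bs in auto)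
  moreover have "L \<le> (\<Sum>n. (cmod (hc f n))\<^sup>2)"
  proof (rule LIMSEQ_le_const2[OF TL])
    have "T k \<le> (\<Sum>n. (cmod (hc f n))\<^sup>2)" for k
      by (rule sums_le[OF _ Ts summable_sums[OF sm]]) (use z in \<open>auto intro!: mult_left_le_one_le power_le_one\<close>)
    then show "\<exists>N. \<forall>k\<ge>N. T k \<le> (\<Sum>n. (cmod (hc f n))\<^sup>2)" by blast
  qed
  ultimately have "(\<Sum>n. (cmod (hc f n))\<^sup>2) = L" by simp
  then show "(\<lambda>n. (cmod (hc f n))\<^sup>2) sums (\<integral>x. (cmod (f x))\<^sup>2 \<partial>lborel)"
    using summable_sums[OF sm] by (simp add: L_def)
qed

text \<open>Parseval for f alone suffices: its partial sums converge in L2, and Cauchy-Schwarz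
  handles an arbitrary g. The pairing is bilinear, without conjugation, because the Hermite
  functions are real.\<close>

lemma parseval_inner:
  fixes f g :: "real \<Rightarrow> complex"
  assumes f: "l2 f" "(\<lambda>n. (cmod (hc f n))\<^sup>2) sums (\<integral>x. (cmod (f x))\<^sup>2 \<partial>lborel)" and g: "l2 g"
  shows "(\<lambda>n. hc f n * hc g n) sums (\<integral>x. f x * g x \<partial>lborel)"
proof -
  define p where "p N x = (\<Sum>n<N. hc f n * complex_of_real (hf n x))" for N x
  have pl: "l2 (p N)" for N unfolding p_def[abs_def] by (rule l2_sum_hf)
  have dl: "l2 (\<lambda>x. f x - p N x)" for N using l2_add[OF f(1) l2_scale[OF pl, of "-1"]] by simp
  have pg: "(\<integral>x. p N x * g x \<partial>lborel) = (\<Sum>n<N. hc f n * hc g n)" for N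
    unfolding p_def sum_distrib_right mult.assoc hc_def[of g] using hc_integrable[OF g]
    by (simp add: Bochner_Integration.integral_sum)
  define G where "G = (\<integral>x. (cmod (g x))\<^sup>2 \<partial>lborel)"
  define L where "L = (\<integral>x. (cmod (f x))\<^sup>2 \<partial>lborel)"
  have bound: "(cmod ((\<integral>x. f x * g x \<partial>lborel) - (\<Sum>n<N. hc f n * hc g n)))\<^sup>2 \<le> (L - (\<Sum>n<N. (cmod (hc f n))\<^sup>2)) * G" for N
  proof -
    have "(\<integral>x. f x * g x \<partial>lborel) - (\<Sum>n<N. hc f n * hc g n) = (\<integral>x. (f x - p N x) * g x \<partial>lborel)"
      unfolding pg[symmetric] left_diff_distrib
      by (rule Bochner_Integration.integral_diff[symmetric]) (intro l2_mult_integrable f g pl)+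
    then show ?thesis
      using l2_Cauchy_Schwarz(2)[OF dl g, of N] bessel_norm[OF f(1), of N] by (simp add: p_def L_def G_def)
  qed
  have "(\<lambda>N. (L - (\<Sum>n<N. (cmod (hc f n))\<^sup>2)) * G) \<longlonglongrightarrow> (L - L) * G"
    using f(2) unfolding sums_def L_def by (intro tendsto_intros)
  then have lim0: "(\<lambda>N. sqrt ((L - (\<Sum>n<N. (cmod (hc f n))\<^sup>2)) * G)) \<longlonglongrightarrow> 0"
    using tendsto_real_sqrt by fastforce
  have "(\<lambda>N. (\<integral>x. f x * g x \<partial>lborel) - (\<Sum>n<N. hc f n * hc g n)) \<longlonglongrightarrow> 0"
  proof (rule Lim_null_comparison[OF _ lim0])
    show "\<forall>\<^sub>F N in sequentially. cmod ((\<integral>x. f x * g x \<partial>lborel) - (\<Sum>n<N. hc f n * hc g n)) \<le> sqrt ((L - (\<Sum>n<N. (cmod (hc f n))\<^sup>2)) * G)"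
      by (intro always_eventually allI real_le_rsqrt bound)
  qed
  from tendsto_diff[OF tendsto_const this, of "\<integral>x. f x * g x \<partial>lborel"] show ?thesis unfolding sums_def by simp
qed

section \<open>Overlaps of chirped Hermite functions\<close>

lemma cis_measurable [measurable]: "cis \<in> borel_measurable borel"
  by (intro borel_measurable_continuous_onI continuous_intros)

definition Umat :: "real \<Rightarrow> nat \<Rightarrow> nat \<Rightarrow> complex" where
  "Umat d n m = (\<integral>x. of_real (hf n x) * (cis (- d * x\<^sup>2) * of_real (hf m x)) \<partial>lborel)"

definition uf :: "real \<Rightarrow> nat \<Rightarrow> real \<Rightarrow> complex" where
  "uf d m x = cis (- d * x\<^sup>2) * of_real (hf m x)"

lemma Umat_hc: "Umat d n m = hc (uf d m) n"
  by (simp add: Umat_def hc_def uf_def)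

text \<open>Real Hermite functions make the matrix symmetric rather than Hermitian, so column bounds
  are row bounds as well.\<close>

lemma Umat_sym: "Umat d n m = Umat d m n"
  by (simp add: Umat_def mult_ac)

lemma uf_measurable [measurable]: "uf d m \<in> borel_measurable borel"
  unfolding uf_def[abs_def] by measurable

lemma cmod_uf: "cmod (uf d m x) = \<bar>hf m x\<bar>" by (simp add: uf_def norm_mult)

lemma uf_l2: "l2 (uf d m)"
  using l2_bounded_mult[OF hf_l2c[of m], of "\<lambda>x. cis (- d * x\<^sup>2)" 1] by (simp add: uf_def[abs_def])

lemma uf_norm: "(\<integral>x. (cmod (uf d m x))\<^sup>2 \<partial>lborel) = 1"
  using hf_norm[of m] by (simp add: cmod_uf power2_eq_square)

lemma Umat_bessel: "(\<Sum>n<N. (cmod (Umat d n m))\<^sup>2) \<le> 1"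
  using bessel_l2[OF uf_l2[of d m]] by (simp add: Umat_hc uf_norm)

lemma Umat_summable: "summable (\<lambda>n. (cmod (Umat d n m))\<^sup>2)" "(\<Sum>n. (cmod (Umat d n m))\<^sup>2) \<le> 1"
proof -
  show s: "summable (\<lambda>n. (cmod (Umat d n m))\<^sup>2)"
    by (rule summableI_nonneg_bounded[where x = 1]) (use Umat_bessel in auto)
  show "(\<Sum>n. (cmod (Umat d n m))\<^sup>2) \<le> 1" by (rule suminf_le_const[OF s Umat_bessel])
qed

text \<open>The characteristic function of the standard normal distribution, rescaled by sqrt (2
  a).\<close>

lemma gauss_fourier:
  fixes a b :: real
  assumes a: "a > 0"
  shows "(\<integral>s. of_real (exp (- a * s\<^sup>2)) * cis (b * s) \<partial>lborel) = complex_of_real (sqrt (pi / a) * exp (- b\<^sup>2 / (4 * a)))"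
proof -
  define q where "q = sqrt (2 * a)"
  have q: "q > 0" "q\<^sup>2 = 2 * a" using a by (auto simp: q_def)
  have "char std_normal_distribution t = (\<integral>x. std_normal_density x *\<^sub>R iexp (t * x) \<partial>lborel)" for t
    unfolding char_def by (rule integral_density) (auto intro!: AE_I2)
  then have "(\<integral>x. std_normal_density x *\<^sub>R iexp (b / q * x) \<partial>lborel) = complex_of_real (exp (- ((b / q)\<^sup>2) / 2))"
    unfolding char_std_normal_distribution by metis
  also have "(\<integral>x. std_normal_density x *\<^sub>R iexp (b / q * x) \<partial>lborel) = \<bar>q\<bar> *\<^sub>R (\<integral>s. std_normal_density (0 + q * s) *\<^sub>R iexp (b / q * (0 + q * s)) \<partial>lborel)"
    by (rule lborel_integral_real_affine) (use q in simp)
  also have "(\<lambda>s. std_normal_density (0 + q * s) *\<^sub>R iexp (b / q * (0 + q * s))) = (\<lambda>s. complex_of_real (1 / sqrt (2 * pi)) * (of_real (exp (- a * s\<^sup>2)) * cis (b * s)))"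
  proof
    fix s
    have "- (q * s)\<^sup>2 / 2 = - a * s\<^sup>2" using q by (simp add: power_mult_distrib)
    then show "std_normal_density (0 + q * s) *\<^sub>R iexp (b / q * (0 + q * s)) = complex_of_real (1 / sqrt (2 * pi)) * (of_real (exp (- a * s\<^sup>2)) * cis (b * s))"
      unfolding std_normal_density_def using q(1) by (simp add: cis_conv_exp scaleR_conv_of_real)
  qed
  finally have eq: "complex_of_real (q / sqrt (2 * pi)) * (\<integral>s. of_real (exp (- a * s\<^sup>2)) * cis (b * s) \<partial>lborel) = complex_of_real (exp (- ((b / q)\<^sup>2) / 2))"
    using q(1) by (simp add: scaleR_conv_of_real)
  have "complex_of_real (sqrt (2 * pi) / q) * complex_of_real (q / sqrt (2 * pi)) = 1"
    using q(1) unfolding of_real_mult[symmetric] by simp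
  then have "(\<integral>s. of_real (exp (- a * s\<^sup>2)) * cis (b * s) \<partial>lborel) = complex_of_real (sqrt (2 * pi) / q) * complex_of_real (exp (- ((b / q)\<^sup>2) / 2))"
    unfolding eq[symmetric] mult.assoc[symmetric] by simp
  moreover have "sqrt (2 * pi) / q = sqrt (pi / a)" unfolding q_def using a by (simp add: real_sqrt_divide[symmetric])
  moreover have "- ((b / q)\<^sup>2) / 2 = - b\<^sup>2 / (4 * a)" using q by (simp add: power_divide)
  ultimately show ?thesis by simp
qed

text \<open>For e \<le> 1 the term with (x - y)^2 / e may be weakened to e (x - y)^2, and then the
  exponent splits into a sum of squares of x and y. The resulting product of Gaussians is the
  majorant for interchanging sum and integral.\<close>

lemma mehler_le:
  assumes e: "0 < e" "e \<le> 1"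
  shows "mehler e x y \<le> (1 + e) / (2 * sqrt pi * sqrt e) * (exp (- (e / 2) * x\<^sup>2) * exp (- (e / 2) * y\<^sup>2))"
proof -
  have "e * (x - y)\<^sup>2 / 4 \<le> (x - y)\<^sup>2 / (4 * e)"
  proof -
    have "e * e \<le> 1" using e by (simp add: mult_le_one)
    then have "e * e * (x - y)\<^sup>2 \<le> 1 * (x - y)\<^sup>2" by (rule mult_right_mono) simp
    then show ?thesis using e by (simp add: field_simps)
  qed
  moreover have "e * (x + y)\<^sup>2 / 4 + e * (x - y)\<^sup>2 / 4 = e / 2 * x\<^sup>2 + e / 2 * y\<^sup>2"
    by (simp add: power2_eq_square field_simps)
  ultimately have "- e * (x + y)\<^sup>2 / 4 - (x - y)\<^sup>2 / (4 * e) \<le> - (e / 2) * x\<^sup>2 + - (e / 2) * y\<^sup>2"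
    by simp
  then have "exp (- e * (x + y)\<^sup>2 / 4 - (x - y)\<^sup>2 / (4 * e)) \<le> exp (- (e / 2) * x\<^sup>2) * exp (- (e / 2) * y\<^sup>2)"
    unfolding exp_add[symmetric] by simp
  then show ?thesis unfolding mehler_def using e by (intro mult_left_mono) auto
qed

lemma mehler_measurable [measurable]: "(\<lambda>(x,y). mehler e x y) \<in> borel_measurable (borel \<Otimes>\<^sub>M borel)"
  unfolding mehler_def by measurable

text \<open>In the coordinates \<open>x + y\<close>, \<open>x - y\<close> the integrand becomes a product of Gaussians times \<open>cis\<close>.\<close>

lemma mehler_overlap_integral:
  fixes d e e' :: real
  assumes e: "0 < e" "0 < e'"
  shows "(\<integral>x. (\<integral>y. of_real (mehler e x y * mehler e' x y) * cis (- d * (x\<^sup>2 - y\<^sup>2)) \<partial>lborel) \<partial>lborel)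
     = complex_of_real ((1 + e) * (1 + e') / (2 * sqrt ((e + e')\<^sup>2 + 4 * d\<^sup>2 * e * e')))"
proof -
  \<comment> \<open>A and B are the coefficients of (x + y)^2 and (x - y)^2 in the product of the
    two kernels. With v = x - y one has x + y = 2 x - v and x^2 - y^2 = v (2 x - v), which is how
    \<open>F\<close> is written.\<close>
  define A where "A = (e + e') / 4"
  define B where "B = (1 / e + 1 / e') / 4"
  define C where "C = (1 + e) / (2 * sqrt pi * sqrt e) * ((1 + e') / (2 * sqrt pi * sqrt e'))"
  have AB: "A > 0" "B > 0" using e by (auto simp: A_def B_def add_pos_pos)
  define F where "F v x = of_real (C * (exp (- B * v\<^sup>2) * exp (- A * (2 * x - v)\<^sup>2))) * cis (- d * (v * (2 * x - v)))" for v x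
  have FF: "of_real (mehler e x (x + (-1) * v) * mehler e' x (x + (-1) * v)) * cis (- d * (x\<^sup>2 - (x + (-1) * v)\<^sup>2)) = F v x" for x v
  proof -
    have xv: "x + (x + (-1) * v) = 2 * x - v" "x - (x + (-1) * v) = v" by auto
    have "mehler e x (x + (-1) * v) * mehler e' x (x + (-1) * v)
      = C * exp ((- e * (2 * x - v)\<^sup>2 / 4 - v\<^sup>2 / (4 * e)) + (- e' * (2 * x - v)\<^sup>2 / 4 - v\<^sup>2 / (4 * e')))"
      unfolding mehler_def xv exp_add C_def by (simp only: mult_ac)
    also have "(- e * (2 * x - v)\<^sup>2 / 4 - v\<^sup>2 / (4 * e)) + (- e' * (2 * x - v)\<^sup>2 / 4 - v\<^sup>2 / (4 * e')) = - B * v\<^sup>2 + - A * (2 * x - v)\<^sup>2"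
      using e by (simp add: A_def B_def field_simps)
    finally have m: "mehler e x (x + (-1) * v) * mehler e' x (x + (-1) * v) = C * (exp (- B * v\<^sup>2) * exp (- A * (2 * x - v)\<^sup>2))"
      unfolding exp_add .
    have "x\<^sup>2 - (x + (-1) * v)\<^sup>2 = v * (2 * x - v)" by (simp add: power2_eq_square algebra_simps)
    then show ?thesis unfolding F_def m by simp
  qed
  have Fm [measurable]: "(\<lambda>(v, x). F v x) \<in> borel_measurable (borel \<Otimes>\<^sub>M borel)"
    unfolding F_def by measurable
  have Fn: "norm (F v x) = \<bar>C\<bar> * exp (- B * v\<^sup>2) * exp (- A * (2 * x - v)\<^sup>2)" for v x
    unfolding F_def norm_mult norm_cis norm_of_real abs_mult by simp
  have gx: "integrable lborel (\<lambda>x. exp (- A * (2 * x - v)\<^sup>2))" for v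
    using lborel_integrable_real_affine[OF gauss_integrable[OF AB(1)], of 2 "- v"] by (simp add: add.commute)
  have gxi: "(\<integral>x. exp (- A * (2 * x - v)\<^sup>2) \<partial>lborel) = sqrt (pi / A) / 2" for v
    using lborel_integral_real_affine[of 2 "\<lambda>x. exp (- A * x\<^sup>2)" "- v"] gauss_integral[OF AB(1)] by (simp add: add.commute)
  have Fi: "integrable (lborel \<Otimes>\<^sub>M lborel) (\<lambda>(v, x). F v x)"
  proof (rule lborel_pair.Fubini_integrable)
    have eq: "(\<integral>x. norm (case (v, x) of (v, x) \<Rightarrow> F v x) \<partial>lborel) = \<bar>C\<bar> * (sqrt (pi / A) / 2) * exp (- B * v\<^sup>2)" for v
      unfolding prod.case Fn integral_mult_right_zero gxi by simp
    show "integrable lborel (\<lambda>v. \<integral>x. norm (case (v, x) of (v, x) \<Rightarrow> F v x) \<partial>lborel)"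
      unfolding eq by (intro integrable_mult_right gauss_integrable AB)
    have "integrable lborel (F v)" for v
    proof (rule integrable_norm_cancel)
      show "integrable lborel (\<lambda>x. norm (F v x))" unfolding Fn by (intro integrable_mult_right gx)
    qed measurable
    then show "AE v in lborel. integrable lborel (\<lambda>x. case (v, x) of (v, x) \<Rightarrow> F v x)" by simp
  qed simp
  have "(\<integral>y. of_real (mehler e x y * mehler e' x y) * cis (- d * (x\<^sup>2 - y\<^sup>2)) \<partial>lborel) = (\<integral>v. F v x \<partial>lborel)" for x
    by (subst lborel_integral_real_affine[of "-1" _ x]) (simp_all only: FF, simp_all)
  then have "(\<integral>x. (\<integral>y. of_real (mehler e x y * mehler e' x y) * cis (- d * (x\<^sup>2 - y\<^sup>2)) \<partial>lborel) \<partial>lborel) = (\<integral>x. (\<integral>v. F v x \<partial>lborel) \<partial>lborel)"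
    by (simp only:)
  also have "\<dots> = (\<integral>v. (\<integral>x. F v x \<partial>lborel) \<partial>lborel)"
    by (rule lborel_pair.Fubini_integral[OF Fi])
  \<comment> \<open>The integral over x is the Fourier transform of a Gaussian at - d v; it
    contributes d^2 / (4 A) to the exponent of the remaining Gaussian in v.\<close>
  also have "\<dots> = (\<integral>v. of_real (C / 2 * sqrt (pi / A)) * of_real (exp (- (B + d\<^sup>2 / (4 * A)) * v\<^sup>2)) \<partial>lborel)"
  proof (rule Bochner_Integration.integral_cong[OF refl])
    fix v
    have "(\<integral>x. F v x \<partial>lborel) = \<bar>1/2\<bar> *\<^sub>R (\<integral>s. F v (v / 2 + 1/2 * s) \<partial>lborel)"
      by (rule lborel_integral_real_affine) simp
    also have "(\<lambda>s. F v (v / 2 + 1/2 * s)) = (\<lambda>s. of_real (C * exp (- B * v\<^sup>2)) * (of_real (exp (- A * s\<^sup>2)) * cis ((- d * v) * s)))"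
    proof
      fix s
      have "2 * (v / 2 + 1/2 * s) - v = s" by simp
      then show "F v (v / 2 + 1/2 * s) = of_real (C * exp (- B * v\<^sup>2)) * (of_real (exp (- A * s\<^sup>2)) * cis ((- d * v) * s))"
        unfolding F_def by (simp add: mult.assoc)
    qed
    also have "(\<integral>s. of_real (C * exp (- B * v\<^sup>2)) * (of_real (exp (- A * s\<^sup>2)) * cis ((- d * v) * s)) \<partial>lborel)
      = of_real (C * exp (- B * v\<^sup>2)) * of_real (sqrt (pi / A) * exp (- (- d * v)\<^sup>2 / (4 * A)))"
      by (simp only: integral_mult_right_zero gauss_fourier[OF AB(1)])
    also have "\<bar>1/2::real\<bar> *\<^sub>R \<dots> = of_real (C / 2 * sqrt (pi / A)) * of_real (exp (- B * v\<^sup>2 + - (- d * v)\<^sup>2 / (4 * A)))"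
      unfolding exp_add by (simp add: scaleR_conv_of_real)
    also have "- B * v\<^sup>2 + - (- d * v)\<^sup>2 / (4 * A) = - (B + d\<^sup>2 / (4 * A)) * v\<^sup>2"
      by (simp add: power_mult_distrib algebra_simps)
    finally show "(\<integral>x. F v x \<partial>lborel) = of_real (C / 2 * sqrt (pi / A)) * of_real (exp (- (B + d\<^sup>2 / (4 * A)) * v\<^sup>2))" .
  qed
  also have "\<dots> = of_real (C / 2 * sqrt (pi / A) * sqrt (pi / (B + d\<^sup>2 / (4 * A))))"
  proof -
    have p: "B + d\<^sup>2 / (4 * A) > 0" using AB by (intro add_pos_nonneg) auto
    show ?thesis by (simp only: integral_mult_right_zero integral_complex_of_real gauss_integral[OF p] of_real_mult)
  qed
  also have "C / 2 * sqrt (pi / A) * sqrt (pi / (B + d\<^sup>2 / (4 * A))) = (1 + e) * (1 + e') / (2 * sqrt ((e + e')\<^sup>2 + 4 * d\<^sup>2 * e * e'))"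
  proof -
    have ABd: "A * (B + d\<^sup>2 / (4 * A)) = ((e + e')\<^sup>2 + 4 * d\<^sup>2 * e * e') / (16 * (e * e'))"
    proof -
      have "A * (B + d\<^sup>2 / (4 * A)) = A * B + d\<^sup>2 / 4" using AB by (simp add: field_simps)
      also have "\<dots> = ((e + e')\<^sup>2 + 4 * d\<^sup>2 * e * e') / (16 * (e * e'))"
        unfolding A_def B_def using e by (simp add: field_simps power2_eq_square)
      finally show ?thesis .
    qed
    have "sqrt (pi / A) * sqrt (pi / (B + d\<^sup>2 / (4 * A))) = sqrt (pi\<^sup>2 / (A * (B + d\<^sup>2 / (4 * A))))"
      by (simp add: real_sqrt_mult[symmetric] power2_eq_square)
    also have "\<dots> = pi * (4 * sqrt (e * e')) / sqrt ((e + e')\<^sup>2 + 4 * d\<^sup>2 * e * e')"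
      unfolding ABd by (simp add: real_sqrt_divide real_sqrt_mult)
    finally have s: "sqrt (pi / A) * sqrt (pi / (B + d\<^sup>2 / (4 * A))) = pi * (4 * sqrt (e * e')) / sqrt ((e + e')\<^sup>2 + 4 * d\<^sup>2 * e * e')" .
    have C: "C = (1 + e) * (1 + e') / (4 * pi * sqrt (e * e'))"
      unfolding C_def by (simp add: real_sqrt_mult)
    have q: "sqrt (e * e') > 0" using e by simp
    have "a / (4 * pi * q) / 2 * (pi * (4 * q) / r) = a / (2 * r)" if "q > 0" for a q r
      using that by simp
    from this[OF q] show ?thesis unfolding mult.assoc s C by (simp only: mult.assoc)
  qed
  finally show ?thesis .
qed

text \<open>Mehler is used twice. The sum over n is \<open>mehler_form\<close> for the chirped
  \<open>hf m\<close>; the integrand still contains \<open>hf m x * hf m y\<close>, so the sum over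
  m produces a second Mehler kernel and leaves the Gaussian integral above.\<close>

lemma Umat_generating:
  fixes d e e' :: real
  assumes e: "0 < e" "e \<le> 1" "0 < e'" "e' \<le> 1"
  defines "z \<equiv> (1 - e) / (1 + e)" and "w \<equiv> (1 - e') / (1 + e')"
  shows "summable (\<lambda>n. z ^ n * (cmod (Umat d n m))\<^sup>2)"
    and "(\<lambda>m. w ^ m * (\<Sum>n. z ^ n * (cmod (Umat d n m))\<^sup>2)) sums ((1 + e) * (1 + e') / (2 * sqrt ((e + e')\<^sup>2 + 4 * d\<^sup>2 * e * e')))"
proof -
  have w: "0 \<le> w" "w < 1" using e by (auto simp: w_def field_simps)
  have form: "(\<lambda>n. complex_of_real (z ^ n * (cmod (Umat d n m))\<^sup>2)) sums (\<integral>x. (\<integral>y. of_real (mehler e x y) * (uf d m x * cnj (uf d m y)) \<partial>lborel) \<partial>lborel)" for m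
    using mehler_form[OF uf_l2[of d m] e(1,2)] unfolding z_def Umat_hc .
  show sz: "summable (\<lambda>n. z ^ n * (cmod (Umat d n m))\<^sup>2)" for m
    using sums_summable[OF form[of m]] by (simp only: summable_of_real_iff)
  define g where "g m = (\<Sum>n. z ^ n * (cmod (Umat d n m))\<^sup>2)" for m
  have g: "complex_of_real (g m) = (\<integral>x. (\<integral>y. of_real (mehler e x y) * (uf d m x * cnj (uf d m y)) \<partial>lborel) \<partial>lborel)" for m
    unfolding g_def by (rule sums_unique2[OF sums_of_real[OF summable_sums[OF sz]] form])
  define F where "F m = (\<lambda>(x,y). of_real (w ^ m) * (of_real (mehler e x y) * (uf d m x * cnj (uf d m y))))" for m
  define C where "C = (1 + e) / (2 * sqrt pi * sqrt e)"
  have C: "C \<ge> 0" using e by (simp add: C_def)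
  define W where "W = (\<lambda>(x,y). exp (- (e / 2) * x\<^sup>2) * exp (- (e / 2) * y\<^sup>2))"
  have Wi: "integrable (lborel \<Otimes>\<^sub>M lborel) W"
  proof -
    have "integrable (lborel \<Otimes>\<^sub>M lborel) (\<lambda>(x,y). complex_of_real (exp (- (e / 2) * x\<^sup>2)) * complex_of_real (exp (- (e / 2) * y\<^sup>2)))"
      by (intro pair_integrable_mult(1) integrable_of_real gauss_integrable) (use e in auto)
    then have "integrable (lborel \<Otimes>\<^sub>M lborel) (\<lambda>p. complex_of_real (W p))"
      by (simp add: W_def case_prod_unfold)
    from integrable_Re[OF this] show ?thesis by simp
  qed
  have Fb: "norm (F m p) \<le> (real m + 3) ^ 3 * w ^ m * (C * W p)" for m p
  proof -
    obtain x y where p: "p = (x, y)" by force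
    have "\<bar>1 * hf m x * hf m y\<bar> \<le> (real m + 3) ^ 3" by (rule hf_prod_le) auto
    then have 1: "\<bar>hf m x\<bar> * \<bar>hf m y\<bar> \<le> (real m + 3) ^ 3" by (simp add: abs_mult)
    have 2: "mehler e x y \<le> C * W p" using mehler_le[OF e(1,2), of x y] by (simp add: C_def W_def p)
    have "norm (F m p) = w ^ m * (mehler e x y * (\<bar>hf m x\<bar> * \<bar>hf m y\<bar>))"
      using w mehler_pos[OF e(1), of x y] unfolding F_def p prod.case norm_mult norm_of_real complex_mod_cnj cmod_uf by simp
    also have "\<dots> \<le> w ^ m * (C * W p * (real m + 3) ^ 3)"
      using w mehler_pos[OF e(1), of x y] 1 2 by (intro mult_left_mono mult_mono) auto
    finally show ?thesis by (simp add: mult_ac)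
  qed
  have Fm [measurable]: "F m \<in> borel_measurable (lborel \<Otimes>\<^sub>M lborel)" for m
    unfolding F_def by measurable
  have Wp: "W p \<ge> 0" for p by (simp add: W_def split: prod.split)
  have Fi: "integrable (lborel \<Otimes>\<^sub>M lborel) (F m)" for m
  proof (rule Bochner_Integration.integrable_bound)
    show "integrable (lborel \<Otimes>\<^sub>M lborel) (\<lambda>p. (real m + 3) ^ 3 * w ^ m * (C * W p))"
      by (intro integrable_mult_right Wi)
    show "AE p in lborel \<Otimes>\<^sub>M lborel. norm (F m p) \<le> norm ((real m + 3) ^ 3 * w ^ m * (C * W p))"
      by (rule AE_I2) (rule order_trans[OF Fb], simp only: real_norm_def abs_ge_self)
  qed measurable
  have sw: "summable (\<lambda>m. (real m + 3) ^ 3 * w ^ m)"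
    by (rule summable_poly_geometric) (use w in auto)
  have FI: "integral\<^sup>L (lborel \<Otimes>\<^sub>M lborel) (F m) = complex_of_real (w ^ m * g m)" for m
  proof -
    have "integral\<^sup>L (lborel \<Otimes>\<^sub>M lborel) (F m) = (\<integral>x. (\<integral>y. F m (x, y) \<partial>lborel) \<partial>lborel)"
      using lborel_pair.integral_fst'[OF Fi] by simp
    also have "\<dots> = of_real (w ^ m) * of_real (g m)" unfolding F_def prod.case integral_mult_right_zero g ..
    finally show ?thesis by simp
  qed
  have AE: "AE p in lborel \<Otimes>\<^sub>M lborel. summable (\<lambda>m. norm (F m p))"
  proof (rule AE_I2)
    fix p
    show "summable (\<lambda>m. norm (F m p))"
      by (rule summable_comparison_test'[OF summable_mult2[OF sw, of "C * W p"], of 0]) (use Fb in auto)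
  qed
  have sm: "summable (\<lambda>m. \<integral>p. norm (F m p) \<partial>(lborel \<Otimes>\<^sub>M lborel))"
  proof (rule summable_comparison_test'[of "\<lambda>m. (real m + 3) ^ 3 * w ^ m * (\<integral>p. C * W p \<partial>(lborel \<Otimes>\<^sub>M lborel))" 0])
    show "summable (\<lambda>m. (real m + 3) ^ 3 * w ^ m * (\<integral>p. C * W p \<partial>(lborel \<Otimes>\<^sub>M lborel)))" by (rule summable_mult2[OF sw])
    fix m
    have "(\<integral>p. norm (F m p) \<partial>(lborel \<Otimes>\<^sub>M lborel)) \<le> (\<integral>p. (real m + 3) ^ 3 * w ^ m * (C * W p) \<partial>(lborel \<Otimes>\<^sub>M lborel))"
      by (rule integral_mono[OF integrable_norm[OF Fi] _ Fb]) (intro integrable_mult_right Wi)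
    then show "norm (\<integral>p. norm (F m p) \<partial>(lborel \<Otimes>\<^sub>M lborel)) \<le> (real m + 3) ^ 3 * w ^ m * (\<integral>p. C * W p \<partial>(lborel \<Otimes>\<^sub>M lborel))"
      by (simp only: integral_mult_right_zero real_norm_def) (simp add: abs_of_nonneg)
  qed
  define Ft where "Ft = (\<lambda>(x,y). of_real (mehler e x y * mehler e' x y) * cis (- d * (x\<^sup>2 - y\<^sup>2)))"
  have Fsum: "(\<lambda>p. \<Sum>m. F m p) = Ft"
  proof
    fix p :: "real \<times> real"
    obtain x y where p: "p = (x, y)" by force
    have c: "cis (- d * x\<^sup>2) * cnj (cis (- d * y\<^sup>2)) = cis (- d * (x\<^sup>2 - y\<^sup>2))"
      by (simp add: cis_cnj cis_mult algebra_simps)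
    have "F m p = of_real (hf m x * hf m y * w ^ m) * (of_real (mehler e x y) * (cis (- d * x\<^sup>2) * cnj (cis (- d * y\<^sup>2))))" for m
      unfolding F_def p prod.case uf_def complex_cnj_mult complex_cnj_complex_of_real of_real_mult by (simp only: mult_ac)
    moreover have "(\<lambda>m. complex_of_real (hf m x * hf m y * w ^ m) * (of_real (mehler e x y) * (cis (- d * x\<^sup>2) * cnj (cis (- d * y\<^sup>2)))))
       sums (of_real (mehler e' x y) * (of_real (mehler e x y) * (cis (- d * x\<^sup>2) * cnj (cis (- d * y\<^sup>2)))))"
      unfolding w_def by (intro sums_mult2 sums_of_real mehler_sums(1) e)
    ultimately have "(\<lambda>m. F m p) sums (of_real (mehler e' x y) * (of_real (mehler e x y) * cis (- d * (x\<^sup>2 - y\<^sup>2))))"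
      unfolding c by (simp only:)
    from sums_unique[OF this] show "(\<Sum>m. F m p) = Ft p" by (simp add: Ft_def p mult_ac)
  qed
  have Fti: "integrable (lborel \<Otimes>\<^sub>M lborel) Ft" using integrable_suminf[OF Fi AE sm] unfolding Fsum .
  have "(\<lambda>m. complex_of_real (w ^ m * g m)) sums integral\<^sup>L (lborel \<Otimes>\<^sub>M lborel) Ft"
    using sums_integral[OF Fi AE sm] unfolding FI Fsum .
  also have "integral\<^sup>L (lborel \<Otimes>\<^sub>M lborel) Ft = (\<integral>x. (\<integral>y. Ft (x, y) \<partial>lborel) \<partial>lborel)"
    using lborel_pair.integral_fst'[OF Fti] by simp
  also have "\<dots> = complex_of_real ((1 + e) * (1 + e') / (2 * sqrt ((e + e')\<^sup>2 + 4 * d\<^sup>2 * e * e')))"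
    unfolding Ft_def prod.case by (rule mehler_overlap_integral[OF e(1,3)])
  finally show "(\<lambda>m. w ^ m * (\<Sum>n. z ^ n * (cmod (Umat d n m))\<^sup>2)) sums ((1 + e) * (1 + e') / (2 * sqrt ((e + e')\<^sup>2 + 4 * d\<^sup>2 * e * e')))"
    unfolding g_def[symmetric] by (simp only: sums_of_real_iff)
qed

text \<open>With e = tanh (s/2) the generating variable is exp (- s), and the half in n + 1/2
  supplies exp (- s/2), which combines with 1 + tanh (s/2) to 1 / cosh (s/2).\<close>

lemma Umat_heat:
  fixes s t d :: real
  assumes s: "s > 0" and t: "t > 0"
  shows "(\<Sum>m. \<Sum>n. ennreal (exp (- (real n + 1/2) * s) * exp (- (real m + 1/2) * t) * (cmod (Umat d n m))\<^sup>2))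
     = ennreal (1 / (2 * sqrt ((sinh ((s + t) / 2))\<^sup>2 + d\<^sup>2 * sinh s * sinh t)))"
proof -
  have th: "0 < tanh (r / 2)" "tanh (r / 2) \<le> 1" "(1 - tanh (r / 2)) / (1 + tanh (r / 2)) = exp (- r)"
     "(1 + tanh (r / 2)) * exp (- r / 2) = 1 / cosh (r / 2)" if "r > 0" for r :: real
  proof -
    have c: "cosh (r/2) > 0" by simp
    show "0 < tanh (r / 2)" "tanh (r / 2) \<le> 1" using that tanh_real_lt_1[of "r/2"] by (auto simp: less_imp_le)
    have p: "cosh (r/2) + sinh (r/2) = exp (r/2)" "cosh (r/2) - sinh (r/2) = exp (- (r/2))"
      by (simp_all add: cosh_plus_sinh cosh_minus_sinh)
    have q: "1 - tanh (r/2) = exp (- (r/2)) / cosh (r/2)" "1 + tanh (r/2) = exp (r/2) / cosh (r/2)"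
      using c unfolding p[symmetric] tanh_def by (simp_all add: field_simps)
    have "exp (- (r/2)) / exp (r/2) = exp (- r)" by (simp add: exp_diff[symmetric])
    then show "(1 - tanh (r / 2)) / (1 + tanh (r / 2)) = exp (- r)" unfolding q using c by simp
    have "exp (r/2) * exp (- r/2) = 1" by (simp add: exp_add[symmetric])
    then show "(1 + tanh (r / 2)) * exp (- r / 2) = 1 / cosh (r / 2)" unfolding q times_divide_eq_left by simp
  qed
  note S = th[OF s] and T = th[OF t]
  define z where "z = exp (- s)" define w where "w = exp (- t)"
  have pw: "exp (- (real n + 1/2) * r) = exp (- r / 2) * exp (- r) ^ n" for n r
    by (simp add: exp_of_nat_mult[symmetric] exp_add[symmetric] algebra_simps)
  define g where "g m = (\<Sum>n. z ^ n * (cmod (Umat d n m))\<^sup>2)" for m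
  have sg: "summable (\<lambda>n. z ^ n * (cmod (Umat d n m))\<^sup>2)" for m
    using Umat_generating(1)[OF S(1,2) T(1,2)] unfolding S(3) z_def .
  have g0: "g m \<ge> 0" for m unfolding g_def by (rule suminf_nonneg[OF sg]) (simp add: z_def)
  have G: "(\<lambda>m. w ^ m * g m) sums ((1 + tanh (s/2)) * (1 + tanh (t/2)) / (2 * sqrt ((tanh (s/2) + tanh (t/2))\<^sup>2 + 4 * d\<^sup>2 * tanh (s/2) * tanh (t/2))))"
    using Umat_generating(2)[OF S(1,2) T(1,2)] unfolding S(3) T(3) z_def w_def g_def .
  have "(\<Sum>n. ennreal (exp (- (real n + 1/2) * s) * exp (- (real m + 1/2) * t) * (cmod (Umat d n m))\<^sup>2)) = ennreal (exp (- s / 2) * exp (- t / 2) * (w ^ m * g m))" for m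
  proof -
    have "(\<lambda>n. exp (- s / 2) * exp (- t / 2) * w ^ m * (z ^ n * (cmod (Umat d n m))\<^sup>2)) sums (exp (- s / 2) * exp (- t / 2) * w ^ m * g m)"
      unfolding g_def by (intro sums_mult summable_sums sg)
    then have "(\<lambda>n. exp (- (real n + 1/2) * s) * exp (- (real m + 1/2) * t) * (cmod (Umat d n m))\<^sup>2) sums (exp (- s / 2) * exp (- t / 2) * (w ^ m * g m))"
      unfolding pw z_def w_def by (simp only: mult_ac)
    then show ?thesis by (intro suminf_ennreal_eq) auto
  qed
  moreover have "(\<Sum>m. ennreal (exp (- s / 2) * exp (- t / 2) * (w ^ m * g m))) = ennreal (exp (- s / 2) * exp (- t / 2) *
      ((1 + tanh (s/2)) * (1 + tanh (t/2)) / (2 * sqrt ((tanh (s/2) + tanh (t/2))\<^sup>2 + 4 * d\<^sup>2 * tanh (s/2) * tanh (t/2)))))"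
    by (intro suminf_ennreal_eq sums_mult G) (auto simp: w_def g0)
  moreover have "exp (- s / 2) * exp (- t / 2) * ((1 + tanh (s/2)) * (1 + tanh (t/2)) / (2 * sqrt ((tanh (s/2) + tanh (t/2))\<^sup>2 + 4 * d\<^sup>2 * tanh (s/2) * tanh (t/2))))
     = 1 / (2 * sqrt ((sinh ((s + t) / 2))\<^sup>2 + d\<^sup>2 * sinh s * sinh t))"
  proof -
    \<comment> \<open>Multiplying the radicand by the squares of both hyperbolic cosines turns
      tangents into sines, by the addition and doubling formulas, and uses up the cosines left by
      \<open>th\<close>.\<close>
    define a b where "a = cosh (s/2)" and "b = cosh (t/2)"
    have ab: "a > 0" "b > 0" by (auto simp: a_def b_def)
    define X where "X = (tanh (s/2) + tanh (t/2))\<^sup>2 + 4 * d\<^sup>2 * tanh (s/2) * tanh (t/2)"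
    have ts: "tanh (s/2) * a = sinh (s/2)" "tanh (t/2) * b = sinh (t/2)" using ab by (auto simp: tanh_def a_def b_def)
    have "(a * b)\<^sup>2 * X = ((tanh (s/2) * a) * b + a * (tanh (t/2) * b))\<^sup>2 + d\<^sup>2 * (2 * (tanh (s/2) * a) * a) * (2 * (tanh (t/2) * b) * b)"
      by (simp add: X_def power2_eq_square algebra_simps)
    also have "\<dots> = (sinh ((s + t) / 2))\<^sup>2 + d\<^sup>2 * sinh s * sinh t"
    proof -
      have "sinh ((s + t) / 2) = sinh (s/2) * b + a * sinh (t/2)" "sinh s = 2 * sinh (s/2) * a" "sinh t = 2 * sinh (t/2) * b"
        using sinh_add[of "s/2" "t/2"] sinh_double[of "s/2"] sinh_double[of "t/2"] by (simp_all add: a_def b_def add_divide_distrib)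
      then show ?thesis unfolding ts by simp
    qed
    finally have "sqrt ((sinh ((s + t) / 2))\<^sup>2 + d\<^sup>2 * sinh s * sinh t) = (a * b) * sqrt X"
    proof -
      assume *: "(a * b)\<^sup>2 * X = (sinh ((s + t) / 2))\<^sup>2 + d\<^sup>2 * sinh s * sinh t"
      show ?thesis unfolding *[symmetric] real_sqrt_mult using ab by simp
    qed
    moreover have "exp (- s / 2) * exp (- t / 2) * ((1 + tanh (s/2)) * (1 + tanh (t/2)) / (2 * sqrt X)) = ((1 + tanh (s/2)) * exp (- s / 2)) * ((1 + tanh (t/2)) * exp (- t / 2)) / (2 * sqrt X)"
      by simp
    ultimately show ?thesis unfolding S(4) T(4) X_def[symmetric] by (simp add: a_def b_def)
  qed
  ultimately show ?thesis by simp
qed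

section \<open>The weighted overlap sum as a double integral and its power series\<close>

lemma sinh_measurable [measurable]: "(sinh :: real \<Rightarrow> real) \<in> borel_measurable borel"
  by (intro borel_measurable_continuous_onI continuous_intros)

lemma ennreal_mult3:
  "0 \<le> a \<Longrightarrow> 0 \<le> b \<Longrightarrow> 0 \<le> c \<Longrightarrow> ennreal a * ennreal b * ennreal c = ennreal (a * b * c)"
  by (simp add: ennreal_mult)

text \<open>The substitution s = p + q, t = p - q as a composition of one-dimensional affine ones:
  two translations in a single variable and a dilation by 2, which is the Jacobian.\<close>

lemma nn_integral_rotate:
  fixes F :: "real \<Rightarrow> real \<Rightarrow> ennreal"
  assumes [measurable]: "(\<lambda>(s,t). F s t) \<in> borel_measurable (borel \<Otimes>\<^sub>M borel)"
  shows "(\<integral>\<^sup>+s. \<integral>\<^sup>+t. F s t \<partial>lborel \<partial>lborel) = 2 * (\<integral>\<^sup>+p. \<integral>\<^sup>+q. F (p + q) (p - q) \<partial>lborel \<partial>lborel)"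
proof -
  have Fs [measurable]: "F s \<in> borel_measurable borel" for s
    using measurable_compose[OF measurable_Pair1'[of s borel borel] assms] by simp
  have "(\<integral>\<^sup>+s. \<integral>\<^sup>+t. F s t \<partial>lborel \<partial>lborel) = (\<integral>\<^sup>+s. \<integral>\<^sup>+p. F s (- s + 1 * p) \<partial>lborel \<partial>lborel)"
  proof (rule nn_integral_cong)
    fix s
    show "(\<integral>\<^sup>+t. F s t \<partial>lborel) = (\<integral>\<^sup>+p. F s (- s + 1 * p) \<partial>lborel)"
      using nn_integral_real_affine[OF Fs[of s], of 1 "- s"] by simp
  qed
  also have "\<dots> = (\<integral>\<^sup>+p. \<integral>\<^sup>+s. F s (- s + 1 * p) \<partial>lborel \<partial>lborel)"
    by (rule lborel_pair.Fubini'[symmetric]) measurable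
  also have "\<dots> = \<bar>2\<bar> * (\<integral>\<^sup>+p. \<integral>\<^sup>+s. F s (- s + 1 * (0 + 2 * p)) \<partial>lborel \<partial>lborel)"
    by (subst nn_integral_real_affine[of _ 2 0]) (simp_all, measurable)
  also have "(\<integral>\<^sup>+p. \<integral>\<^sup>+s. F s (- s + 1 * (0 + 2 * p)) \<partial>lborel \<partial>lborel) = (\<integral>\<^sup>+p. \<integral>\<^sup>+q. F (p + 1 * q) (- (p + 1 * q) + 1 * (0 + 2 * p)) \<partial>lborel \<partial>lborel)"
  proof (rule nn_integral_cong)
    fix p :: real
    have [measurable]: "(\<lambda>s. F s (- s + 1 * (0 + 2 * p))) \<in> borel_measurable borel" by measurable
    show "(\<integral>\<^sup>+s. F s (- s + 1 * (0 + 2 * p)) \<partial>lborel) = (\<integral>\<^sup>+q. F (p + 1 * q) (- (p + 1 * q) + 1 * (0 + 2 * p)) \<partial>lborel)"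
      by (subst nn_integral_real_affine[of _ 1 p]) simp_all
  qed
  finally show ?thesis by (simp add: algebra_simps)
qed

lemma ennreal_suminf_swap:
  fixes f :: "nat \<Rightarrow> nat \<Rightarrow> ennreal"
  shows "(\<Sum>m. \<Sum>n. f n m) = (\<Sum>n. \<Sum>m. f n m)"
  unfolding nn_integral_count_space_nat[symmetric, of "\<lambda>n. f n _"] nn_integral_count_space_nat[symmetric, of "\<lambda>n. suminf (f n)"]
  by (rule nn_integral_suminf[symmetric]) simp

lemma bcoef_le_1: "bcoef k \<le> 1"
  unfolding bcoef_def by (rule pochhammer_le_fact) auto

lemma bcoef_sums:
  assumes "0 \<le> x" "x < (1::real)"
  shows "(\<lambda>k. bcoef k * x ^ k) sums (1 / sqrt (1 - x))"
proof -
  have "(\<lambda>k. ((- (1/2)) gchoose k) * (- x) ^ k) sums (1 + - x) powr (- (1/2))"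
    by (rule gen_binomial_real) (use assms in auto)
  then have "(\<lambda>k. bcoef k * x ^ k) sums (1 + - x) powr (- (1/2))"
    unfolding gchoose_uminus_power bcoef_def .
  moreover have "(1 + - x) powr (- (1/2)) = 1 / sqrt (1 - x)"
    using assms by (simp add: powr_minus powr_half_sqrt divide_simps)
  ultimately show ?thesis by simp
qed

lemma Mint_nonneg: "Mint k \<ge> 0"
  unfolding Mint_def set_lebesgue_integral_def
  by (rule Bochner_Integration.integral_nonneg) (auto simp: indicator_def gint_nonneg)

lemma Zodd_nonneg: "Zodd \<ge> 0"
  unfolding Zodd_def by (rule suminf_nonneg[OF summable_Zodd]) auto

text \<open>In \<open>Mint_closed_form\<close> a nonnegative sum is subtracted from
  \<open>Zodd\<close> and \<open>bcoef\<close> is at most 1. Hence the coefficients are bounded and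
  the power series converges for t < 1.\<close>

lemma Mint_coeff_bounds: "0 \<le> 2 * bcoef k * Mint k" "2 * bcoef k * Mint k \<le> Zodd"
proof -
  show "0 \<le> 2 * bcoef k * Mint k" using Mint_nonneg[of k] bcoef_pos[of k] by simp
  have "0 \<le> (\<Sum>j<k. 1 / ((2 * real j + 1) ^ 3 * (bcoef j)\<^sup>2))" by (intro sum_nonneg) auto
  then have "bcoef k ^ 3 * (Zodd - 2 * (\<Sum>j<k. 1 / ((2 * real j + 1) ^ 3 * (bcoef j)\<^sup>2))) \<le> bcoef k ^ 3 * Zodd"
    using bcoef_pos[of k] by (intro mult_left_mono) auto
  also have "\<dots> \<le> 1 * Zodd"
    using bcoef_pos[of k] bcoef_le_1[of k] Zodd_nonneg by (intro mult_right_mono power_le_one) auto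
  finally show "2 * bcoef k * Mint k \<le> Zodd" unfolding Mint_closed_form by simp
qed

lemma Mint_series_summable:
  assumes "0 \<le> t" "t < (1::real)" shows "summable (\<lambda>k. 2 * bcoef k * Mint k * t ^ k)"
proof (rule summable_comparison_test'[of "\<lambda>k. Zodd * t ^ k" 0])
  show "summable (\<lambda>k. Zodd * t ^ k)" using assms by (intro summable_mult summable_geometric) simp
  show "norm (2 * bcoef k * Mint k * t ^ k) \<le> Zodd * t ^ k" for k
  proof -
    have "0 \<le> 2 * bcoef k * Mint k * t ^ k"
      using Mint_nonneg[of k] bcoef_pos[of k] assms by (intro mult_nonneg_nonneg) auto
    moreover have "2 * bcoef k * Mint k * t ^ k \<le> Zodd * t ^ k"
      using Mint_coeff_bounds[of k] assms by (intro mult_right_mono) auto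
    ultimately show ?thesis by simp
  qed
qed

lemma nn_integral_gint: "(\<integral>\<^sup>+x. ennreal (gint k x) * indicator {0<..} x \<partial>lborel) = ennreal (Mint k)"
proof -
  have "(\<integral>\<^sup>+x. ennreal (gint k x) * indicator {0<..} x \<partial>lborel) = (\<integral>\<^sup>+x. ennreal (indicator {0<..} x *\<^sub>R gint k x) \<partial>lborel)"
    by (rule nn_integral_cong) (auto simp: indicator_def)
  also have "\<dots> = ennreal (\<integral>x. indicator {0<..} x *\<^sub>R gint k x \<partial>lborel)"
    by (rule nn_integral_eq_integral) (use gint_integrable in \<open>auto simp: set_integrable_def indicator_def gint_nonneg\<close>)
  finally show ?thesis by (simp add: Mint_def set_lebesgue_integral_def)
qed

lemma nn_integral_sinh_power:
  assumes p: "p > 0"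
  shows "(\<integral>\<^sup>+q. ennreal (sinh q ^ (2 * k)) * indicator {-p<..<p} q \<partial>lborel) = ennreal (2 * Wint k p)"
proof -
  have "((\<lambda>q. sinh (- q) ^ (2 * k)) has_integral Wint k p) {- p..- 0}"
    by (subst has_integral_reflect_real) (rule Wint_has_integral)
  then have "((\<lambda>q. sinh q ^ (2 * k)) has_integral Wint k p) {- p..0}" by simp
  from has_integral_combine[OF _ _ this Wint_has_integral[of k p]] p
  have "((\<lambda>q. sinh q ^ (2 * k)) has_integral (Wint k p + Wint k p)) {- p..p}" by simp
  then have "((\<lambda>q. if q \<in> {- p..p} then sinh q ^ (2 * k) else 0) has_integral (Wint k p + Wint k p)) UNIV"
    by (simp only: has_integral_restrict_UNIV)
  also have "(\<lambda>q. if q \<in> {- p..p} then sinh q ^ (2 * k) else 0) = (\<lambda>q. indicator {-p..p} q * sinh q ^ (2 * k))"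
    by (auto simp: indicator_def)
  finally have "(\<integral>\<^sup>+q. ennreal (indicator {-p..p} q * sinh q ^ (2 * k)) \<partial>lborel) = ennreal (Wint k p + Wint k p)"
    by (intro nn_integral_has_integral_lborel) (auto intro!: borel_measurable_times borel_measurable_power)
  moreover have "(\<integral>\<^sup>+q. ennreal (sinh q ^ (2 * k)) * indicator {-p<..<p} q \<partial>lborel) = (\<integral>\<^sup>+q. ennreal (indicator {-p..p} q * sinh q ^ (2 * k)) \<partial>lborel)"
  proof (rule nn_integral_cong_AE)
    show "AE q in lborel. ennreal (sinh q ^ (2 * k)) * indicator {-p<..<p} q = ennreal (indicator {-p..p} q * sinh q ^ (2 * k))"
      using AE_lborel_singleton[of p] AE_lborel_singleton[of "- p"]
      by eventually_elim (auto simp: indicator_def)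
  qed
  ultimately show ?thesis by simp
qed

text \<open>The whole computation stays in \<open>ennreal\<close>, so that sums and integrals may be
  exchanged freely; finiteness is read off from the resulting series. The value of d is what makes
  the radicand factor after the rotation.\<close>

lemma That_eq:
  assumes t: "0 < t" "t < (1::real)"
  defines "d \<equiv> sqrt (t / (1 - t))"
  shows "(\<Sum>m. \<Sum>n. ennreal (1 / ((real n + 1/2)\<^sup>2 * (real m + 1/2)) * (cmod (Umat d n m))\<^sup>2))
     = ennreal (sqrt (1 - t) * (\<Sum>k. 2 * bcoef k * Mint k * t ^ k))" (is "?L = _")
proof -
  define P where "P n m = (cmod (Umat d n m))\<^sup>2" for n m
  have Psym: "P n m = P m n" for n m by (simp add: P_def Umat_sym)
  have Pnn: "P n m \<ge> 0" for n m by (simp add: P_def)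
  define E where "E n m s r = ennreal (exp (- (real n + 1/2) * s) * exp (- (real m + 1/2) * r) * P n m)" for n m s r
  define I where "I = (indicator {0<..} :: real \<Rightarrow> ennreal)"
  define H where "H s r = (\<Sum>m. \<Sum>n. E n m s r)" for s r
  have Im [measurable]: "I \<in> borel_measurable borel" unfolding I_def by measurable
  have Em [measurable]: "(\<lambda>(s,r). E n m s r) \<in> borel_measurable (borel \<Otimes>\<^sub>M borel)" for n m
    unfolding E_def by measurable
  \<comment> \<open>The powers of 1 / (n + 1/2) and 1 / (m + 1/2) as Laplace integrals: exponents i,
    j of s, r give the powers i + 1 and j + 1.\<close>
  have int: "(\<integral>\<^sup>+s. \<integral>\<^sup>+r. ennreal (s ^ i * r ^ j) * (I s * I r) * E n m s r \<partial>lborel \<partial>lborel)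
     = ennreal (fact i / (real n + 1/2) ^ (i + 1) * (fact j / (real m + 1/2) ^ (j + 1)) * P n m)" for i j n m
  proof -
    have "ennreal (s ^ i * r ^ j) * (I s * I r) * E n m s r = (ennreal (P n m) * (ennreal (s ^ i * exp (- (real n + 1/2) * s)) * I s)) * (ennreal (r ^ j * exp (- (real m + 1/2) * r)) * I r)" for s r
      unfolding E_def I_def using Pnn[of n m]
      by (auto simp: indicator_def ennreal_mult[symmetric] mult_ac)
    then have "(\<integral>\<^sup>+s. \<integral>\<^sup>+r. ennreal (s ^ i * r ^ j) * (I s * I r) * E n m s r \<partial>lborel \<partial>lborel)
       = (\<integral>\<^sup>+s. (ennreal (P n m) * (ennreal (s ^ i * exp (- (real n + 1/2) * s)) * I s)) * (\<integral>\<^sup>+r. ennreal (r ^ j * exp (- (real m + 1/2) * r)) * I r \<partial>lborel) \<partial>lborel)"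
      by (simp add: nn_integral_cmult)
    also have "\<dots> = (ennreal (P n m) * (\<integral>\<^sup>+s. ennreal (s ^ i * exp (- (real n + 1/2) * s)) * I s \<partial>lborel)) * (\<integral>\<^sup>+r. ennreal (r ^ j * exp (- (real m + 1/2) * r)) * I r \<partial>lborel)"
      by (simp add: nn_integral_cmult nn_integral_multc)
    also have "\<dots> = ennreal (P n m) * ennreal (fact i / (real n + 1/2) ^ (i + 1)) * ennreal (fact j / (real m + 1/2) ^ (j + 1))"
      unfolding I_def by (simp only: nn_integral_power_exp[of "real n + 1/2"] nn_integral_power_exp[of "real m + 1/2"] add_nonneg_pos of_nat_0_le_iff zero_less_divide_1_iff zero_less_numeral)
    also have "\<dots> = ennreal (fact i / (real n + 1/2) ^ (i + 1) * (fact j / (real m + 1/2) ^ (j + 1)) * P n m)"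
      using Pnn[of n m] by (subst ennreal_mult3) (auto simp: mult_ac)
    finally show ?thesis .
  qed
  have dsum: "(\<integral>\<^sup>+s. \<integral>\<^sup>+r. ennreal (s ^ i * r ^ j) * (I s * I r) * H s r \<partial>lborel \<partial>lborel)
     = (\<Sum>m. \<Sum>n. ennreal (fact i / (real n + 1/2) ^ (i + 1) * (fact j / (real m + 1/2) ^ (j + 1)) * P n m))" for i j
  proof -
    have eq: "ennreal (s ^ i * r ^ j) * (I s * I r) * H s r = (\<Sum>m. \<Sum>n. ennreal (s ^ i * r ^ j) * (I s * I r) * E n m s r)" for s r
      unfolding H_def by (simp only: ennreal_suminf_cmult)
    show ?thesis unfolding int[symmetric] eq by (simp add: nn_integral_suminf del: ennreal_suminf_cmult)
  qed
  have L1: "?L = (\<integral>\<^sup>+s. \<integral>\<^sup>+r. ennreal (s ^ 1 * r ^ 0) * (I s * I r) * H s r \<partial>lborel \<partial>lborel)"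
    unfolding dsum by (simp add: P_def power2_eq_square)
  have "?L = (\<Sum>n. \<Sum>m. ennreal (1 / ((real n + 1/2)\<^sup>2 * (real m + 1/2)) * P n m))"
    unfolding P_def by (rule ennreal_suminf_swap)
  also have "\<dots> = (\<integral>\<^sup>+s. \<integral>\<^sup>+r. ennreal (s ^ 0 * r ^ 1) * (I s * I r) * H s r \<partial>lborel \<partial>lborel)"
    unfolding dsum by (simp add: Psym power2_eq_square mult_ac)
  finally have L2: "?L = (\<integral>\<^sup>+s. \<integral>\<^sup>+r. ennreal (s ^ 0 * r ^ 1) * (I s * I r) * H s r \<partial>lborel \<partial>lborel)" .
  have Hm [measurable]: "(\<lambda>(s,r). H s r) \<in> borel_measurable (borel \<Otimes>\<^sub>M borel)" unfolding H_def by measurable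
  \<comment> \<open>Symmetry of P lets the extra power sit on either index, that is, the factor s or
    the factor r in the integral. Adding both versions gives s + r, which is 2 p after the
    rotation.\<close>
  have "2 * ?L = ?L + ?L" by (rule mult_2)
  also have "\<dots> = (\<integral>\<^sup>+s. \<integral>\<^sup>+r. ennreal (s ^ 1 * r ^ 0) * (I s * I r) * H s r \<partial>lborel \<partial>lborel)
     + (\<integral>\<^sup>+s. \<integral>\<^sup>+r. ennreal (s ^ 0 * r ^ 1) * (I s * I r) * H s r \<partial>lborel \<partial>lborel)"
    by (rule arg_cong2[OF L1 L2])
  also have "\<dots> = (\<integral>\<^sup>+s. \<integral>\<^sup>+r. ennreal (s ^ 1 * r ^ 0) * (I s * I r) * H s r + ennreal (s ^ 0 * r ^ 1) * (I s * I r) * H s r \<partial>lborel \<partial>lborel)"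
    by (simp add: nn_integral_add)
  also have "\<dots> = (\<integral>\<^sup>+s. \<integral>\<^sup>+r. ennreal (s + r) * (I s * I r) * H s r \<partial>lborel \<partial>lborel)"
  proof (intro nn_integral_cong)
    fix s r :: real
    show "ennreal (s ^ 1 * r ^ 0) * (I s * I r) * H s r + ennreal (s ^ 0 * r ^ 1) * (I s * I r) * H s r = ennreal (s + r) * (I s * I r) * H s r"
      unfolding I_def by (auto simp: indicator_def ennreal_plus distrib_right simp del: ennreal_plus[symmetric])
  qed
  also have "\<dots> = 2 * (\<integral>\<^sup>+p. \<integral>\<^sup>+q. ennreal ((p + q) + (p - q)) * (I (p + q) * I (p - q)) * H (p + q) (p - q) \<partial>lborel \<partial>lborel)"
    by (rule nn_integral_rotate) measurable
  finally have "?L = (\<integral>\<^sup>+p. \<integral>\<^sup>+q. ennreal ((p + q) + (p - q)) * (I (p + q) * I (p - q)) * H (p + q) (p - q) \<partial>lborel \<partial>lborel)"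
    by (simp add: ennreal_mult_cancel_left)
  also have "\<dots> = (\<integral>\<^sup>+p. \<integral>\<^sup>+q. (\<Sum>k. ennreal (sqrt (1 - t) * bcoef k * t ^ k) * (ennreal (p / sinh p ^ (2 * k + 1)) * I p) * (ennreal (sinh q ^ (2 * k)) * indicator {-p<..<p} q)) \<partial>lborel \<partial>lborel)"
  proof (intro nn_integral_cong)
    fix p q :: real
    show "ennreal ((p + q) + (p - q)) * (I (p + q) * I (p - q)) * H (p + q) (p - q)
      = (\<Sum>k. ennreal (sqrt (1 - t) * bcoef k * t ^ k) * (ennreal (p / sinh p ^ (2 * k + 1)) * I p) * (ennreal (sinh q ^ (2 * k)) * indicator {-p<..<p} q))"
    proof (cases "- p < q \<and> q < p")
      \<comment> \<open>The quadrant s, r > 0 is the cone - p < q < p; outside of it both sides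
        vanish.\<close>
      case False
      then have "I (p + q) * I (p - q) = 0" "indicator {-p<..<p} q = (0::ennreal)" by (auto simp: I_def indicator_def)
      then show ?thesis by simp
    next
      case True
      then have pq: "p + q > 0" "p - q > 0" "p > 0" by auto
      have S: "sinh p > 0" using pq by simp
      have d2: "d\<^sup>2 = t / (1 - t)" using t by (simp add: d_def)
      \<comment> \<open>The variable of the binomial series: sinh (p + q) sinh (p - q) = sinh^2 p -
        sinh^2 q together with d^2 = t / (1 - t) makes the radicand sinh^2 p (1 - x) / (1 -
        t).\<close>
      define x where "x = t * (sinh q / sinh p)\<^sup>2"
      have q1: "(sinh q / sinh p)\<^sup>2 \<le> 1"
      proof -
        have "\<bar>sinh q\<bar> \<le> sinh p" using True by (auto simp: abs_le_iff simp flip: sinh_minus)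
        then show ?thesis using S by (simp add: power_divide abs_le_square_iff[symmetric])
      qed
      have x: "0 \<le> x" "x < 1"
      proof -
        show "0 \<le> x" using t by (simp add: x_def)
        have "x \<le> t * 1" unfolding x_def using t q1 by (intro mult_left_mono) auto
        then show "x < 1" using t by simp
      qed
      have "sinh (p + q) * sinh (p - q) = (sinh p)\<^sup>2 - (sinh q)\<^sup>2"
      proof -
        have "sinh (p + q) * sinh (p - q) = (sinh p)\<^sup>2 * (cosh q)\<^sup>2 - (cosh p)\<^sup>2 * (sinh q)\<^sup>2"
          by (simp add: sinh_add sinh_diff power2_eq_square algebra_simps)
        then show ?thesis unfolding cosh_square_eq by (simp add: algebra_simps)
      qed
      moreover have "A + t / (1 - t) * (A - B) = A * (1 - t * (B / A)) / (1 - t)" if "A > 0" for A B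
        using that t by (simp add: field_simps)
      ultimately have "(sinh p)\<^sup>2 + d\<^sup>2 * sinh (p + q) * sinh (p - q) = (sinh p)\<^sup>2 * (1 - x) / (1 - t)"
        unfolding d2 x_def mult.assoc power_divide using S by simp
      then have sq: "sqrt ((sinh p)\<^sup>2 + d\<^sup>2 * sinh (p + q) * sinh (p - q)) = sinh p * sqrt (1 - x) / sqrt (1 - t)"
        using S by (simp add: real_sqrt_divide real_sqrt_mult)
      have "H (p + q) (p - q) = ennreal (1 / (2 * (sinh p * sqrt (1 - x) / sqrt (1 - t))))"
        unfolding H_def E_def P_def Umat_heat[OF pq(1,2)] sq[symmetric] by simp
      then have "ennreal ((p + q) + (p - q)) * (I (p + q) * I (p - q)) * H (p + q) (p - q) = ennreal (2 * p * (1 / (2 * (sinh p * sqrt (1 - x) / sqrt (1 - t)))))"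
        using pq S x t by (simp add: I_def ennreal_mult[symmetric])
      also have "2 * p * (1 / (2 * (sinh p * sqrt (1 - x) / sqrt (1 - t)))) = sqrt (1 - t) * p / sinh p * (1 / sqrt (1 - x))"
        by simp
      also have "ennreal \<dots> = (\<Sum>k. ennreal (sqrt (1 - t) * p / sinh p * (bcoef k * x ^ k)))"
      proof (rule suminf_ennreal_eq[symmetric])
        show "0 \<le> sqrt (1 - t) * p / sinh p * (bcoef k * x ^ k)" for k
          using t pq S x bcoef_pos[of k] by (intro mult_nonneg_nonneg divide_nonneg_nonneg) auto
      qed (intro sums_mult bcoef_sums x)
      also have "\<dots> = (\<Sum>k. ennreal (sqrt (1 - t) * bcoef k * t ^ k) * (ennreal (p / sinh p ^ (2 * k + 1)) * I p) * (ennreal (sinh q ^ (2 * k)) * indicator {-p<..<p} q))"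
      proof (rule arg_cong[where f = suminf], rule ext)
        fix k
        have "sqrt (1 - t) * p / sinh p * (bcoef k * x ^ k) = (sqrt (1 - t) * bcoef k * t ^ k) * (p / sinh p ^ (2 * k + 1)) * sinh q ^ (2 * k)"
          unfolding x_def power_mult_distrib power_divide by (simp add: power_mult)
        then show "ennreal (sqrt (1 - t) * p / sinh p * (bcoef k * x ^ k)) = ennreal (sqrt (1 - t) * bcoef k * t ^ k) * (ennreal (p / sinh p ^ (2 * k + 1)) * I p) * (ennreal (sinh q ^ (2 * k)) * indicator {-p<..<p} q)"
        proof -
          have "ennreal (sqrt (1 - t) * bcoef k * t ^ k) * ennreal (p / sinh p ^ (2 * k + 1)) * ennreal (sinh q ^ (2 * k))
            = ennreal ((sqrt (1 - t) * bcoef k * t ^ k) * (p / sinh p ^ (2 * k + 1)) * sinh q ^ (2 * k))"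
            by (rule ennreal_mult3) (use pq S t bcoef_pos[of k] in auto)
          moreover assume "sqrt (1 - t) * p / sinh p * (bcoef k * x ^ k) = (sqrt (1 - t) * bcoef k * t ^ k) * (p / sinh p ^ (2 * k + 1)) * sinh q ^ (2 * k)"
          ultimately show ?thesis using True pq by (simp add: I_def)
        qed
      qed
      finally show ?thesis .
    qed
  qed
  also have "\<dots> = (\<integral>\<^sup>+p. (\<Sum>k. ennreal (sqrt (1 - t) * bcoef k * t ^ k) * (ennreal (p / sinh p ^ (2 * k + 1)) * I p) * (\<integral>\<^sup>+q. ennreal (sinh q ^ (2 * k)) * indicator {-p<..<p} q \<partial>lborel)) \<partial>lborel)"
    by (simp add: nn_integral_suminf nn_integral_cmult)
  also have "\<dots> = (\<integral>\<^sup>+p. (\<Sum>k. ennreal (sqrt (1 - t) * bcoef k * t ^ k) * (2 * (ennreal (gint k p) * indicator {0<..} p))) \<partial>lborel)"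
  proof (intro nn_integral_cong arg_cong[where f = suminf] ext)
    fix p k
    show "ennreal (sqrt (1 - t) * bcoef k * t ^ k) * (ennreal (p / sinh p ^ (2 * k + 1)) * I p) * (\<integral>\<^sup>+q. ennreal (sinh q ^ (2 * k)) * indicator {-p<..<p} q \<partial>lborel)
      = ennreal (sqrt (1 - t) * bcoef k * t ^ k) * (2 * (ennreal (gint k p) * indicator {0<..} p))"
    proof (cases "p > 0")
      case True
      have "ennreal (p / sinh p ^ (2 * k + 1)) * ennreal (2 * Wint k p) = 2 * ennreal (gint k p)"
        using True Wint_nonneg[of k p] unfolding gint_def
        by (subst ennreal_mult[symmetric]) (auto simp: ennreal_mult'[symmetric] ennreal_numeral[symmetric] mult_ac simp del: ennreal_numeral)
      then show ?thesis unfolding nn_integral_sinh_power[OF True] using True by (simp add: I_def mult.assoc)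
    qed (simp add: I_def)
  qed
  also have "\<dots> = (\<Sum>k. ennreal (sqrt (1 - t) * bcoef k * t ^ k) * (2 * (\<integral>\<^sup>+p. ennreal (gint k p) * indicator {0<..} p \<partial>lborel)))"
  proof -
    have [measurable]: "(\<lambda>p. ennreal (gint k p) * indicator {0<..} p) \<in> borel_measurable borel" for k
    proof -
      have "(\<lambda>p. ennreal (indicator {0<..} p *\<^sub>R gint k p)) \<in> borel_measurable borel"
        using gint_integrable[of k] unfolding set_integrable_def by (intro measurable_compose[OF borel_measurable_integrable[of lborel, simplified] measurable_ennreal])
      also have "(\<lambda>p. ennreal (indicator {0<..} p *\<^sub>R gint k p)) = (\<lambda>p. ennreal (gint k p) * indicator {0<..} p)"
        by (auto simp: indicator_def)
      finally show ?thesis .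
    qed
    show ?thesis by (simp add: nn_integral_suminf nn_integral_cmult)
  qed
  also have "\<dots> = (\<Sum>k. ennreal (sqrt (1 - t) * (2 * bcoef k * Mint k * t ^ k)))"
  proof (intro arg_cong[where f = suminf] ext)
    fix k
    show "ennreal (sqrt (1 - t) * bcoef k * t ^ k) * (2 * (\<integral>\<^sup>+p. ennreal (gint k p) * indicator {0<..} p \<partial>lborel)) = ennreal (sqrt (1 - t) * (2 * bcoef k * Mint k * t ^ k))"
    proof -
      have "2 * ennreal (Mint k) = ennreal (2 * Mint k)" using Mint_nonneg[of k] by (subst ennreal_mult) auto
      moreover have "ennreal (sqrt (1 - t) * bcoef k * t ^ k) * ennreal (2 * Mint k) = ennreal (sqrt (1 - t) * bcoef k * t ^ k * (2 * Mint k))"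
        using t bcoef_pos[of k] Mint_nonneg[of k] by (intro ennreal_mult[symmetric]) auto
      ultimately show ?thesis unfolding nn_integral_gint by (simp add: mult_ac)
    qed
  qed
  also have "\<dots> = ennreal (sqrt (1 - t) * (\<Sum>k. 2 * bcoef k * Mint k * t ^ k))"
  proof (rule suminf_ennreal_eq)
    show "0 \<le> sqrt (1 - t) * (2 * bcoef k * Mint k * t ^ k)" for k
      using t bcoef_pos[of k] Mint_nonneg[of k] by auto
    show "(\<lambda>k. sqrt (1 - t) * (2 * bcoef k * Mint k * t ^ k)) sums (sqrt (1 - t) * (\<Sum>k. 2 * bcoef k * Mint k * t ^ k))"
      by (intro sums_mult summable_sums Mint_series_summable) (use t in auto)
  qed
  finally show ?thesis .
qed

section \<open>The domain of the harmonic oscillator\<close>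

text \<open>A continuous function cut off to an interval is bounded, integrable and continuous away
  from the two end points, so \<open>parseval\<close> covers it.\<close>

lemma test_function_parseval:
  fixes p :: "real \<Rightarrow> complex" and a b :: real
  assumes p: "continuous_on UNIV p"
  defines "f \<equiv> \<lambda>x. indicator {a..b} x *\<^sub>R p x"
  shows "l2 f" and "(\<lambda>n. (cmod (hc f n))\<^sup>2) sums (\<integral>x. (cmod (f x))\<^sup>2 \<partial>lborel)"
proof -
  have "compact (p ` {a..b})"
    by (rule compact_continuous_image[OF continuous_on_subset[OF p]]) auto
  then obtain B where B: "\<And>x. x \<in> {a..b} \<Longrightarrow> cmod (p x) \<le> B"
    using compact_imp_bounded[of "p ` {a..b}"] unfolding bounded_iff by blast
  have bd: "cmod (f x) \<le> max B 0" for x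
    using B[of x] by (auto simp: f_def indicator_def)
  have m: "f \<in> borel_measurable borel"
    unfolding f_def by (intro borel_measurable_continuous_on_indicator continuous_on_subset[OF p]) auto
  have i: "integrable lborel f"
    using borel_integrable_atLeastAtMost'[OF continuous_on_subset[OF p subset_UNIV], of a b]
    unfolding set_integrable_def f_def .
  have c: "AE x in lborel. isCont f x"
    using AE_lborel_singleton[of a] AE_lborel_singleton[of b]
  proof eventually_elim
    case (elim x)
    have px: "isCont p x" using p by (simp add: continuous_on_eq_continuous_at)
    consider "x < a \<or> x > b" | "a < x" "x < b" using elim by fastforce
    then show ?case
    proof cases
      case 1
      have "open (- {a..b})" by (simp add: open_Compl)
      then have "\<forall>\<^sub>F y in nhds x. y \<in> - {a..b}" using 1 by (intro eventually_nhds_in_open) auto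
      then have "\<forall>\<^sub>F y in nhds x. f y = 0" by eventually_elim (auto simp: f_def)
      then show ?thesis using isCont_cong[of f "\<lambda>_. 0" x] by simp
    next
      case 2
      have "\<forall>\<^sub>F y in nhds x. y \<in> {a<..<b}" using 2 by (intro eventually_nhds_in_open) auto
      then have "\<forall>\<^sub>F y in nhds x. f y = p y" by eventually_elim (auto simp: f_def)
      then show ?thesis using isCont_cong[of f p x] px by simp
    qed
  qed
  show "l2 f" and "(\<lambda>n. (cmod (hc f n))\<^sup>2) sums (\<integral>x. (cmod (f x))\<^sup>2 \<partial>lborel)"
    using parseval[OF m bd i c] by auto
qed

text \<open>Completeness in the form used from here on: the Hermite partial sums of any g in L2
  converge to g when tested on intervals against continuous functions. Parseval is applied to the
  test function, not to g.\<close>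

lemma test_function_pairing:
  fixes p g :: "real \<Rightarrow> complex"
  assumes p: "continuous_on UNIV p" and g: "l2 g"
  shows "(\<lambda>N. \<integral>x. indicator {a..b} x *\<^sub>R (p x * (\<Sum>n<N. hc g n * of_real (hf n x))) \<partial>lborel)
     \<longlonglongrightarrow> (\<integral>x. indicator {a..b} x *\<^sub>R (p x * g x) \<partial>lborel)"
proof -
  define f where "f = (\<lambda>x. indicator {a..b} x *\<^sub>R p x)"
  have fl: "l2 f" unfolding f_def by (rule test_function_parseval(1)[OF p])
  have "(\<lambda>n. hc f n * hc g n) sums (\<integral>x. f x * g x \<partial>lborel)"
    by (rule parseval_inner[OF fl _ g]) (unfold f_def, rule test_function_parseval(2)[OF p])
  moreover have "(\<integral>x. indicator {a..b} x *\<^sub>R (p x * (\<Sum>n<N. hc g n * of_real (hf n x))) \<partial>lborel) = (\<Sum>n<N. hc f n * hc g n)" for N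
  proof -
    have "(\<integral>x. indicator {a..b} x *\<^sub>R (p x * (\<Sum>n<N. hc g n * of_real (hf n x))) \<partial>lborel) = (\<integral>x. (\<Sum>n<N. hc g n * (of_real (hf n x) * f x)) \<partial>lborel)"
      by (rule Bochner_Integration.integral_cong) (auto simp: f_def sum_distrib_left scaleR_sum_right mult_ac)
    also have "\<dots> = (\<Sum>n<N. hc g n * hc f n)"
      unfolding hc_def[of f] using hc_integrable[OF fl] by (simp add: Bochner_Integration.integral_sum)
    finally show ?thesis by (simp add: mult.commute)
  qed
  moreover have "(\<integral>x. indicator {a..b} x *\<^sub>R (p x * g x) \<partial>lborel) = (\<integral>x. f x * g x \<partial>lborel)"
    by (simp add: f_def)
  ultimately show ?thesis by (simp add: sums_def)
qed

lemma hc_diff: "l2 f \<Longrightarrow> l2 g \<Longrightarrow> hc (\<lambda>x. f x - g x) n = hc f n - hc g n"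
  unfolding hc_def by (simp add: right_diff_distrib hc_integrable)
lemma hc_add: "l2 f \<Longrightarrow> l2 g \<Longrightarrow> hc (\<lambda>x. f x + g x) n = hc f n + hc g n"
  unfolding hc_def by (simp add: distrib_left hc_integrable)
lemma hc_scale: "hc (\<lambda>x. c * f x) n = c * hc f n"
  unfolding hc_def by (simp add: mult.left_commute[of _ c])

lemma l2_diff: "l2 f \<Longrightarrow> l2 g \<Longrightarrow> l2 (\<lambda>x. f x - g x)"
  for f g :: "real \<Rightarrow> 'b::{real_normed_field,second_countable_topology}"
  using l2_add[of f "\<lambda>x. - 1 * g x"] l2_scale[of g "-1"] by simp

lemma integral_zero_imp_zero:
  fixes g :: "real \<Rightarrow> complex"
  assumes c: "continuous_on UNIV g" and z: "\<And>a b. a \<le> b \<Longrightarrow> integral {a..b} g = 0"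
  shows "g x = 0"
proof -
  have "((\<lambda>u. integral {x-1..u} g) has_vector_derivative g x) (at x within {x-1..x+1})"
    by (rule integral_has_vector_derivative) (use continuous_on_subset[OF c] in auto)
  then have d1: "((\<lambda>u. integral {x-1..u} g) has_vector_derivative g x) (at x)"
    using at_within_Icc_at[of "x-1" x "x+1"] by simp
  have "((\<lambda>u. integral {x-1..u} g) has_vector_derivative 0) (at x)"
    by (rule has_vector_derivative_transform_within_open[OF has_vector_derivative_const[of 0], where S = "{x-1<..<x+1}"])
       (use z in \<open>auto\<close>)
  then show ?thesis using vector_derivative_unique_at[OF d1] by blast
qed

lemma hc_zero_imp_zero:
  fixes g :: "real \<Rightarrow> complex"
  assumes c: "continuous_on UNIV g" and g: "l2 g" and z: "\<And>n. hc g n = 0"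
  shows "g x = 0"
proof (rule integral_zero_imp_zero[OF c])
  fix a b :: real
  have "(\<lambda>N. \<integral>x. indicator {a..b} x *\<^sub>R (1 * (\<Sum>n<N. hc g n * of_real (hf n x))) \<partial>lborel) \<longlonglongrightarrow> (\<integral>x. indicator {a..b} x *\<^sub>R (1 * g x) \<partial>lborel)"
    by (rule test_function_pairing[OF _ g]) simp
  then have "(\<integral>x. indicator {a..b} x *\<^sub>R g x \<partial>lborel) = 0"
    using z LIMSEQ_unique[OF tendsto_const] by fastforce
  moreover have "set_integrable lborel {a..b} g"
    by (rule borel_integrable_atLeastAtMost') (use continuous_on_subset[OF c] in auto)
  ultimately show "integral {a..b} g = 0"
    using set_borel_integral_eq_integral(2)[of "{a..b}" g] by (simp add: set_lebesgue_integral_def)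
qed

lemma hc_eq_imp_eq:
  assumes "continuous_on UNIV f" "l2 f" "continuous_on UNIV g" "l2 g" "\<And>n. hc f n = hc g n"
  shows "f = g"
proof
  fix x
  have "f x - g x = 0"
    by (rule hc_zero_imp_zero[of "\<lambda>x. f x - g x"]) (use assms in \<open>auto intro!: continuous_intros l2_diff simp: hc_diff\<close>)
  then show "f x = g x" by simp
qed

text \<open>A classical counterpart of the operator domain: for eigenfunctions the equation itself
  makes the second weak derivative continuous up to a null set, so nothing of an eigenspace is lost.
  The derivatives are arguments because the equation is stated by prescribing the second
  one.\<close>

definition dom2 :: "(real \<Rightarrow> complex) \<Rightarrow> (real \<Rightarrow> complex) \<Rightarrow> (real \<Rightarrow> complex) \<Rightarrow> bool" where
  "dom2 q q1 q2 \<longleftrightarrow> (\<forall>x. (q has_vector_derivative q1 x) (at x)) \<and> (\<forall>x. (q1 has_vector_derivative q2 x) (at x)) \<and>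
     continuous_on UNIV q2 \<and> l2 q \<and> l2 (\<lambda>x. of_real x * q x) \<and> l2 (\<lambda>x. of_real (x\<^sup>2) * q x) \<and> l2 q1 \<and>
     l2 (\<lambda>x. of_real x * q1 x) \<and> l2 q2"

lemma dom2D:
  assumes "dom2 q q1 q2"
  shows "(q has_vector_derivative q1 x) (at x)" "(q1 has_vector_derivative q2 x) (at x)"
    "continuous_on UNIV q" "continuous_on UNIV q1" "continuous_on UNIV q2"
    "l2 q" "l2 (\<lambda>x. of_real x * q x)" "l2 (\<lambda>x. of_real (x\<^sup>2) * q x)" "l2 q1" "l2 (\<lambda>x. of_real x * q1 x)" "l2 q2"
  using assms unfolding dom2_def
  by (auto intro!: continuous_at_imp_continuous_on has_vector_derivative_continuous)

lemma has_vector_derivative_mult_complex: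
  fixes f g :: "real \<Rightarrow> complex"
  assumes "(f has_vector_derivative f') (at x)" "(g has_vector_derivative g') (at x)"
  shows "((\<lambda>x. f x * g x) has_vector_derivative (f x * g' + f' * g x)) (at x)"
  by (rule has_vector_derivative_mult[OF assms])

lemma has_vector_derivative_of_real_complex:
  assumes "(f has_real_derivative f') (at x)"
  shows "((\<lambda>x. complex_of_real (f x)) has_vector_derivative of_real f') (at x)"
  using assms by (rule has_vector_derivative_of_real[unfolded has_real_derivative_iff_has_vector_derivative[symmetric]])

text \<open>Green's identity: the derivative of h q' - h' q is h q'' - h'' q, whose integral
  vanishes. This transfers the oscillator to the Hermite function, where it acts as 2 n + 1.\<close>

lemma dom2_hc:
  assumes q: "dom2 q q1 q2"
  shows "hc (\<lambda>x. of_real (x\<^sup>2) * q x - q2 x) n = of_real (2 * real n + 1) * hc q n"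
proof -
  note D = dom2D[OF q]
  let ?h = "\<lambda>x. complex_of_real (hf n x)" and ?h' = "\<lambda>x. complex_of_real (hf' n x)"
  have "(\<integral>x. ?h x * q2 x + ?h' x * q1 x - (?h' x * q1 x + of_real ((x\<^sup>2 - (2 * real n + 1)) * hf n x) * q x) \<partial>lborel) = 0"
  proof (rule integral_derivative_eq_0)
    show "((\<lambda>x. ?h x * q1 x - ?h' x * q x) has_vector_derivative
       ?h x * q2 x + ?h' x * q1 x - (?h' x * q1 x + of_real ((x\<^sup>2 - (2 * real n + 1)) * hf n x) * q x)) (at x)" for x
      by (intro has_vector_derivative_diff has_vector_derivative_mult_complex has_vector_derivative_of_real_complex hf_deriv hf'_deriv D)
    show "continuous_on UNIV (\<lambda>x. ?h x * q2 x + ?h' x * q1 x - (?h' x * q1 x + of_real ((x\<^sup>2 - (2 * real n + 1)) * hf n x) * q x))"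
      by (intro continuous_intros D)
    show "integrable lborel (\<lambda>x. ?h x * q1 x - ?h' x * q x)"
      by (intro Bochner_Integration.integrable_diff l2_mult_integrable l2_of_real hf_l2 hf'_l2 D)
    have "integrable lborel (\<lambda>x. ?h x * q2 x - (?h x * (of_real (x\<^sup>2) * q x) - of_real (2 * real n + 1) * (?h x * q x)))"
      by (intro Bochner_Integration.integrable_diff integrable_mult_right l2_mult_integrable l2_of_real hf_l2 D)
    then show "integrable lborel (\<lambda>x. ?h x * q2 x + ?h' x * q1 x - (?h' x * q1 x + of_real ((x\<^sup>2 - (2 * real n + 1)) * hf n x) * q x))"
      by (simp add: algebra_simps)
  qed
  then have "(\<integral>x. of_real (2 * real n + 1) * (?h x * q x) - ?h x * (of_real (x\<^sup>2) * q x - q2 x) \<partial>lborel) = 0"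
    by (simp add: algebra_simps)
  moreover have "(\<integral>x. of_real (2 * real n + 1) * (?h x * q x) - ?h x * (of_real (x\<^sup>2) * q x - q2 x) \<partial>lborel)
     = of_real (2 * real n + 1) * hc q n - hc (\<lambda>x. of_real (x\<^sup>2) * q x - q2 x) n"
    unfolding hc_def integral_mult_right_zero[symmetric]
    by (intro Bochner_Integration.integral_diff integrable_mult_right hc_integrable l2_diff D)
  ultimately show ?thesis by simp
qed

section \<open>Building domain elements from Hermite coefficients\<close>

lemma l2_fatou:
  fixes f :: "nat \<Rightarrow> real \<Rightarrow> complex"
  assumes l: "\<And>N. l2 (f N)" and b: "\<And>N. (\<integral>x. (cmod (f N x))\<^sup>2 \<partial>lborel) \<le> C"
    and lim: "\<And>x. (\<lambda>N. f N x) \<longlonglongrightarrow> g x"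
  shows "l2 g"
proof -
  have fm [measurable]: "f N \<in> borel_measurable borel" for N using l[of N] by (simp add: l2_def)
  have gm [measurable]: "g \<in> borel_measurable borel" by (rule borel_measurable_LIMSEQ_metric[OF fm lim])
  have "(\<integral>\<^sup>+x. ennreal ((cmod (g x))\<^sup>2) \<partial>lborel) = (\<integral>\<^sup>+x. liminf (\<lambda>N. ennreal ((cmod (f N x))\<^sup>2)) \<partial>lborel)"
  proof (rule nn_integral_cong)
    fix x
    have "(\<lambda>N. ennreal ((cmod (f N x))\<^sup>2)) \<longlonglongrightarrow> ennreal ((cmod (g x))\<^sup>2)"
      by (intro tendsto_ennrealI tendsto_intros lim)
    then show "ennreal ((cmod (g x))\<^sup>2) = liminf (\<lambda>N. ennreal ((cmod (f N x))\<^sup>2))"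
      by (simp add: tendsto_iff_Liminf_eq_Limsup)
  qed
  also have "\<dots> \<le> liminf (\<lambda>N. \<integral>\<^sup>+x. ennreal ((cmod (f N x))\<^sup>2) \<partial>lborel)"
    by (rule nn_integral_liminf) measurable
  also have "\<dots> \<le> liminf (\<lambda>N::nat. ennreal C)"
  proof (rule Liminf_mono, rule always_eventually, rule allI)
    fix N
    have "(\<integral>\<^sup>+x. ennreal ((cmod (f N x))\<^sup>2) \<partial>lborel) = ennreal (\<integral>x. (cmod (f N x))\<^sup>2 \<partial>lborel)"
      by (rule nn_integral_eq_integral) (use l[of N] in \<open>auto simp: l2_def\<close>)
    then show "(\<integral>\<^sup>+x. ennreal ((cmod (f N x))\<^sup>2) \<partial>lborel) \<le> ennreal C" using b[of N] by (simp add: ennreal_leI)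
  qed
  also have "\<dots> < \<infinity>" by (simp add: Liminf_const)
  finally show ?thesis unfolding l2_def by (auto intro!: integrableI_bounded)
qed

lemma hf_sum_deriv:
  "((\<lambda>x. \<Sum>n<N. c n * complex_of_real (hf n x)) has_vector_derivative (\<Sum>n<N. c n * complex_of_real (hf' n x))) (at x)"
  "((\<lambda>x. \<Sum>n<N. c n * complex_of_real (hf' n x)) has_vector_derivative
     of_real (x\<^sup>2) * (\<Sum>n<N. c n * complex_of_real (hf n x)) - 2 * (\<Sum>n<N. (of_real (real n + 1/2) * c n) * complex_of_real (hf n x))) (at x)"
proof -
  have c: "((\<lambda>x. c * f x) has_vector_derivative c * f') (at x)" if "(f has_vector_derivative f') (at x)" for c f' :: complex and f
    using has_vector_derivative_mult_complex[OF has_vector_derivative_const that, of c] by simp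
  show "((\<lambda>x. \<Sum>n<N. c n * complex_of_real (hf n x)) has_vector_derivative (\<Sum>n<N. c n * complex_of_real (hf' n x))) (at x)"
    by (intro has_vector_derivative_sum c has_vector_derivative_of_real_complex hf_deriv)
  have "((\<lambda>x. \<Sum>n<N. c n * complex_of_real (hf' n x)) has_vector_derivative (\<Sum>n<N. c n * complex_of_real ((x\<^sup>2 - (2 * real n + 1)) * hf n x))) (at x)"
    by (intro has_vector_derivative_sum c has_vector_derivative_of_real_complex hf'_deriv)
  also have "(\<Sum>n<N. c n * complex_of_real ((x\<^sup>2 - (2 * real n + 1)) * hf n x))
     = of_real (x\<^sup>2) * (\<Sum>n<N. c n * complex_of_real (hf n x)) - 2 * (\<Sum>n<N. (of_real (real n + 1/2) * c n) * complex_of_real (hf n x))"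
    unfolding sum_distrib_left sum_subtractf[symmetric] by (intro sum.cong refl) (simp add: algebra_simps)
  finally show "((\<lambda>x. \<Sum>n<N. c n * complex_of_real (hf' n x)) has_vector_derivative
     of_real (x\<^sup>2) * (\<Sum>n<N. c n * complex_of_real (hf n x)) - 2 * (\<Sum>n<N. (of_real (real n + 1/2) * c n) * complex_of_real (hf n x))) (at x)" .
qed

lemma l2_power_sum_hf: "l2 (\<lambda>x. of_real (x ^ k) * (\<Sum>n<N. c n * complex_of_real (hf n x)))"
proof (induction N)
  case 0 show ?case by (simp add: l2_def)
next
  case (Suc N)
  have "l2 (\<lambda>x. c N * complex_of_real (x ^ k * hf N x))" by (intro l2_scale l2_of_real hf_power_l2)
  from l2_add[OF Suc this] show ?case by (simp add: algebra_simps)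
qed

lemma hf'_power_l2: "l2 (\<lambda>x. x ^ k * hf' n x)"
proof -
  have "l2 (\<lambda>x. sqrt 2 * sqrt (real n) * (x ^ k * hf (n - 1) x) + (- 1) * (x ^ Suc k * hf n x))"
    by (intro l2_add l2_scale hf_power_l2)
  then show ?thesis by (simp add: hf'_def algebra_simps)
qed

lemma l2_power_sum_hf': "l2 (\<lambda>x. of_real (x ^ k) * (\<Sum>n<N. c n * complex_of_real (hf' n x)))"
proof (induction N)
  case 0 show ?case by (simp add: l2_def)
next
  case (Suc N)
  have "l2 (\<lambda>x. c N * complex_of_real (x ^ k * hf' N x))" by (intro l2_scale l2_of_real hf'_power_l2)
  from l2_add[OF Suc this] show ?case by (simp add: algebra_simps)
qed

lemma l2_sq_integrable: "l2 f \<Longrightarrow> integrable lborel (\<lambda>x. (cmod (f x))\<^sup>2)"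
  by (simp add: l2_def)

lemma has_vector_derivative_Re_mult_cnj:
  fixes f g :: "real \<Rightarrow> complex"
  assumes "(f has_vector_derivative f') (at x)" "(g has_vector_derivative g') (at x)"
  shows "((\<lambda>x. Re (f x * cnj (g x))) has_real_derivative Re (f x * cnj g' + f' * cnj (g x))) (at x)"
proof -
  have "((\<lambda>x. cnj (g x)) has_vector_derivative cnj g') (at x)" by (rule has_vector_derivative_cnj[OF assms(2)])
  from has_vector_derivative_mult_complex[OF assms(1) this]
  show ?thesis unfolding has_real_derivative_iff_has_vector_derivative
    by (rule bounded_linear.has_vector_derivative[OF bounded_linear_Re])
qed

text \<open>The identity \<open>|x^2 S - S''|^2 = |x^2 S|^2 + |S''|^2 + 2 |x S'|^2 - 2 |S|^2\<close> holds up to a total derivative.\<close>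

lemma hf_sum_energy:
  fixes c :: "nat \<Rightarrow> complex" and N :: nat
  defines "S \<equiv> \<lambda>x. \<Sum>n<N. c n * complex_of_real (hf n x)" and "S1 \<equiv> \<lambda>x. \<Sum>n<N. c n * complex_of_real (hf' n x)"
  defines "E \<equiv> (\<Sum>n<N. (real n + 1/2)\<^sup>2 * (cmod (c n))\<^sup>2)"
  shows "(\<integral>x. (cmod (S x))\<^sup>2 \<partial>lborel) \<le> 4 * E"
    "(\<integral>x. (cmod (of_real x * S x))\<^sup>2 \<partial>lborel) \<le> 16 * E"
    "(\<integral>x. (cmod (of_real (x\<^sup>2) * S x))\<^sup>2 \<partial>lborel) \<le> 12 * E"
    "(\<integral>x. (cmod (S1 x))\<^sup>2 \<partial>lborel) \<le> 16 * E"
    "(\<integral>x. (cmod (of_real x * S1 x))\<^sup>2 \<partial>lborel) \<le> 12 * E"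
proof -
  define T where "T x = (\<Sum>n<N. (of_real (real n + 1/2) * c n) * complex_of_real (hf n x))" for x
  define S2 where "S2 x = of_real (x\<^sup>2) * S x - 2 * T x" for x
  have dS: "(S has_vector_derivative S1 x) (at x)" for x unfolding S_def S1_def by (rule hf_sum_deriv(1))
  have dS1: "(S1 has_vector_derivative S2 x) (at x)" for x unfolding S_def S1_def S2_def T_def by (rule hf_sum_deriv(2))
  have cS: "continuous_on UNIV S" "continuous_on UNIV S1" "continuous_on UNIV T"
    unfolding S_def S1_def T_def by (intro continuous_intros)+
  have lS: "l2 (\<lambda>x. of_real (x ^ k) * S x)" "l2 (\<lambda>x. of_real (x ^ k) * S1 x)" "l2 (\<lambda>x. of_real (x ^ k) * T x)" for k
    unfolding S_def S1_def T_def by (rule l2_power_sum_hf l2_power_sum_hf')+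
  have l: "l2 S" "l2 (\<lambda>x. of_real x * S x)" "l2 (\<lambda>x. of_real (x\<^sup>2) * S x)" "l2 S1" "l2 (\<lambda>x. of_real x * S1 x)" "l2 (\<lambda>x. of_real (x\<^sup>2) * S1 x)" "l2 T"
    using lS(1)[of 0] lS(1)[of 1] lS(1)[of 2] lS(2)[of 0] lS(2)[of 1] lS(2)[of 2] lS(3)[of 0] by simp_all
  have lS2: "l2 S2" unfolding S2_def[abs_def] by (intro l2_diff l2_scale l)
  note i = l[THEN l2_sq_integrable] l2_sq_integrable[OF lS2]
  define I where "I f = (\<integral>x. (cmod (f x))\<^sup>2 \<partial>lborel)" for f :: "real \<Rightarrow> complex"
  have I0: "I f \<ge> 0" for f unfolding I_def by simp
  have IT: "I T = E" unfolding I_def T_def norm_sum_hf E_def norm_mult norm_of_real power_mult_distrib by simp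
  have IS: "I S = (\<Sum>n<N. (cmod (c n))\<^sup>2)" unfolding I_def S_def by (rule norm_sum_hf)
  have IS_le: "I S \<le> 4 * E"
    unfolding IS E_def sum_distrib_left
  proof (rule sum_mono)
    fix n
    define y where "y = real n + 1/2"
    have "(1/2)\<^sup>2 \<le> y\<^sup>2" by (rule power_mono) (auto simp: y_def)
    then have "1 \<le> 4 * (real n + 1/2)\<^sup>2" unfolding y_def[symmetric] by (simp add: power2_eq_square)
    from mult_right_mono[OF this, of "(cmod (c n))\<^sup>2"] show "(cmod (c n))\<^sup>2 \<le> 4 * ((real n + 1/2)\<^sup>2 * (cmod (c n))\<^sup>2)" by simp
  qed
  have pq: "cmod z ^ 2 = Re (z * cnj z)" for z by (simp add: complex_norm_square[symmetric] flip: of_real_power)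
  have j: "integrable lborel (\<lambda>x. Re (f x * cnj (g x)))" if "l2 f" "l2 g" for f g
    by (intro integrable_Re l2_mult_integrable that l2_cnj)
  have "integrable lborel (\<lambda>x. 4 * Re (S1 x * cnj (of_real x * S x)) + 2 * (cmod (S x))\<^sup>2 - 2 * ((Re (S2 x * cnj (of_real (x\<^sup>2) * S x)) + (cmod (of_real x * S1 x))\<^sup>2) + 2 * Re (S1 x * cnj (of_real x * S x))))"
    by (intro Bochner_Integration.integrable_diff Bochner_Integration.integrable_add integrable_mult_right j l lS2 i)
  then have int1: "integrable lborel (\<lambda>x. 2 * (x * (2 * Re (S1 x * cnj (S x)))) + 2 * (cmod (S x))\<^sup>2 - 2 * (x\<^sup>2 * (Re (S2 x * cnj (S x)) + (cmod (S1 x))\<^sup>2) + 2 * x * Re (S1 x * cnj (S x))))"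
    by (simp add: algebra_simps norm_mult power_mult_distrib)
  \<comment> \<open>The integrand is the derivative of 2 x |S|^2 - 2 x^2 Re (S' cnj S), the total
    derivative meant in the identity above.\<close>
  have id1: "(\<integral>x. 2 * (x * (2 * Re (S1 x * cnj (S x)))) + 2 * (cmod (S x))\<^sup>2 - 2 * (x\<^sup>2 * (Re (S2 x * cnj (S x)) + (cmod (S1 x))\<^sup>2) + 2 * x * Re (S1 x * cnj (S x))) \<partial>lborel) = 0"
  proof (rule integral_derivative_eq_0)
    fix x
    have d1: "((\<lambda>x. Re (S x * cnj (S x))) has_real_derivative 2 * Re (S1 x * cnj (S x))) (at x)"
      using has_vector_derivative_Re_mult_cnj[OF dS dS, of x] by (simp add: algebra_simps)
    have d2: "((\<lambda>x. Re (S1 x * cnj (S x))) has_real_derivative Re (S2 x * cnj (S x)) + (cmod (S1 x))\<^sup>2) (at x)"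
      using has_vector_derivative_Re_mult_cnj[OF dS1 dS, of x] by (simp add: pq algebra_simps)
    have "((\<lambda>x. 2 * (x * Re (S x * cnj (S x))) - 2 * (x\<^sup>2 * Re (S1 x * cnj (S x)))) has_real_derivative
       2 * (x * (2 * Re (S1 x * cnj (S x)))) + 2 * (cmod (S x))\<^sup>2 - 2 * (x\<^sup>2 * (Re (S2 x * cnj (S x)) + (cmod (S1 x))\<^sup>2) + 2 * x * Re (S1 x * cnj (S x)))) (at x)"
      by (rule DERIV_cong, (rule derivative_eq_intros d1 d2 refl)+) (simp add: pq algebra_simps)
    then show "((\<lambda>x. 2 * (x * Re (S x * cnj (S x))) - 2 * (x\<^sup>2 * Re (S1 x * cnj (S x)))) has_vector_derivative
       2 * (x * (2 * Re (S1 x * cnj (S x)))) + 2 * (cmod (S x))\<^sup>2 - 2 * (x\<^sup>2 * (Re (S2 x * cnj (S x)) + (cmod (S1 x))\<^sup>2) + 2 * x * Re (S1 x * cnj (S x)))) (at x)"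
      by (simp only: has_real_derivative_iff_has_vector_derivative)
  next
    have cS2: "continuous_on UNIV S2" unfolding S2_def[abs_def] by (intro continuous_intros cS)
    show "continuous_on UNIV (\<lambda>x. 2 * (x * (2 * Re (S1 x * cnj (S x)))) + 2 * (cmod (S x))\<^sup>2 - 2 * (x\<^sup>2 * (Re (S2 x * cnj (S x)) + (cmod (S1 x))\<^sup>2) + 2 * x * Re (S1 x * cnj (S x))))"
      by (intro continuous_intros cS cS2)
    have "integrable lborel (\<lambda>x. 2 * Re (S x * cnj (of_real x * S x)) - 2 * Re (S1 x * cnj (of_real (x\<^sup>2) * S x)))"
      by (intro Bochner_Integration.integrable_diff integrable_mult_right j l)
    then show "integrable lborel (\<lambda>x. 2 * (x * Re (S x * cnj (S x))) - 2 * (x\<^sup>2 * Re (S1 x * cnj (S x))))"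
      by (simp add: algebra_simps)
    show "integrable lborel (\<lambda>x. 2 * (x * (2 * Re (S1 x * cnj (S x)))) + 2 * (cmod (S x))\<^sup>2 - 2 * (x\<^sup>2 * (Re (S2 x * cnj (S x)) + (cmod (S1 x))\<^sup>2) + 2 * x * Re (S1 x * cnj (S x))))"
      by (rule int1)
  qed
  have "4 * I T = (\<integral>x. (cmod (of_real (x\<^sup>2) * S x))\<^sup>2 + (cmod (S2 x))\<^sup>2 + 2 * (cmod (of_real x * S1 x))\<^sup>2 - 2 * (cmod (S x))\<^sup>2
     + (2 * (x * (2 * Re (S1 x * cnj (S x)))) + 2 * (cmod (S x))\<^sup>2 - 2 * (x\<^sup>2 * (Re (S2 x * cnj (S x)) + (cmod (S1 x))\<^sup>2) + 2 * x * Re (S1 x * cnj (S x)))) \<partial>lborel)"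
    unfolding I_def integral_mult_right_zero[symmetric]
  proof (rule Bochner_Integration.integral_cong[OF refl])
    fix x
    have "4 * (cmod (T x))\<^sup>2 = (cmod (of_real (x\<^sup>2) * S x - S2 x))\<^sup>2" by (simp add: S2_def norm_mult power_mult_distrib)
    also have "\<dots> = (cmod (of_real (x\<^sup>2) * S x))\<^sup>2 + (cmod (S2 x))\<^sup>2 - 2 * (x\<^sup>2 * Re (S2 x * cnj (S x)))"
      unfolding cmod_power2 by (simp add: power2_eq_square algebra_simps)
    finally show "4 * (cmod (T x))\<^sup>2 = (cmod (of_real (x\<^sup>2) * S x))\<^sup>2 + (cmod (S2 x))\<^sup>2 + 2 * (cmod (of_real x * S1 x))\<^sup>2 - 2 * (cmod (S x))\<^sup>2
     + (2 * (x * (2 * Re (S1 x * cnj (S x)))) + 2 * (cmod (S x))\<^sup>2 - 2 * (x\<^sup>2 * (Re (S2 x * cnj (S x)) + (cmod (S1 x))\<^sup>2) + 2 * x * Re (S1 x * cnj (S x))))"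
      by (simp add: norm_mult power_mult_distrib algebra_simps)
  qed
  also have "\<dots> = (I (\<lambda>x. of_real (x\<^sup>2) * S x) + I S2 + 2 * I (\<lambda>x. of_real x * S1 x) - 2 * I S) + 0"
    unfolding id1[symmetric] I_def
    by (subst Bochner_Integration.integral_add, intro Bochner_Integration.integrable_diff Bochner_Integration.integrable_add integrable_mult_right i, rule int1)
       (use i in simp)
  \<comment> \<open>The terms on the right are nonnegative, and \<open>I S\<close> is at most 4 E
    because n + 1/2 \<ge> 1/2; so each is at most 4 E + 8 E = 12 E. The remaining constants 16 arise
    as 12 + 4.\<close>
  finally have main: "4 * E + 2 * I S = I (\<lambda>x. of_real (x\<^sup>2) * S x) + I S2 + 2 * I (\<lambda>x. of_real x * S1 x)" by (simp add: IT)
  show "(\<integral>x. (cmod (S x))\<^sup>2 \<partial>lborel) \<le> 4 * E" using IS_le by (simp add: I_def)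
  have bx: "I (\<lambda>x. of_real (x\<^sup>2) * S x) \<le> 12 * E" "I (\<lambda>x. of_real x * S1 x) \<le> 12 * E" and bS2: "I S2 \<le> 12 * E"
    using main IS_le I0[of "\<lambda>x. of_real (x\<^sup>2) * S x"] I0[of "\<lambda>x. of_real x * S1 x"] I0[of S2] by linarith+
  show "(\<integral>x. (cmod (of_real (x\<^sup>2) * S x))\<^sup>2 \<partial>lborel) \<le> 12 * E"
    "(\<integral>x. (cmod (of_real x * S1 x))\<^sup>2 \<partial>lborel) \<le> 12 * E" using bx by (simp_all only: I_def)
  have "I (\<lambda>x. of_real x * S x) \<le> (\<integral>x. (cmod (S x))\<^sup>2 + (cmod (of_real (x\<^sup>2) * S x))\<^sup>2 \<partial>lborel)"
    unfolding I_def
  proof (rule integral_mono)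
    fix x :: real
    define y where "y = x\<^sup>2"
    have "0 \<le> (y - 1/2)\<^sup>2" by simp
    then have "y \<le> 1 + y\<^sup>2" by (simp add: power2_eq_square algebra_simps)
    from mult_right_mono[OF this, of "(cmod (S x))\<^sup>2"]
    show "(cmod (of_real x * S x))\<^sup>2 \<le> (cmod (S x))\<^sup>2 + (cmod (of_real (x\<^sup>2) * S x))\<^sup>2"
      unfolding norm_mult norm_of_real power_mult_distrib y_def by (simp add: algebra_simps)
  qed (intro i Bochner_Integration.integrable_add)+
  also have "\<dots> = I S + I (\<lambda>x. of_real (x\<^sup>2) * S x)" unfolding I_def by (rule Bochner_Integration.integral_add[OF i(1,3)])
  finally show "(\<integral>x. (cmod (of_real x * S x))\<^sup>2 \<partial>lborel) \<le> 16 * E" using bx IS_le by (simp add: I_def)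
  \<comment> \<open>Integration by parts expresses the norm of S1 through the pairing of S2 with S,
    both of which are already bounded.\<close>
  have "(\<integral>x. Re (S2 x * cnj (S x)) + (cmod (S1 x))\<^sup>2 \<partial>lborel) = 0"
  proof (rule integral_derivative_eq_0)
    have cS2: "continuous_on UNIV S2" unfolding S2_def[abs_def] by (intro continuous_intros cS)
    show "((\<lambda>x. Re (S1 x * cnj (S x))) has_vector_derivative Re (S2 x * cnj (S x)) + (cmod (S1 x))\<^sup>2) (at x)" for x
      using has_vector_derivative_Re_mult_cnj[OF dS1 dS, of x] unfolding has_real_derivative_iff_has_vector_derivative by (simp add: pq algebra_simps)
    show "continuous_on UNIV (\<lambda>x. Re (S2 x * cnj (S x)) + (cmod (S1 x))\<^sup>2)" by (intro continuous_intros cS cS2)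
  qed (intro Bochner_Integration.integrable_add j l lS2 i)+
  then have "I S1 = (\<integral>x. - Re (S2 x * cnj (S x)) \<partial>lborel)"
    unfolding I_def Bochner_Integration.integral_add[OF j[OF lS2 l(1)] i(4)] Bochner_Integration.integral_minus by linarith
  also have "\<dots> \<le> (\<integral>x. (cmod (S2 x))\<^sup>2 + (cmod (S x))\<^sup>2 \<partial>lborel)"
  proof (rule integral_mono)
    fix x
    have "- Re (S2 x * cnj (S x)) \<le> cmod (S2 x * cnj (S x))"
      using abs_Re_le_cmod[of "S2 x * cnj (S x)"] by linarith
    also have "\<dots> = cmod (S2 x) * cmod (S x)" by (simp add: norm_mult)
    also have "\<dots> \<le> (cmod (S2 x))\<^sup>2 + (cmod (S x))\<^sup>2"
      using sum_squares_bound[of "cmod (S2 x)" "cmod (S x)"] mult_nonneg_nonneg[OF norm_ge_zero[of "S2 x"] norm_ge_zero[of "S x"]] by linarith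
    finally show "- Re (S2 x * cnj (S x)) \<le> (cmod (S2 x))\<^sup>2 + (cmod (S x))\<^sup>2" .
  qed (intro i j l lS2 Bochner_Integration.integrable_add integrable_minus)+
  also have "\<dots> = I S2 + I S" unfolding I_def by (rule Bochner_Integration.integral_add[OF i(8,1)])
  finally show "(\<integral>x. (cmod (S1 x))\<^sup>2 \<partial>lborel) \<le> 16 * E" using bS2 IS_le by (simp add: I_def)
qed

lemma has_integral_imp_derivative:
  fixes f g :: "real \<Rightarrow> complex"
  assumes c: "continuous_on UNIV g" and i: "\<And>a b. a \<le> b \<Longrightarrow> (g has_integral (f b - f a)) {a..b}"
  shows "(f has_vector_derivative g x) (at x)"
proof -
  have "((\<lambda>u. integral {x-1..u} g) has_vector_derivative g x) (at x within {x-1..x+1})"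
    by (rule integral_has_vector_derivative) (use continuous_on_subset[OF c] in auto)
  then have "((\<lambda>u. f (x-1) + integral {x-1..u} g) has_vector_derivative 0 + g x) (at x)"
    using at_within_Icc_at[of "x-1" x "x+1"] by (intro has_vector_derivative_add has_vector_derivative_const) simp
  then have "(f has_vector_derivative 0 + g x) (at x)"
    by (rule has_vector_derivative_transform_within_open[where S = "{x-1<..<x+1}"])
       (use integral_unique[OF i] in auto)
  then show ?thesis by simp
qed

lemma integral_Icc_lborel:
  fixes h :: "real \<Rightarrow> complex"
  assumes c: "continuous_on UNIV h"
  shows "(\<integral>x. indicator {a..b} x *\<^sub>R h x \<partial>lborel) = integral {a..b} h"
proof -
  have "set_integrable lborel {a..b} h"
    by (rule borel_integrable_atLeastAtMost') (use continuous_on_subset[OF c] in auto)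
  from set_borel_integral_eq_integral(2)[OF this] show ?thesis by (simp add: set_lebesgue_integral_def)
qed

text \<open>Taylor's formula with integral remainder recovers the first derivative at a from values
  of f and a weighted integral of the second derivative. This is how convergence of first
  derivatives is deduced from weak convergence of second ones.\<close>

lemma taylor_has_integral:
  fixes f f1 f2 :: "real \<Rightarrow> complex"
  assumes "a \<le> b" "\<And>x. (f has_vector_derivative f1 x) (at x)" "\<And>x. (f1 has_vector_derivative f2 x) (at x)"
  shows "((\<lambda>t. of_real (b - t) * f2 t) has_integral (f b - f a - of_real (b - a) * f1 a)) {a..b}"
proof -
  have d: "((\<lambda>t. f t + of_real (b - t) * f1 t) has_vector_derivative of_real (b - t) * f2 t) (at t)" for t
  proof -
    have "((\<lambda>t. f t + of_real (b - t) * f1 t) has_vector_derivative f1 t + (of_real (b - t) * f2 t + of_real (- 1) * f1 t)) (at t)"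
      by (intro has_vector_derivative_add assms has_vector_derivative_mult_complex has_vector_derivative_of_real_complex)
         (auto intro!: derivative_eq_intros)
    then show ?thesis by simp
  qed
  have "((\<lambda>t. of_real (b - t) * f2 t) has_integral ((f b + of_real (b - b) * f1 b) - (f a + of_real (b - a) * f1 a))) {a..b}"
    by (rule fundamental_theorem_of_calculus[OF assms(1)]) (rule has_vector_derivative_at_within[OF d])
  then show ?thesis by (simp add: algebra_simps)
qed

text \<open>Splitting |c n h n| by Young's inequality with weight (n + 1/2)^2 gives the assumed
  series plus h_n^2 / (n + 1/2)^2, and \<open>hf_sup\<close> makes the latter of order n^(-3/2). So
  the series converges uniformly, and the L2 bound follows by Fatou.\<close>

lemma hf_synthesis:
  fixes c :: "nat \<Rightarrow> complex"
  assumes sE: "summable (\<lambda>n. (real n + 1/2)\<^sup>2 * (cmod (c n))\<^sup>2)"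
  defines "V \<equiv> \<lambda>x. \<Sum>n. c n * complex_of_real (hf n x)"
  shows "\<And>x. (\<lambda>N. \<Sum>n<N. c n * complex_of_real (hf n x)) \<longlonglongrightarrow> V x"
    "continuous_on UNIV V" "l2 V" "\<And>n. hc V n = c n"
proof -
  define E where "E = (\<Sum>n. (real n + 1/2)\<^sup>2 * (cmod (c n))\<^sup>2)"
  define S where "S N x = (\<Sum>n<N. c n * complex_of_real (hf n x))" for N x
  define M where "M n = (real n + 1/2)\<^sup>2 * (cmod (c n))\<^sup>2 + 2 * sqrt (real n + 1) / (real n + 1/2)\<^sup>2" for n
  have E: "(\<Sum>n<N. (real n + 1/2)\<^sup>2 * (cmod (c n))\<^sup>2) \<le> E" for N
    unfolding E_def by (rule sum_le_suminf[OF sE]) auto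
  have "summable (\<lambda>n. 2 * sqrt (real n + 1) / (real n + 1/2)\<^sup>2)"
  proof (rule summable_comparison_test_bigo)
    show "summable (\<lambda>n. norm (real n powr (-3/2)))" by (simp add: summable_real_powr_iff)
    show "(\<lambda>n. 2 * sqrt (real n + 1) / (real n + 1/2)\<^sup>2) \<in> O(\<lambda>n. real n powr (-3/2))" by real_asymp
  qed
  then have sM: "summable M" unfolding M_def[abs_def] by (rule summable_add[OF sE])
  have young: "u * v \<le> y\<^sup>2 * u\<^sup>2 + v\<^sup>2 / y\<^sup>2" if "y > 0" "u \<ge> 0" "v \<ge> 0" for u v y :: real
    using sum_squares_bound[of "y * u" "v / y"] that mult_nonneg_nonneg[of u v] by (simp add: power_mult_distrib power_divide del: zero_le_mult_iff mult_nonneg_nonneg)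
  have bM: "norm (c n * complex_of_real (hf n x)) \<le> M n" for n x
  proof -
    have "norm (c n * complex_of_real (hf n x)) = cmod (c n) * \<bar>hf n x\<bar>" by (simp add: norm_mult)
    also have "\<dots> \<le> (real n + 1/2)\<^sup>2 * (cmod (c n))\<^sup>2 + \<bar>hf n x\<bar>\<^sup>2 / (real n + 1/2)\<^sup>2" by (rule young) auto
    also have "\<dots> \<le> M n" unfolding M_def using hf_sup[of n x] by (intro add_left_mono divide_right_mono) auto
    finally show ?thesis .
  qed
  have sc: "summable (\<lambda>n. cmod (c n))"
  proof (rule summable_comparison_test'[OF sM])
    fix n
    have "cmod (c n) * 1 \<le> (real n + 1/2)\<^sup>2 * (cmod (c n))\<^sup>2 + 1\<^sup>2 / (real n + 1/2)\<^sup>2" by (rule young) auto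
    also have "\<dots> \<le> M n" unfolding M_def
    proof (intro add_left_mono divide_right_mono zero_le_power2)
      have "1 \<le> sqrt (real n + 1)" by simp
      then show "1\<^sup>2 \<le> 2 * sqrt (real n + 1)" unfolding power_one by linarith
    qed
    finally show "norm (cmod (c n)) \<le> M n" by simp
  qed
  have ul: "uniform_limit UNIV S V sequentially"
    unfolding S_def[abs_def] V_def by (rule Weierstrass_m_test[OF _ sM]) (rule bM)
  have SV: "(\<lambda>N. S N x) \<longlonglongrightarrow> V x" for x using tendsto_uniform_limitI[OF ul] by simp
  then show "(\<lambda>N. \<Sum>n<N. c n * complex_of_real (hf n x)) \<longlonglongrightarrow> V x" for x by (simp only: S_def)
  have cS: "continuous_on UNIV (S N)" for N
    unfolding S_def[abs_def] by (intro continuous_intros)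
  show "continuous_on UNIV V"
    by (rule uniform_limit_theorem[OF _ ul]) (auto intro: always_eventually cS)
  have l: "l2 (S N)" for N
    unfolding S_def using l2_power_sum_hf[of 0 c N] by simp
  show "l2 V"
    by (rule l2_fatou[where C = "4 * E", OF l order_trans[OF hf_sum_energy(1)[where c = c, folded S_def]]]) (use E SV in auto)
  show hV: "hc V n = c n" for n
  proof -
    have i: "integrable lborel (\<lambda>x. complex_of_real (hf n x) * (c m * complex_of_real (hf m x)))" for m
      by (intro l2_mult_integrable l2_of_real hf_l2 l2_scale)
    have n1: "(\<integral>x. norm (complex_of_real (hf n x) * (c m * complex_of_real (hf m x))) \<partial>lborel) \<le> cmod (c m)" for m
    proof -
      have "(\<integral>x. norm (complex_of_real (hf n x) * (c m * complex_of_real (hf m x))) \<partial>lborel) \<le> (\<integral>x. cmod (c m) * (((hf n x)\<^sup>2 + (hf m x)\<^sup>2) / 2) \<partial>lborel)"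
      proof (rule integral_mono)
        show "integrable lborel (\<lambda>x. norm (complex_of_real (hf n x) * (c m * complex_of_real (hf m x))))" by (rule integrable_norm[OF i])
        show "integrable lborel (\<lambda>x. cmod (c m) * (((hf n x)\<^sup>2 + (hf m x)\<^sup>2) / 2))"
          using hf_l2[of n] hf_l2[of m] unfolding l2_def by auto
        fix x
        have "\<bar>hf n x\<bar> * \<bar>hf m x\<bar> \<le> ((hf n x)\<^sup>2 + (hf m x)\<^sup>2) / 2"
          using sum_squares_bound[of "\<bar>hf n x\<bar>" "\<bar>hf m x\<bar>"] by simp
        from mult_left_mono[OF this norm_ge_zero[of "c m"]]
        show "norm (complex_of_real (hf n x) * (c m * complex_of_real (hf m x))) \<le> cmod (c m) * (((hf n x)\<^sup>2 + (hf m x)\<^sup>2) / 2)"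
          by (simp add: norm_mult mult_ac)
      qed
      also have "\<dots> = cmod (c m)"
        using hf_orthonormal[of n n] hf_orthonormal[of m m] hf_l2[of n] hf_l2[of m] unfolding l2_def
        by (simp add: power2_eq_square)
      finally show ?thesis .
    qed
    have "(\<lambda>m. \<integral>x. complex_of_real (hf n x) * (c m * complex_of_real (hf m x)) \<partial>lborel) sums
      (\<integral>x. (\<Sum>m. complex_of_real (hf n x) * (c m * complex_of_real (hf m x))) \<partial>lborel)"
    proof (rule sums_integral[OF i])
      show "AE x in lborel. summable (\<lambda>m. norm (complex_of_real (hf n x) * (c m * complex_of_real (hf m x))))"
      proof (rule AE_I2)
        fix x
        have "summable (\<lambda>m. \<bar>hf n x\<bar> * norm (c m * complex_of_real (hf m x)))"
          by (intro summable_mult summable_comparison_test'[OF sM]) (use bM in simp)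
        then show "summable (\<lambda>m. norm (complex_of_real (hf n x) * (c m * complex_of_real (hf m x))))" by (simp add: norm_mult)
      qed
      show "summable (\<lambda>m. \<integral>x. norm (complex_of_real (hf n x) * (c m * complex_of_real (hf m x))) \<partial>lborel)"
        by (rule summable_comparison_test'[OF sc]) (use n1 in simp)
    qed
    moreover have "(\<integral>x. complex_of_real (hf n x) * (c m * complex_of_real (hf m x)) \<partial>lborel) = (if m = n then c m else 0)" for m
    proof -
      have "(\<integral>x. complex_of_real (hf n x) * (c m * complex_of_real (hf m x)) \<partial>lborel) = c m * of_real (\<integral>x. hf n x * hf m x \<partial>lborel)"
        unfolding integral_complex_of_real[symmetric] integral_mult_right_zero[symmetric]
        by (rule Bochner_Integration.integral_cong) auto
      then show ?thesis by (simp add: hf_orthonormal)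
    qed
    moreover have "(\<Sum>m. complex_of_real (hf n x) * (c m * complex_of_real (hf m x))) = complex_of_real (hf n x) * V x" for x
      unfolding V_def by (rule suminf_mult, rule summable_norm_cancel, rule summable_comparison_test'[OF sM]) (use bM in simp)
    ultimately have "(\<lambda>m. if m = n then c m else 0) sums hc V n" by (simp add: hc_def)
    from sums_unique2[OF this sums_single[of n c]] show ?thesis .
  qed
qed

text \<open>The second derivatives of the partial sums S N are x^2 S N - 2 T N, where T N are the
  partial sums of F and converge only in the weak sense of \<open>test_function_pairing\<close>. Two
  applications of Taylor's formula upgrade this to a C^2 limit; the weighted L2 bounds come from the
  energy estimates.\<close>

lemma dom2_synthesis:
  fixes c :: "nat \<Rightarrow> complex"
  assumes sE: "summable (\<lambda>n. (real n + 1/2)\<^sup>2 * (cmod (c n))\<^sup>2)"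
    and cF: "continuous_on UNIV F" and lF: "l2 F" and hF: "\<And>n. hc F n = of_real (real n + 1/2) * c n"
  defines "V \<equiv> \<lambda>x. \<Sum>n. c n * complex_of_real (hf n x)"
  shows "\<exists>q. dom2 V q (\<lambda>x. of_real (x\<^sup>2) * V x - 2 * F x)"
proof -
  define E where "E = (\<Sum>n. (real n + 1/2)\<^sup>2 * (cmod (c n))\<^sup>2)"
  define S where "S N x = (\<Sum>n<N. c n * complex_of_real (hf n x))" for N x
  define D where "D N x = (\<Sum>n<N. c n * complex_of_real (hf' n x))" for N x
  define T where "T N x = (\<Sum>n<N. hc F n * complex_of_real (hf n x))" for N x
  define G where "G N x = of_real (x\<^sup>2) * S N x - 2 * T N x" for N x
  define g where "g x = of_real (x\<^sup>2) * V x - 2 * F x" for x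
  have E: "(\<Sum>n<N. (real n + 1/2)\<^sup>2 * (cmod (c n))\<^sup>2) \<le> E" for N
    unfolding E_def by (rule sum_le_suminf[OF sE]) auto
  note syn = hf_synthesis(2-4)[OF sE, folded V_def]
  have SV: "(\<lambda>N. S N x) \<longlonglongrightarrow> V x" for x unfolding S_def V_def by (rule hf_synthesis(1)[OF sE])
  note cV = syn(1) and hV = syn(3)
  have cS: "continuous_on UNIV (S N)" "continuous_on UNIV (T N)" "continuous_on UNIV (D N)" for N
    unfolding S_def[abs_def] T_def[abs_def] D_def[abs_def] by (intro continuous_intros)+
  have cg: "continuous_on UNIV g" unfolding g_def[abs_def] by (intro continuous_intros cV cF)
  have lS: "l2 (\<lambda>x. of_real (x ^ k) * S N x)" "l2 (\<lambda>x. of_real (x ^ k) * D N x)" for k N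
    unfolding S_def D_def by (rule l2_power_sum_hf l2_power_sum_hf')+
  have l: "l2 (S N)" "l2 (\<lambda>x. of_real x * S N x)" "l2 (\<lambda>x. of_real (x\<^sup>2) * S N x)" "l2 (D N)" "l2 (\<lambda>x. of_real x * D N x)" for N
    using lS(1)[of 0 N] lS(1)[of 1 N] lS(1)[of 2 N] lS(2)[of 0 N] lS(2)[of 1 N] by simp_all
  note en = hf_sum_energy[where c = c, folded S_def D_def]
  have lV: "l2 V" "l2 (\<lambda>x. of_real x * V x)" "l2 (\<lambda>x. of_real (x\<^sup>2) * V x)"
    by (rule l2_fatou[where C = "4 * E", OF l(1) order_trans[OF en(1)]]
        l2_fatou[where C = "16 * E", OF l(2) order_trans[OF en(2)]]
        l2_fatou[where C = "12 * E", OF l(3) order_trans[OF en(3)]];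
        use E in \<open>auto intro!: tendsto_intros SV\<close>)+
  have dS: "(S N has_vector_derivative D N x) (at x)" for N x
    unfolding S_def[abs_def] D_def by (rule hf_sum_deriv(1))
  have dD: "(D N has_vector_derivative G N x) (at x)" for N x
    unfolding S_def D_def[abs_def] G_def T_def hF by (rule hf_sum_deriv(2))
  \<comment> \<open>Weak convergence of the second derivatives on intervals. Both V and F are
    covered, since their Hermite coefficients are those of the partial sums S N and T N.\<close>
  have lim: "(\<lambda>N. integral {a..b} (\<lambda>t. p t * G N t)) \<longlonglongrightarrow> integral {a..b} (\<lambda>t. p t * g t)"
    if p: "continuous_on UNIV p" for p a b
  proof -
    have A: "(\<lambda>N. \<integral>x. indicator {a..b} x *\<^sub>R ((p x * of_real (x\<^sup>2)) * S N x) \<partial>lborel) \<longlonglongrightarrow> (\<integral>x. indicator {a..b} x *\<^sub>R ((p x * of_real (x\<^sup>2)) * V x) \<partial>lborel)"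
      unfolding S_def hV[symmetric] by (intro test_function_pairing lV continuous_intros p)
    have B: "(\<lambda>N. \<integral>x. indicator {a..b} x *\<^sub>R (p x * T N x) \<partial>lborel) \<longlonglongrightarrow> (\<integral>x. indicator {a..b} x *\<^sub>R (p x * F x) \<partial>lborel)"
      unfolding T_def by (intro test_function_pairing lF continuous_intros p)
    have e: "(\<integral>x. indicator {a..b} x *\<^sub>R ((p x * of_real (x\<^sup>2)) * f x) \<partial>lborel) = integral {a..b} (\<lambda>x. (p x * of_real (x\<^sup>2)) * f x)"
       "(\<integral>x. indicator {a..b} x *\<^sub>R (p x * f x) \<partial>lborel) = integral {a..b} (\<lambda>x. p x * f x)" if "continuous_on UNIV f" for f
      by (rule integral_Icc_lborel, intro continuous_intros p that)+
    have L: "(\<lambda>N. integral {a..b} (\<lambda>x. (p x * of_real (x\<^sup>2)) * S N x) - 2 * integral {a..b} (\<lambda>x. p x * T N x)) \<longlonglongrightarrow>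
        integral {a..b} (\<lambda>x. (p x * of_real (x\<^sup>2)) * V x) - 2 * integral {a..b} (\<lambda>x. p x * F x)"
    proof -
      have "(\<integral>x. indicator {a..b} x *\<^sub>R ((p x * of_real (x\<^sup>2)) * S N x) \<partial>lborel) = integral {a..b} (\<lambda>x. (p x * of_real (x\<^sup>2)) * S N x)"
        "(\<integral>x. indicator {a..b} x *\<^sub>R (p x * T N x) \<partial>lborel) = integral {a..b} (\<lambda>x. p x * T N x)" for N
        by (rule e cS)+
      then show ?thesis
        using tendsto_diff[OF A tendsto_mult_left[OF B, of 2]] e(1)[OF cV] e(2)[OF cF] by (simp only:)
    qed
    moreover have e3: "integral {a..b} (\<lambda>x. (p x * of_real (x\<^sup>2)) * f1 x) - 2 * integral {a..b} (\<lambda>x. p x * f2 x) = integral {a..b} (\<lambda>x. p x * (of_real (x\<^sup>2) * f1 x - 2 * f2 x))"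
      if "continuous_on UNIV f1" "continuous_on UNIV f2" for f1 f2
    proof -
      have i1: "(\<lambda>x. (p x * of_real (x\<^sup>2)) * f1 x) integrable_on {a..b}" "(\<lambda>x. 2 * (p x * f2 x)) integrable_on {a..b}"
        by (rule integrable_continuous_interval, rule continuous_on_subset[OF _ subset_UNIV], intro continuous_intros p that)+
      have "integral {a..b} (\<lambda>x. p x * (of_real (x\<^sup>2) * f1 x - 2 * f2 x)) = integral {a..b} (\<lambda>x. (p x * of_real (x\<^sup>2)) * f1 x - 2 * (p x * f2 x))"
        by (rule arg_cong[where f = "integral {a..b}"]) (simp add: fun_eq_iff algebra_simps)
      also have "\<dots> = integral {a..b} (\<lambda>x. (p x * of_real (x\<^sup>2)) * f1 x) - integral {a..b} (\<lambda>x. 2 * (p x * f2 x))"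
        by (rule Henstock_Kurzweil_Integration.integral_diff[OF i1])
      also have "integral {a..b} (\<lambda>x. 2 * (p x * f2 x)) = 2 * integral {a..b} (\<lambda>x. p x * f2 x)"
        by (rule integral_mult_right)
      finally show ?thesis by (rule sym)
    qed
    have e4: "integral {a..b} (\<lambda>x. (p x * of_real (x\<^sup>2)) * S N x) - 2 * integral {a..b} (\<lambda>x. p x * T N x) = integral {a..b} (\<lambda>t. p t * G N t)" for N
      using e3[OF cS(1)[of N] cS(2)[of N]] by (simp only: G_def)
    have e5: "integral {a..b} (\<lambda>x. (p x * of_real (x\<^sup>2)) * V x) - 2 * integral {a..b} (\<lambda>x. p x * F x) = integral {a..b} (\<lambda>t. p t * g t)"
      using e3[OF cV cF] by (simp only: g_def)
    show ?thesis using L by (simp only: e4 e5)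
  qed
  \<comment> \<open>Taylor's formula on [a, a + 1], solved for the first derivative at a. By
    \<open>lim2\<close> the derivatives D N converge to it pointwise.\<close>
  define q where "q a = V (a + 1) - V a - integral {a..a+1} (\<lambda>t. of_real (a + 1 - t) * g t)" for a
  have lim2: "(\<lambda>N. S N b - S N a - of_real (b - a) * D N a) \<longlonglongrightarrow> integral {a..b} (\<lambda>t. of_real (b - t) * g t)" if "a \<le> b" for a b
  proof -
    have "S N b - S N a - of_real (b - a) * D N a = integral {a..b} (\<lambda>t. of_real (b - t) * G N t)" for N
      by (rule integral_unique[symmetric, OF taylor_has_integral[OF that dS dD]])
    moreover have "continuous_on UNIV (\<lambda>t. complex_of_real (b - t))" by (intro continuous_intros)
    ultimately show ?thesis using lim by simp
  qed
  have Dq: "(\<lambda>N. D N a) \<longlonglongrightarrow> q a" for a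
  proof -
    have "(\<lambda>N. S N (a+1) - S N a - (S N (a+1) - S N a - of_real (a + 1 - a) * D N a)) \<longlonglongrightarrow> q a"
      unfolding q_def by (intro tendsto_diff SV lim2) simp
    then show ?thesis by simp
  qed
  have qg: "(g has_integral (q b - q a)) {a..b}" if "a \<le> b" for a b
  proof -
    have "integral {a..b} (G N) = D N b - D N a" for N
      by (rule integral_unique, rule fundamental_theorem_of_calculus[OF that]) (rule has_vector_derivative_at_within[OF dD])
    then have "(\<lambda>N. D N b - D N a) \<longlonglongrightarrow> integral {a..b} g" using lim[of "\<lambda>_. 1" a b] by simp
    from LIMSEQ_unique[OF this tendsto_diff[OF Dq Dq]] have "integral {a..b} g = q b - q a" .
    moreover have "g integrable_on {a..b}" by (intro integrable_continuous_interval continuous_on_subset[OF cg]) auto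
    ultimately show ?thesis by (simp add: has_integral_integrable_integral)
  qed
  have dq: "(q has_vector_derivative g x) (at x)" for x by (rule has_integral_imp_derivative[OF cg qg])
  then have cq: "continuous_on UNIV q" by (auto intro!: continuous_at_imp_continuous_on has_vector_derivative_continuous)
  \<comment> \<open>Taylor's formula in the limit, compared with the same remainder computed from a
    primitive W of q, shows that V is a primitive of q.\<close>
  have Vq: "(q has_integral (V b - V a)) {a..b}" if ab: "a \<le> b" for a b
  proof -
    define W where "W t = integral {a..t} q" for t
    have "((\<lambda>u. integral {a..u} q) has_vector_derivative q t) (at t within {a..b})" if "t \<in> {a..b}" for t
      by (rule integral_has_vector_derivative[OF continuous_on_subset[OF cq] that]) auto
    then have dW: "(W has_vector_derivative q t) (at t within {a..b})" if "t \<in> {a..b}" for t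
      using that unfolding W_def[abs_def] by blast
    have "((\<lambda>t. W t + of_real (b - t) * q t) has_vector_derivative of_real (b - t) * g t) (at t within {a..b})" if t: "t \<in> {a..b}" for t
    proof -
      have "((\<lambda>t. complex_of_real (b - t)) has_vector_derivative of_real (- 1)) (at t within {a..b})"
        by (rule has_vector_derivative_at_within, rule has_vector_derivative_of_real_complex) (auto intro!: derivative_eq_intros)
      from has_vector_derivative_add[OF dW[OF t] has_vector_derivative_mult[OF this has_vector_derivative_at_within[OF dq]]]
      show ?thesis by simp
    qed
    from fundamental_theorem_of_calculus[OF ab this]
    have "integral {a..b} (\<lambda>t. of_real (b - t) * g t) = W b - of_real (b - a) * q a"
      by (intro integral_unique) (simp add: W_def)
    moreover have "V b - V a - of_real (b - a) * q a = integral {a..b} (\<lambda>t. of_real (b - t) * g t)"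
      by (rule LIMSEQ_unique[OF _ lim2[OF ab]]) (intro tendsto_intros SV Dq)
    ultimately have "integral {a..b} q = V b - V a" unfolding W_def by simp
    moreover have "q integrable_on {a..b}" by (intro integrable_continuous_interval continuous_on_subset[OF cq]) auto
    ultimately show ?thesis by (simp add: has_integral_integrable_integral)
  qed
  have dV: "(V has_vector_derivative q x) (at x)" for x by (rule has_integral_imp_derivative[OF cq Vq])
  have lq: "l2 q" "l2 (\<lambda>x. of_real x * q x)"
    by (rule l2_fatou[where C = "16 * E", OF l(4) order_trans[OF en(4)]] l2_fatou[where C = "12 * E", OF l(5) order_trans[OF en(5)]]; use E in \<open>auto intro!: tendsto_intros Dq\<close>)+
  have "dom2 V q g"
    unfolding dom2_def using dV dq cg lV lq by (auto simp: g_def[abs_def] intro!: l2_diff l2_scale lF)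
  then show "\<exists>q. dom2 V q (\<lambda>x. of_real (x\<^sup>2) * V x - 2 * F x)" unfolding g_def[abs_def] by blast
qed

section \<open>Reduction to coupled oscillators\<close>

lemma l2_rescale:
  fixes f :: "real \<Rightarrow> complex"
  assumes f: "l2 f" and s: "s \<noteq> 0"
  shows "l2 (\<lambda>y. f (s * y))"
proof -
  have [measurable]: "f \<in> borel_measurable borel" using f by (simp add: l2_def)
  have "integrable lborel (\<lambda>y. (norm (f (0 + s * y)))\<^sup>2)"
    by (rule lborel_integrable_real_affine[OF _ s]) (use f in \<open>simp add: l2_def\<close>)
  then show ?thesis by (simp add: l2_def)
qed

lemma l2_chirp:
  fixes f :: "real \<Rightarrow> complex"
  assumes f: "l2 f" and s: "s \<noteq> 0"
  shows "l2 (\<lambda>y. cis (c * y\<^sup>2) * f (s * y))"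
  by (rule l2_bounded_mult[OF l2_rescale[OF f s], where C = 1]) auto

lemma has_vector_derivative_chirp:
  assumes q: "(q has_vector_derivative q1) (at (s * y))"
  shows "((\<lambda>y. cis (c * y\<^sup>2) * q (s * y)) has_vector_derivative
    cis (c * y\<^sup>2) * (2 * \<i> * of_real (c * y) * q (s * y) + of_real s * q1)) (at y)"
proof -
  have "((\<lambda>y. c * y\<^sup>2) has_real_derivative 2 * c * y) (at y)" by (auto intro!: derivative_eq_intros)
  then have "((\<lambda>y. cis (c * y\<^sup>2)) has_derivative (\<lambda>t. (2 * c * y * t) *\<^sub>R (\<i> * cis (c * y\<^sup>2)))) (at y)"
    unfolding has_field_derivative_def by (rule has_derivative_cis)
  then have d1: "((\<lambda>y. cis (c * y\<^sup>2)) has_vector_derivative of_real (2 * c * y) * (\<i> * cis (c * y\<^sup>2))) (at y)"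
    unfolding has_vector_derivative_def by (simp add: scaleR_conv_of_real mult_ac)
  have "((\<lambda>y. s * y) has_vector_derivative s) (at y)"
    by (auto intro!: derivative_eq_intros simp flip: has_real_derivative_iff_has_vector_derivative)
  from vector_diff_chain_at[OF this q]
  have d2: "((\<lambda>y. q (s * y)) has_vector_derivative of_real s * q1) (at y)"
    by (simp add: o_def scaleR_conv_of_real)
  from has_vector_derivative_mult_complex[OF d1 d2] show ?thesis by (simp add: algebra_simps)
qed

text \<open>Each derivative that falls on the chirp produces a factor y. The conditions on x q, x^2
  q and x q' are therefore exactly what keeps the domain invariant under chirps and
  dilations.\<close>

lemma dom2_chirp:
  assumes q: "dom2 q q1 q2" and s: "s \<noteq> 0"
  shows "dom2 (\<lambda>y. cis (c * y\<^sup>2) * q (s * y))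
     (\<lambda>y. cis (c * y\<^sup>2) * (2 * \<i> * of_real (c * y) * q (s * y) + of_real s * q1 (s * y)))
     (\<lambda>y. cis (c * y\<^sup>2) * ((2 * \<i> * of_real c - of_real (4 * c\<^sup>2 * y\<^sup>2)) * q (s * y)
        + 4 * \<i> * of_real (c * y * s) * q1 (s * y) + of_real (s\<^sup>2) * q2 (s * y)))" (is "dom2 ?V ?V1 ?V2")
proof -
  note D = dom2D[OF q]
  have d1: "(?V has_vector_derivative ?V1 y) (at y)" for y
    by (rule has_vector_derivative_chirp[OF D(1)])
  have d2: "(?V1 has_vector_derivative ?V2 y) (at y)" for y
  proof -
    have "((\<lambda>y. 2 * \<i> * of_real c / of_real s * of_real y) has_vector_derivative 2 * \<i> * of_real c / of_real s) (at x)" for x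
      using has_vector_derivative_mult_complex[OF has_vector_derivative_const has_vector_derivative_of_real_complex[OF DERIV_ident], of "2 * \<i> * of_real c / of_real s" x] by simp
    from has_vector_derivative_mult_complex[OF this D(1)]
    have e: "((\<lambda>x. 2 * \<i> * of_real c / of_real s * of_real x * q x) has_vector_derivative
       2 * \<i> * of_real c / of_real s * of_real x * q1 x + 2 * \<i> * of_real c / of_real s * q x) (at x)" for x .
    have f: "((\<lambda>x. of_real s * q1 x) has_vector_derivative of_real s * q2 x) (at x)" for x
      using has_vector_derivative_mult_complex[OF has_vector_derivative_const D(2), of "of_real s"] by simp
    have "((\<lambda>y. cis (c * y\<^sup>2) * (2 * \<i> * of_real c / of_real s * of_real (s * y) * q (s * y) + of_real s * q1 (s * y))) has_vector_derivative
      cis (c * y\<^sup>2) * (2 * \<i> * of_real (c * y) * (2 * \<i> * of_real c / of_real s * of_real (s * y) * q (s * y) + of_real s * q1 (s * y))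
        + of_real s * (2 * \<i> * of_real c / of_real s * of_real (s * y) * q1 (s * y) + 2 * \<i> * of_real c / of_real s * q (s * y) + of_real s * q2 (s * y)))) (at y)"
      by (rule has_vector_derivative_chirp[OF has_vector_derivative_add[OF e f], of c s y])
    moreover have "(\<lambda>y. cis (c * y\<^sup>2) * (2 * \<i> * of_real c / of_real s * of_real (s * y) * q (s * y) + of_real s * q1 (s * y))) = ?V1"
      using s by (simp add: fun_eq_iff field_simps)
    moreover have "cis (c * y\<^sup>2) * (2 * \<i> * of_real (c * y) * (2 * \<i> * of_real c / of_real s * of_real (s * y) * q (s * y) + of_real s * q1 (s * y))
        + of_real s * (2 * \<i> * of_real c / of_real s * of_real (s * y) * q1 (s * y) + 2 * \<i> * of_real c / of_real s * q (s * y) + of_real s * q2 (s * y))) = ?V2 y"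
      using s by (simp add: field_simps power2_eq_square)
    ultimately show ?thesis by simp
  qed
  have l0: "l2 ?V" by (rule l2_chirp[OF D(6) s])
  have l1: "l2 (\<lambda>y. of_real y * ?V y)"
    using l2_chirp[OF l2_scale[OF D(7), of "1 / of_real s"] s, of c] s by (simp add: field_simps)
  have l2': "l2 (\<lambda>y. of_real (y\<^sup>2) * ?V y)"
    using l2_chirp[OF l2_scale[OF D(8), of "1 / of_real (s\<^sup>2)"] s, of c] s by (simp add: field_simps power2_eq_square)
  have l3: "l2 ?V1"
    using l2_chirp[OF l2_add[OF l2_scale[OF D(7), of "2 * \<i> * of_real c / of_real s"] l2_scale[OF D(9), of "of_real s"]] s, of c] s
    by (simp add: field_simps)
  have l4: "l2 (\<lambda>y. of_real y * ?V1 y)"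
    using l2_chirp[OF l2_add[OF l2_scale[OF D(8), of "2 * \<i> * of_real c / of_real (s\<^sup>2)"] l2_scale[OF D(10), of "1"]] s, of c] s
    by (simp add: field_simps power2_eq_square)
  have l5: "l2 ?V2"
    using l2_chirp[OF l2_add[OF l2_add[OF l2_diff[OF l2_scale[OF D(6), of "2 * \<i> * of_real c"] l2_scale[OF D(8), of "of_real (4 * c\<^sup>2 / s\<^sup>2)"]]
       l2_scale[OF D(10), of "4 * \<i> * of_real c"]] l2_scale[OF D(11), of "of_real (s\<^sup>2)"]] s, of c] s
    by (simp add: field_simps power2_eq_square)
  have c2: "continuous_on UNIV ?V2"
  proof -
    have comp: "continuous_on UNIV (\<lambda>y. f (s * y))" if "continuous_on UNIV f" for f :: "real \<Rightarrow> complex"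
      by (rule continuous_on_compose2[OF that]) (auto intro!: continuous_intros)
    show ?thesis by (intro continuous_intros comp[OF D(3)] comp[OF D(4)] comp[OF D(5)])
  qed
  show ?thesis unfolding dom2_def using d1 d2 c2 l0 l1 l2' l3 l4 l5 by blast
qed

lemma dom2_add:
  assumes p: "dom2 p p1 p2" and q: "dom2 q q1 q2"
  shows "dom2 (\<lambda>x. p x + q x) (\<lambda>x. p1 x + q1 x) (\<lambda>x. p2 x + q2 x)"
proof -
  note P = dom2D[OF p] and Q = dom2D[OF q]
  show ?thesis unfolding dom2_def
    using l2_add[OF P(6) Q(6)] l2_add[OF P(7) Q(7)] l2_add[OF P(8) Q(8)] l2_add[OF P(9) Q(9)] l2_add[OF P(10) Q(10)] l2_add[OF P(11) Q(11)]
      has_vector_derivative_add[OF P(1) Q(1)] has_vector_derivative_add[OF P(2) Q(2)] continuous_on_add[OF P(5) Q(5)]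
    by (simp add: distrib_left)
qed

lemma dom2_scale:
  assumes q: "dom2 q q1 q2"
  shows "dom2 (\<lambda>x. c * q x) (\<lambda>x. c * q1 x) (\<lambda>x. c * q2 x)"
proof -
  note Q = dom2D[OF q]
  have d: "((\<lambda>x. c * f x) has_vector_derivative c * f') (at x)" if "(f has_vector_derivative f') (at x)" for f f' x
    using has_vector_derivative_mult_complex[OF has_vector_derivative_const that, of c] by simp
  show ?thesis unfolding dom2_def
    using l2_scale[OF Q(6), of c] l2_scale[OF Q(7), of c] l2_scale[OF Q(8), of c] l2_scale[OF Q(9), of c] l2_scale[OF Q(10), of c] l2_scale[OF Q(11), of c]
      d[OF Q(1)] d[OF Q(2)] continuous_on_mult[OF continuous_on_const Q(5), of c]
    by (simp add: mult.left_commute[of c])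
qed

section \<open>From the vector equation to component equations with classical derivatives\<close>

definition vec2 :: "complex \<Rightarrow> complex \<Rightarrow> complex^2" where
  "vec2 a b = axis 1 a + axis 2 b"

lemma vec2_nth [simp]: "vec2 a b $ 1 = a" "vec2 a b $ 2 = b"
  by (simp_all add: vec2_def axis_def)

lemma vec2_eqI: "v $ 1 = w $ 1 \<Longrightarrow> v $ 2 = w $ 2 \<Longrightarrow> v = w" for v w :: "'a^2"
  by (simp add: vec_eq_iff forall_2)

lemma bounded_linear_axis: "bounded_linear (axis i :: complex \<Rightarrow> complex^2)"
proof -
  have "linear (axis i :: complex \<Rightarrow> complex^2)"
    by (rule linearI) (auto simp: axis_def vec_eq_iff)
  then show ?thesis by (simp add: linear_conv_bounded_linear)
qed

lemma norm_complex_2: "(norm v)\<^sup>2 = (cmod (v $ 1))\<^sup>2 + (cmod (v $ 2))\<^sup>2" for v :: "complex^2"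
  by (simp add: norm_vec_def L2_set_def sum_2)

lemma scaleR_nth_complex: "(r *\<^sub>R v) $ k = of_real r * v $ k" for v :: "complex^'n"
  by (subst vector_scaleR_component) (rule scaleR_conv_of_real)

lemma square_integrable_iff_l2:
  "square_integrable f \<longleftrightarrow> l2 (\<lambda>x. f x $ 1) \<and> l2 (\<lambda>x. f x $ 2)"
proof
  assume f: "square_integrable f"
  then have m: "f \<in> borel_measurable borel" and i: "integrable lborel (\<lambda>x. (norm (f x))\<^sup>2)" by (auto simp: square_integrable_def)
  have n: "(\<lambda>v::complex^2. v $ k) \<in> borel_measurable borel" for k
    by (rule borel_measurable_continuous_onI) (intro continuous_intros)
  have mk: "(\<lambda>x. f x $ k) \<in> borel_measurable borel" for k by (rule measurable_compose[OF m n])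
  have "l2 (\<lambda>x. f x $ k)" for k
    unfolding l2_def
  proof
    show "(\<lambda>x. f x $ k) \<in> borel_measurable lborel" using mk by simp
    show "integrable lborel (\<lambda>x. (norm (f x $ k))\<^sup>2)"
    proof (rule Bochner_Integration.integrable_bound[OF i])
      show "(\<lambda>x. (norm (f x $ k))\<^sup>2) \<in> borel_measurable lborel" using mk[of k] by simp
      show "AE x in lborel. norm ((norm (f x $ k))\<^sup>2) \<le> norm ((norm (f x))\<^sup>2)"
        by (rule AE_I2) (auto intro!: power_mono simp: Finite_Cartesian_Product.norm_nth_le)
    qed
  qed
  then show "l2 (\<lambda>x. f x $ 1) \<and> l2 (\<lambda>x. f x $ 2)" by blast
next
  assume l: "l2 (\<lambda>x. f x $ 1) \<and> l2 (\<lambda>x. f x $ 2)"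
  have a: "(axis k :: complex \<Rightarrow> complex^2) \<in> borel_measurable borel" for k
    by (rule borel_measurable_continuous_onI) (rule linear_continuous_on[OF bounded_linear_axis])
  have "(\<lambda>x. vec2 (f x $ 1) (f x $ 2)) \<in> borel_measurable borel"
    unfolding vec2_def
    using l by (intro borel_measurable_add measurable_compose[where f = "\<lambda>x. f x $ 1", OF _ a] measurable_compose[where f = "\<lambda>x. f x $ 2", OF _ a]) (auto simp: l2_def)
  also have "(\<lambda>x. vec2 (f x $ 1) (f x $ 2)) = f"
    by (rule ext, rule vec2_eqI) auto
  finally show "square_integrable f" using l unfolding square_integrable_def norm_complex_2 by (auto simp: l2_def)
qed

lemma has_integral_primitive_continuous:
  fixes f g :: "real \<Rightarrow> complex"
  assumes i: "\<And>a b. a \<le> b \<Longrightarrow> (g has_integral (f b - f a)) {a..b}"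
  shows "continuous_on UNIV f"
proof (rule continuous_at_imp_continuous_on, rule ballI)
  fix x
  have "g integrable_on {x-1..x+1}" using i[of "x-1" "x+1"] by (auto simp: integrable_on_def)
  then have "continuous_on {x-1..x+1} (\<lambda>u. f (x-1) + integral {x-1..u} g)"
    by (intro continuous_intros indefinite_integral_continuous_1)
  then have "continuous_on {x-1..x+1} f"
    by (rule continuous_on_eq) (use integral_unique[OF i] in auto)
  then show "isCont f x" by (rule continuous_on_interior) auto
qed

lemma ncho_A_nth: "(ncho_A \<alpha> \<beta> *v v) $ 1 = of_real \<alpha> * v $ 1" "(ncho_A \<alpha> \<beta> *v v) $ 2 = of_real \<beta> * v $ 2"
  by (simp_all add: ncho_A_def matrix_vector_mult_def sum_2)

lemma ncho_J_nth: "(ncho_J *v v) $ 1 = - v $ 2" "(ncho_J *v v) $ 2 = v $ 1"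
  by (simp_all add: ncho_J_def matrix_vector_mult_def sum_2)

text \<open>The eigenvalue equation solved for the second derivatives of the two components. Its
  right side is continuous, since u and D 1 are primitives; so the second weak derivative may be
  replaced by it and u is C^2.\<close>

lemma ncho_eigenspace_dom2:
  assumes ab: "\<alpha> \<noteq> 0" "\<beta> \<noteq> 0"
  shows "u \<in> ncho_eigenspace \<alpha> \<beta> (of_real \<mu>) \<longleftrightarrow> (\<exists>p1 p2.
     dom2 (\<lambda>x. u x $ 1) p1 (\<lambda>x. of_real (x\<^sup>2) * u x $ 1 - 2 / of_real \<alpha> * (of_real \<mu> * u x $ 1 + (of_real x * p2 x + u x $ 2 / 2))) \<and>
     dom2 (\<lambda>x. u x $ 2) p2 (\<lambda>x. of_real (x\<^sup>2) * u x $ 2 - 2 / of_real \<beta> * (of_real \<mu> * u x $ 2 - (of_real x * p1 x + u x $ 1 / 2))))"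
    (is "?L \<longleftrightarrow> (\<exists>p1 p2. dom2 _ _ (?R1 p2) \<and> dom2 _ _ (?R2 p1))")
proof
  assume ?L
  then obtain D where D: "weak_derivs u D" and eq: "AE x in lborel. of_real \<mu> *s u x =
           ncho_A \<alpha> \<beta> *v (- (1/2) *\<^sub>R D 2 x + (x\<^sup>2 / 2) *\<^sub>R D 0 x)
           + ncho_J *v (x *\<^sub>R D 1 x + (1/2) *\<^sub>R D 0 x)"
    unfolding ncho_eigenspace_def ncho_graph_def by blast
  have D0: "D 0 = u" and
    int: "\<And>j a b. j < 2 \<Longrightarrow> a \<le> b \<Longrightarrow> (D (Suc j) has_integral (D j b - D j a)) {a..b}" and
    sq: "\<And>i j. i + j \<le> 2 \<Longrightarrow> square_integrable (\<lambda>x. x ^ i *\<^sub>R D j x)"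
    using D unfolding weak_derivs_def by auto
  have ik: "((\<lambda>x. D (Suc j) x $ k) has_integral (D j b $ k - D j a $ k)) {a..b}" if "j < 2" "a \<le> b" for j k a b
    using has_integral_linear[OF int[OF that] bounded_linear_vec_nth[of k]] by (simp add: o_def)
  have c0: "continuous_on UNIV (\<lambda>x. u x $ k)" for k
    by (rule has_integral_primitive_continuous[where g = "\<lambda>x. D 1 x $ k"]) (use ik[of 0 _ _ k] D0 in simp)
  have c1: "continuous_on UNIV (\<lambda>x. D 1 x $ k)" for k
    by (rule has_integral_primitive_continuous[where g = "\<lambda>x. D 2 x $ k"]) (use ik[of 1 _ _ k] in \<open>simp add: numeral_2_eq_2\<close>)
  \<comment> \<open>The continuous candidates for the second derivatives of the components, with
    \<open>D 1\<close> as first derivative.\<close>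
  define R where "R k = (if k = 1 then ?R1 (\<lambda>x. D 1 x $ 2) else ?R2 (\<lambda>x. D 1 x $ 1))" for k :: 2
  have cR: "continuous_on UNIV (R k)" for k
  proof -
    have "continuous_on UNIV (\<lambda>x. of_real (x\<^sup>2) * f x - z * (of_real \<mu> * f x + (of_real x * g x + h x / 2)))"
      "continuous_on UNIV (\<lambda>x. of_real (x\<^sup>2) * f x - z * (of_real \<mu> * f x - (of_real x * g x + h x / 2)))"
      if "continuous_on UNIV f" "continuous_on UNIV g" "continuous_on UNIV h" for f g h :: "real \<Rightarrow> complex" and z
      by (intro continuous_intros that; simp)+
    note r = this(1)[OF c0[of 1] c1[of 2] c0[of 2], of "2 / of_real \<alpha>"] this(2)[OF c0[of 2] c1[of 1] c0[of 1], of "2 / of_real \<beta>"]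
    show ?thesis by (cases "k = 1") (simp_all only: R_def if_True if_False simp_thms r)
  qed
  have "AE x in lborel. D 2 x $ 1 = R 1 x \<and> D 2 x $ 2 = R 2 x"
    using eq
  proof eventually_elim
    case (elim x)
    have "of_real \<mu> * u x $ 1 = of_real \<alpha> * (- (1/2) *\<^sub>R D 2 x $ 1 + (x\<^sup>2 / 2) *\<^sub>R D 0 x $ 1) - (x *\<^sub>R D 1 x $ 2 + (1/2) *\<^sub>R D 0 x $ 2)"
      "of_real \<mu> * u x $ 2 = of_real \<beta> * (- (1/2) *\<^sub>R D 2 x $ 2 + (x\<^sup>2 / 2) *\<^sub>R D 0 x $ 2) + (x *\<^sub>R D 1 x $ 1 + (1/2) *\<^sub>R D 0 x $ 1)"
      using arg_cong[OF elim, of "\<lambda>v. v $ 1"] arg_cong[OF elim, of "\<lambda>v. v $ 2"]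
      by (simp_all only: ncho_A_nth ncho_J_nth scaleR_nth_complex vector_add_component vector_smult_component) (simp_all add: scaleR_conv_of_real)
    then show ?case using ab unfolding R_def D0 scaleR_conv_of_real by (simp add: field_simps)
  qed
  \<comment> \<open>Passing to the completed measure makes the exceptional set negligible, so it can
    be ignored by the gauge integral.\<close>
  then have "AE x in lebesgue. D 2 x $ 1 = R 1 x \<and> D 2 x $ 2 = R 2 x" by (rule AE_completion)
  then obtain N where N: "N \<in> null_sets lebesgue" "{x. \<not> (D 2 x $ 1 = R 1 x \<and> D 2 x $ 2 = R 2 x)} \<subseteq> N"
    unfolding eventually_ae_filter by auto
  have neg: "negligible N" using N(1) by (simp add: negligible_iff_null_sets)
  have "(R k has_integral (D 1 b $ k - D 1 a $ k)) {a..b}" if "a \<le> b" for a b k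
  proof (rule has_integral_spike[OF neg])
    show "((\<lambda>x. D 2 x $ k) has_integral (D 1 b $ k - D 1 a $ k)) {a..b}"
      using ik[of 1 a b k] that by (simp add: numeral_2_eq_2)
    show "R k x = D 2 x $ k" if "x \<in> {a..b} - N" for x
    proof -
      have "D 2 x $ 1 = R 1 x \<and> D 2 x $ 2 = R 2 x" using N(2) that by blast
      then show ?thesis using exhaust_2[of k] by auto
    qed
  qed
  then have d1: "((\<lambda>x. D 1 x $ k) has_vector_derivative R k x) (at x)" for k x
    by (rule has_integral_imp_derivative[OF cR])
  have d0: "((\<lambda>x. u x $ k) has_vector_derivative D 1 x $ k) (at x)" for k x
    by (rule has_integral_imp_derivative[OF c1]) (use ik[of 0 _ _ k] D0 in simp)
  have l: "l2 (\<lambda>x. of_real (x ^ i) * D j x $ k)" if "i + j \<le> 2" for i j k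
    using sq[OF that] exhaust_2[of k] unfolding square_integrable_iff_l2 scaleR_nth_complex by (auto simp del: of_real_power)
  have lR: "l2 (R k)" for k
  proof -
    have [measurable]: "R k \<in> borel_measurable borel" by (rule borel_measurable_continuous_onI[OF cR])
    have [measurable]: "(\<lambda>x. D 2 x $ k) \<in> borel_measurable borel" using l[of 0 2 k] by (simp add: l2_def)
    have "AE x in lborel. (norm (D 2 x $ k))\<^sup>2 = (norm (R k x))\<^sup>2"
      using \<open>AE x in lborel. D 2 x $ 1 = R 1 x \<and> D 2 x $ 2 = R 2 x\<close>
      by eventually_elim (use exhaust_2[of k] in auto)
    moreover have "integrable lborel (\<lambda>x. (norm (D 2 x $ k))\<^sup>2)" using l[of 0 2 k] by (simp add: l2_def)
    ultimately have "integrable lborel (\<lambda>x. (norm (R k x))\<^sup>2)"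
      using integrable_cong_AE[of "\<lambda>x. (norm (D 2 x $ k))\<^sup>2" lborel "\<lambda>x. (norm (R k x))\<^sup>2"] by auto
    then show ?thesis by (simp add: l2_def)
  qed
  have "dom2 (\<lambda>x. u x $ k) (\<lambda>x. D 1 x $ k) (R k)" for k
    unfolding dom2_def using d0 d1 cR lR l[of 0 0 k] l[of 1 0 k] l[of 2 0 k] l[of 0 1 k] l[of 1 1 k] by (simp add: D0)
  from this[of 1] this[of 2] show "\<exists>p1 p2. dom2 (\<lambda>x. u x $ 1) p1 (?R1 p2) \<and> dom2 (\<lambda>x. u x $ 2) p2 (?R2 p1)"
    unfolding R_def by auto
next
  assume "\<exists>p1 p2. dom2 (\<lambda>x. u x $ 1) p1 (?R1 p2) \<and> dom2 (\<lambda>x. u x $ 2) p2 (?R2 p1)"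
  then obtain p1 p2 where d1: "dom2 (\<lambda>x. u x $ 1) p1 (?R1 p2)" and d2: "dom2 (\<lambda>x. u x $ 2) p2 (?R2 p1)" by blast
  note A = dom2D[OF d1] and B = dom2D[OF d2]
  define D where "D j x = (if j = 0 then u x else if j = 1 then vec2 (p1 x) (p2 x) else vec2 (?R1 p2 x) (?R2 p1 x))" for j :: nat and x
  have v: "(g has_integral (f b - f a)) {a..b}"
    if "a \<le> b" "\<And>x. ((\<lambda>x. f x $ 1) has_vector_derivative g x $ 1) (at x)" "\<And>x. ((\<lambda>x. f x $ 2) has_vector_derivative g x $ 2) (at x)"
    for f g :: "real \<Rightarrow> complex^2" and a b
  proof (rule fundamental_theorem_of_calculus[OF \<open>a \<le> b\<close>], rule has_vector_derivative_at_within)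
    fix x
    have "((\<lambda>x. vec2 (f x $ 1) (f x $ 2)) has_vector_derivative vec2 (g x $ 1) (g x $ 2)) (at x)"
      unfolding vec2_def
      by (rule has_vector_derivative_add[OF bounded_linear.has_vector_derivative[OF bounded_linear_axis that(2)]
            bounded_linear.has_vector_derivative[OF bounded_linear_axis that(3)]])
    moreover have "vec2 (h x $ 1) (h x $ 2) = h x" for h :: "real \<Rightarrow> complex^2" and x
      by (rule vec2_eqI) auto
    ultimately show "(f has_vector_derivative g x) (at x)" by (simp only:)
  qed
  have wd: "weak_derivs u D"
    unfolding weak_derivs_def
  proof (intro conjI allI impI)
    show "D 0 = u" by (auto simp: D_def)
    show "(D (Suc j) has_integral D j b - D j a) {a..b}" if "j < 2" "a \<le> b" for j a b
    proof -
      have "j = 0 \<or> j = 1" using that by auto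
      then show ?thesis by (elim disjE; intro v[OF that(2)]) (use A B in \<open>simp_all add: D_def\<close>)
    qed
    show "square_integrable (\<lambda>x. x ^ i *\<^sub>R D j x)" if "i + j \<le> 2" for i j
    proof -
      consider "i = 0" "j = 0" | "i = 1" "j = 0" | "i = 2" "j = 0" | "i = 0" "j = 1" | "i = 1" "j = 1" | "i = 0" "j = 2"
        using \<open>i + j \<le> 2\<close> by linarith
      then show ?thesis
        by cases (use A B in \<open>simp_all only: D_def square_integrable_iff_l2 scaleR_nth_complex, simp_all\<close>)
    qed
  qed
  have "of_real \<mu> *s u x = ncho_A \<alpha> \<beta> *v (- (1/2) *\<^sub>R D 2 x + (x\<^sup>2 / 2) *\<^sub>R D 0 x) + ncho_J *v (x *\<^sub>R D 1 x + (1/2) *\<^sub>R D 0 x)" for x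
    using ab by (intro vec2_eqI) (simp_all only: ncho_A_nth ncho_J_nth D_def scaleR_nth_complex vector_add_component vector_smult_component,
      simp_all add: field_simps)
  moreover have "square_integrable (\<lambda>x. of_real \<mu> *s u x)"
    unfolding square_integrable_iff_l2 using l2_scale[OF A(6)] l2_scale[OF B(6)] by simp
  ultimately show ?L unfolding ncho_eigenspace_def ncho_graph_def using wd by blast
qed

section \<open>Parameters and diagonalisation of the first-order part\<close>

locale ncho_params =
  fixes \<alpha> \<beta> :: real
  assumes pos: "\<alpha> > 0" "\<beta> > 0" and prod_gt_1: "\<alpha> * \<beta> > 1"
begin

text \<open>After scaling by the square roots of \<alpha> and \<beta>, the first-order part acts on
  its two eigencombinations as plus or minus i \<open>gam\<close>, and completing the square lowers
  the frequency from 1 to \<open>kap\<close>. In these combinations the inverse of diag(\<alpha>,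
  \<beta>) has diagonal entry \<open>ca\<close> and off-diagonal entry \<open>cb\<close>.\<close>

definition kap :: real where "kap = sqrt (1 - 1 / (\<alpha> * \<beta>))"
definition gam :: real where "gam = 1 / (sqrt \<alpha> * sqrt \<beta>)"
definition dlt :: real where "dlt = gam / kap"
definition ca :: real where "ca = (1 / \<alpha> + 1 / \<beta>) / 2"
definition cb :: real where "cb = (1 / \<alpha> - 1 / \<beta>) / 2"

definition sg :: "bool \<Rightarrow> real" where "sg s = (if s then 1 else - 1)"

lemma sg_simps [simp]: "sg True = 1" "sg False = -1" "sg (\<not> s) = - sg s" "sg s * sg s = 1" "sg s * (sg s * x) = x"
  by (auto simp: sg_def)

lemma kap_pos: "kap > 0" and kap_gam: "kap\<^sup>2 + gam\<^sup>2 = 1" and gam_dlt: "gam = dlt * kap"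
proof -
  have "1 / (\<alpha> * \<beta>) < 1" using prod_gt_1 by simp
  then show k: "kap > 0" by (simp add: kap_def)
  have "kap\<^sup>2 = 1 - 1 / (\<alpha> * \<beta>)" unfolding kap_def using \<open>1 / (\<alpha> * \<beta>) < 1\<close> by simp
  moreover have "gam\<^sup>2 = 1 / (\<alpha> * \<beta>)" unfolding gam_def using pos by (simp add: power_divide power_mult_distrib)
  ultimately show "kap\<^sup>2 + gam\<^sup>2 = 1" by simp
  show "gam = dlt * kap" using k by (simp add: dlt_def)
qed

lemma ca_pos: "ca > 0" using pos by (simp add: ca_def add_pos_pos)

end

text \<open>The identity behind the conjugation, freed of functions. The first condition cancels the
  terms in Q1 and the constant multiples of Q; the second lets the coefficients of y^2 Q add up to
  1.\<close>

lemma chirp_algebra_fwd: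
  fixes S g d y Q Q1 R :: complex
  assumes a: "S\<^sup>2 * g = d" and b: "(S\<^sup>2)\<^sup>2 = 1 + d\<^sup>2"
  shows "(- \<i> * d - d\<^sup>2 * y\<^sup>2) * Q - 2 * \<i> * d * y * S * Q1 + S\<^sup>2 * ((S * y)\<^sup>2 * Q + 2 * \<i> * g * (S * y * Q1 + Q / 2) - 2 * R)
     = y\<^sup>2 * Q - 2 * (S\<^sup>2 * R)"
proof -
  have "S\<^sup>2 * ((S * y)\<^sup>2 * Q + 2 * \<i> * g * (S * y * Q1 + Q / 2) - 2 * R)
     = (S\<^sup>2)\<^sup>2 * y\<^sup>2 * Q + 2 * \<i> * (S\<^sup>2 * g) * (S * y * Q1 + Q / 2) - 2 * (S\<^sup>2 * R)"
    by (simp add: algebra_simps power2_eq_square)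
  then show ?thesis unfolding a b by (simp add: algebra_simps)
qed

lemma dom2_chirp_fwd:
  fixes k g d :: real
  assumes q: "dom2 q q1 (\<lambda>x. of_real (x\<^sup>2) * q x + 2 * \<i> * of_real g * (of_real x * q1 x + q x / 2) - 2 * R x)"
    and k: "k > 0" "k\<^sup>2 + g\<^sup>2 = 1" and d: "g = d * k"
  shows "\<exists>p. dom2 (\<lambda>y. cis (- (d / 2) * y\<^sup>2) * q (1 / sqrt k * y)) p
    (\<lambda>y. of_real (y\<^sup>2) * (cis (- (d / 2) * y\<^sup>2) * q (1 / sqrt k * y)) - 2 * (cis (- (d / 2) * y\<^sup>2) * R (1 / sqrt k * y) / of_real k))"
proof -
  define S where "S = 1 / sqrt k"
  have S: "S \<noteq> 0" using k by (simp add: S_def)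
  have S2: "S\<^sup>2 = 1 / k" using k by (simp add: S_def power_divide)
  have a: "S\<^sup>2 * g = d" using k d by (simp add: S2)
  have b: "(S\<^sup>2)\<^sup>2 = 1 + d\<^sup>2"
  proof -
    have "k\<^sup>2 * (1 + d\<^sup>2) = 1" using k(2) d by (simp add: algebra_simps power_mult_distrib)
    then show ?thesis using k by (simp add: S2 field_simps)
  qed
  have ac: "(complex_of_real S)\<^sup>2 * of_real g = of_real d" "((complex_of_real S)\<^sup>2)\<^sup>2 = 1 + (of_real d)\<^sup>2"
    using arg_cong[OF a, of complex_of_real] arg_cong[OF b, of complex_of_real]
    by (simp_all only: of_real_power of_real_mult of_real_add of_real_1)
  let ?c = "- (d / 2)"
  define p where "p y = cis (?c * y\<^sup>2) * (2 * \<i> * of_real (?c * y) * q (S * y) + of_real S * q1 (S * y))" for y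
  note * = dom2_chirp[OF q S, of ?c, folded p_def]
  have "(\<lambda>y. cis (?c * y\<^sup>2) * ((2 * \<i> * of_real ?c - of_real (4 * ?c\<^sup>2 * y\<^sup>2)) * q (S * y)
        + 4 * \<i> * of_real (?c * y * S) * q1 (S * y) + of_real (S\<^sup>2) *
          (of_real ((S * y)\<^sup>2) * q (S * y) + 2 * \<i> * of_real g * (of_real (S * y) * q1 (S * y) + q (S * y) / 2) - 2 * R (S * y))))
     = (\<lambda>y. of_real (y\<^sup>2) * (cis (?c * y\<^sup>2) * q (S * y)) - 2 * (cis (?c * y\<^sup>2) * R (S * y) / of_real k))" (is "?l = ?r")
  proof
    fix y
    have "?l y = cis (?c * y\<^sup>2) * ((- \<i> * of_real d - (of_real d)\<^sup>2 * (of_real y)\<^sup>2) * q (S * y) - 2 * \<i> * of_real d * of_real y * of_real S * q1 (S * y)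
       + (of_real S)\<^sup>2 * ((of_real S * of_real y)\<^sup>2 * q (S * y) + 2 * \<i> * of_real g * (of_real S * of_real y * q1 (S * y) + q (S * y) / 2) - 2 * R (S * y)))"
      by (rule arg_cong[where f = "\<lambda>z. cis (?c * y\<^sup>2) * z"]) (simp add: power_divide)
    also have "\<dots> = cis (?c * y\<^sup>2) * ((of_real y)\<^sup>2 * q (S * y) - 2 * ((of_real S)\<^sup>2 * R (S * y)))"
      unfolding chirp_algebra_fwd[OF ac] ..
    also have "(complex_of_real S)\<^sup>2 = 1 / of_real k" using S2 by (simp flip: of_real_power)
    finally show "?l y = ?r y" by (simp add: algebra_simps)
  qed
  from *[unfolded this] show ?thesis unfolding S_def by (rule exI[where x = p])
qed

lemma chirp_algebra_bwd:
  fixes S g K x V V1 F :: complex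
  assumes a: "S\<^sup>2 = K" and b: "K\<^sup>2 + g\<^sup>2 = 1"
  shows "(\<i> * g - g\<^sup>2 * x\<^sup>2) * V + 2 * \<i> * g * x * S * V1 + K * ((S * x)\<^sup>2 * V - 2 * F)
    = x\<^sup>2 * V + 2 * \<i> * g * (x * (\<i> * g * x * V + S * V1) + V / 2) - 2 * (K * F)"
proof -
  have "K * ((S * x)\<^sup>2 * V - 2 * F) = K\<^sup>2 * x\<^sup>2 * V - 2 * (K * F)"
    unfolding power_mult_distrib a by (simp add: algebra_simps power2_eq_square)
  moreover have "K\<^sup>2 = 1 - g\<^sup>2" using b by (simp add: eq_diff_eq)
  ultimately have "K * ((S * x)\<^sup>2 * V - 2 * F) = (1 - g\<^sup>2) * x\<^sup>2 * V - 2 * (K * F)" by (simp only:)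
  then show ?thesis by (simp add: algebra_simps power2_eq_square)
qed

lemma dom2_chirp_bwd:
  fixes k g d :: real
  assumes q: "dom2 V V1 (\<lambda>y. of_real (y\<^sup>2) * V y - 2 * F y)"
    and k: "k > 0" "k\<^sup>2 + g\<^sup>2 = 1" and d: "g = d * k"
  defines "Q \<equiv> \<lambda>x. cis (g / 2 * x\<^sup>2) * V (sqrt k * x)"
  shows "\<exists>q1. dom2 Q q1 (\<lambda>x. of_real (x\<^sup>2) * Q x + 2 * \<i> * of_real g * (of_real x * q1 x + Q x / 2)
     - 2 * (of_real k * (cis (g / 2 * x\<^sup>2) * F (sqrt k * x))))"
proof -
  define S where "S = sqrt k"
  have S: "S \<noteq> 0" using k by (simp add: S_def)
  have "(complex_of_real S)\<^sup>2 = of_real k" using k by (simp add: S_def flip: of_real_power)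
  moreover have "(complex_of_real k)\<^sup>2 + (of_real g)\<^sup>2 = 1"
    using arg_cong[OF k(2), of complex_of_real] by (simp only: of_real_add of_real_power of_real_1)
  ultimately have ac: "(complex_of_real S)\<^sup>2 = of_real k" "(complex_of_real k)\<^sup>2 + (of_real g)\<^sup>2 = 1" .
  \<comment> \<open>The first derivative occurs inside the prescribed second derivative, so the
    witness has to be the very derivative that \<open>dom2_chirp\<close> produces.\<close>
  define q1 where "q1 x = cis (g / 2 * x\<^sup>2) * (2 * \<i> * of_real (g / 2 * x) * V (S * x) + of_real S * V1 (S * x))" for x
  have *: "dom2 Q q1 (\<lambda>x. cis (g / 2 * x\<^sup>2) * ((2 * \<i> * of_real (g / 2) - of_real (4 * (g / 2)\<^sup>2 * x\<^sup>2)) * V (S * x)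
        + 4 * \<i> * of_real (g / 2 * x * S) * V1 (S * x) + of_real (S\<^sup>2) * (of_real ((S * x)\<^sup>2) * V (S * x) - 2 * F (S * x))))"
    unfolding Q_def q1_def S_def[symmetric] by (rule dom2_chirp[OF q S])
  have "(\<lambda>x. cis (g / 2 * x\<^sup>2) * ((2 * \<i> * of_real (g / 2) - of_real (4 * (g / 2)\<^sup>2 * x\<^sup>2)) * V (S * x)
        + 4 * \<i> * of_real (g / 2 * x * S) * V1 (S * x) + of_real (S\<^sup>2) * (of_real ((S * x)\<^sup>2) * V (S * x) - 2 * F (S * x))))
    = (\<lambda>x. of_real (x\<^sup>2) * Q x + 2 * \<i> * of_real g * (of_real x * q1 x + Q x / 2)
     - 2 * (of_real k * (cis (g / 2 * x\<^sup>2) * F (S * x))))" (is "?l = ?r")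
  proof
    fix x
    have "?l x = cis (g / 2 * x\<^sup>2) * ((\<i> * of_real g - (of_real g)\<^sup>2 * (of_real x)\<^sup>2) * V (S * x) + 2 * \<i> * of_real g * of_real x * of_real S * V1 (S * x)
      + of_real k * ((of_real S * of_real x)\<^sup>2 * V (S * x) - 2 * F (S * x)))"
      by (rule arg_cong[where f = "\<lambda>z. cis (g / 2 * x\<^sup>2) * z"]) (simp add: power_divide ac(1))
    also have "\<dots> = cis (g / 2 * x\<^sup>2) * ((of_real x)\<^sup>2 * V (S * x) + 2 * \<i> * of_real g * (of_real x * (\<i> * of_real g * of_real x * V (S * x) + of_real S * V1 (S * x)) + V (S * x) / 2)
      - 2 * (of_real k * F (S * x)))"
      unfolding chirp_algebra_bwd[OF ac] ..
    also have "\<dots> = ?r x"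
      unfolding Q_def q1_def S_def[symmetric] by (simp add: algebra_simps power2_eq_square)
    finally show "?l x = ?r x" .
  qed
  from *[unfolded this] show ?thesis unfolding S_def by (rule exI[where x = q1])
qed

context ncho_params
begin

definition qc :: "(real \<Rightarrow> complex^2) \<Rightarrow> bool \<Rightarrow> real \<Rightarrow> complex" where
  "qc u s x = of_real (sqrt \<alpha> / 2) * u x $ 1 + of_real (sg s) * \<i> * of_real (sqrt \<beta> / 2) * u x $ 2"

definition toV :: "(real \<Rightarrow> complex^2) \<Rightarrow> bool \<Rightarrow> real \<Rightarrow> complex" where
  "toV u s y = cis (- (sg s * dlt / 2) * y\<^sup>2) * qc u s (1 / sqrt kap * y)"

definition qV :: "(bool \<Rightarrow> real \<Rightarrow> complex) \<Rightarrow> bool \<Rightarrow> real \<Rightarrow> complex" where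
  "qV V s x = cis (sg s * gam / 2 * x\<^sup>2) * V s (sqrt kap * x)"

definition toU :: "(bool \<Rightarrow> real \<Rightarrow> complex) \<Rightarrow> real \<Rightarrow> complex^2" where
  "toU V x = vec2 (of_real (1 / sqrt \<alpha>) * (qV V True x + qV V False x)) (- \<i> * of_real (1 / sqrt \<beta>) * (qV V True x - qV V False x))"

text \<open>The right side of the coupled system H V = Fo with H = (- D^2 + y^2) / 2;
  \<open>osc\<close> is this system solved for the second derivative.\<close>

definition Fo :: "real \<Rightarrow> (bool \<Rightarrow> real \<Rightarrow> complex) \<Rightarrow> bool \<Rightarrow> real \<Rightarrow> complex" where
  "Fo \<mu> V s y = of_real (\<mu> / kap) * (of_real ca * V s y + of_real cb * (cis (- (sg s * dlt) * y\<^sup>2) * V (\<not> s) y))"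

definition osc :: "real \<Rightarrow> (bool \<Rightarrow> real \<Rightarrow> complex) \<Rightarrow> bool" where
  "osc \<mu> V \<longleftrightarrow> (\<forall>s. \<exists>p. dom2 (V s) p (\<lambda>y. of_real (y\<^sup>2) * V s y - 2 * Fo \<mu> V s y))"

lemma toU_toV: "toU (toV u) = u"
proof
  fix x
  have k: "sqrt kap \<noteq> 0" "(sqrt kap)\<^sup>2 = kap" using kap_pos by auto
  have "qV (toV u) s x = qc u s x" for s
  proof -
    have "cis (sg s * gam / 2 * x\<^sup>2) * cis (- (sg s * dlt / 2) * (sqrt kap * x)\<^sup>2) = 1"
      unfolding cis_mult power_mult_distrib k gam_dlt by (simp add: algebra_simps)
    then show ?thesis unfolding qV_def toV_def using k by (simp flip: mult.assoc)
  qed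
  then show "toU (toV u) x = u x"
    using pos by (intro vec2_eqI) (simp_all add: toU_def qc_def algebra_simps)
qed

lemma qc_toU: "qc (toU V) s = qV V s"
  using pos by (cases s) (auto simp: qc_def toU_def fun_eq_iff algebra_simps)

lemma toV_toU: "toV (toU V) = V"
proof (intro ext)
  fix s y
  have k: "sqrt kap \<noteq> 0" "(sqrt kap)\<^sup>2 = kap" "kap \<noteq> 0" using kap_pos by auto
  have "cis (- (sg s * dlt / 2) * y\<^sup>2) * cis (sg s * gam / 2 * (1 / sqrt kap * y)\<^sup>2) = 1"
    unfolding cis_mult power_mult_distrib power_divide k(2) gam_dlt using k by (simp add: algebra_simps)
  then show "toV (toU V) s y = V s y"
    unfolding toV_def qc_toU qV_def using k by (simp flip: mult.assoc)
qed

lemma sg_kap: "kap\<^sup>2 + (sg s * gam)\<^sup>2 = 1"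
  using kap_gam by (simp add: sg_def)

lemma eigenspace_imp_osc:
  assumes u: "u \<in> ncho_eigenspace \<alpha> \<beta> (of_real \<mu>)"
  shows "osc \<mu> (toV u)"
  unfolding osc_def
proof
  fix s
  have nz: "\<alpha> \<noteq> 0" "\<beta> \<noteq> 0" using pos by auto
  obtain p1 p2 where d1: "dom2 (\<lambda>x. u x $ 1) p1 (\<lambda>x. of_real (x\<^sup>2) * u x $ 1 - 2 / of_real \<alpha> * (of_real \<mu> * u x $ 1 + (of_real x * p2 x + u x $ 2 / 2)))"
    and d2: "dom2 (\<lambda>x. u x $ 2) p2 (\<lambda>x. of_real (x\<^sup>2) * u x $ 2 - 2 / of_real \<beta> * (of_real \<mu> * u x $ 2 - (of_real x * p1 x + u x $ 1 / 2)))"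
    using u unfolding ncho_eigenspace_dom2[OF nz] by (elim exE conjE) (rule that)
  define A B where "A = complex_of_real (sqrt \<alpha> / 2)" and "B = of_real (sg s) * \<i> * complex_of_real (sqrt \<beta> / 2)"
  define g where "g = sg s * gam"
  define q1 where "q1 x = A * p1 x + B * p2 x" for x
  define R where "R x = of_real \<mu> * (of_real ca * qc u s x + of_real cb * qc u (\<not> s) x)" for x
  have q: "qc u s = (\<lambda>x. A * u x $ 1 + B * u x $ 2)" "qc u (\<not> s) = (\<lambda>x. A * u x $ 1 - B * u x $ 2)"
    by (auto simp: fun_eq_iff qc_def A_def B_def)
  have ra: "sqrt \<alpha> * sqrt \<alpha> = \<alpha>" "sqrt \<beta> * sqrt \<beta> = \<beta>" "sqrt \<alpha> > 0" "sqrt \<beta> > 0" using pos by auto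
  have "sqrt \<alpha> / 2 / \<alpha> = gam * (sqrt \<beta> / 2)" "sqrt \<beta> / 2 / \<beta> = gam * (sqrt \<alpha> / 2)"
    unfolding gam_def using ra nz by (simp_all add: field_simps)
  from this[THEN arg_cong[where f = complex_of_real]]
  have "complex_of_real (sqrt \<alpha> / 2) / of_real \<alpha> = of_real gam * of_real (sqrt \<beta> / 2)" "complex_of_real (sqrt \<beta> / 2) / of_real \<beta> = of_real gam * of_real (sqrt \<alpha> / 2)"
    by (simp_all only: of_real_divide of_real_mult)
  then have e0: "A / of_real \<alpha> = of_real gam * of_real (sqrt \<beta> / 2)" "B / of_real \<beta> = of_real (sg s) * \<i> * (of_real gam * of_real (sqrt \<alpha> / 2))"
    unfolding A_def B_def times_divide_eq_right[symmetric] by (simp_all only:)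
  \<comment> \<open>With \<open>e'\<close> this says that the row (A, B) is an eigenvector of the
    scaled antisymmetric matrix, with eigenvalue given by i g: the combination \<open>qc\<close>
    decouples the first-order part.\<close>
  have e: "A / of_real \<alpha> = - (\<i> * of_real g * B)"
    unfolding e0 B_def g_def by (cases s) (simp_all add: algebra_simps)
  have e': "B / of_real \<beta> = \<i> * of_real g * A"
    unfolding e0 unfolding A_def g_def by (cases s) (simp_all add: algebra_simps)
  have f: "of_real ca + of_real cb = 1 / complex_of_real \<alpha>" "of_real ca - of_real cb = 1 / complex_of_real \<beta>"
    by (simp_all add: ca_def cb_def field_simps)
  have dq: "dom2 (qc u s) q1 (\<lambda>x. of_real (x\<^sup>2) * qc u s x + 2 * \<i> * of_real g * (of_real x * q1 x + qc u s x / 2) - 2 * R x)"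
  proof -
    have "A * (of_real (x\<^sup>2) * u x $ 1 - 2 / of_real \<alpha> * (of_real \<mu> * u x $ 1 + (of_real x * p2 x + u x $ 2 / 2)))
      + B * (of_real (x\<^sup>2) * u x $ 2 - 2 / of_real \<beta> * (of_real \<mu> * u x $ 2 - (of_real x * p1 x + u x $ 1 / 2)))
      = of_real (x\<^sup>2) * qc u s x + 2 * \<i> * of_real g * (of_real x * q1 x + qc u s x / 2) - 2 * R x" (is "?l = ?r") for x
    proof -
      have "?l = of_real (x\<^sup>2) * qc u s x - 2 * of_real \<mu> * (A * (1 / of_real \<alpha>) * u x $ 1 + B * (1 / of_real \<beta>) * u x $ 2)
         - 2 * (A / of_real \<alpha>) * (of_real x * p2 x + u x $ 2 / 2) + 2 * (B / of_real \<beta>) * (of_real x * p1 x + u x $ 1 / 2)"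
        unfolding q by (simp add: algebra_simps)
      also have "\<dots> = ?r" unfolding e e' f[symmetric] R_def q q1_def by (simp add: algebra_simps)
      finally show ?thesis .
    qed
    then show ?thesis using dom2_add[OF dom2_scale[OF d1, of A] dom2_scale[OF d2, of B]] unfolding q q1_def[abs_def] by simp
  qed
  have kg: "kap\<^sup>2 + g\<^sup>2 = 1" "g = (sg s * dlt) * kap" using sg_kap[of s] by (simp_all add: g_def gam_dlt)
  from dom2_chirp_fwd[OF dq kap_pos kg] obtain p where
    p: "dom2 (\<lambda>y. cis (- (sg s * dlt / 2) * y\<^sup>2) * qc u s (1 / sqrt kap * y)) p
    (\<lambda>y. of_real (y\<^sup>2) * (cis (- (sg s * dlt / 2) * y\<^sup>2) * qc u s (1 / sqrt kap * y)) - 2 * (cis (- (sg s * dlt / 2) * y\<^sup>2) * R (1 / sqrt kap * y) / of_real kap))"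
    ..
  \<comment> \<open>The chirps of the two signs differ by the factor cis (- (sg s dlt) y^2), which
    is the one coupling V s to V (\<not> s) in \<open>Fo\<close>.\<close>
  have Feq: "cis (- (sg s * dlt / 2) * y\<^sup>2) * R (1 / sqrt kap * y) / of_real kap = Fo \<mu> (toV u) s y" for y
  proof -
    have "cis (- (sg s * dlt / 2) * y\<^sup>2) = cis (- (sg s * dlt) * y\<^sup>2) * cis (- (sg (\<not> s) * dlt / 2) * y\<^sup>2)"
      unfolding cis_mult by (rule arg_cong[where f = cis]) (simp add: field_simps)
    then have "cis (- (sg s * dlt / 2) * y\<^sup>2) * qc u (\<not> s) (1 / sqrt kap * y) = cis (- (sg s * dlt) * y\<^sup>2) * toV u (\<not> s) y"
      unfolding toV_def by simp
    then show ?thesis unfolding R_def Fo_def by (simp add: toV_def[of u s] algebra_simps add_divide_distrib)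
  qed
  have Veq: "toV u s = (\<lambda>y. cis (- (sg s * dlt / 2) * y\<^sup>2) * qc u s (1 / sqrt kap * y))"
    by (simp only: fun_eq_iff toV_def simp_thms)
  show "\<exists>p. dom2 (toV u s) p (\<lambda>y. of_real (y\<^sup>2) * toV u s y - 2 * Fo \<mu> (toV u) s y)"
    unfolding Feq[symmetric] Veq by (rule exI[where x = p]) (rule p)
qed

lemma osc_imp_eigenspace:
  assumes V: "osc \<mu> V"
  shows "toU V \<in> ncho_eigenspace \<alpha> \<beta> (of_real \<mu>)"
proof -
  have nz: "\<alpha> \<noteq> 0" "\<beta> \<noteq> 0" using pos by auto
  have "\<exists>q1. dom2 (qV V s) q1 (\<lambda>x. of_real (x\<^sup>2) * qV V s x + 2 * \<i> * of_real (sg s * gam) * (of_real x * q1 x + qV V s x / 2)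
      - 2 * (of_real \<mu> * (of_real ca * qV V s x + of_real cb * qV V (\<not> s) x)))" for s
  proof -
    obtain p where p: "dom2 (V s) p (\<lambda>y. of_real (y\<^sup>2) * V s y - 2 * Fo \<mu> V s y)" using V unfolding osc_def by blast
    have Feq: "of_real kap * (cis (sg s * gam / 2 * x\<^sup>2) * Fo \<mu> V s (sqrt kap * x)) = of_real \<mu> * (of_real ca * qV V s x + of_real cb * qV V (\<not> s) x)" for x
    proof -
      have k: "(sqrt kap)\<^sup>2 = kap" using kap_pos by auto
      have "cis (sg s * gam / 2 * x\<^sup>2) * cis (- (sg s * dlt) * (sqrt kap * x)\<^sup>2) = cis (sg (\<not> s) * gam / 2 * x\<^sup>2)"
        unfolding cis_mult power_mult_distrib k gam_dlt by (rule arg_cong[where f = cis]) (simp add: field_simps)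
      then have "cis (sg s * gam / 2 * x\<^sup>2) * (cis (- (sg s * dlt) * (sqrt kap * x)\<^sup>2) * V (\<not> s) (sqrt kap * x)) = qV V (\<not> s) x"
        unfolding qV_def by (simp only: mult.assoc[symmetric])
      moreover have "cis (sg s * gam / 2 * x\<^sup>2) * Fo \<mu> V s (sqrt kap * x) = of_real (\<mu> / kap) * (of_real ca * qV V s x
          + of_real cb * (cis (sg s * gam / 2 * x\<^sup>2) * (cis (- (sg s * dlt) * (sqrt kap * x)\<^sup>2) * V (\<not> s) (sqrt kap * x))))"
        unfolding Fo_def qV_def by (simp add: algebra_simps)
      ultimately show ?thesis using kap_pos by simp
    qed
    have X: "sg s * gam = (sg s * dlt) * kap" by (simp add: gam_dlt)
    show ?thesis
      using dom2_chirp_bwd[OF p kap_pos sg_kap[of s] X] unfolding qV_def[of V s, symmetric] Feq .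
  qed
  then have ex: "\<forall>s. \<exists>q1. dom2 (qV V s) (q1) (\<lambda>x. of_real (x\<^sup>2) * qV V s x + 2 * \<i> * of_real (sg s * gam) * (of_real x * q1 x + qV V s x / 2)
      - 2 * (of_real \<mu> * (of_real ca * qV V s x + of_real cb * qV V (\<not> s) x)))" by (rule allI)
  from choice[OF ex] obtain q1 where q1': "\<forall>s. dom2 (qV V s) (q1 s) (\<lambda>x. of_real (x\<^sup>2) * qV V s x + 2 * \<i> * of_real (sg s * gam) * (of_real x * q1 s x + qV V s x / 2)
      - 2 * (of_real \<mu> * (of_real ca * qV V s x + of_real cb * qV V (\<not> s) x)))" ..
  note q1 = q1'[rule_format]
  define A B where "A = complex_of_real (1 / sqrt \<alpha>)" and "B = - \<i> * complex_of_real (1 / sqrt \<beta>)"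
  have ra: "sqrt \<alpha> * sqrt \<alpha> = \<alpha>" "sqrt \<beta> * sqrt \<beta> = \<beta>" "sqrt \<alpha> > 0" "sqrt \<beta> > 0" using pos by auto
  have "1 / sqrt \<alpha> * gam = 1 / \<alpha> * (1 / sqrt \<beta>)" "1 / sqrt \<beta> * gam = 1 / \<beta> * (1 / sqrt \<alpha>)"
    unfolding gam_def using ra nz by (simp_all add: field_simps)
  from this[THEN arg_cong[where f = complex_of_real]]
  have "complex_of_real (1 / sqrt \<alpha>) * of_real gam = 1 / of_real \<alpha> * of_real (1 / sqrt \<beta>)" "complex_of_real (1 / sqrt \<beta>) * of_real gam = 1 / of_real \<beta> * of_real (1 / sqrt \<alpha>)"
    by (simp_all only: of_real_divide of_real_mult of_real_1)
  \<comment> \<open>The inverse change of basis: these relations reassemble the two decoupled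
    first-order terms into those of the components of u.\<close>
  then have e: "\<i> * of_real gam * A = - (1 / of_real \<alpha> * B)" "\<i> * of_real gam * B = 1 / of_real \<beta> * A"
    unfolding A_def B_def by (simp_all add: mult_ac)
  have f: "of_real ca + of_real cb = 1 / complex_of_real \<alpha>" "of_real ca - of_real cb = 1 / complex_of_real \<beta>"
    by (simp_all add: ca_def cb_def field_simps)
  have u: "(\<lambda>x. toU V x $ 1) = (\<lambda>x. A * qV V True x + A * qV V False x)" "(\<lambda>x. toU V x $ 2) = (\<lambda>x. B * qV V True x + - B * qV V False x)"
    by (auto simp: toU_def A_def B_def algebra_simps)
  define p1 p2 where "p1 x = A * q1 True x + A * q1 False x" and "p2 x = B * q1 True x + - B * q1 False x" for x
  have d1: "dom2 (\<lambda>x. toU V x $ 1) p1 (\<lambda>x. of_real (x\<^sup>2) * toU V x $ 1 - 2 / of_real \<alpha> * (of_real \<mu> * toU V x $ 1 + (of_real x * p2 x + toU V x $ 2 / 2)))"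
  proof -
    have "A * (of_real (x\<^sup>2) * qV V True x + 2 * \<i> * of_real (sg True * gam) * (of_real x * q1 True x + qV V True x / 2) - 2 * (of_real \<mu> * (of_real ca * qV V True x + of_real cb * qV V (\<not> True) x)))
     + A * (of_real (x\<^sup>2) * qV V False x + 2 * \<i> * of_real (sg False * gam) * (of_real x * q1 False x + qV V False x / 2) - 2 * (of_real \<mu> * (of_real ca * qV V False x + of_real cb * qV V (\<not> False) x)))
     = of_real (x\<^sup>2) * toU V x $ 1 - 2 / of_real \<alpha> * (of_real \<mu> * toU V x $ 1 + (of_real x * p2 x + toU V x $ 2 / 2))" (is "?l = ?r") for x
    proof -
      have "?l = of_real (x\<^sup>2) * toU V x $ 1 + 2 * (\<i> * of_real gam * A) * (of_real x * (q1 True x - q1 False x) + (qV V True x - qV V False x) / 2)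
         - 2 * of_real \<mu> * (of_real ca + of_real cb) * toU V x $ 1"
        unfolding u[THEN fun_cong] by (simp add: algebra_simps add_divide_distrib diff_divide_distrib)
      also have "\<dots> = ?r" unfolding e f u[THEN fun_cong] p2_def by (simp add: algebra_simps add_divide_distrib diff_divide_distrib)
      finally show ?thesis .
    qed
    then show ?thesis using dom2_add[OF dom2_scale[OF q1[of True], of A] dom2_scale[OF q1[of False], of A]] unfolding u(1)[symmetric] p1_def[abs_def] by simp
  qed
  have d2: "dom2 (\<lambda>x. toU V x $ 2) p2 (\<lambda>x. of_real (x\<^sup>2) * toU V x $ 2 - 2 / of_real \<beta> * (of_real \<mu> * toU V x $ 2 - (of_real x * p1 x + toU V x $ 1 / 2)))"
  proof -
    have "B * (of_real (x\<^sup>2) * qV V True x + 2 * \<i> * of_real (sg True * gam) * (of_real x * q1 True x + qV V True x / 2) - 2 * (of_real \<mu> * (of_real ca * qV V True x + of_real cb * qV V (\<not> True) x)))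
     + - B * (of_real (x\<^sup>2) * qV V False x + 2 * \<i> * of_real (sg False * gam) * (of_real x * q1 False x + qV V False x / 2) - 2 * (of_real \<mu> * (of_real ca * qV V False x + of_real cb * qV V (\<not> False) x)))
     = of_real (x\<^sup>2) * toU V x $ 2 - 2 / of_real \<beta> * (of_real \<mu> * toU V x $ 2 - (of_real x * p1 x + toU V x $ 1 / 2))" (is "?l = ?r") for x
    proof -
      have "?l = of_real (x\<^sup>2) * toU V x $ 2 + 2 * (\<i> * of_real gam * B) * (of_real x * (q1 True x + q1 False x) + (qV V True x + qV V False x) / 2)
         - 2 * of_real \<mu> * (of_real ca - of_real cb) * toU V x $ 2"
        unfolding u[THEN fun_cong] by (simp add: algebra_simps add_divide_distrib diff_divide_distrib)
      also have "\<dots> = ?r" unfolding e f u[THEN fun_cong] p1_def by (simp add: algebra_simps add_divide_distrib diff_divide_distrib)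
      finally show ?thesis .
    qed
    then show ?thesis using dom2_add[OF dom2_scale[OF q1[of True], of B] dom2_scale[OF q1[of False], of "- B"]] unfolding u(2)[symmetric] p2_def[abs_def] by simp
  qed
  show ?thesis unfolding ncho_eigenspace_dom2[OF nz] by (intro exI conjI) (rule d1, rule d2)
qed

end

section \<open>Eigenspaces as those of a Hilbert-Schmidt kernel\<close>

lemma cscale_Complex: "cscale (Complex p q) b = p *\<^sub>R b + q *\<^sub>R cscale \<i> b"
  by (rule ell2_eqI) (simp add: complex_eq_iff)

lemma inner_cscale_i_self: "x \<bullet> cscale \<i> x = 0"
  using inner_cscale_i_left[of x x] inner_commute[of "cscale \<i> x" x] by linarith

context hs_kernel
begin

definition orthonormal_eigenset :: "real \<Rightarrow> 'i ell2 set \<Rightarrow> bool" where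
  "orthonormal_eigenset \<nu> B \<longleftrightarrow> finite B \<and> (\<forall>x\<in>B. op x = \<nu> *\<^sub>R x) \<and>
     (\<forall>x\<in>B. \<forall>y\<in>B. x \<bullet> y = (if x = y then 1 else 0)) \<and> (\<forall>x\<in>B. \<forall>y\<in>B. x \<bullet> cscale \<i> y = 0)"

text \<open>A complex orthonormal basis of the eigenspace in terms of the real inner product:
  \<open>x \<bullet> b\<close> and \<open>x \<bullet> cscale \<i> b\<close> are the real and the
  imaginary part of the Hermitian coefficient of x along b.\<close>

definition eigenframe :: "real \<Rightarrow> 'i ell2 set \<Rightarrow> bool" where
  "eigenframe \<nu> B \<longleftrightarrow> orthonormal_eigenset \<nu> B \<and>
     (\<forall>x. op x = \<nu> *\<^sub>R x \<longrightarrow> x = (\<Sum>b\<in>B. cscale (Complex (x \<bullet> b) (x \<bullet> cscale \<i> b)) b))"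

lemma orthonormal_eigensetD:
  assumes "orthonormal_eigenset \<nu> B"
  shows "finite B" "\<And>x. x \<in> B \<Longrightarrow> op x = \<nu> *\<^sub>R x" "\<And>x y. x \<in> B \<Longrightarrow> y \<in> B \<Longrightarrow> x \<bullet> y = (if x = y then 1 else 0)"
    "\<And>x y. x \<in> B \<Longrightarrow> y \<in> B \<Longrightarrow> x \<bullet> cscale \<i> y = 0"
  using assms unfolding orthonormal_eigenset_def by blast+

lemma inner_combination:
  assumes B: "orthonormal_eigenset \<nu> B" and b: "b \<in> B"
  shows "(\<Sum>x\<in>B. cscale (z x) x) \<bullet> b = Re (z b)" "(\<Sum>x\<in>B. cscale (z x) x) \<bullet> cscale \<i> b = Im (z b)"
proof -
  note D = orthonormal_eigensetD[OF B]
  have z: "cscale (z x) x = Re (z x) *\<^sub>R x + Im (z x) *\<^sub>R cscale \<i> x" for x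
    using cscale_Complex[of "Re (z x)" "Im (z x)" x] by simp
  have "cscale (z x) x \<bullet> b = (if x = b then Re (z b) else 0)" "cscale (z x) x \<bullet> cscale \<i> b = (if x = b then Im (z b) else 0)" if "x \<in> B" for x
    unfolding z using that b by (auto simp: inner_add_left D(3) D(4) inner_cscale_i inner_cscale_i_left inner_cscale_i_self)
  then show "(\<Sum>x\<in>B. cscale (z x) x) \<bullet> b = Re (z b)" "(\<Sum>x\<in>B. cscale (z x) x) \<bullet> cscale \<i> b = Im (z b)"
    unfolding inner_sum_left using D(1) b by (simp_all add: sum.delta)
qed

lemma op_combination:
  assumes "finite B" "\<And>x. x \<in> B \<Longrightarrow> op x = \<nu> *\<^sub>R x"
  shows "op (\<Sum>x\<in>B. cscale (z x) x) = \<nu> *\<^sub>R (\<Sum>x\<in>B. cscale (z x) x)"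
proof -
  have lin: "linear op" by (rule bounded_linear.linear[OF bounded_linear_op])
  have "op (\<Sum>x\<in>B. cscale (z x) x) = (\<Sum>x\<in>B. op (cscale (z x) x))" by (rule linear_sum[OF lin])
  also have "\<dots> = (\<Sum>x\<in>B. \<nu> *\<^sub>R cscale (z x) x)" by (rule sum.cong) (simp_all add: op_cscale assms(2) cscale_scaleR)
  finally show ?thesis by (simp add: scaleR_sum_right)
qed

text \<open>Cardinalities of orthonormal families are bounded by
  \<open>orthonormal_eigen_bound\<close>, so a largest one exists. If some eigenvector were not its
  own projection, the normalised remainder could be added to the family.\<close>

lemma eigenframe_exists:
  assumes nu: "\<nu> \<noteq> 0"
  shows "\<exists>B. eigenframe \<nu> B"
proof -
  have bound: "\<forall>B. orthonormal_eigenset \<nu> B \<longrightarrow> card B < nat \<lceil>HS / \<nu>\<^sup>2\<rceil> + 1"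
  proof (intro allI impI)
    fix B assume B: "orthonormal_eigenset \<nu> B"
    have "real (card B) \<le> HS / \<nu>\<^sup>2"
      by (rule orthonormal_eigen_bound[OF orthonormal_eigensetD(1)[OF B] orthonormal_eigensetD(3)[OF B] orthonormal_eigensetD(2)[OF B] nu orthonormal_eigensetD(4)[OF B]])
    then show "card B < nat \<lceil>HS / \<nu>\<^sup>2\<rceil> + 1" by linarith
  qed
  have "orthonormal_eigenset \<nu> {}" by (simp add: orthonormal_eigenset_def)
  from Lattices_Big.ex_has_greatest_nat[OF this bound] obtain B where
    B: "orthonormal_eigenset \<nu> B" and max: "\<And>B'. orthonormal_eigenset \<nu> B' \<Longrightarrow> card B' \<le> card B" by auto
  note D = orthonormal_eigensetD[OF B]
  have "x = (\<Sum>b\<in>B. cscale (Complex (x \<bullet> b) (x \<bullet> cscale \<i> b)) b)" if x: "op x = \<nu> *\<^sub>R x" for x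
  proof (rule ccontr)
    define s where "s = (\<Sum>b\<in>B. cscale (Complex (x \<bullet> b) (x \<bullet> cscale \<i> b)) b)"
    define r where "r = x - s"
    define e where "e = (1 / norm r) *\<^sub>R r"
    assume "x \<noteq> (\<Sum>b\<in>B. cscale (Complex (x \<bullet> b) (x \<bullet> cscale \<i> b)) b)"
    then have r0: "norm r \<noteq> 0" by (simp add: r_def s_def)
    have rb: "r \<bullet> b = 0" "r \<bullet> cscale \<i> b = 0" if "b \<in> B" for b
      unfolding r_def s_def inner_diff_left inner_combination[OF B that] by simp_all
    have lin: "linear op" by (rule bounded_linear.linear[OF bounded_linear_op])
    have os: "op s = \<nu> *\<^sub>R s" unfolding s_def by (rule op_combination[OF D(1,2)])
    have "op r = \<nu> *\<^sub>R r"
      unfolding r_def linear_diff[OF lin] os x by (simp add: scaleR_diff_right)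
    then have oe: "op e = \<nu> *\<^sub>R e" unfolding e_def linear_scale[OF lin] by simp
    have ee: "e \<bullet> e = 1" using r0 by (simp add: e_def power2_norm_eq_inner[symmetric] power2_eq_square)
    have eb: "e \<bullet> b = 0" "e \<bullet> cscale \<i> b = 0" if "b \<in> B" for b using rb[OF that] by (simp_all add: e_def)
    have be: "b \<bullet> e = 0" "b \<bullet> cscale \<i> e = 0" if "b \<in> B" for b
      using eb[OF that] inner_cscale_i_left[of b e] inner_commute[of b e] inner_commute[of "cscale \<i> b" e] by simp_all
    have nB: "e \<notin> B" using eb(1)[of e] ee by auto
    have "orthonormal_eigenset \<nu> (insert e B)"
      unfolding orthonormal_eigenset_def using D oe ee eb be nB inner_cscale_i_self[of e] by auto
    from max[OF this] show False using nB D(1) by simp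
  qed
  then show ?thesis using B unfolding eigenframe_def by blast
qed

text \<open>Equal cardinalities allow the indices n with a given value \<open>lam n\<close> to be
  matched bijectively with a frame of the corresponding eigenspace. This makes the sequence of
  eigenvalues into a sequence of eigenvectors to which \<open>trace_cube\<close> applies.\<close>

lemma trace_cube_frames:
  fixes lam :: "nat \<Rightarrow> real"
  assumes kp: "\<kappa> > 0" and pos: "\<And>n. lam n > 0" and fin: "\<And>\<mu>. finite {n. lam n = \<mu>}"
    and mult: "\<And>\<mu> B. \<mu> \<noteq> 0 \<Longrightarrow> eigenframe (\<kappa> / \<mu>) B \<Longrightarrow> card {n. lam n = \<mu>} = card B"
    and tr: "((\<lambda>i. Re (coeff (op (op (op (basis_ell2 i)))) i)) has_sum T) UNIV"
  shows "(\<lambda>n. (\<kappa> / lam n) ^ 3) sums T"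
proof -
  \<comment> \<open>One frame and one enumeration per value \<mu>, not per index, so that equal
    eigenvalues receive distinct vectors of the same frame.\<close>
  have "\<forall>\<mu>. \<exists>B \<phi>. \<mu> \<noteq> 0 \<longrightarrow> eigenframe (\<kappa> / \<mu>) B \<and> bij_betw \<phi> {n. lam n = \<mu>} B"
  proof
    fix \<mu>
    show "\<exists>B \<phi>. \<mu> \<noteq> 0 \<longrightarrow> eigenframe (\<kappa> / \<mu>) B \<and> bij_betw \<phi> {n. lam n = \<mu>} B"
    proof (cases "\<mu> = 0")
      case False
      obtain B where B: "eigenframe (\<kappa> / \<mu>) B" using eigenframe_exists[of "\<kappa> / \<mu>"] kp False by auto
      have "finite B" using B by (simp add: eigenframe_def orthonormal_eigenset_def)
      from finite_same_card_bij[OF fin[of \<mu>] this mult[OF False B]] B show ?thesis by blast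
    qed simp
  qed
  from choice[OF this] obtain Bf where "\<forall>\<mu>. \<exists>\<phi>. \<mu> \<noteq> 0 \<longrightarrow> eigenframe (\<kappa> / \<mu>) (Bf \<mu>) \<and> bij_betw \<phi> {n. lam n = \<mu>} (Bf \<mu>)" ..
  from choice[OF this] obtain \<phi> where F: "\<And>\<mu>. \<mu> \<noteq> 0 \<Longrightarrow> eigenframe (\<kappa> / \<mu>) (Bf \<mu>)"
    and bij: "\<And>\<mu>. \<mu> \<noteq> 0 \<Longrightarrow> bij_betw (\<phi> \<mu>) {n. lam n = \<mu>} (Bf \<mu>)" by blast
  define b where "b n = \<phi> (lam n) n" for n
  have nz: "lam n \<noteq> 0" for n using pos[of n] by simp
  have onb: "orthonormal_eigenset (\<kappa> / lam n) (Bf (lam n))" for n using F[OF nz[of n]] unfolding eigenframe_def by blast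
  have bB: "b n \<in> Bf (lam n)" for n unfolding b_def using bij[OF nz[of n]] by (auto simp: bij_betw_def)
  have eig: "op (b n) = (\<kappa> / lam n) *\<^sub>R b n" for n using orthonormal_eigensetD(2)[OF onb bB] .
  have eig': "op (cscale \<i> (b n)) = (\<kappa> / lam n) *\<^sub>R cscale \<i> (b n)" for n by (simp only: op_cscale eig cscale_scaleR)
  have diff: "b i \<bullet> y = 0" if "lam i \<noteq> lam j" "op y = (\<kappa> / lam j) *\<^sub>R y" for i j y
  proof -
    have "(\<kappa> / lam i) * (b i \<bullet> y) = (\<kappa> / lam j) * (b i \<bullet> y)"
      using op_symmetric[of "b i" y] unfolding eig that(2) by simp
    then show ?thesis using that(1) kp nz[of i] nz[of j] by (auto simp: field_simps)
  qed
  have inj: "b i = b j \<longleftrightarrow> i = j" if "lam i = lam j" for i j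
    using bij_betw_imp_inj_on[OF bij[OF nz[of i]]] that unfolding b_def inj_on_def by auto
  show ?thesis
  proof (rule trace_cube[OF _ _ eig _ _ tr])
    show "b i \<bullet> b j = (if i = j then 1 else 0)" for i j
    proof (cases "lam i = lam j")
      case True
      then show ?thesis using orthonormal_eigensetD(3)[OF onb[of i] bB[of i], of "b j"] bB[of j] inj[OF True] by simp
    next
      case False
      then show ?thesis using diff[OF False eig] by auto
    qed
    show "b i \<bullet> cscale \<i> (b j) = 0" for i j
    proof (cases "lam i = lam j")
      case True
      then show ?thesis using orthonormal_eigensetD(4)[OF onb[of i] bB[of i], of "b j"] bB[of j] by simp
    next
      case False
      then show ?thesis using diff[OF False eig'] by auto
    qed
    show "\<kappa> / lam n \<ge> 0" for n using kp pos[of n] by simp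
    fix x c
    assume x: "op x = c *\<^sub>R x" "c \<noteq> 0" "\<And>n. b n \<bullet> x = 0" "\<And>n. cscale \<i> (b n) \<bullet> x = 0"
    \<comment> \<open>Any nonzero eigenvalue c, of either sign, is \<kappa> / \<mu> for some \<mu>.
      If no \<open>lam n\<close> equals \<mu>, its frame is empty and the expansion gives x = 0 at
      once.\<close>
    define \<mu> where "\<mu> = \<kappa> / c"
    have mu: "\<mu> \<noteq> 0" "\<kappa> / \<mu> = c" using x(2) kp by (auto simp: \<mu>_def)
    have "x = (\<Sum>y\<in>Bf \<mu>. cscale (Complex (x \<bullet> y) (x \<bullet> cscale \<i> y)) y)"
      using F[OF mu(1)] x(1) unfolding eigenframe_def mu(2) by blast
    also have "\<dots> = (\<Sum>y\<in>Bf \<mu>. 0)"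
    proof (rule sum.cong[OF refl])
      fix y assume "y \<in> Bf \<mu>"
      then obtain n where n: "lam n = \<mu>" "y = \<phi> \<mu> n" using bij[OF mu(1)] unfolding bij_betw_def by blast
      then have "y = b n" by (simp add: b_def)
      then have "x \<bullet> y = 0" "x \<bullet> cscale \<i> y = 0"
        using x(3)[of n] x(4)[of n] inner_commute[of x "b n"] inner_commute[of x "cscale \<i> (b n)"] by simp_all
      then show "cscale (Complex (x \<bullet> y) (x \<bullet> cscale \<i> y)) y = 0" by (simp add: Complex_eq)
    qed
    finally show "x = 0" by simp
  qed
qed

end

section \<open>The chirp matrix acting on coefficient sequences\<close>

lemma has_sum_bool_prod:
  fixes f :: "bool \<times> 'a \<Rightarrow> 'b::{topological_comm_monoid_add}"
  assumes "((\<lambda>a. f (True, a)) has_sum x) UNIV" "((\<lambda>a. f (False, a)) has_sum y) UNIV"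
  shows "(f has_sum (x + y)) UNIV"
proof -
  have U: "(UNIV :: (bool \<times> 'a) set) = range (Pair True) \<union> range (Pair False)"
  proof -
    have "(s, a) \<in> range (Pair True) \<union> range (Pair False)" for s and a :: 'a by (cases s) auto
    then show ?thesis by auto
  qed
  have "(f has_sum x) (range (Pair True))" "(f has_sum y) (range (Pair False))"
    using assms by (subst has_sum_reindex; simp add: inj_on_def o_def)+
  then show ?thesis unfolding U by (rule has_sum_Un_disjoint) auto
qed

lemma Umat_cnj: "Umat (- d) n m = cnj (Umat d n m)"
proof -
  have "cnj (Umat d n m) = (\<integral>x. cnj (of_real (hf n x) * (cis (- d * x\<^sup>2) * of_real (hf m x))) \<partial>lborel)"
    unfolding Umat_def
    by (rule integral_bounded_linear[OF bounded_linear_cnj l2_mult_integrable[OF hf_l2c uf_l2[unfolded uf_def[abs_def]]], symmetric])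
  then show ?thesis unfolding Umat_def by (simp add: cis_cnj)
qed

lemma uf_parseval: "(\<lambda>m. (cmod (hc (uf d n) m))\<^sup>2) sums (\<integral>x. (cmod (uf d n x))\<^sup>2 \<partial>lborel)"
proof (rule parseval(2))
  show "uf d n \<in> borel_measurable borel" by measurable
  show "cmod (uf d n x) \<le> real n + 2" for x unfolding cmod_uf by (rule hf_abs_le)
  show "integrable lborel (uf d n)"
  proof -
    obtain C where C: "\<bar>x\<bar> ^ 0 * \<bar>hf n x\<bar> \<le> C * exp (- x\<^sup>2 / 4)" for x using hf_decay[of 0 n] by blast
    have "integrable lborel (\<lambda>x. C * exp (- (1/4) * x\<^sup>2))" by (intro integrable_mult_right gauss_integrable) simp
    moreover have "norm (uf d n x) \<le> norm (C * exp (- (1/4) * x\<^sup>2))" for x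
      using C[of x] by (simp add: cmod_uf)
    ultimately show ?thesis by - (rule Bochner_Integration.integrable_bound[where f = "\<lambda>x. C * exp (- (1/4) * x\<^sup>2)"], auto)
  qed
  have "continuous_on UNIV (uf d n)" unfolding uf_def[abs_def] by (intro continuous_intros)
  then show "AE x in lborel. isCont (uf d n) x" by (simp add: continuous_on_eq_continuous_at)
qed

text \<open>Parseval is needed only for the chirped Hermite function, so g may be an arbitrary
  element of L2.\<close>

lemma chirp_hc:
  assumes g: "l2 g"
  shows "(\<lambda>m. Umat d n m * hc g m) sums hc (\<lambda>y. cis (- d * y\<^sup>2) * g y) n"
proof -
  have "(\<lambda>m. hc (uf d n) m * hc g m) sums (\<integral>x. uf d n x * g x \<partial>lborel)"
    by (rule parseval_inner[OF uf_l2 uf_parseval g])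
  moreover have "hc (uf d n) m = Umat d n m" for m using Umat_hc[of d m n] Umat_sym[of d n m] by simp
  moreover have "(\<integral>x. uf d n x * g x \<partial>lborel) = hc (\<lambda>y. cis (- d * y\<^sup>2) * g y) n"
    unfolding hc_def uf_def by (simp add: mult_ac)
  ultimately show ?thesis by simp
qed

lemma Umat_summable_row: "summable (\<lambda>m. (cmod (Umat d n m))\<^sup>2)" "(\<Sum>m. (cmod (Umat d n m))\<^sup>2) \<le> 1"
  using Umat_summable[of d n] by (simp_all add: Umat_sym[of d n])

lemma Umat_mult_summable:
  assumes "summable (\<lambda>m. (cmod (c m))\<^sup>2)"
  shows "summable (\<lambda>m. norm (Umat d n m * c m))"
proof (rule summable_comparison_test')
  show "summable (\<lambda>m. (cmod (Umat d n m))\<^sup>2 + (cmod (c m))\<^sup>2)" by (rule summable_add[OF Umat_summable_row(1) assms])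
  fix m
  show "norm (norm (Umat d n m * c m)) \<le> (cmod (Umat d n m))\<^sup>2 + (cmod (c m))\<^sup>2"
    using sum_squares_bound[of "cmod (Umat d n m)" "cmod (c m)"] mult_nonneg_nonneg[of "cmod (Umat d n m)" "cmod (c m)"]
    by (simp add: norm_mult del: mult_nonneg_nonneg zero_le_mult_iff)
qed

text \<open>For finitely many c the function with these coefficients keeps its norm under the chirp,
  and Bessel bounds the coefficients of the result; the bound survives the limit because only N
  outputs are looked at.\<close>

lemma Umat_contraction:
  assumes c: "summable (\<lambda>m. (cmod (c m))\<^sup>2)"
  shows "summable (\<lambda>n. (cmod (\<Sum>m. Umat d n m * c m))\<^sup>2)"
proof (rule summableI_nonneg_bounded)
  fix N
  define g where "g M x = (\<Sum>m<M. c m * uf d m x)" for M x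
  have gl: "l2 (g M) \<and> (\<forall>n. hc (g M) n = (\<Sum>m<M. c m * Umat d n m))" for M
  proof (induction M)
    case 0 show ?case by (simp add: g_def[abs_def] l2_def hc_def)
  next
    case (Suc M)
    have "g (Suc M) = (\<lambda>x. g M x + c M * uf d M x)" by (simp add: g_def fun_eq_iff)
    then show ?case
      using Suc l2_add[of "g M" "\<lambda>x. c M * uf d M x"] l2_scale[OF uf_l2[of d M], of "c M"] hc_add[of "g M" "\<lambda>x. c M * uf d M x"]
      by (simp add: hc_scale Umat_hc)
  qed
  have gn: "(\<integral>x. (cmod (g M x))\<^sup>2 \<partial>lborel) = (\<Sum>m<M. (cmod (c m))\<^sup>2)" for M
  proof -
    have "g M x = cis (- d * x\<^sup>2) * (\<Sum>m<M. c m * of_real (hf m x))" for x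
      unfolding g_def uf_def sum_distrib_left by (simp add: mult_ac)
    then show ?thesis using norm_sum_hf[of c M] by (simp add: norm_mult)
  qed
  have "(\<Sum>n<N. (cmod (\<Sum>m<M. Umat d n m * c m))\<^sup>2) \<le> (\<Sum>m. (cmod (c m))\<^sup>2)" for M
  proof -
    have "(\<Sum>n<N. (cmod (\<Sum>m<M. Umat d n m * c m))\<^sup>2) = (\<Sum>n<N. (cmod (hc (g M) n))\<^sup>2)"
      using gl[of M] by (simp add: mult.commute)
    also have "\<dots> \<le> (\<Sum>m<M. (cmod (c m))\<^sup>2)" using bessel_l2[of "g M" N] gl[of M] unfolding gn by blast
    also have "\<dots> \<le> (\<Sum>m. (cmod (c m))\<^sup>2)" by (rule sum_le_suminf[OF c]) auto
    finally show ?thesis .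
  qed
  moreover have "(\<lambda>M. \<Sum>n<N. (cmod (\<Sum>m<M. Umat d n m * c m))\<^sup>2) \<longlonglongrightarrow> (\<Sum>n<N. (cmod (\<Sum>m. Umat d n m * c m))\<^sup>2)"
    by (intro tendsto_intros summable_LIMSEQ[OF summable_norm_cancel[OF Umat_mult_summable[OF c]]])
  ultimately show "(\<Sum>n<N. (cmod (\<Sum>m. Umat d n m * c m))\<^sup>2) \<le> (\<Sum>m. (cmod (c m))\<^sup>2)"
    by (intro LIMSEQ_le_const2) auto
qed auto

lemma sums_of_ennreal_double:
  fixes f :: "nat \<Rightarrow> nat \<Rightarrow> real"
  assumes f: "\<And>n m. f n m \<ge> 0" and s: "\<And>n. summable (f n)"
    and T: "(\<Sum>n. \<Sum>m. ennreal (f n m)) = ennreal T" "T \<ge> 0"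
  shows "(\<lambda>n. \<Sum>m. f n m) sums T"
proof -
  have e: "(\<Sum>m. ennreal (f n m)) = ennreal (\<Sum>m. f n m)" for n by (rule suminf_ennreal2[OF f s])
  have nn: "(\<Sum>m. f n m) \<ge> 0" for n by (rule suminf_nonneg[OF s f])
  have T': "(\<Sum>n. ennreal (\<Sum>m. f n m)) = ennreal T" using T(1) by (simp only: e)
  have sm: "summable (\<lambda>n. \<Sum>m. f n m)"
    by (rule summable_suminf_not_top[OF nn]) (simp add: T')
  have "ennreal (\<Sum>n. \<Sum>m. f n m) = ennreal T" using suminf_ennreal2[OF nn sm] T' by simp
  then have "(\<Sum>n. \<Sum>m. f n m) = T" using T(2) suminf_nonneg[OF sm nn] by simp
  then show ?thesis using summable_sums[OF sm] by simp
qed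

section \<open>The kernel of the coupled system and its Hilbert-Schmidt property\<close>

context ncho_params
begin

definition ms :: "nat \<Rightarrow> real" where "ms n = real n + 1/2"

lemma ms_pos: "ms n > 0" by (simp add: ms_def)
lemma ms_nz [simp]: "ms n \<noteq> 0" using ms_pos[of n] by simp
lemma ms_ge: "1 \<le> 2 * ms n" by (simp add: ms_def)

definition Us :: "bool \<Rightarrow> nat \<Rightarrow> nat \<Rightarrow> complex" where "Us s = Umat (sg s * dlt)"

text \<open>Changing the sign conjugates the matrix and symmetry transposes it, so the two
  off-diagonal blocks are adjoint to each other; this makes the kernel Hermitian.\<close>

lemma Us_not: "Us (\<not> s) m n = cnj (Us s n m)"
  unfolding Us_def using Umat_cnj[of "sg s * dlt" m n] by (simp add: Umat_sym[of _ n m])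

lemma cmod_Us: "cmod (Us s n m) = cmod (Umat dlt n m)"
  using Umat_cnj[of dlt n m] by (cases s) (simp_all add: Us_def)

text \<open>In Hermite coefficients c the system reads (n + 1/2) c s n = (\<mu> / kap) (ca c s n +
  cb times the chirp matrix applied to c (\<not> s)). Dividing symmetrically by the square roots of
  n + 1/2 gives these entries.\<close>

definition kern :: "bool \<times> nat \<Rightarrow> bool \<times> nat \<Rightarrow> complex" where
  "kern i j = (if fst i = fst j then (if snd i = snd j then of_real (ca / ms (snd i)) else 0)
     else of_real (cb / (sqrt (ms (snd i)) * sqrt (ms (snd j)))) * Us (fst i) (snd i) (snd j))"

lemma kern_herm: "kern j i = cnj (kern i j)"
proof (cases "fst i = fst j")
  case True
  then show ?thesis by (simp add: kern_def)
next
  case False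
  then have "fst j = (\<not> fst i)" by auto
  then show ?thesis using False by (simp add: kern_def Us_not mult.commute)
qed

lemma kern_row_has_sum:
  fixes g :: "bool \<times> nat \<Rightarrow> 'b::topological_comm_monoid_add"
  assumes z: "((\<lambda>m. g (\<not> s, m)) has_sum z) UNIV" and d: "\<And>m. m \<noteq> n \<Longrightarrow> g (s, m) = 0"
  shows "(g has_sum (g (s, n) + z)) UNIV"
proof -
  have "((\<lambda>m. g (s, m)) has_sum g (s, n)) UNIV"
    by (rule has_sum_finite_neutralI[where B = "{n}"]) (use d in auto)
  then show ?thesis
    using has_sum_bool_prod[of g "g (s, n)" z] has_sum_bool_prod[of g z "g (s, n)"] z by (cases s) (simp_all add: add.commute)
qed

lemma summable_ms_sq: "summable (\<lambda>n. 1 / (ms n)\<^sup>2)"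
proof (rule summable_comparison_test_bigo)
  show "summable (\<lambda>n. norm (real n powr (-2)))" by (simp add: summable_real_powr_iff)
  show "(\<lambda>n. 1 / (ms n)\<^sup>2) \<in> O(\<lambda>n. real n powr (-2))" unfolding ms_def by real_asymp
qed

lemma weighted_summable:
  assumes w: "\<And>m. 0 \<le> w m \<and> w m \<le> C"
  shows "summable (\<lambda>m. (cmod (Umat d n m))\<^sup>2 * w m)"
proof (rule summable_comparison_test')
  show "summable (\<lambda>m. (cmod (Umat d n m))\<^sup>2 * C)" by (rule summable_mult2[OF Umat_summable_row(1)])
  show "norm ((cmod (Umat d n m))\<^sup>2 * w m) \<le> (cmod (Umat d n m))\<^sup>2 * C" for m
    using w[of m] by (simp add: abs_mult mult_left_mono)
qed

lemma inv_ms_bounds: "0 \<le> 1 / ms m \<and> 1 / ms m \<le> 2" "0 \<le> 1 / (ms m)\<^sup>2 \<and> 1 / (ms m)\<^sup>2 \<le> 4"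
proof -
  show a: "0 \<le> 1 / ms m \<and> 1 / ms m \<le> 2" using ms_pos[of m] ms_ge[of m] by (simp add: field_simps)
  then have "(1 / ms m)\<^sup>2 \<le> 2\<^sup>2" by (intro power_mono) auto
  then show "0 \<le> 1 / (ms m)\<^sup>2 \<and> 1 / (ms m)\<^sup>2 \<le> 4" by (simp add: power_divide)
qed

definition A1 :: "nat \<Rightarrow> real" where "A1 n = (\<Sum>m. (cmod (Umat dlt n m))\<^sup>2 * (1 / ms m))"
definition A2 :: "nat \<Rightarrow> real" where "A2 n = (\<Sum>m. (cmod (Umat dlt n m))\<^sup>2 * (1 / (ms m)\<^sup>2))"

lemma A1_sums: "(\<lambda>m. (cmod (Umat dlt n m))\<^sup>2 * (1 / ms m)) sums A1 n"
  and A2_sums: "(\<lambda>m. (cmod (Umat dlt n m))\<^sup>2 * (1 / (ms m)\<^sup>2)) sums A2 n"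
  unfolding A1_def A2_def by (rule summable_sums, rule weighted_summable[OF inv_ms_bounds(1)], rule summable_sums, rule weighted_summable[OF inv_ms_bounds(2)])

lemma A1_nonneg: "A1 n \<ge> 0" and A2_nonneg: "A2 n \<ge> 0"
  unfolding A1_def A2_def
  by (rule suminf_nonneg[OF weighted_summable[OF inv_ms_bounds(1)]], use inv_ms_bounds in simp,
      rule suminf_nonneg[OF weighted_summable[OF inv_ms_bounds(2)]], use inv_ms_bounds in simp)

text \<open>With the sums exchanged, each column of the chirp matrix has square sum at most 1, which
  leaves the sum of 1 / ms^2.\<close>

lemma A2_summable: "summable A2"
proof -
  have "(\<Sum>n. \<Sum>m. ennreal ((cmod (Umat dlt n m))\<^sup>2 * (1 / (ms m)\<^sup>2))) = (\<Sum>m. \<Sum>n. ennreal ((cmod (Umat dlt n m))\<^sup>2 * (1 / (ms m)\<^sup>2)))"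
    by (rule ennreal_suminf_swap)
  also have "\<dots> = (\<Sum>m. ennreal (\<Sum>n. (cmod (Umat dlt n m))\<^sup>2 * (1 / (ms m)\<^sup>2)))"
    by (rule arg_cong[where f = suminf], rule ext, rule suminf_ennreal2[OF _ summable_mult2[OF Umat_summable(1)]])
       (use inv_ms_bounds in simp)
  also have "\<dots> \<le> (\<Sum>m. ennreal (1 / (ms m)\<^sup>2))"
  proof (intro suminf_le allI ennreal_leI)
    fix m
    have "(\<Sum>n. (cmod (Umat dlt n m))\<^sup>2 * (1 / (ms m)\<^sup>2)) = (\<Sum>n. (cmod (Umat dlt n m))\<^sup>2) * (1 / (ms m)\<^sup>2)"
      by (rule suminf_mult2[OF Umat_summable(1), symmetric])
    also have "\<dots> \<le> 1 * (1 / (ms m)\<^sup>2)" by (rule mult_right_mono[OF Umat_summable(2)]) simp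
    finally show "(\<Sum>n. (cmod (Umat dlt n m))\<^sup>2 * (1 / (ms m)\<^sup>2)) \<le> 1 / (ms m)\<^sup>2" by simp
  qed auto
  also have "\<dots> = ennreal (\<Sum>m. 1 / (ms m)\<^sup>2)" by (rule suminf_ennreal2[OF _ summable_ms_sq]) simp
  also have "\<dots> < \<infinity>" by simp
  finally have fin: "(\<Sum>n. \<Sum>m. ennreal ((cmod (Umat dlt n m))\<^sup>2 * (1 / (ms m)\<^sup>2))) < \<infinity>" .
  have "(\<lambda>n. \<Sum>m. (cmod (Umat dlt n m))\<^sup>2 * (1 / (ms m)\<^sup>2)) sums enn2real (\<Sum>n. \<Sum>m. ennreal ((cmod (Umat dlt n m))\<^sup>2 * (1 / (ms m)\<^sup>2)))"
    by (rule sums_of_ennreal_double) (use inv_ms_bounds(2) fin weighted_summable[OF inv_ms_bounds(2)] in \<open>auto simp: ennreal_enn2real\<close>)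
  then show ?thesis unfolding A2_def[abs_def] by (rule sums_summable)
qed

text \<open>The mixed weight 1 / (ms m ms n) is split by u v \<le> u^2 + v^2; the pure weights are
  controlled by the row bound of the chirp matrix and by \<open>A2_summable\<close>.\<close>

lemma A1_weighted_summable: "summable (\<lambda>n. A1 n / ms n)"
proof (rule summable_comparison_test')
  show "summable (\<lambda>n. 1 / (ms n)\<^sup>2 + A2 n)" by (rule summable_add[OF summable_ms_sq A2_summable])
  fix n
  have "(\<lambda>m. (cmod (Umat dlt n m))\<^sup>2 * (1 / ms m) * (1 / ms n)) sums (A1 n * (1 / ms n))" by (rule sums_mult2[OF A1_sums])
  moreover have "(\<lambda>m. (cmod (Umat dlt n m))\<^sup>2 * (1 / (ms n)\<^sup>2) + (cmod (Umat dlt n m))\<^sup>2 * (1 / (ms m)\<^sup>2)) sums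
     ((\<Sum>m. (cmod (Umat dlt n m))\<^sup>2) * (1 / (ms n)\<^sup>2) + A2 n)"
    by (intro sums_add A2_sums sums_mult2 summable_sums Umat_summable_row)
  moreover have "(cmod (Umat dlt n m))\<^sup>2 * (1 / ms m) * (1 / ms n) \<le> (cmod (Umat dlt n m))\<^sup>2 * (1 / (ms n)\<^sup>2) + (cmod (Umat dlt n m))\<^sup>2 * (1 / (ms m)\<^sup>2)" for m
  proof -
    have "1 / ms m * (1 / ms n) \<le> (1 / ms n)\<^sup>2 + (1 / ms m)\<^sup>2"
    proof -
      have "0 \<le> 1 / ms m * (1 / ms n)" using inv_ms_bounds(1)[of m] inv_ms_bounds(1)[of n] by (intro mult_nonneg_nonneg) auto
      then show ?thesis using sum_squares_bound[of "1 / ms n" "1 / ms m"] mult.commute[of "1 / ms m" "1 / ms n"] by linarith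
    qed
    from mult_left_mono[OF this, of "(cmod (Umat dlt n m))\<^sup>2"] show ?thesis by (simp add: distrib_left power_divide)
  qed
  ultimately have "A1 n * (1 / ms n) \<le> (\<Sum>m. (cmod (Umat dlt n m))\<^sup>2) * (1 / (ms n)\<^sup>2) + A2 n" by (rule sums_le[rotated 1])
  also have "\<dots> \<le> 1 * (1 / (ms n)\<^sup>2) + A2 n" by (intro add_right_mono mult_right_mono Umat_summable_row) simp
  finally show "norm (A1 n / ms n) \<le> 1 / (ms n)\<^sup>2 + A2 n" using A1_nonneg[of n] ms_pos[of n] by simp
qed

lemma kern_hs: "(\<lambda>(i,j). (cmod (kern i j))\<^sup>2) summable_on UNIV"
proof -
  define r where "r i = ca\<^sup>2 * (1 / (ms (snd i))\<^sup>2) + cb\<^sup>2 * (A1 (snd i) / ms (snd i))" for i :: "bool \<times> nat"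
  have row: "((\<lambda>j. (cmod (kern i j))\<^sup>2) has_sum r i) UNIV" for i
  proof -
    obtain s n where i: "i = (s, n)" by (cases i)
    have "(\<lambda>m. (cb\<^sup>2 / ms n) * ((cmod (Umat dlt n m))\<^sup>2 * (1 / ms m))) sums ((cb\<^sup>2 / ms n) * A1 n)" by (rule sums_mult[OF A1_sums])
    then have "((\<lambda>m. (cb\<^sup>2 / ms n) * ((cmod (Umat dlt n m))\<^sup>2 * (1 / ms m))) has_sum ((cb\<^sup>2 / ms n) * A1 n)) UNIV"
      by (rule sums_nonneg_imp_has_sum) (use inv_ms_bounds ms_pos[of n] in auto)
    moreover have "(cmod (kern i (\<not> s, m)))\<^sup>2 = (cb\<^sup>2 / ms n) * ((cmod (Umat dlt n m))\<^sup>2 * (1 / ms m))" for m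
      using ms_pos[of n] ms_pos[of m] unfolding i by (simp add: kern_def norm_mult norm_divide cmod_Us power_mult_distrib power_divide)
    ultimately have "((\<lambda>m. (cmod (kern i (\<not> s, m)))\<^sup>2) has_sum ((cb\<^sup>2 / ms n) * A1 n)) UNIV" by simp
    from kern_row_has_sum[where g = "\<lambda>j. (cmod (kern i j))\<^sup>2", OF this, of n]
    have "((\<lambda>j. (cmod (kern i j))\<^sup>2) has_sum ((cmod (kern i (s, n)))\<^sup>2 + (cb\<^sup>2 / ms n) * A1 n)) UNIV"
      unfolding i by (simp add: kern_def)
    moreover have "(cmod (kern i (s, n)))\<^sup>2 + (cb\<^sup>2 / ms n) * A1 n = r i"
      unfolding i r_def by (simp add: kern_def norm_divide power_divide)
    ultimately show ?thesis by simp
  qed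
  have "summable (\<lambda>n. ca\<^sup>2 * (1 / (ms n)\<^sup>2) + cb\<^sup>2 * (A1 n / ms n))"
    by (intro summable_add summable_mult summable_ms_sq A1_weighted_summable)
  then have s: "((\<lambda>n. ca\<^sup>2 * (1 / (ms n)\<^sup>2) + cb\<^sup>2 * (A1 n / ms n)) has_sum (\<Sum>n. ca\<^sup>2 * (1 / (ms n)\<^sup>2) + cb\<^sup>2 * (A1 n / ms n))) UNIV"
    by (intro sums_nonneg_imp_has_sum summable_sums add_nonneg_nonneg mult_nonneg_nonneg divide_nonneg_pos)
       (use A1_nonneg ms_pos in auto)
  have "r summable_on UNIV"
    by (rule has_sum_imp_summable, rule has_sum_bool_prod) (use s in \<open>simp_all add: r_def\<close>)
  then have "(\<lambda>(i,j). (cmod (kern i j))\<^sup>2) summable_on (UNIV \<times> UNIV)"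
    by (intro summable_on_SigmaI[where g = r]) (use row in auto)
  then show ?thesis by simp
qed

sublocale K: hs_kernel kern
  by unfold_locales (rule kern_hs, rule kern_herm)

text \<open>Undoes the scaling that made the kernel Hermitian: for eigenvectors these are the
  Hermite coefficients of the function in component s.\<close>

definition cf :: "(bool \<times> nat) ell2 \<Rightarrow> bool \<Rightarrow> nat \<Rightarrow> complex" where
  "cf x s n = coeff x (s, n) / of_real (sqrt (ms n))"

lemma coeff_cf: "coeff x (s, n) = of_real (sqrt (ms n)) * cf x s n"
  using ms_pos[of n] by (simp add: cf_def)

lemma cf_eqI: "(\<And>s n. cf x s n = cf y s n) \<Longrightarrow> x = y"
  by (rule ell2_eqI) (metis coeff_cf surj_pair)

lemma cf_summable: "summable (\<lambda>n. (cmod (cf x s n))\<^sup>2)"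
proof (rule summableI_nonneg_bounded)
  fix N
  have "(\<Sum>n<N. (cmod (cf x s n))\<^sup>2) \<le> (\<Sum>n<N. 2 * (cmod (coeff x (s, n)))\<^sup>2)"
  proof (rule sum_mono)
    fix n
    have "(cmod (cf x s n))\<^sup>2 = (cmod (coeff x (s, n)))\<^sup>2 * (1 / ms n)"
      using ms_pos[of n] by (simp add: cf_def norm_divide power_divide)
    also have "\<dots> \<le> (cmod (coeff x (s, n)))\<^sup>2 * 2" using inv_ms_bounds(1)[of n] by (intro mult_left_mono) auto
    finally show "(cmod (cf x s n))\<^sup>2 \<le> 2 * (cmod (coeff x (s, n)))\<^sup>2" by simp
  qed
  also have "\<dots> = 2 * (\<Sum>i\<in>Pair s ` {..<N}. (cmod (coeff x i))\<^sup>2)"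
    by (subst sum.reindex) (auto simp: inj_on_def sum_distrib_left)
  also have "\<dots> \<le> 2 * (norm x)\<^sup>2" by (intro mult_left_mono sum_coeff_le_norm) auto
  finally show "(\<Sum>n<N. (cmod (cf x s n))\<^sup>2) \<le> 2 * (norm x)\<^sup>2" .
qed auto

lemma cf_op: "cf (K.op x) s n = (of_real ca * cf x s n + of_real cb * (\<Sum>m. Us s n m * cf x (\<not> s) m)) / of_real (ms n)"
proof -
  define z where "z = (\<Sum>m. Us s n m * cf x (\<not> s) m)"
  have sm: "summable (\<lambda>m. norm (Us s n m * cf x (\<not> s) m))" unfolding Us_def by (rule Umat_mult_summable[OF cf_summable])
  have "(\<lambda>m. Us s n m * cf x (\<not> s) m) sums z" unfolding z_def by (rule summable_sums[OF summable_norm_cancel[OF sm]])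
  with sm have "((\<lambda>m. Us s n m * cf x (\<not> s) m) has_sum z) UNIV" by (rule norm_summable_imp_has_sum)
  then have "((\<lambda>m. of_real (cb / sqrt (ms n)) * (Us s n m * cf x (\<not> s) m)) has_sum (of_real (cb / sqrt (ms n)) * z)) UNIV"
    by (rule has_sum_cmult_right)
  moreover have "kern (s, n) (\<not> s, m) * coeff x (\<not> s, m) = of_real (cb / sqrt (ms n)) * (Us s n m * cf x (\<not> s) m)" for m
    using ms_pos[of m] unfolding coeff_cf by (simp add: kern_def)
  ultimately have "((\<lambda>m. kern (s, n) (\<not> s, m) * coeff x (\<not> s, m)) has_sum (of_real (cb / sqrt (ms n)) * z)) UNIV" by simp
  from kern_row_has_sum[where g = "\<lambda>j. kern (s, n) j * coeff x j", OF this, of n]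
  have "((\<lambda>j. kern (s, n) j * coeff x j) has_sum (kern (s, n) (s, n) * coeff x (s, n) + of_real (cb / sqrt (ms n)) * z)) UNIV"
    by (simp add: kern_def)
  then have "coeff (K.op x) (s, n) = kern (s, n) (s, n) * coeff x (s, n) + of_real (cb / sqrt (ms n)) * z"
    unfolding K.coeff_op by (rule infsumI)
  also have "\<dots> = of_real (ca / ms n) * (of_real (sqrt (ms n)) * cf x s n) + of_real (cb / sqrt (ms n)) * z"
    unfolding coeff_cf by (simp add: kern_def)
  finally have "cf (K.op x) s n = (of_real (ca / ms n) * (of_real (sqrt (ms n)) * cf x s n) + of_real (cb / sqrt (ms n)) * z) / of_real (sqrt (ms n))"
    by (simp only: cf_def)
  also have "\<dots> = (of_real ca * cf x s n + of_real cb * z) / of_real (ms n)"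
  proof -
    define w where "w = complex_of_real (sqrt (ms n))"
    have w: "w \<noteq> 0" "complex_of_real (ms n) = w * w"
      using ms_pos[of n] by (auto simp: w_def simp flip: of_real_mult)
    show ?thesis unfolding of_real_divide w(2) w_def[symmetric] using w(1) by (simp add: field_simps)
  qed
  finally show ?thesis unfolding z_def .
qed

lemma eigen_iff:
  "K.op x = \<nu> *\<^sub>R x \<longleftrightarrow> (\<forall>s n. of_real ca * cf x s n + of_real cb * (\<Sum>m. Us s n m * cf x (\<not> s) m) = of_real (\<nu> * ms n) * cf x s n)"
proof -
  have "K.op x = \<nu> *\<^sub>R x \<longleftrightarrow> (\<forall>s n. cf (K.op x) s n = of_real \<nu> * cf x s n)"
  proof
    assume "K.op x = \<nu> *\<^sub>R x"
    then show "\<forall>s n. cf (K.op x) s n = of_real \<nu> * cf x s n" by (simp add: cf_def scaleR_conv_of_real)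
  next
    assume a: "\<forall>s n. cf (K.op x) s n = of_real \<nu> * cf x s n"
    show "K.op x = \<nu> *\<^sub>R x" by (rule cf_eqI) (use a in \<open>simp add: cf_def scaleR_conv_of_real\<close>)
  qed
  also have "\<dots> \<longleftrightarrow> (\<forall>s n. of_real ca * cf x s n + of_real cb * (\<Sum>m. Us s n m * cf x (\<not> s) m) = of_real (\<nu> * ms n) * cf x s n)"
  proof -
    have "complex_of_real (ms n) \<noteq> 0" for n using ms_pos[of n] by simp
    then show ?thesis unfolding cf_op by (simp add: divide_eq_eq mult_ac)
  qed
  finally show ?thesis .
qed

end

section \<open>Matching eigenfunctions with eigenvectors of the kernel\<close>

lemma hc_combination:
  assumes "finite B" "\<And>b. b \<in> B \<Longrightarrow> l2 (f b)"
  shows "l2 (\<lambda>y. \<Sum>b\<in>B. z b * f b y) \<and> (\<forall>n. hc (\<lambda>y. \<Sum>b\<in>B. z b * f b y) n = (\<Sum>b\<in>B. z b * hc (f b) n))"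
  using assms
proof (induction B rule: finite_induct)
  case empty show ?case by (simp add: l2_def hc_def)
next
  case (insert b B)
  have I: "l2 (\<lambda>y. \<Sum>b\<in>B. z b * f b y)" "\<And>n. hc (\<lambda>y. \<Sum>b\<in>B. z b * f b y) n = (\<Sum>b\<in>B. z b * hc (f b) n)"
    using insert.IH insert.prems by auto
  have b: "l2 (\<lambda>y. z b * f b y)" by (rule l2_scale[OF insert.prems]) simp
  show ?case using l2_add[OF b I(1)] hc_add[OF b I(1)] insert.hyps I(2) by (simp add: hc_scale)
qed

context ncho_params
begin

lemma toV_add: "toV (u + v) s y = toV u s y + toV v s y"
  by (simp add: toV_def qc_def algebra_simps)

lemma toV_zero: "toV 0 s y = 0"
  by (simp add: toV_def qc_def)

lemma toV_cscale: "toV (cscale_fun c u) s y = c * toV u s y"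
  by (simp add: toV_def qc_def cscale_fun_def algebra_simps)

lemma toV_combination:
  assumes "finite B"
  shows "toV (\<Sum>b\<in>B. cscale_fun (z b) (G b)) s y = (\<Sum>b\<in>B. z b * toV (G b) s y)"
  using assms by (induction B rule: finite_induct) (simp_all only: sum.empty sum.insert toV_zero toV_add toV_cscale not_False_eq_True)

lemma toV_inject: "toV u = toV v \<longleftrightarrow> u = v"
  using toU_toV by metis

lemma osc_regular:
  assumes "osc \<mu> V"
  shows "continuous_on UNIV (V s)" "l2 (V s)"
    and "hc (Fo \<mu> V s) n = of_real (ms n) * hc (V s) n" and "l2 (Fo \<mu> V s)"
proof -
  obtain p where p: "dom2 (V s) p (\<lambda>y. of_real (y\<^sup>2) * V s y - 2 * Fo \<mu> V s y)" using assms unfolding osc_def by blast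
  note D = dom2D[OF p]
  show "continuous_on UNIV (V s)" "l2 (V s)" by (rule D)+
  have "hc (\<lambda>x. of_real (x\<^sup>2) * V s x - (of_real (x\<^sup>2) * V s x - 2 * Fo \<mu> V s x)) n = of_real (2 * real n + 1) * hc (V s) n"
    by (rule dom2_hc[OF p])
  then have "hc (\<lambda>x. 2 * Fo \<mu> V s x) n = 2 * (of_real (ms n) * hc (V s) n)"
    by (simp add: ms_def algebra_simps)
  then show "hc (Fo \<mu> V s) n = of_real (ms n) * hc (V s) n" unfolding hc_scale by simp
  have "l2 (\<lambda>x. 1/2 * (of_real (x\<^sup>2) * V s x - (of_real (x\<^sup>2) * V s x - 2 * Fo \<mu> V s x)))"
    by (intro l2_scale l2_diff D(8) D(11))
  then show "l2 (Fo \<mu> V s)" by simp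
qed

lemma l2_chirp_mult: "l2 g \<Longrightarrow> l2 (\<lambda>y. cis (- d * y\<^sup>2) * g y)"
  using l2_chirp[of g 1 "- d"] by simp

lemma hc_Fo:
  assumes l: "\<And>s. l2 (V s)"
  shows "hc (Fo \<mu> V s) n = of_real (\<mu> / kap) * (of_real ca * hc (V s) n + of_real cb * (\<Sum>m. Us s n m * hc (V (\<not> s)) m))"
proof -
  have "hc (\<lambda>y. cis (- (sg s * dlt) * y\<^sup>2) * V (\<not> s) y) n = (\<Sum>m. Us s n m * hc (V (\<not> s)) m)"
    using sums_unique[OF chirp_hc[OF l[of "\<not> s"], of "sg s * dlt" n]] by (simp add: Us_def)
  moreover have "hc (Fo \<mu> V s) n = of_real (\<mu> / kap) * (of_real ca * hc (V s) n + of_real cb * hc (\<lambda>y. cis (- (sg s * dlt) * y\<^sup>2) * V (\<not> s) y) n)"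
    unfolding Fo_def[abs_def] hc_scale
    by (subst hc_add) (use l2_scale[OF l] l2_scale[OF l2_chirp_mult[OF l]] in \<open>simp_all add: hc_scale\<close>)
  ultimately show ?thesis by simp
qed

text \<open>The candidate vector has coordinates sqrt (n + 1/2) times the Hermite coefficients of V.
  The eigenvector equation is the coefficient form of the system, with \<mu> / kap inverted.\<close>

lemma osc_to_ell2:
  assumes V: "osc \<mu> V" and mu: "\<mu> \<noteq> 0"
  shows "\<exists>x. (\<forall>s n. cf x s n = hc (V s) n) \<and> K.op x = (kap / \<mu>) *\<^sub>R x"
proof -
  define f where "f i = complex_of_real (sqrt (ms (snd i))) * hc (V (fst i)) (snd i)" for i
  have sm: "summable (\<lambda>n. (cmod (f (s, n)))\<^sup>2)" for s
  proof (rule summable_comparison_test')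
    show "summable (\<lambda>n. 2 * (cmod (hc (Fo \<mu> V s) n))\<^sup>2)"
      by (rule summable_mult, rule summableI_nonneg_bounded[OF _ bessel_l2[OF osc_regular(4)[OF V]]]) simp
    fix n
    have "(cmod (f (s, n)))\<^sup>2 = ms n * (cmod (hc (V s) n))\<^sup>2"
      using ms_pos[of n] by (simp add: f_def norm_mult power_mult_distrib)
    \<comment> \<open>One factor n + 1/2 is bounded by twice its square, since n + 1/2 \<ge> 1/2;
      with the square, the terms are the squared Hermite coefficients of \<open>Fo\<close>, which
      lies in L2.\<close>
    also have "\<dots> \<le> (2 * ms n * ms n) * (cmod (hc (V s) n))\<^sup>2"
      using ms_ge[of n] ms_pos[of n] mult_right_mono[of 1 "2 * ms n" "ms n"] by (intro mult_right_mono) auto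
    also have "\<dots> = 2 * (cmod (hc (Fo \<mu> V s) n))\<^sup>2"
      unfolding osc_regular(3)[OF V] by (simp add: norm_mult power2_eq_square)
    finally show "norm ((cmod (f (s, n)))\<^sup>2) \<le> 2 * (cmod (hc (Fo \<mu> V s) n))\<^sup>2" by simp
  qed
  have hs: "((\<lambda>n. (cmod (f (s, n)))\<^sup>2) has_sum (\<Sum>n. (cmod (f (s, n)))\<^sup>2)) UNIV" for s
    by (rule sums_nonneg_imp_has_sum[OF summable_sums[OF sm]]) simp
  have "(\<lambda>i. (cmod (f i))\<^sup>2) summable_on UNIV"
    by (rule has_sum_imp_summable, rule has_sum_bool_prod[OF hs hs])
  then have c: "coeff (Abs_ell2 f) = f" by (intro Abs_ell2_inverse) simp
  have cfx: "cf (Abs_ell2 f) s n = hc (V s) n" for s n unfolding cf_def c by (simp add: f_def)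
  have k: "kap \<noteq> 0" using kap_pos by simp
  have "K.op (Abs_ell2 f) = (kap / \<mu>) *\<^sub>R Abs_ell2 f"
    unfolding eigen_iff
  proof (intro allI)
    fix s n
    define S where "S = of_real ca * hc (V s) n + of_real cb * (\<Sum>m. Us s n m * hc (V (\<not> s)) m)"
    have "of_real (\<mu> / kap) * S = of_real (ms n) * hc (V s) n"
      using osc_regular(3)[OF V, of s n] unfolding hc_Fo[OF osc_regular(2)[OF V]] S_def .
    then have "of_real (kap / \<mu>) * (of_real (\<mu> / kap) * S) = of_real (kap / \<mu>) * (of_real (ms n) * hc (V s) n)" by simp
    moreover have "complex_of_real (kap / \<mu>) * of_real (\<mu> / kap) = 1" using k mu by simp
    ultimately have "S = of_real (kap / \<mu> * ms n) * hc (V s) n" by (simp only: mult.assoc[symmetric] mult_1_left of_real_mult)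
    then show "of_real ca * cf (Abs_ell2 f) s n + of_real cb * (\<Sum>m. Us s n m * cf (Abs_ell2 f) (\<not> s) m) = of_real (kap / \<mu> * ms n) * cf (Abs_ell2 f) s n"
      unfolding S_def cfx .
  qed
  with cfx show ?thesis by blast
qed

definition syn :: "(bool \<times> nat) ell2 \<Rightarrow> bool \<Rightarrow> real \<Rightarrow> complex" where
  "syn x s y = (\<Sum>n. cf x s n * of_real (hf n y))"

text \<open>Decay is bootstrapped from the equation: \<nu> (n + 1/2) times the coefficients is a
  combination of the coefficients and their image under the chirp matrix, both square summable. That
  is the hypothesis of the synthesis lemmas, with \<open>Fo\<close> in the role of F.\<close>

lemma syn_osc:
  assumes x: "K.op x = \<nu> *\<^sub>R x" and nu: "\<nu> \<noteq> 0"
  shows "osc (kap / \<nu>) (syn x)" and "\<And>s n. hc (syn x s) n = cf x s n"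
proof -
  have eq: "of_real ca * cf x s n + of_real cb * (\<Sum>m. Us s n m * cf x (\<not> s) m) = of_real (\<nu> * ms n) * cf x s n" for s n
    using x unfolding eigen_iff by blast
  have sE: "summable (\<lambda>n. (real n + 1/2)\<^sup>2 * (cmod (cf x s n))\<^sup>2)" for s
  proof (rule summable_comparison_test')
    define u where "u n = (\<Sum>m. Us s n m * cf x (\<not> s) m)" for n
    have "summable (\<lambda>n. (cmod (u n))\<^sup>2)" unfolding u_def Us_def by (rule Umat_contraction[OF cf_summable])
    then show "summable (\<lambda>n. (1 / \<nu>\<^sup>2) * (2 * (ca\<^sup>2 * (cmod (cf x s n))\<^sup>2 + cb\<^sup>2 * (cmod (u n))\<^sup>2)))"
      by (intro summable_mult summable_add cf_summable)
    fix n
    have "\<nu>\<^sup>2 * ((ms n)\<^sup>2 * (cmod (cf x s n))\<^sup>2) = (cmod (of_real (\<nu> * ms n) * cf x s n))\<^sup>2"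
      unfolding norm_mult norm_of_real power_mult_distrib power2_abs by (simp add: mult.assoc power_mult_distrib)
    also have "\<dots> = (cmod (of_real ca * cf x s n + of_real cb * u n))\<^sup>2" unfolding eq[symmetric] u_def ..
    also have "\<dots> \<le> (cmod (of_real ca * cf x s n) + cmod (of_real cb * u n))\<^sup>2" by (intro power_mono norm_triangle_ineq) simp
    also have "\<dots> \<le> 2 * ((cmod (of_real ca * cf x s n))\<^sup>2 + (cmod (of_real cb * u n))\<^sup>2)"
      using sum_squares_bound[of "cmod (of_real ca * cf x s n)" "cmod (of_real cb * u n)"] by (simp add: power2_sum)
    also have "\<dots> = 2 * (ca\<^sup>2 * (cmod (cf x s n))\<^sup>2 + cb\<^sup>2 * (cmod (u n))\<^sup>2)"
      by (simp add: norm_mult power_mult_distrib)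
    finally have b: "\<nu>\<^sup>2 * ((ms n)\<^sup>2 * (cmod (cf x s n))\<^sup>2) \<le> 2 * (ca\<^sup>2 * (cmod (cf x s n))\<^sup>2 + cb\<^sup>2 * (cmod (u n))\<^sup>2)" .
    have "(1 / \<nu>\<^sup>2) * (\<nu>\<^sup>2 * ((ms n)\<^sup>2 * (cmod (cf x s n))\<^sup>2)) \<le> (1 / \<nu>\<^sup>2) * (2 * (ca\<^sup>2 * (cmod (cf x s n))\<^sup>2 + cb\<^sup>2 * (cmod (u n))\<^sup>2))"
      by (rule mult_left_mono[OF b]) simp
    then have "(ms n)\<^sup>2 * (cmod (cf x s n))\<^sup>2 \<le> (1 / \<nu>\<^sup>2) * (2 * (ca\<^sup>2 * (cmod (cf x s n))\<^sup>2 + cb\<^sup>2 * (cmod (u n))\<^sup>2))"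
      using nu by (simp only: mult.assoc[symmetric]) simp
    then show "norm ((real n + 1/2)\<^sup>2 * (cmod (cf x s n))\<^sup>2) \<le> (1 / \<nu>\<^sup>2) * (2 * (ca\<^sup>2 * (cmod (cf x s n))\<^sup>2 + cb\<^sup>2 * (cmod (u n))\<^sup>2))"
      unfolding ms_def[symmetric] by (simp only: real_norm_def abs_mult abs_power2 power2_abs)
  qed
  have V: "syn x s = (\<lambda>y. \<Sum>n. cf x s n * complex_of_real (hf n y))" for s by (simp add: syn_def fun_eq_iff)
  have cV: "continuous_on UNIV (syn x s)" and lV: "l2 (syn x s)" and hV: "hc (syn x s) n = cf x s n" for s n
    unfolding V using hf_synthesis(2-4)[OF sE] by blast+
  show "hc (syn x s) n = cf x s n" for s n by (rule hV)
  have k: "kap / \<nu> / kap = 1 / \<nu>" using kap_pos by simp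
  show "osc (kap / \<nu>) (syn x)"
    unfolding osc_def
  proof
    fix s
    have cF: "continuous_on UNIV (Fo (kap / \<nu>) (syn x) s)"
      unfolding Fo_def[abs_def] by (intro continuous_intros cV)
    have lF: "l2 (Fo (kap / \<nu>) (syn x) s)"
      unfolding Fo_def[abs_def] by (intro l2_scale l2_add lV l2_chirp_mult)
    have hF: "hc (Fo (kap / \<nu>) (syn x) s) n = of_real (real n + 1/2) * cf x s n" for n
      unfolding hc_Fo[OF lV] hV eq k ms_def[symmetric] using nu by simp
    from dom2_synthesis[OF sE cF lF hF]
    show "\<exists>p. dom2 (syn x s) p (\<lambda>y. of_real (y\<^sup>2) * syn x s y - 2 * Fo (kap / \<nu>) (syn x) s y)"
      unfolding V[of s, symmetric] by (simp only: syn_def)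
  qed
qed

text \<open>Synthesis followed by \<open>toU\<close> carries a frame to a complex basis of the
  eigenspace. Spanning comes from the frame expansion and the uniqueness of Hermite coefficients of
  continuous functions; independence is read off from the coefficients by orthonormality.\<close>

lemma multiplicity_eq_card:
  assumes mu: "\<mu> \<noteq> 0" and B: "K.eigenframe (kap / \<mu>) B"
  shows "ncho_multiplicity \<alpha> \<beta> (of_real \<mu>) = card B"
proof -
  interpret vs: vector_space cscale_fun by (rule vector_space_cscale_fun)
  define G where "G x = toU (syn x)" for x
  have k: "kap / \<mu> \<noteq> 0" "kap / (kap / \<mu>) = \<mu>" using kap_pos mu by auto
  have ob: "K.orthonormal_eigenset (kap / \<mu>) B" using B by (simp add: K.eigenframe_def)
  note D = K.orthonormal_eigensetD[OF ob]
  have osc: "osc \<mu> (syn b)" and hcf: "hc (syn b s) n = cf b s n" if "b \<in> B" for b s n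
    using syn_osc[OF D(2)[OF that] k(1)] unfolding k(2) by blast+
  have tG: "toV (G b) = syn b" for b by (simp only: G_def toV_toU)
  have comb: "toV (\<Sum>b\<in>B. cscale_fun (z b) (G b)) s = (\<lambda>y. \<Sum>b\<in>B. z b * syn b s y)" for z s
    by (rule ext) (simp only: toV_combination[OF D(1)] tG)
  have hcomb: "l2 (\<lambda>y. \<Sum>b\<in>B. z b * syn b s y)" "hc (\<lambda>y. \<Sum>b\<in>B. z b * syn b s y) n = (\<Sum>b\<in>B. z b * cf b s n)" for z s n
  proof -
    have "l2 (syn b s)" if "b \<in> B" for b by (rule osc_regular(2)[OF osc[OF that]])
    from hc_combination[OF D(1) this, of "\<lambda>b. b" z]
    show "l2 (\<lambda>y. \<Sum>b\<in>B. z b * syn b s y)" "hc (\<lambda>y. \<Sum>b\<in>B. z b * syn b s y) n = (\<Sum>b\<in>B. z b * cf b s n)"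
      using hcf by auto
  qed
  have cfc: "cf (\<Sum>b\<in>B. cscale (z b) b) s n = (\<Sum>b\<in>B. z b * cf b s n)" for z s n
    by (simp add: cf_def coeff_sum sum_divide_distrib)
  have inj: "inj_on G B"
  proof (rule inj_onI)
    fix x y assume xy: "x \<in> B" "y \<in> B" "G x = G y"
    then have "syn x = syn y" using tG by metis
    then show "x = y" using hcf[OF xy(1)] hcf[OF xy(2)] by (intro cf_eqI) simp
  qed
  have "vs.dim (ncho_eigenspace \<alpha> \<beta> (of_real \<mu>)) = card B"
  proof (rule vs.dim_unique)
    show "G ` B \<subseteq> ncho_eigenspace \<alpha> \<beta> (of_real \<mu>)"
      unfolding G_def using osc_imp_eigenspace[OF osc] by blast
    show "card (G ` B) = card B" by (rule card_image[OF inj])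
    show "ncho_eigenspace \<alpha> \<beta> (of_real \<mu>) \<subseteq> vs.span (G ` B)"
    proof
      fix u assume "u \<in> ncho_eigenspace \<alpha> \<beta> (of_real \<mu>)"
      then have o: "osc \<mu> (toV u)" by (rule eigenspace_imp_osc)
      obtain x where x: "\<And>s n. cf x s n = hc (toV u s) n" "K.op x = (kap / \<mu>) *\<^sub>R x"
        using osc_to_ell2[OF o mu] by blast
      \<comment> \<open>The Hermitian coefficients of x in the frame; the same scalars express u
        through the synthesised functions.\<close>
      define z where "z b = Complex (x \<bullet> b) (x \<bullet> cscale \<i> b)" for b
      have xz: "x = (\<Sum>b\<in>B. cscale (z b) b)" using B x(2) unfolding K.eigenframe_def z_def by blast
      have "toV u s = (\<lambda>y. \<Sum>b\<in>B. z b * syn b s y)" for s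
      proof (rule hc_eq_imp_eq)
        show "continuous_on UNIV (toV u s)" "l2 (toV u s)" by (rule osc_regular[OF o])+
        show "continuous_on UNIV (\<lambda>y. \<Sum>b\<in>B. z b * syn b s y)"
          by (intro continuous_on_sum continuous_on_mult continuous_on_const osc_regular(1)[OF osc])
        show "l2 (\<lambda>y. \<Sum>b\<in>B. z b * syn b s y)" by (rule hcomb)
        show "hc (toV u s) n = hc (\<lambda>y. \<Sum>b\<in>B. z b * syn b s y) n" for n
          unfolding hcomb x(1)[symmetric] cfc[symmetric] using xz by simp
      qed
      then have "toV u = toV (\<Sum>b\<in>B. cscale_fun (z b) (G b))" by (intro ext) (simp only: comb)
      then have "u = (\<Sum>b\<in>B. cscale_fun (z b) (G b))" by (simp only: toV_inject)
      also have "\<dots> \<in> vs.span (G ` B)" by (intro vs.span_sum vs.span_scale vs.span_base imageI)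
      finally show "u \<in> vs.span (G ` B)" .
    qed
    show "vs.independent (G ` B)"
    proof (rule vs.independent_if_scalars_zero)
      show "finite (G ` B)" using D(1) by simp
      fix f v assume s0: "(\<Sum>v\<in>G ` B. cscale_fun (f v) v) = 0" and v: "v \<in> G ` B"
      obtain b where b: "b \<in> B" "v = G b" using v by blast
      define z where "z b = f (G b)" for b
      have s1: "(\<Sum>b\<in>B. cscale_fun (z b) (G b)) = 0" using s0 unfolding sum.reindex[OF inj] z_def by simp
      have "(\<lambda>y. \<Sum>b\<in>B. z b * syn b s y) = (\<lambda>y. 0)" for s
        using comb[of z s, symmetric] toV_zero[of s] unfolding s1 by (simp only: fun_eq_iff simp_thms)
      then have "(\<Sum>b\<in>B. z b * cf b s n) = 0" for s n
        using hcomb(2)[where z = z and s = s and n = n] by (simp add: hc_def)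
      then have "(\<Sum>b\<in>B. cscale (z b) b) = 0" by (intro cf_eqI) (simp add: cfc, simp add: cf_def)
      then have "Re (z b) = 0" "Im (z b) = 0"
        using K.inner_combination[OF ob b(1), of z] by simp_all
      then show "f v = 0" unfolding b(2) z_def by (simp add: complex_eq_iff)
    qed
  qed
  then show ?thesis unfolding ncho_multiplicity_def .
qed

end

section \<open>The trace of the cube\<close>

lemma sums_single_index: "(\<And>m. m \<noteq> n \<Longrightarrow> f m = 0) \<Longrightarrow> f sums f n" for f :: "nat \<Rightarrow> complex"
  using sums_finite[of "{n}" f] by simp

context ncho_params
begin

text \<open>The closed paths of length three from (s, n): the sign must return, so either no step or
  two steps cross between the blocks. In the latter case the diagonal step comes first or last, at
  n, giving \<open>A1\<close> twice, or in the middle, at the other index, giving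
  \<open>A2\<close>.\<close>

lemma trace_diagonal:
  "coeff (K.op (K.op (K.op (basis_ell2 (s, n))))) (s, n)
     = of_real (ca ^ 3 * (1 / ms n ^ 3) + 2 * (ca * cb\<^sup>2) * (A1 n / (ms n)\<^sup>2) + (ca * cb\<^sup>2) * (A2 n / ms n))"
proof -
  define x0 where "x0 = basis_ell2 (s, n)"
  define r where "r = 1 / complex_of_real (sqrt (ms n))"
  define a b where "a = complex_of_real ca" and "b = complex_of_real cb"
  define d where "d m = complex_of_real (ms m)" for m
  have d: "d m \<noteq> 0" for m by (simp add: d_def)
  note op = cf_op[folded a_def b_def d_def]
  have c0: "cf x0 s m = (if m = n then r else 0)" "cf x0 (\<not> s) m = 0" for m
    by (auto simp: cf_def x0_def r_def)
  \<comment> \<open>Going across and back along the same entry multiplies it by its conjugate; only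
    squared moduli of overlaps survive, and the sign s disappears.\<close>
  have U: "Us s n m * Us (\<not> s) m n = of_real ((cmod (Umat dlt n m))\<^sup>2)" for m
    unfolding Us_not cmod_Us[of s n m, symmetric] by (rule complex_norm_square[symmetric])
  have c1: "cf (K.op x0) s m = (if m = n then a * r / d n else 0)" for m
    unfolding op c0 by simp
  have c1': "cf (K.op x0) (\<not> s) m = b * (Us (\<not> s) m n * r) / d m" for m
  proof -
    have "(\<lambda>m'. Us (\<not> s) m m' * (if m' = n then r else 0)) sums (Us (\<not> s) m n * (if n = n then r else 0))"
      by (rule sums_single_index) simp
    then have "(\<Sum>m'. Us (\<not> s) m m' * (if m' = n then r else 0)) = Us (\<not> s) m n * r" by (simp add: sums_iff)
    then show ?thesis unfolding op c0 not_not by simp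
  qed
  have s1: "(\<lambda>m. of_real ((cmod (Umat dlt n m))\<^sup>2 * (1 / ms m))) sums complex_of_real (A1 n)" using A1_sums by (simp only: sums_of_real_iff)
  have s2: "(\<lambda>m. of_real ((cmod (Umat dlt n m))\<^sup>2 * (1 / (ms m)\<^sup>2))) sums complex_of_real (A2 n)" using A2_sums by (simp only: sums_of_real_iff)
  have c2: "cf (K.op (K.op x0)) s n = (a * (a * r / d n) + b * (b * r * of_real (A1 n))) / d n"
  proof -
    have "(\<lambda>m. b * r * of_real ((cmod (Umat dlt n m))\<^sup>2 * (1 / ms m))) sums (b * r * of_real (A1 n))" by (rule sums_mult[OF s1])
    moreover have "b * r * of_real ((cmod (Umat dlt n m))\<^sup>2 * (1 / ms m)) = Us s n m * (b * (Us (\<not> s) m n * r) / d m)" for m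
      unfolding of_real_mult U[symmetric] d_def by simp
    ultimately have "(\<Sum>m. Us s n m * (b * (Us (\<not> s) m n * r) / d m)) = b * r * of_real (A1 n)" by (simp add: sums_iff)
    then show ?thesis unfolding op[of "K.op x0"] c1 c1' by simp
  qed
  have c2': "cf (K.op (K.op x0)) (\<not> s) m = (a * (b * (Us (\<not> s) m n * r) / d m) + b * (Us (\<not> s) m n * (a * r / d n))) / d m" for m
  proof -
    have "(\<lambda>m'. Us (\<not> s) m m' * (if m' = n then a * r / d n else 0)) sums (Us (\<not> s) m n * (if n = n then a * r / d n else 0))"
      by (rule sums_single_index) simp
    then have "(\<Sum>m'. Us (\<not> s) m m' * (if m' = n then a * r / d n else 0)) = Us (\<not> s) m n * (a * r / d n)" by (simp add: sums_iff)
    then show ?thesis unfolding op[of "K.op x0"] c1' not_not c1 by simp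
  qed
  have c3: "cf (K.op (K.op (K.op x0))) s n = (a * ((a * (a * r / d n) + b * (b * r * of_real (A1 n))) / d n)
      + b * (a * b * r * of_real (A2 n) + a * b * r / d n * of_real (A1 n))) / d n"
  proof -
    have "(\<lambda>m. a * b * r * of_real ((cmod (Umat dlt n m))\<^sup>2 * (1 / (ms m)\<^sup>2)) + a * b * r / d n * of_real ((cmod (Umat dlt n m))\<^sup>2 * (1 / ms m)))
        sums (a * b * r * of_real (A2 n) + a * b * r / d n * of_real (A1 n))"
      by (intro sums_add sums_mult s1 s2)
    moreover have "a * b * r * of_real ((cmod (Umat dlt n m))\<^sup>2 * (1 / (ms m)\<^sup>2)) + a * b * r / d n * of_real ((cmod (Umat dlt n m))\<^sup>2 * (1 / ms m))
      = Us s n m * ((a * (b * (Us (\<not> s) m n * r) / d m) + b * (Us (\<not> s) m n * (a * r / d n))) / d m)" for m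
      unfolding of_real_mult U[symmetric] unfolding of_real_divide of_real_power of_real_1 d_def[symmetric] using d[of m] d[of n]
      by (simp add: field_simps power2_eq_square)
    ultimately have "(\<Sum>m. Us s n m * ((a * (b * (Us (\<not> s) m n * r) / d m) + b * (Us (\<not> s) m n * (a * r / d n))) / d m))
      = a * b * r * of_real (A2 n) + a * b * r / d n * of_real (A1 n)" by (simp add: sums_iff)
    then show ?thesis unfolding op[of "K.op (K.op x0)"] c2 c2' by simp
  qed
  have r: "complex_of_real (sqrt (ms n)) * r = 1" using ms_pos[of n] by (simp add: r_def)
  have "coeff (K.op (K.op (K.op x0))) (s, n) = (complex_of_real (sqrt (ms n)) * r) * ((a * ((a * (a / d n) + b * (b * of_real (A1 n))) / d n)
      + b * (a * b * of_real (A2 n) + a * b / d n * of_real (A1 n))) / d n)"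
    unfolding coeff_cf c3 using d[of n] by (simp add: field_simps)
  also have "\<dots> = a ^ 3 * (1 / d n ^ 3) + 2 * (a * b\<^sup>2) * (of_real (A1 n) / (d n)\<^sup>2) + (a * b\<^sup>2) * (of_real (A2 n) / d n)"
    unfolding r using d[of n] by (simp add: field_simps power2_eq_square power3_eq_cube)
  also have "\<dots> = of_real (ca ^ 3 * (1 / ms n ^ 3) + 2 * (ca * cb\<^sup>2) * (A1 n / (ms n)\<^sup>2) + (ca * cb\<^sup>2) * (A2 n / ms n))"
    by (simp add: a_def b_def d_def)
  finally show ?thesis unfolding x0_def .
qed

definition tau :: real where "tau = 1 / (\<alpha> * \<beta>)"

lemma tau: "0 < tau" "tau < 1" "kap = sqrt (1 - tau)" "dlt = sqrt (tau / (1 - tau))"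
proof -
  show "0 < tau" "tau < 1" using pos prod_gt_1 by (simp_all add: tau_def)
  show "kap = sqrt (1 - tau)" by (simp add: kap_def tau_def)
  then show "dlt = sqrt (tau / (1 - tau))"
    by (simp add: dlt_def gam_def tau_def real_sqrt_divide real_sqrt_mult)
qed

definition Th :: real where "Th = kap * (\<Sum>k. 2 * bcoef k * Mint k * tau ^ k)"

lemma Th_nonneg: "Th \<ge> 0"
  unfolding Th_def using Mint_series_summable[of tau] tau kap_pos Mint_nonneg
  by (intro mult_nonneg_nonneg suminf_nonneg) (auto intro: less_imp_le[OF bcoef_pos])

lemma Th_eq: "(\<Sum>m. \<Sum>n. ennreal (1 / ((ms n)\<^sup>2 * ms m) * (cmod (Umat dlt n m))\<^sup>2)) = ennreal Th"
  using That_eq[OF tau(1,2)] unfolding Th_def tau(3,4) ms_def .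

lemma A1_sums_Th: "(\<lambda>n. A1 n / (ms n)\<^sup>2) sums Th"
proof -
  define f where "f n m = (cmod (Umat dlt n m))\<^sup>2 * (1 / ms m) * (1 / (ms n)\<^sup>2)" for n m
  have "(\<Sum>n. \<Sum>m. ennreal (f n m)) = (\<Sum>m. \<Sum>n. ennreal (f n m))" by (rule ennreal_suminf_swap[symmetric])
  also have "\<dots> = ennreal Th" unfolding Th_eq[symmetric] by (simp add: f_def mult.commute)
  finally have e: "(\<Sum>n. \<Sum>m. ennreal (f n m)) = ennreal Th" .
  have nn: "f n m \<ge> 0" for n m
    unfolding f_def by (intro mult_nonneg_nonneg) (use inv_ms_bounds in auto)
  have sf: "summable (f n)" for n
    unfolding f_def by (rule summable_mult2[OF weighted_summable[OF inv_ms_bounds(1)]])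
  have "(\<lambda>n. \<Sum>m. f n m) sums Th" by (rule sums_of_ennreal_double[OF nn sf e Th_nonneg])
  moreover have "(\<Sum>m. f n m) = A1 n * (1 / (ms n)\<^sup>2)" for n
    unfolding f_def A1_def by (rule suminf_mult2[OF weighted_summable[OF inv_ms_bounds(1)], symmetric])
  ultimately show ?thesis by simp
qed

text \<open>The same double sum as for \<open>A1\<close>, with the roles of the two indices
  exchanged by symmetry of the chirp matrix.\<close>

lemma A2_sums_Th: "(\<lambda>n. A2 n / ms n) sums Th"
proof -
  define f where "f n m = (cmod (Umat dlt n m))\<^sup>2 * (1 / (ms m)\<^sup>2) * (1 / ms n)" for n m
  have "f n m = 1 / ((ms m)\<^sup>2 * ms n) * (cmod (Umat dlt m n))\<^sup>2" for n m
    unfolding f_def Umat_sym[of dlt n m] by simp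
  then have e: "(\<Sum>n. \<Sum>m. ennreal (f n m)) = ennreal Th" using Th_eq by (simp only:)
  have nn: "f n m \<ge> 0" for n m
    unfolding f_def by (intro mult_nonneg_nonneg) (use inv_ms_bounds in auto)
  have sf: "summable (f n)" for n
    unfolding f_def by (rule summable_mult2[OF weighted_summable[OF inv_ms_bounds(2)]])
  have "(\<lambda>n. \<Sum>m. f n m) sums Th" by (rule sums_of_ennreal_double[OF nn sf e Th_nonneg])
  moreover have "(\<Sum>m. f n m) = A2 n * (1 / ms n)" for n
    unfolding f_def A2_def by (rule suminf_mult2[OF weighted_summable[OF inv_ms_bounds(2)], symmetric])
  ultimately show ?thesis by simp
qed

text \<open>The two signs contribute equally, hence the outer factor 2; the 3 collects the two paths
  through \<open>A1\<close> and the one through \<open>A2\<close>.\<close>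

lemma trace_has_sum:
  "((\<lambda>i. Re (coeff (K.op (K.op (K.op (basis_ell2 i)))) i)) has_sum (2 * (ca ^ 3 * Zodd + 3 * (ca * cb\<^sup>2) * Th))) UNIV"
proof -
  define t where "t n = ca ^ 3 * (1 / ms n ^ 3) + 2 * (ca * cb\<^sup>2) * (A1 n / (ms n)\<^sup>2) + (ca * cb\<^sup>2) * (A2 n / ms n)" for n
  have "(\<lambda>n. 1 / ms n ^ 3) sums Zodd" unfolding ms_def Zodd_def by (rule summable_sums[OF summable_Zodd])
  then have "t sums (ca ^ 3 * Zodd + 2 * (ca * cb\<^sup>2) * Th + (ca * cb\<^sup>2) * Th)"
    unfolding t_def[abs_def] by (intro sums_add sums_mult A1_sums_Th A2_sums_Th)
  moreover have "ca ^ 3 * Zodd + 2 * (ca * cb\<^sup>2) * Th + (ca * cb\<^sup>2) * Th = ca ^ 3 * Zodd + 3 * (ca * cb\<^sup>2) * Th"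
    by (simp add: algebra_simps)
  ultimately have "t sums (ca ^ 3 * Zodd + 3 * (ca * cb\<^sup>2) * Th)" by (simp only:)
  moreover have "t n \<ge> 0" for n
  proof -
    have c: "ca * cb\<^sup>2 \<ge> 0" using ca_pos by simp
    have "2 * c * (x / y\<^sup>2) \<ge> 0" "c * (z / y) \<ge> 0" if "c \<ge> 0" "x \<ge> 0" "y \<ge> 0" "z \<ge> 0" for c x y z :: real
      using that by simp_all
    from this[OF c A1_nonneg[of n] less_imp_le[OF ms_pos[of n]] A2_nonneg[of n]]
    have "2 * (ca * cb\<^sup>2) * (A1 n / (ms n)\<^sup>2) \<ge> 0" "(ca * cb\<^sup>2) * (A2 n / ms n) \<ge> 0" .
    moreover have "ca ^ 3 * (1 / ms n ^ 3) \<ge> 0" using ca_pos ms_pos[of n] by simp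
    ultimately show ?thesis unfolding t_def by linarith
  qed
  ultimately have h: "(t has_sum (ca ^ 3 * Zodd + 3 * (ca * cb\<^sup>2) * Th)) UNIV" by (rule sums_nonneg_imp_has_sum)
  have R: "Re (coeff (K.op (K.op (K.op (basis_ell2 (s, n))))) (s, n)) = t n" for s n
    unfolding trace_diagonal t_def by (rule Re_complex_of_real)
  show ?thesis unfolding mult_2 by (rule has_sum_bool_prod) (simp_all only: R h)
qed

text \<open>Positivity of every \<open>lam n\<close> comes from monotonicity and the first term,
  finiteness of the level sets from divergence to infinity, and the cardinalities from
  \<open>multiplicity_eq_card\<close>.\<close>

lemma eigenvalue_cube_sums:
  assumes lam: "ncho_eigenvalue_seq \<alpha> \<beta> lam"
  shows "(\<lambda>n. (kap / lam n) ^ 3) sums (2 * (ca ^ 3 * Zodd + 3 * (ca * cb\<^sup>2) * Th))"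
proof (rule K.trace_cube_frames[OF kap_pos _ _ _ trace_has_sum])
  have l: "0 < lam 0" "mono lam" "filterlim lam at_top sequentially"
    "\<And>\<mu>. card {n. complex_of_real (lam n) = \<mu>} = ncho_multiplicity \<alpha> \<beta> \<mu>"
    using lam unfolding ncho_eigenvalue_seq_def by auto
  show "lam n > 0" for n using l(1) monoD[OF l(2), of 0 n] by simp
  show "finite {n. lam n = \<mu>}" for \<mu>
  proof -
    have "eventually (\<lambda>n. lam n > \<mu>) sequentially" using l(3) by (simp add: filterlim_at_top_dense)
    then obtain N where N: "\<And>n. n \<ge> N \<Longrightarrow> lam n > \<mu>" by (auto simp: eventually_sequentially)
    have "{n. lam n = \<mu>} \<subseteq> {..<N}" using N by (auto simp: not_less[symmetric] intro: ccontr)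
    then show ?thesis by (rule finite_subset) simp
  qed
  show "card {n. lam n = \<mu>} = card B" if "\<mu> \<noteq> 0" "K.eigenframe (kap / \<mu>) B" for \<mu> B
    using l(4)[of "of_real \<mu>"] multiplicity_eq_card[OF that] by simp
qed

end

section \<open>Evaluation of the constants and the final formula\<close>

lemma Zodd_eq: "Zodd = 7 * (\<Sum>n. 1 / (real n + 1) ^ 3)"
proof -
  define f where "f n = 1 / (real n + 1) ^ 3" for n :: nat
  have sf: "summable f"
  proof (rule summable_comparison_test_bigo)
    show "summable (\<lambda>n. norm (real n powr (-3)))" by (simp add: summable_real_powr_iff)
    show "f \<in> O(\<lambda>n. real n powr (-3))" unfolding f_def by real_asymp
  qed
  then have fs: "f sums suminf f" by (rule summable_sums)
  have "(\<lambda>n. sum f {n * 2..<n * 2 + 2}) sums suminf f" by (rule sums_group[OF fs]) simp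
  \<comment> \<open>The indices 2 n and 2 n + 1 carry the denominators 2 n + 1 and 2 n + 2, so
    pairing splits odd from even: the odd part is Zodd / 8, the even part an eighth of the whole
    sum.\<close>
  moreover have "sum f {n * 2..<n * 2 + 2} = 1 / 8 * (1 / (real n + 1/2) ^ 3) + 1 / 8 * f n" for n
  proof -
    have s: "{n * 2..<n * 2 + 2} = {2 * n, 2 * n + 1}" by auto
    have e: "real (2 * n) + 1 = 2 * (real n + 1/2)" "real (2 * n + 1) + 1 = 2 * (real n + 1)" by simp_all
    have "sum f {n * 2..<n * 2 + 2} = 1 / (2 * (real n + 1/2)) ^ 3 + 1 / (2 * (real n + 1)) ^ 3"
      unfolding s f_def e[symmetric] by simp
    then show ?thesis unfolding power_mult_distrib f_def by simp
  qed
  ultimately have "(\<lambda>n. 1 / 8 * (1 / (real n + 1/2) ^ 3) + 1 / 8 * f n) sums suminf f" by (simp only:)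
  moreover have "(\<lambda>n. 1 / 8 * (1 / (real n + 1/2) ^ 3) + 1 / 8 * f n) sums (1 / 8 * Zodd + 1 / 8 * suminf f)"
    unfolding Zodd_def by (intro sums_add sums_mult summable_sums[OF summable_Zodd] fs)
  ultimately have "suminf f = 1 / 8 * Zodd + 1 / 8 * suminf f" by (rule sums_unique2)
  then show ?thesis unfolding f_def by simp
qed

lemma of_real_powr_minus_3: "x > 0 \<Longrightarrow> complex_of_real x powr (- 3) = of_real (1 / x ^ 3)"
  using powr_of_real[of x "-3"] powr_minus[of x 3] powr_realpow[of x 3] by (simp add: field_simps)

lemma riemann_zeta_3: "riemann_zeta 3 = of_real (\<Sum>n. 1 / (real n + 1) ^ 3)"
proof -
  have e: "of_nat (Suc n) powr (- 3) = complex_of_real (1 / (real n + 1) ^ 3)" for n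
    using of_real_powr_minus_3[of "real n + 1"] by (simp add: add.commute)
  have "summable (\<lambda>n. 1 / (real n + 1) ^ 3)"
  proof (rule summable_comparison_test_bigo)
    show "summable (\<lambda>n. norm (real n powr (-3)))" by (simp add: summable_real_powr_iff)
    show "(\<lambda>n. 1 / (real n + 1) ^ 3) \<in> O(\<lambda>n. real n powr (-3))" by real_asymp
  qed
  then show ?thesis unfolding riemann_zeta_def e by (rule suminf_of_real[symmetric])
qed

theorem theorem1p1:
  fixes \<alpha> \<beta> :: real and lam :: "nat \<Rightarrow> real"
  assumes "\<alpha> > 0" and "\<beta> > 0" and "\<alpha> * \<beta> > 2"
    and "ncho_eigenvalue_seq \<alpha> \<beta> lam"
  shows "spectral_zeta lam 3 =
      7 / 4 * riemann_zeta 3 *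
        complex_of_real ((\<alpha> + \<beta>) ^ 3 / (\<alpha> * \<beta> * (\<alpha> * \<beta> - 1)) powr (3 / 2) *
          (1 + 3 * ((\<alpha> - \<beta>) / (\<alpha> + \<beta>) *
                    hypergeo_2F1 (1 / 4) (3 / 4) 1 (1 / (1 - \<alpha> * \<beta>)))\<^sup>2))
      - complex_of_real (3 * (\<alpha> + \<beta>) * (\<alpha> - \<beta>)\<^sup>2 / (2 * \<alpha>\<^sup>2 * \<beta>\<^sup>2 * (\<alpha> * \<beta> - 1)) *
          (\<Sum>k. (- 1) ^ k * ((- 1 / 2 :: real) gchoose k) ^ 3 * (\<alpha> * \<beta>) powi (- int k) *
             (\<Sum>j<k. 1 / (2 * real j + 1) ^ 3 * ((- 1 / 2 :: real) gchoose j) powi (- 2))))"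
proof -
  interpret ncho_params \<alpha> \<beta> by unfold_locales (use assms in auto)
  define p where "p = \<alpha> * \<beta>"
  define F where "F = hypergeo_2F1 (1 / 4) (3 / 4) 1 (1 / (1 - p))"
  define Z where "Z = (\<Sum>n. 1 / (real n + 1) ^ 3)"
  define S where "S k = (\<Sum>j<k. 1 / ((2 * real j + 1) ^ 3 * (bcoef j)\<^sup>2))" for k
  define W where "W = (\<Sum>k. bcoef k ^ 3 * S k * tau ^ k)"
  have p2: "p > 2" using assms by (simp add: p_def)
  have tp: "tau = 1 / p" by (simp add: tau_def p_def)
  \<comment> \<open>This is where \<alpha>\<beta> > 2 enters: Pfaff's transformation at tau needs
    tau < 1/2.\<close>
  have t12: "tau < 1/2" using p2 by (simp add: tp)
  have k2: "kap\<^sup>2 = (p - 1) / p" using p2 unfolding tau(3) tp by (simp add: field_simps)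
  have arg: "- tau / (1 - tau) = 1 / (1 - p)" using p2 unfolding tp by (simp add: field_simps)
  have H: "(\<lambda>n. bcoef n ^ 3 * tau ^ n) sums (F\<^sup>2 / kap)"
    using hypergeo_square[OF tau(1) t12] unfolding arg tau(3) F_def .
  \<comment> \<open>The closed form of \<open>Mint\<close> splits the series into a multiple of
    Clausen's series and the series W of the statement.\<close>
  have M: "2 * bcoef k * Mint k * tau ^ k = Zodd * (bcoef k ^ 3 * tau ^ k) - 2 * (bcoef k ^ 3 * S k * tau ^ k)" for k
    unfolding Mint_closed_form S_def by (simp add: algebra_simps)
  have Ms: "(\<lambda>k. 2 * bcoef k * Mint k * tau ^ k) sums (\<Sum>k. 2 * bcoef k * Mint k * tau ^ k)"
    by (rule summable_sums, rule Mint_series_summable) (use tau in auto)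
  have "(\<lambda>k. 1 / 2 * (Zodd * (bcoef k ^ 3 * tau ^ k) - 2 * bcoef k * Mint k * tau ^ k)) sums
     (1 / 2 * (Zodd * (F\<^sup>2 / kap) - (\<Sum>k. 2 * bcoef k * Mint k * tau ^ k)))"
    by (intro sums_mult sums_diff H Ms)
  then have "W = 1 / 2 * (Zodd * (F\<^sup>2 / kap) - (\<Sum>k. 2 * bcoef k * Mint k * tau ^ k))"
    unfolding M W_def by (simp add: sums_iff)
  \<comment> \<open>The prefactor \<open>kap\<close> of \<open>Th\<close> cancels the 1 / kap from
    Clausen's series, so the square of the hypergeometric value appears without a root, while W
    keeps one factor \<open>kap\<close>.\<close>
  then have Th: "Th = Zodd * F\<^sup>2 - 2 * kap * W" using kap_pos unfolding Th_def by (simp add: field_simps)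
  have lam0: "lam n > 0" for n
    using assms(4) monoD[of lam 0 n] unfolding ncho_eigenvalue_seq_def by auto
  have "(\<lambda>n. 1 / kap ^ 3 * (kap / lam n) ^ 3) sums (1 / kap ^ 3 * (2 * (ca ^ 3 * Zodd + 3 * (ca * cb\<^sup>2) * Th)))"
    by (rule sums_mult[OF eigenvalue_cube_sums[OF assms(4)]])
  moreover have "1 / kap ^ 3 * (kap / lam n) ^ 3 = 1 / lam n ^ 3" for n using kap_pos by (simp add: power_divide)
  ultimately have L: "(\<lambda>n. 1 / lam n ^ 3) sums (1 / kap ^ 3 * (2 * (ca ^ 3 * Zodd + 3 * (ca * cb\<^sup>2) * Th)))" by (simp only:)
  have "spectral_zeta lam 3 = of_real (\<Sum>n. 1 / lam n ^ 3)"
    unfolding spectral_zeta_def of_real_powr_minus_3[OF lam0] by (rule suminf_of_real[symmetric, OF sums_summable[OF L]])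
  then have sz: "spectral_zeta lam 3 = of_real (1 / kap ^ 3 * (2 * (ca ^ 3 * Zodd + 3 * (ca * cb\<^sup>2) * Th)))"
    using sums_unique[OF L] by simp
  have Zo: "Zodd = 7 * Z" unfolding Z_def by (rule Zodd_eq)
  \<comment> \<open>Since kap^2 = (p - 1) / p, the half-integer power of p (p - 1) is the cube of p
    kap; this absorbs the 1 / kap^3 from rescaling the eigenvalues.\<close>
  have P: "(p * (p - 1)) powr (3 / 2) = p ^ 3 * kap ^ 3"
  proof -
    have "p * (p - 1) = (p * kap)\<^sup>2" using p2 unfolding power_mult_distrib k2 by (simp add: power2_eq_square)
    then have "(p * (p - 1)) powr (3 / 2) = ((p * kap) powr 2) powr (3 / 2)" using p2 kap_pos by (simp add: powr_realpow)
    also have "\<dots> = (p * kap) powr 3" by (simp only: powr_powr) simp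
    also have "\<dots> = (p * kap) ^ 3" using p2 kap_pos powr_realpow[of "p * kap" 3] by simp
    finally show ?thesis by (simp add: power_mult_distrib)
  qed
  have caf: "ca = (\<alpha> + \<beta>) / (2 * p)" "cb = (\<beta> - \<alpha>) / (2 * p)" using assms(1,2) by (simp_all add: ca_def cb_def p_def field_simps)
  have nz: "p \<noteq> 0" "kap \<noteq> 0" "p - 1 \<noteq> 0" "\<alpha> + \<beta> \<noteq> 0" using p2 kap_pos assms(1,2) by auto
  have real_eq: "1 / kap ^ 3 * (2 * (ca ^ 3 * Zodd + 3 * (ca * cb\<^sup>2) * Th))
    = 7 / 4 * Z * ((\<alpha> + \<beta>) ^ 3 / (p ^ 3 * kap ^ 3) * (1 + 3 * ((\<alpha> - \<beta>) / (\<alpha> + \<beta>) * F)\<^sup>2))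
      - 3 * (\<alpha> + \<beta>) * (\<alpha> - \<beta>)\<^sup>2 / (2 * p\<^sup>2 * (p - 1)) * W"
  proof -
    define s e where "s = \<alpha> + \<beta>" and "e = \<alpha> - \<beta>"
    have s0: "s \<noteq> 0" using nz by (simp add: s_def)
    have "1 / kap ^ 3 * (2 * ((s / (2 * p)) ^ 3 * (7 * Z) + 3 * (s / (2 * p) * (- e / (2 * p))\<^sup>2) * (7 * Z * F\<^sup>2 - 2 * kap * W)))
      = 7 / 4 * Z * (s ^ 3 / (p ^ 3 * kap ^ 3) * (1 + 3 * (e / s * F)\<^sup>2)) - 3 * s * e\<^sup>2 / (2 * p ^ 3 * kap\<^sup>2) * W"
      using nz s0 by (simp add: power2_eq_square power3_eq_cube field_simps)
    \<comment> \<open>For the W term one \<open>kap\<close> cancels, leaving kap^2, which is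
      rational in p; so no root survives in the last term of the formula.\<close>
    moreover have "2 * p ^ 3 * kap\<^sup>2 = 2 * p\<^sup>2 * (p - 1)" unfolding k2 using nz by (simp add: power2_eq_square power3_eq_cube)
    ultimately show ?thesis unfolding caf Th Zo s_def e_def by simp
  qed
  \<comment> \<open>The signs of the binomial coefficients cancel: the cube contributes (- 1)^(3 k),
    offset by the explicit (- 1)^k, and in the inner sum they occur squared.\<close>
  have W: "(\<Sum>k. (- 1) ^ k * ((- 1 / 2 :: real) gchoose k) ^ 3 * p powi (- int k) *
             (\<Sum>j<k. 1 / (2 * real j + 1) ^ 3 * ((- 1 / 2 :: real) gchoose j) powi (- 2))) = W"
    unfolding W_def
  proof (rule suminf_cong)
    fix k
    have a: "(- 1) ^ k * ((- 1 / 2 :: real) gchoose k) ^ 3 = bcoef k ^ 3"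
    proof -
      have "(- 1 :: real) ^ k * ((- 1) ^ k) ^ 3 = 1" by (cases "even k") auto
      then show ?thesis unfolding gchoose_minus_half power_mult_distrib by (simp only: mult.assoc[symmetric] mult_1_left)
    qed
    have b: "p powi (- int k) = tau ^ k" by (simp add: tp power_int_minus power_one_over inverse_eq_divide)
    have c: "1 / (2 * real j + 1) ^ 3 * ((- 1 / 2 :: real) gchoose j) powi (- 2) = 1 / ((2 * real j + 1) ^ 3 * (bcoef j)\<^sup>2)" for j
    proof -
      have "((- 1 / 2 :: real) gchoose j) powi (- 2) = inverse (((- 1 / 2 :: real) gchoose j)\<^sup>2)" by (simp add: power_int_minus)
      also have "((- 1 / 2 :: real) gchoose j)\<^sup>2 = (bcoef j)\<^sup>2" unfolding gchoose_minus_half by (cases "even j") (simp_all add: power_mult_distrib)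
      finally show ?thesis by (simp add: inverse_eq_divide)
    qed
    show "(- 1) ^ k * ((- 1 / 2 :: real) gchoose k) ^ 3 * p powi (- int k) *
             (\<Sum>j<k. 1 / (2 * real j + 1) ^ 3 * ((- 1 / 2 :: real) gchoose j) powi (- 2)) = bcoef k ^ 3 * S k * tau ^ k"
      unfolding a b c S_def by simp
  qed
  have ab2: "2 * \<alpha>\<^sup>2 * \<beta>\<^sup>2 = 2 * p\<^sup>2" by (simp add: p_def power_mult_distrib)
  show ?thesis
    unfolding ab2 p_def[symmetric] P W F_def[symmetric] riemann_zeta_3 Z_def[symmetric] sz real_eq by simp
qed

end
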